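(* The variety $\mathcal V$ is irreducible of dimension $38$.
   Context: We work over $\mathbb C$. Let $V_6$ be a $6$-dimensional complex vector space. For a four-dimensional subspace $H\subset \wedge^2V_6$ consider the natural linear map $Sym^2H\to\wedge^4V_6$ induced by the wedge product, $\omega\omega'\mapsto \omega\wedge\omega'$. An element of $Sym^2H$ is regarded as a quadratic form on $H^*$. Let $\mathcal V\subset G(4,\wedge^2V_6)$ be the subvariety (locally closed, with the induced Zariski topology) of the Grassmannian of four-dimensional subspaces $H$ of $\wedge^2V_6$ such that (1) the map $Sym^2H\to\wedge^4V_6$ has rank exactly nine (equivalently, its kernel is one-dimensional), and (2) its kernel is generated by a non-degenerate quadratic form on $H^*$. *)

theory Defs
  imports
    "HOL-Analysis.Abstract_Topology"
    "HOL-Library.Function_Algebras"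
    "HOL-Library.Extended_Nat"
    "Jordan_Normal_Form.Determinant"
begin

section \<open>Linear algebra\<close>

text \<open>
  The only abstract vector space is \<open>V\<^sub>6\<close>, the whole of a type with a scalar multiplication \<open>s\<close>.
  The spaces built from it are linear subspaces of spaces of complex-valued functions, with
  pointwise addition (from Function-Algebras) and the following pointwise scalar multiplication.
\<close>

definition cscale :: "complex \<Rightarrow> ('a \<Rightarrow> complex) \<Rightarrow> 'a \<Rightarrow> complex" where
  "cscale c f = (\<lambda>x. c * f x)"

global_interpretation cfun: vector_space "cscale :: complex \<Rightarrow> ('a \<Rightarrow> complex) \<Rightarrow> 'a \<Rightarrow> complex"
  by unfold_locales (auto simp: cscale_def fun_eq_iff algebra_simps)

text \<open>
  The dual of a linear subspace \<open>H\<close>. A functional takes the junk value 0 outside \<open>H\<close>, so that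
  functionals on \<open>H\<close> are equal as functions iff they agree on \<open>H\<close>.
\<close>

definition dual_on :: "(complex \<Rightarrow> 'v \<Rightarrow> 'v) \<Rightarrow> 'v set \<Rightarrow> ('v::ab_group_add \<Rightarrow> complex) set" where
  "dual_on s H = {\<phi>. (\<forall>x\<in>H. \<forall>y\<in>H. \<phi> (x + y) = \<phi> x + \<phi> y) \<and>
                     (\<forall>c. \<forall>x\<in>H. \<phi> (s c x) = c * \<phi> x) \<and> (\<forall>x. x \<notin> H \<longrightarrow> \<phi> x = 0)}"

section \<open>Bivectors and the wedge product\<close>

text \<open>
  The exterior power \<open>\<And>\<^sup>kV\<close> is realised inside the functions of \<open>k\<close> functionals on \<open>V\<close>: the
  decomposable vector \<open>v\<^sub>1 \<and> \<dots> \<and> v\<^sub>k\<close> is the alternating form \<open>(f\<^sub>1, \<dots>, f\<^sub>k) \<mapsto> det (f\<^sub>i v\<^sub>j)\<close> (with value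
  0 if some \<open>f\<^sub>i\<close> is not a functional), and \<open>\<And>\<^sup>kV\<close> is the span of these.
\<close>

type_synonym 'v bivector = "('v \<Rightarrow> complex) \<times> ('v \<Rightarrow> complex) \<Rightarrow> complex"

type_synonym 'v fourvector =
  "('v \<Rightarrow> complex) \<times> ('v \<Rightarrow> complex) \<times> ('v \<Rightarrow> complex) \<times> ('v \<Rightarrow> complex) \<Rightarrow> complex"

definition wedge_vec :: "(complex \<Rightarrow> 'v \<Rightarrow> 'v) \<Rightarrow> 'v::ab_group_add \<Rightarrow> 'v \<Rightarrow> 'v bivector" where
  "wedge_vec s v w = (\<lambda>(f, g).
     if f \<in> dual_on s UNIV \<and> g \<in> dual_on s UNIV then f v * g w - f w * g v else 0)"

definition ext2 :: "(complex \<Rightarrow> 'v \<Rightarrow> 'v) \<Rightarrow> 'v::ab_group_add bivector set" where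
  "ext2 s = cfun.span {wedge_vec s v w | v w. True}"

text \<open>
  The product \<open>\<And>\<^sup>2V \<times> \<And>\<^sup>2V \<rightarrow> \<And>\<^sup>4V\<close> is the sum over the (2,2)-shuffles; by bilinearity the lemma
  below determines it on all of \<open>\<And>\<^sup>2V\<close>.
\<close>

definition wedge :: "'v bivector \<Rightarrow> 'v bivector \<Rightarrow> 'v fourvector" where
  "wedge \<omega> \<eta> = (\<lambda>(a, b, c, d).
       \<omega> (a, b) * \<eta> (c, d) - \<omega> (a, c) * \<eta> (b, d) + \<omega> (a, d) * \<eta> (b, c)
     + \<omega> (b, c) * \<eta> (a, d) - \<omega> (b, d) * \<eta> (a, c) + \<omega> (c, d) * \<eta> (a, b))"

lemma wedge_wedge_vec:
  assumes "\<And>i. i < 4 \<Longrightarrow> f i \<in> dual_on s UNIV"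
  shows "wedge (wedge_vec s (v 0) (v 1)) (wedge_vec s (v 2) (v 3)) (f 0, f 1, f 2, f (3::nat))
       = det (mat 4 4 (\<lambda>(i, j). f i (v j)))"
proof -
  have S: "{0..<4} = {0, 1, 2, 3::nat}"
    by auto
  have "det (mat 4 4 (\<lambda>(i, j). f i (v j)))
      = (\<Sum>p | p permutes {0..<4}. signof p * (\<Prod>i\<in>{0..<4}. f i (v (p i))))"
    unfolding det_def by (auto intro!: sum.cong prod.cong simp: permutes_in_image)
  then show ?thesis
    using assms[of 0] assms[of 1] assms[of 2] assms[of 3]
    unfolding wedge_def wedge_vec_def S
    by (simp add: sum_over_permutations_insert permutes_sing sign_compose sign_swap_id
        permutation_swap_id permutation_compose sign_id swap_id_eq Transposition.transpose_def)
       (simp add: algebra_simps)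
qed

section \<open>The symmetric square and quadratic forms\<close>

text \<open>
  An element of \<open>Sym\<^sup>2 H\<close> is a quadratic form on \<open>H\<^sup>*\<close>; the product \<open>h h'\<close> is \<open>\<phi> \<mapsto> \<phi>(h) \<phi>(h')\<close>.
\<close>

definition sym_prod :: "('a \<Rightarrow> complex) set \<Rightarrow> ('a \<Rightarrow> complex) \<Rightarrow> ('a \<Rightarrow> complex) \<Rightarrow>
    (('a \<Rightarrow> complex) \<Rightarrow> complex) \<Rightarrow> complex" where
  "sym_prod H h h' = (\<lambda>\<phi>. if \<phi> \<in> dual_on cscale H then \<phi> h * \<phi> h' else 0)"

definition Sym2 :: "('a \<Rightarrow> complex) set \<Rightarrow> ((('a \<Rightarrow> complex) \<Rightarrow> complex) \<Rightarrow> complex) set" where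
  "Sym2 H = cfun.span {sym_prod H h h' | h h'. h \<in> H \<and> h' \<in> H}"

definition nondegenerate_form ::
    "('a \<Rightarrow> complex) set \<Rightarrow> ((('a \<Rightarrow> complex) \<Rightarrow> complex) \<Rightarrow> complex) \<Rightarrow> bool" where
  "nondegenerate_form H Q \<longleftrightarrow>
     (\<forall>\<phi>\<in>dual_on cscale H.
        (\<forall>\<psi>\<in>dual_on cscale H. Q (\<phi> + \<psi>) - Q \<phi> - Q \<psi> = 0) \<longrightarrow> \<phi> = 0)"

text \<open>
  \<open>\<mu>\<close> is the natural map \<open>Sym\<^sup>2 H \<rightarrow> \<And>\<^sup>4V\<close>. It is uniquely determined on \<open>Sym2 H\<close>; its values on
  the rest of the ambient function space are irrelevant.
\<close>

definition natural_map :: "'v bivector set \<Rightarrow>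
    ((('v bivector \<Rightarrow> complex) \<Rightarrow> complex) \<Rightarrow> 'v fourvector) \<Rightarrow> bool" where
  "natural_map H \<mu> \<longleftrightarrow> Vector_Spaces.linear cscale cscale \<mu> \<and>
     (\<forall>h\<in>H. \<forall>h'\<in>H. \<mu> (sym_prod H h h') = wedge h h')"

section \<open>Grassmannians and their Zariski topology\<close>

text \<open>For \<open>k = 0\<close> this also contains the infinite-dimensional subspaces, whose \<open>dim\<close> is 0.\<close>

definition Grass :: "nat \<Rightarrow> ('a \<Rightarrow> complex) set \<Rightarrow> ('a \<Rightarrow> complex) set set" where
  "Grass k W = {H. cfun.subspace H \<and> H \<subseteq> W \<and> cfun.dim H = k}"

definition frame_of :: "nat \<Rightarrow> ('a \<Rightarrow> complex) set \<Rightarrow> (nat \<Rightarrow> 'a \<Rightarrow> complex) \<Rightarrow> bool" where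
  "frame_of k H w \<longleftrightarrow>
     inj_on w {..<k} \<and> cfun.independent (w ` {..<k}) \<and> cfun.span (w ` {..<k}) = H"

text \<open>
  Homogeneous polynomials of degree \<open>d\<close> in the Pluecker coordinates on \<open>\<And>\<^sup>kW\<close>, evaluated at
  \<open>w\<^sub>1 \<and> \<dots> \<and> w\<^sub>k\<close>. A linear coordinate on \<open>\<And>\<^sup>kW\<close> is a linear combination of the minors
  \<open>det (\<phi>\<^sub>i w\<^sub>j)\<close> with \<open>\<phi>\<^sub>1, \<dots>, \<phi>\<^sub>k \<in> W\<^sup>*\<close>, so no choice of a basis of \<open>W\<close> is needed.
\<close>

inductive pluecker_form ::
    "nat \<Rightarrow> ('a \<Rightarrow> complex) set \<Rightarrow> nat \<Rightarrow> ((nat \<Rightarrow> 'a \<Rightarrow> complex) \<Rightarrow> complex) \<Rightarrow> bool"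
  for k W where
  const: "pluecker_form k W 0 (\<lambda>w. c)"
| minor: "(\<And>i. i < k \<Longrightarrow> \<phi> i \<in> dual_on cscale W) \<Longrightarrow>
    pluecker_form k W 1 (\<lambda>w. det (mat k k (\<lambda>(i, j). \<phi> i (w j))))"
| add: "pluecker_form k W d F \<Longrightarrow> pluecker_form k W d G \<Longrightarrow> pluecker_form k W d (\<lambda>w. F w + G w)"
| mult: "pluecker_form k W d F \<Longrightarrow> pluecker_form k W e G \<Longrightarrow>
    pluecker_form k W (d + e) (\<lambda>w. F w * G w)"

text \<open>
  The common zero locus in the Grassmannian of a set of forms (of possibly different degrees).
  Another frame of \<open>H\<close> rescales the value of a form of degree \<open>d\<close> by the \<open>d\<close>-th power of a nonzero
  determinant, so vanishing at one frame and at all frames amount to the same.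
\<close>

definition zero_locus ::
    "nat \<Rightarrow> ('a \<Rightarrow> complex) set \<Rightarrow> ((nat \<Rightarrow> 'a \<Rightarrow> complex) \<Rightarrow> complex) set \<Rightarrow> ('a \<Rightarrow> complex) set set" where
  "zero_locus k W S = {H \<in> Grass k W. \<forall>F\<in>S. \<forall>w. frame_of k H w \<longrightarrow> F w = 0}"

definition pluecker_forms ::
    "nat \<Rightarrow> ('a \<Rightarrow> complex) set \<Rightarrow> ((nat \<Rightarrow> 'a \<Rightarrow> complex) \<Rightarrow> complex) set" where
  "pluecker_forms k W = {F. \<exists>d. pluecker_form k W d F}"

definition zariski :: "nat \<Rightarrow> ('a \<Rightarrow> complex) set \<Rightarrow> ('a \<Rightarrow> complex) set topology" where
  "zariski k W = topology (\<lambda>U. \<exists>S \<subseteq> pluecker_forms k W. U = Grass k W - zero_locus k W S)"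

lemma dual_on_sum:
  assumes "\<phi> \<in> dual_on cscale W" "cfun.subspace H" "H \<subseteq> W" "finite A" "\<And>l. l \<in> A \<Longrightarrow> w l \<in> H"
  shows "\<phi> (\<Sum>l\<in>A. cscale (c l) (w l)) = (\<Sum>l\<in>A. c l * \<phi> (w l))"
  using assms(4,5)
proof (induction A rule: finite_induct)
  case empty
  have "0 \<in> W"
    using assms(2,3) cfun.subspace_0 by blast
  then have "\<phi> (cscale 0 0) = 0 * \<phi> 0"
    using assms(1) unfolding dual_on_def by blast
  then have "\<phi> 0 = 0"
    by (simp only: cfun.scale_zero_left mult_zero_left)
  then show ?case
    by (simp only: sum.empty)
next
  case (insert x A)
  have "cscale (c x) (w x) \<in> H" "(\<Sum>l\<in>A. cscale (c l) (w l)) \<in> H" "w x \<in> H"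
    using insert.prems assms(2) by (auto intro!: cfun.subspace_scale cfun.subspace_sum)
  then have "\<phi> (cscale (c x) (w x) + (\<Sum>l\<in>A. cscale (c l) (w l)))
      = c x * \<phi> (w x) + \<phi> (\<Sum>l\<in>A. cscale (c l) (w l))"
    using assms(1,3) unfolding dual_on_def by (auto simp: subset_iff)
  then show ?case
    using insert by (simp only: sum.insert insert_iff simp_thms)
qed

lemma pluecker_form_change_frame:
  assumes "pluecker_form k W d F" "cfun.subspace H" "H \<subseteq> W" "\<And>l. l < k \<Longrightarrow> w l \<in> H"
    and "\<And>j. j < k \<Longrightarrow> w' j = (\<Sum>l<k. cscale (g l j) (w l))"
  shows "F w' = det (mat k k (\<lambda>(i, j). g i j)) ^ d * F w"
  using assms(1)
proof (induction rule: pluecker_form.induct)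
  case (minor \<phi>)
  have "mat k k (\<lambda>(i, j). \<phi> i (w' j))
      = mat k k (\<lambda>(i, j). \<phi> i (w j)) * mat k k (\<lambda>(i, j). g i j)"
  proof (rule eq_matI)
    fix i j assume "i < dim_row (mat k k (\<lambda>(i, j). \<phi> i (w j)) * mat k k (\<lambda>(i, j). g i j))"
      and "j < dim_col (mat k k (\<lambda>(i, j). \<phi> i (w j)) * mat k k (\<lambda>(i, j). g i j))"
    then have ij: "i < k" "j < k"
      by auto
    then show "mat k k (\<lambda>(i, j). \<phi> i (w' j)) $$ (i, j)
        = (mat k k (\<lambda>(i, j). \<phi> i (w j)) * mat k k (\<lambda>(i, j). g i j)) $$ (i, j)"
      using dual_on_sum[OF minor assms(2,3), of i "{..<k}" w "\<lambda>l. g l j"] assms(4,5)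
      by (simp add: scalar_prod_def mult.commute atLeast0LessThan)
  qed auto
  then show ?case
    by (simp add: det_mult[of _ k] mult.commute)
qed (auto simp: algebra_simps power_add)

lemma frame_combination:
  assumes "frame_of k H w" "x \<in> H"
  shows "\<exists>c. x = (\<Sum>l<k. cscale (c l) (w l))"
proof -
  have "x \<in> range (\<lambda>u. \<Sum>v\<in>w ` {..<k}. cscale (u v) v)"
    using assms cfun.span_finite[of "w ` {..<k}"] unfolding frame_of_def by auto
  then obtain u where "x = (\<Sum>v\<in>w ` {..<k}. cscale (u v) v)"
    by auto
  then have "x = (\<Sum>l<k. cscale (u (w l)) (w l))"
    using assms by (simp add: frame_of_def sum.reindex)
  then show ?thesis
    by (rule exI[of _ "\<lambda>l. u (w l)"])
qed

lemma frame_of_mem: "frame_of k H w \<Longrightarrow> l < k \<Longrightarrow> w l \<in> H"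
  by (auto simp: frame_of_def intro: cfun.span_base)

lemma vanishing_frame_indep:
  assumes "pluecker_form k W d F" "H \<in> Grass k W" "frame_of k H w" "frame_of k H w'" "F w = 0"
  shows "F w' = 0"
proof -
  have "\<exists>c. w' j = (\<Sum>l<k. cscale (c l) (w l))" if "j < k" for j
    using frame_combination[OF assms(3)] frame_of_mem[OF assms(4) that] by blast
  then obtain c where "\<And>j. j < k \<Longrightarrow> w' j = (\<Sum>l<k. cscale (c j l) (w l))"
    by metis
  then show ?thesis
    using pluecker_form_change_frame[OF assms(1), of H w w' "\<lambda>l j. c j l"] assms(2,5)
      frame_of_mem[OF assms(3)] by (simp add: Grass_def)
qed

lemma zero_locus_Un:
  assumes "S \<subseteq> pluecker_forms k W" "T \<subseteq> pluecker_forms k W"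
  shows "zero_locus k W S \<union> zero_locus k W T
       = zero_locus k W {\<lambda>w. F w * G w | F G. F \<in> S \<and> G \<in> T}" (is "?L = ?R")
proof
  show "?L \<subseteq> ?R"
    by (auto simp: zero_locus_def)
  show "?R \<subseteq> ?L"
  proof
    fix H assume H: "H \<in> ?R"
    then have G: "H \<in> Grass k W"
      by (simp add: zero_locus_def)
    show "H \<in> ?L"
    proof (rule ccontr)
      assume "H \<notin> ?L"
      then obtain F w F' w' where F: "F \<in> S" "frame_of k H w" "F w \<noteq> 0"
        and F': "F' \<in> T" "frame_of k H w'" "F' w' \<noteq> 0"
        using G by (auto simp: zero_locus_def)
      have "F' w \<noteq> 0"
      proof -
        obtain d where "pluecker_form k W d F'"
          using F'(1) assms(2) by (auto simp: pluecker_forms_def)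
        then show ?thesis
          using vanishing_frame_indep G F(2) F'(2,3) by blast
      qed
      moreover have "(\<lambda>w. F w * F' w) \<in> {\<lambda>w. F w * G w | F G. F \<in> S \<and> G \<in> T}"
        using F(1) F'(1) by blast
      then have "F w * F' w = 0"
        using H F(2) unfolding zero_locus_def mem_Collect_eq[of H] by (metis (no_types, lifting))
      ultimately show False
        using F by simp
    qed
  qed
qed

lemma istopology_zariski:
  "istopology (\<lambda>U. \<exists>S \<subseteq> pluecker_forms k W. U = Grass k W - zero_locus k W S)"
  unfolding istopology_def
proof (intro conjI allI impI)
  fix U U' assume "\<exists>S \<subseteq> pluecker_forms k W. U = Grass k W - zero_locus k W S"
    and "\<exists>S \<subseteq> pluecker_forms k W. U' = Grass k W - zero_locus k W S"
  then obtain S T where ST: "S \<subseteq> pluecker_forms k W" "T \<subseteq> pluecker_forms k W"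
    and U: "U = Grass k W - zero_locus k W S" "U' = Grass k W - zero_locus k W T"
    by (elim exE conjE)
  define P where "P = {\<lambda>w. F w * G w | F G. F \<in> S \<and> G \<in> T}"
  have "P \<subseteq> pluecker_forms k W"
  proof
    fix X assume "X \<in> P"
    then obtain F G where X: "X = (\<lambda>w. F w * G w)" and "F \<in> S" "G \<in> T"
      unfolding P_def mem_Collect_eq by (elim exE conjE)
    then obtain d e where "pluecker_form k W d F" "pluecker_form k W e G"
      using subsetD[OF ST(1)] subsetD[OF ST(2)] unfolding pluecker_forms_def mem_Collect_eq
      by meson
    then have "pluecker_form k W (d + e) X"
      unfolding X by (rule pluecker_form.mult)
    then show "X \<in> pluecker_forms k W"
      unfolding pluecker_forms_def mem_Collect_eq by (rule exI)
  qed
  moreover have "U \<inter> U' = Grass k W - zero_locus k W P"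
    unfolding P_def zero_locus_Un[OF ST, symmetric] U Diff_Un ..
  ultimately show "\<exists>S \<subseteq> pluecker_forms k W. U \<inter> U' = Grass k W - zero_locus k W S"
    by (intro exI conjI)
next
  fix \<K> assume "\<forall>U\<in>\<K>. \<exists>S \<subseteq> pluecker_forms k W. U = Grass k W - zero_locus k W S"
  then have "\<exists>S. \<forall>U\<in>\<K>. S U \<subseteq> pluecker_forms k W \<and> U = Grass k W - zero_locus k W (S U)"
    by (rule bchoice)
  then obtain S where S: "\<forall>U\<in>\<K>. S U \<subseteq> pluecker_forms k W \<and> U = Grass k W - zero_locus k W (S U)"
    by (elim exE)
  have "(\<Union>U\<in>\<K>. U) = (\<Union>U\<in>\<K>. Grass k W - zero_locus k W (S U))"
    by (rule SUP_cong[OF refl]) (rule conjunct2[OF bspec[OF S]])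
  then have "\<Union>\<K> = (\<Union>U\<in>\<K>. Grass k W - zero_locus k W (S U))"
    by (simp only: image_ident)
  also have "\<dots> = Grass k W - zero_locus k W (\<Union>U\<in>\<K>. S U)"
    by (auto simp: zero_locus_def)
  finally have "\<Union>\<K> = Grass k W - zero_locus k W (\<Union>U\<in>\<K>. S U)" .
  moreover have "(\<Union>U\<in>\<K>. S U) \<subseteq> pluecker_forms k W"
    by (rule UN_least) (rule conjunct1[OF bspec[OF S]])
  ultimately show "\<exists>S \<subseteq> pluecker_forms k W. \<Union>\<K> = Grass k W - zero_locus k W S"
    by (intro exI conjI)
qed

lemma Grass_frame_exists:
  assumes "H \<in> Grass k W" "k > 0"
  shows "\<exists>w. frame_of k H w"
proof -
  obtain B where B: "B \<subseteq> H" "cfun.independent B" "H \<subseteq> cfun.span B" "card B = cfun.dim H"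
    using cfun.basis_exists by blast
  have span: "cfun.span B = H"
    using B assms cfun.span_minimal[of B H] by (auto simp: Grass_def)
  have card: "card B = k"
    using B assms by (simp add: Grass_def)
  then have "finite B"
    using assms(2) card_ge_0_finite by blast
  then obtain w where "bij_betw w {0..<k} B"
    using ex_bij_betw_nat_finite card by blast
  then have "frame_of k H w"
    using B span unfolding frame_of_def by (auto simp: bij_betw_def atLeast0LessThan)
  then show ?thesis
    by blast
qed

lemma closedin_zariski:
  assumes "k > 0"
  shows "closedin (zariski k W) Z \<longleftrightarrow> (\<exists>S \<subseteq> pluecker_forms k W. Z = zero_locus k W S)"
proof -
  have op: "openin (zariski k W) U
      \<longleftrightarrow> (\<exists>S \<subseteq> pluecker_forms k W. U = Grass k W - zero_locus k W S)" for U
    unfolding zariski_def topology_inverse'[OF istopology_zariski[of k W]] ..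
  have "(\<lambda>w. 1) \<in> pluecker_forms k W"
    unfolding pluecker_forms_def mem_Collect_eq by (rule exI, rule pluecker_form.const)
  then have "{\<lambda>w. 1} \<subseteq> pluecker_forms k W"
    by (simp only: insert_subset empty_subsetI simp_thms)
  moreover have "zero_locus k W {\<lambda>w. 1} = {}"
    using Grass_frame_exists[OF _ assms, where W = W] by (auto simp: zero_locus_def)
  then have "Grass k W = Grass k W - zero_locus k W {\<lambda>w. 1}"
    by (simp only: Diff_empty)
  ultimately have "openin (zariski k W) (Grass k W)"
    unfolding op by (intro exI conjI)
  moreover have "openin (zariski k W) U \<Longrightarrow> U \<subseteq> Grass k W" for U
    unfolding op by (elim exE conjE) (simp only: Diff_subset)
  ultimately have top: "topspace (zariski k W) = Grass k W"
    by (meson openin_subset openin_topspace subset_antisym)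
  have sub: "zero_locus k W S \<subseteq> Grass k W" for S
    by (simp only: zero_locus_def Collect_subset Collect_conj_eq Collect_mem_eq Int_lower1)
  show ?thesis
  proof
    assume "closedin (zariski k W) Z"
    then obtain S where "S \<subseteq> pluecker_forms k W" "Z \<subseteq> Grass k W"
      "Grass k W - Z = Grass k W - zero_locus k W S"
      unfolding closedin_def op top by (elim exE conjE)
    moreover from this have "Z = zero_locus k W S"
      using sub[of S] by (metis double_diff order_refl)
    ultimately show "\<exists>S \<subseteq> pluecker_forms k W. Z = zero_locus k W S"
      by (intro exI conjI)
  next
    assume "\<exists>S \<subseteq> pluecker_forms k W. Z = zero_locus k W S"
    then obtain S where "S \<subseteq> pluecker_forms k W" "Z = zero_locus k W S"
      by (elim exE conjE)
    then show "closedin (zariski k W) Z"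
      unfolding closedin_def op top using sub by (intro conjI exI) simp_all
  qed
qed

section \<open>Irreducibility and Krull dimension\<close>

definition irreducible_space :: "'a topology \<Rightarrow> bool" where
  "irreducible_space X \<longleftrightarrow> topspace X \<noteq> {} \<and>
     (\<forall>A B. closedin X A \<longrightarrow> closedin X B \<longrightarrow> topspace X = A \<union> B \<longrightarrow>
        A = topspace X \<or> B = topspace X)"

definition krull_dim :: "'a topology \<Rightarrow> enat" where
  "krull_dim X = Sup {enat n | n. \<exists>Z :: nat \<Rightarrow> 'a set.
     (\<forall>i\<le>n. closedin X (Z i) \<and> irreducible_space (subtopology X (Z i))) \<and>
     (\<forall>i<n. Z i \<subset> Z (Suc i))}"

section \<open>The variety\<close>

definition variety_V :: "(complex \<Rightarrow> 'v \<Rightarrow> 'v) \<Rightarrow> 'v::ab_group_add bivector set set" where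
  "variety_V s = {H \<in> Grass 4 (ext2 s).
     \<exists>\<mu>. natural_map H \<mu> \<and>
       cfun.dim (\<mu> ` Sym2 H) = 9 \<and>
       (\<exists>Q. nondegenerate_form H Q \<and> {R \<in> Sym2 H. \<mu> R = 0} = cfun.span {Q})}"

definition variety_V_top :: "(complex \<Rightarrow> 'v \<Rightarrow> 'v) \<Rightarrow> 'v::ab_group_add bivector set topology" where
  "variety_V_top s = subtopology (zariski 4 (ext2 s)) (variety_V s)"

end

theory Submission
  imports Defs
begin

lemma sum_fun_apply: "(\<Sum>i\<in>A. f i) x = (\<Sum>i\<in>A. f i x)"
  for f :: "'b \<Rightarrow> 'a \<Rightarrow> 'c::comm_monoid_add"
  by (induction A rule: infinite_finite_induct) auto

lemma family_dependent:
  assumes "finite T" "card T < n" "\<And>j. j < n \<Longrightarrow> u j \<in> cfun.span T"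
  obtains c where "\<exists>j<n. c j \<noteq> 0" "\<And>x. (\<Sum>j<n. c j * u j x) = 0"
proof (cases "inj_on u {..<n}")
  case True
  then have "card (u ` {..<n}) = n"
    by (simp add: card_image)
  then have "cfun.dependent (u ` {..<n})"
    using cfun.independent_span_bound[OF assms(1), of "u ` {..<n}"] assms(2,3) by fastforce
  then obtain d where d: "\<exists>v\<in>u ` {..<n}. d v \<noteq> 0" "(\<Sum>v\<in>u ` {..<n}. cscale (d v) v) = 0"
    using cfun.dependent_finite[of "u ` {..<n}"] by auto
  from d(2) have *: "(\<Sum>j<n. cscale (d (u j)) (u j)) = 0"
    using True by (simp add: sum.reindex)
  have "(\<Sum>j<n. d (u j) * u j x) = 0" for x
    using fun_cong[OF *, of x] by (simp add: sum_fun_apply cscale_def)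
  with d(1) show ?thesis
    by (intro that[of "\<lambda>j. d (u j)"]) auto
next
  case False
  then obtain i j where ij: "i < n" "j < n" "i \<noteq> j" "u i = u j"
    by (auto simp: inj_on_def)
  define c :: "nat \<Rightarrow> complex" where "c k = (if k = i then 1 else if k = j then -1 else 0)" for k
  have "(\<Sum>k<n. c k * u k x) = 0" for x
  proof -
    have "(\<Sum>k<n. c k * u k x) = (\<Sum>k\<in>{i, j}. c k * u k x)"
      using ij by (intro sum.mono_neutral_right) (auto simp: c_def)
    then show ?thesis
      using ij by (simp add: c_def)
  qed
  then show ?thesis
    using ij by (intro that[of c]) (auto simp: c_def)
qed

lemma homogeneous_system:
  fixes A :: "nat \<Rightarrow> nat \<Rightarrow> complex"
  assumes "m < n"
  obtains x where "\<exists>j<n. x j \<noteq> 0" "\<And>i. i < m \<Longrightarrow> (\<Sum>j<n. A i j * x j) = 0"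
proof -
  define T :: "(nat \<Rightarrow> complex) set" where "T = (\<lambda>k i. if i = k then 1 else 0) ` {..<m}"
  define u where "u j i = (if i < m then A i j else 0)" for i j
  have u: "u j = (\<Sum>k<m. cscale (A k j) (\<lambda>i. if i = k then 1 else 0))" for j
    by (auto simp: u_def fun_eq_iff sum_fun_apply cscale_def if_distrib cong: if_cong)
  have "u j \<in> cfun.span T" for j
    unfolding u by (intro cfun.span_sum cfun.span_scale cfun.span_base) (auto simp: T_def)
  moreover have "card T \<le> m"
    unfolding T_def using card_image_le[of "{..<m}"] by fastforce
  ultimately obtain c where c: "\<exists>j<n. c j \<noteq> 0" "\<And>x. (\<Sum>j<n. c j * u j x) = 0"
    using family_dependent[of T n u] assms by (auto simp: T_def)
  have "(\<Sum>j<n. A i j * c j) = 0" if "i < m" for i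
    using c(2)[of i] that by (simp add: u_def mult.commute)
  with c(1) show ?thesis
    using that by blast
qed

section \<open>Polynomial functions\<close>

inductive polyfun :: "nat \<Rightarrow> nat \<Rightarrow> ((nat \<Rightarrow> complex) \<Rightarrow> complex) \<Rightarrow> bool" for N where
  const: "polyfun N d (\<lambda>x. c)"
| var: "i < N \<Longrightarrow> polyfun N 1 (\<lambda>x. x i)"
| add: "polyfun N d f \<Longrightarrow> polyfun N d g \<Longrightarrow> polyfun N d (\<lambda>x. f x + g x)"
| mult: "polyfun N d f \<Longrightarrow> polyfun N e g \<Longrightarrow> polyfun N (d + e) (\<lambda>x. f x * g x)"
| mono: "polyfun N d f \<Longrightarrow> d \<le> e \<Longrightarrow> polyfun N e f"

lemma polyfun_sum: "(\<And>i. i \<in> A \<Longrightarrow> polyfun N d (f i)) \<Longrightarrow> polyfun N d (\<lambda>x. \<Sum>i\<in>A. f i x)"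
  by (induction A rule: infinite_finite_induct) (auto intro: polyfun.intros)

lemma polyfun_prod:
  "(\<And>i. i \<in> A \<Longrightarrow> polyfun N d (f i)) \<Longrightarrow> polyfun N (card A * d) (\<lambda>x. \<Prod>i\<in>A. f i x)"
  by (induction A rule: infinite_finite_induct) (auto intro: polyfun.intros)

lemma polyfun_line:
  assumes "polyfun N d f"
  shows "\<exists>p. \<forall>t. f (\<lambda>i. x i + t * (y i - x i)) = poly p t"
  using assms
proof induction
  case (const d c)
  show ?case by (rule exI[of _ "[:c:]"]) simp
next
  case (var i)
  show ?case by (rule exI[of _ "[:x i, y i - x i:]"]) simp
next
  case (add d f g)
  then obtain p q where "\<forall>t. f (\<lambda>i. x i + t * (y i - x i)) = poly p t"
    "\<forall>t. g (\<lambda>i. x i + t * (y i - x i)) = poly q t" by blast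
  then show ?case by (intro exI[of _ "p + q"]) simp
next
  case (mult d f e g)
  then obtain p q where "\<forall>t. f (\<lambda>i. x i + t * (y i - x i)) = poly p t"
    "\<forall>t. g (\<lambda>i. x i + t * (y i - x i)) = poly q t" by blast
  then show ?case by (intro exI[of _ "p * q"]) simp
qed

definition monomials :: "nat \<Rightarrow> nat \<Rightarrow> ((nat \<Rightarrow> complex) \<Rightarrow> complex) set" where
  "monomials N d = (\<lambda>a x. \<Prod>i<N. x i ^ a i) ` PiE {..<N} (\<lambda>_. {..d})"

lemma finite_monomials: "finite (monomials N d)"
  by (auto simp: monomials_def intro!: finite_PiE)

lemma card_monomials: "card (monomials N d) \<le> (d + 1) ^ N"
  unfolding monomials_def
  by (rule card_image_le[THEN order_trans]) (auto simp: card_PiE intro!: finite_PiE)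

lemma monomialI: "(\<And>i. i < N \<Longrightarrow> a i \<le> d) \<Longrightarrow> (\<lambda>x. \<Prod>i<N. x i ^ a i) \<in> monomials N d"
  unfolding monomials_def
  by (rule image_eqI[of _ _ "restrict a {..<N}"]) (auto intro!: prod.cong)

lemma monomialE:
  assumes "f \<in> monomials N d"
  obtains a where "f = (\<lambda>x. \<Prod>i<N. x i ^ a i)" "\<And>i. i < N \<Longrightarrow> a i \<le> d"
proof -
  from assms obtain a where a: "a \<in> PiE {..<N} (\<lambda>_. {..d})" "f = (\<lambda>x. \<Prod>i<N. x i ^ a i)"
    unfolding monomials_def by blast
  have "a i \<le> d" if "i < N" for i
    using PiE_mem[OF a(1), of i] that by simp
  with a(2) show thesis
    by (rule that)
qed

lemma monomials_mult:
  assumes "f \<in> monomials N d" "g \<in> monomials N e"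
  shows "(\<lambda>x. f x * g x) \<in> monomials N (d + e)"
proof -
  obtain a where a: "f = (\<lambda>x. \<Prod>i<N. x i ^ a i)" "\<And>i. i < N \<Longrightarrow> a i \<le> d"
    using assms(1) by (rule monomialE) (rule that)
  obtain b where b: "g = (\<lambda>x. \<Prod>i<N. x i ^ b i)" "\<And>i. i < N \<Longrightarrow> b i \<le> e"
    using assms(2) by (rule monomialE) (rule that)
  have "(\<lambda>x. f x * g x) = (\<lambda>x. \<Prod>i<N. x i ^ (a i + b i))"
    by (simp add: a b power_add prod.distrib)
  then show ?thesis
    using a(2) b(2) by (auto intro!: monomialI add_mono)
qed

lemma span_mult:
  fixes f g :: "'a \<Rightarrow> complex"
  assumes "f \<in> cfun.span A" "g \<in> cfun.span B"
    and AB: "\<And>a b. a \<in> A \<Longrightarrow> b \<in> B \<Longrightarrow> (\<lambda>x. a x * b x) \<in> cfun.span C"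
  shows "(\<lambda>x. f x * g x) \<in> cfun.span C"
  using assms(1)
proof (induction rule: cfun.span_induct_alt)
  case base
  have "(\<lambda>x. 0 x * g x) = 0" by (auto simp: fun_eq_iff)
  then show ?case by (simp only: cfun.span_zero)
next
  case (step c a f)
  have "(\<lambda>x. a x * g x) \<in> cfun.span C"
    using assms(2)
  proof (induction rule: cfun.span_induct_alt)
    case base
    have "(\<lambda>x. a x * 0 x) = 0" by (auto simp: fun_eq_iff)
    then show ?case by (simp only: cfun.span_zero)
  next
    case (step d b g)
    have "(\<lambda>x. a x * (cscale d b + g) x) = cscale d (\<lambda>x. a x * b x) + (\<lambda>x. a x * g x)"
      by (auto simp: fun_eq_iff cscale_def algebra_simps)
    then show ?case
      using step AB \<open>a \<in> A\<close> by (simp only: cfun.span_add cfun.span_scale)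
  qed
  moreover have "(\<lambda>x. (cscale c a + f) x * g x) = cscale c (\<lambda>x. a x * g x) + (\<lambda>x. f x * g x)"
    by (auto simp: fun_eq_iff cscale_def algebra_simps)
  ultimately show ?case
    using step by (simp only: cfun.span_add cfun.span_scale)
qed

lemma polyfun_span_monomials: "polyfun N d f \<Longrightarrow> f \<in> cfun.span (monomials N d)"
proof (induction rule: polyfun.induct)
  case (const d c)
  have "(\<lambda>x. 1) \<in> monomials N d"
    using monomialI[of N "\<lambda>_. 0" d] by simp
  then have "cscale c (\<lambda>x. 1) \<in> cfun.span (monomials N d)"
    by (intro cfun.span_scale cfun.span_base)
  moreover have "cscale c (\<lambda>x. 1) = (\<lambda>x :: nat \<Rightarrow> complex. c)"
    by (simp add: cscale_def)
  ultimately show ?case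
    by (simp only:)
next
  case (var i)
  have "(\<Prod>j<N. x j ^ (if j = i then 1 else 0)) = x i" for x :: "nat \<Rightarrow> complex"
  proof -
    have "(\<Prod>j<N. x j ^ (if j = i then 1 else 0)) = (\<Prod>j<N. if j = i then x j else 1)"
      by (intro prod.cong) auto
    then show ?thesis
      using var by simp
  qed
  then show ?case
    using monomialI[of N "\<lambda>j. if j = i then 1 else 0" 1] by (intro cfun.span_base) auto
next
  case (add d f g)
  have "f + g \<in> cfun.span (monomials N d)"
    using add by (intro cfun.span_add)
  then show ?case
    by (simp add: plus_fun_def)
next
  case (mult d f e g)
  then show ?case
    by (elim span_mult) (auto intro: cfun.span_base monomials_mult)
next
  case (mono d f e)
  have "monomials N d \<subseteq> monomials N e"
  proof
    fix g assume "g \<in> monomials N d"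
    then obtain a where a: "g = (\<lambda>x. \<Prod>i<N. x i ^ a i)" "\<And>i. i < N \<Longrightarrow> a i \<le> d"
      by (rule monomialE) (rule that)
    with mono show "g \<in> monomials N e"
      by (auto intro!: monomialI intro: order_trans)
  qed
  then show ?case
    using mono cfun.span_mono by blast
qed

definition ispoly :: "nat \<Rightarrow> ((nat \<Rightarrow> complex) \<Rightarrow> complex) \<Rightarrow> bool" where
  "ispoly N f \<longleftrightarrow> (\<exists>d. polyfun N d f)"

named_theorems poly_intros

lemma ispoly_const [poly_intros]: "ispoly N (\<lambda>x. c)"
  by (auto simp: ispoly_def intro: polyfun.const)

lemma ispoly_var [poly_intros]: "i < N \<Longrightarrow> ispoly N (\<lambda>x. x i)"
  by (auto simp: ispoly_def intro: polyfun.var)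

lemma ispoly_add [poly_intros]: "ispoly N f \<Longrightarrow> ispoly N g \<Longrightarrow> ispoly N (\<lambda>x. f x + g x)"
proof -
  assume "ispoly N f" "ispoly N g"
  then obtain d e where "polyfun N d f" "polyfun N e g"
    unfolding ispoly_def by blast
  then have "polyfun N (max d e) f" "polyfun N (max d e) g"
    by (auto elim: polyfun.mono)
  from polyfun.add[OF this] show ?thesis
    unfolding ispoly_def by (rule exI)
qed

lemma ispoly_mult [poly_intros]: "ispoly N f \<Longrightarrow> ispoly N g \<Longrightarrow> ispoly N (\<lambda>x. f x * g x)"
proof -
  assume "ispoly N f" "ispoly N g"
  then obtain d e where "polyfun N d f" "polyfun N e g"
    unfolding ispoly_def by blast
  from polyfun.mult[OF this] show ?thesis
    unfolding ispoly_def by (rule exI)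
qed

lemma ispoly_uminus [poly_intros]: "ispoly N f \<Longrightarrow> ispoly N (\<lambda>x. - f x)"
  using ispoly_mult[OF ispoly_const[of N "-1"], of f] by simp

lemma ispoly_diff [poly_intros]: "ispoly N f \<Longrightarrow> ispoly N g \<Longrightarrow> ispoly N (\<lambda>x. f x - g x)"
  using ispoly_add[OF _ ispoly_uminus, of N f g] by simp

lemma ispoly_divide [poly_intros]: "ispoly N f \<Longrightarrow> ispoly N (\<lambda>x. f x / c)"
  using ispoly_mult[OF _ ispoly_const[of N "inverse c"], of f] by (simp add: field_simps)

lemma ispoly_power [poly_intros]: "ispoly N f \<Longrightarrow> ispoly N (\<lambda>x. f x ^ k)"
  by (induction k) (auto intro: poly_intros)

lemma ispoly_sum [poly_intros]:
  "(\<And>i. i \<in> A \<Longrightarrow> ispoly N (f i)) \<Longrightarrow> ispoly N (\<lambda>x. \<Sum>i\<in>A. f i x)"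
  by (induction A rule: infinite_finite_induct) (auto intro: poly_intros)

lemma ispoly_prod [poly_intros]:
  "(\<And>i. i \<in> A \<Longrightarrow> ispoly N (f i)) \<Longrightarrow> ispoly N (\<lambda>x. \<Prod>i\<in>A. f i x)"
  by (induction A rule: infinite_finite_induct) (auto intro: poly_intros)

lemma ispoly_if [poly_intros]:
  "(b \<Longrightarrow> ispoly N f) \<Longrightarrow> (\<not> b \<Longrightarrow> ispoly N g) \<Longrightarrow> ispoly N (\<lambda>x. if b then f x else g x)"
  by (cases b) simp_all

lemma ispoly_det [poly_intros]:
  assumes "\<And>i j. i < n \<Longrightarrow> j < n \<Longrightarrow> ispoly N (\<lambda>x. f x i j)"
  shows "ispoly N (\<lambda>x. det (mat n n (\<lambda>(i, j). f x i j)))"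
proof -
  have "det (mat n n (\<lambda>(i, j). f x i j))
      = (\<Sum>p\<in>{p. p permutes {0..<n}}. signof p * (\<Prod>i\<in>{0..<n}. f x i (p i)))" for x
    unfolding det_def
    by (auto intro!: sum.cong prod.cong simp: permutes_in_image)
  then show ?thesis
    by (auto intro!: poly_intros assms simp: permutes_in_image)
qed

definition line_closed :: "(nat \<Rightarrow> complex) set \<Rightarrow> bool" where
  "line_closed A \<longleftrightarrow> (\<forall>x\<in>A. \<forall>y\<in>A. \<forall>t. (\<lambda>i. x i + t * (y i - x i)) \<in> A)"

lemma line_closed_UNIV: "line_closed UNIV"
  by (simp add: line_closed_def)

lemma line_closed_flag: "line_closed {x. \<forall>i\<ge>k. x i = x0 i}"
  by (simp add: line_closed_def)

definition zopen :: "nat \<Rightarrow> (nat \<Rightarrow> complex) set \<Rightarrow> (nat \<Rightarrow> complex) set \<Rightarrow> bool" where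
  "zopen N A E \<longleftrightarrow>
     E \<subseteq> A \<and> (\<forall>x\<in>E. \<exists>\<Delta>. ispoly N \<Delta> \<and> \<Delta> x \<noteq> 0 \<and> (\<forall>z\<in>A. \<Delta> z \<noteq> 0 \<longrightarrow> z \<in> E))"

lemma poly_common_nonzero:
  assumes "ispoly N f" "ispoly N g" "line_closed A" "x \<in> A" "y \<in> A" "f x \<noteq> 0" "g y \<noteq> 0"
  obtains z where "z \<in> A" "f z \<noteq> 0" "g z \<noteq> 0"
proof -
  define l where "l t i = x i + t * (y i - x i)" for t i
  obtain p where p: "\<And>t. f (l t) = poly p t"
    using assms(1) polyfun_line unfolding ispoly_def l_def by metis
  obtain q where q: "\<And>t. g (l t) = poly q t"
    using assms(2) polyfun_line unfolding ispoly_def l_def by metis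
  have "l 0 = x" "l 1 = y"
    by (auto simp: l_def)
  with assms p[of 0] q[of 1] have "p \<noteq> 0" "q \<noteq> 0"
    by auto
  then have "finite {t. poly (p * q) t = 0}"
    by (intro poly_roots_finite) simp
  then obtain t where "t \<notin> {t. poly (p * q) t = 0}"
    using ex_new_if_finite infinite_UNIV_char_0 by blast
  moreover have "l t \<in> A"
    using assms by (auto simp: line_closed_def l_def[abs_def])
  ultimately show ?thesis
    using that[of "l t"] p q by auto
qed

lemma zopen_common_nonzero:
  assumes "zopen N A E" "line_closed A" "ispoly N f" "ispoly N g"
    and "x \<in> E" "y \<in> E" "f x \<noteq> 0" "g y \<noteq> 0"
  obtains z where "z \<in> E" "f z \<noteq> 0" "g z \<noteq> 0"
proof -
  obtain \<Delta> where D: "ispoly N \<Delta>" "\<Delta> x \<noteq> 0" "\<And>z. z \<in> A \<Longrightarrow> \<Delta> z \<noteq> 0 \<Longrightarrow> z \<in> E"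
    using assms(1,5) unfolding zopen_def by metis
  have "x \<in> A" "y \<in> A"
    using assms by (auto simp: zopen_def)
  then obtain z where "z \<in> A" "f z * \<Delta> z \<noteq> 0" "g z \<noteq> 0"
    using poly_common_nonzero[OF ispoly_mult[OF assms(3) D(1)] assms(4,2), of x y]
      assms(7,8) D(2) by auto
  then show ?thesis
    using that D(3) by auto
qed

section \<open>Closed subsets of subspaces of the Grassmannian\<close>

definition vanishes_on ::
    "nat \<Rightarrow> ((nat \<Rightarrow> 'a \<Rightarrow> complex) \<Rightarrow> complex) \<Rightarrow> ('a \<Rightarrow> complex) set set \<Rightarrow> bool" where
  "vanishes_on k F T \<longleftrightarrow> (\<forall>H\<in>T. \<forall>w. frame_of k H w \<longrightarrow> F w = 0)"

lemma topspace_zariski: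
  assumes "k > 0"
  shows "topspace (zariski k W) = Grass k W"
proof
  have "closedin (zariski k W) (topspace (zariski k W))"
    by simp
  then obtain S where "topspace (zariski k W) = zero_locus k W S"
    unfolding closedin_zariski[OF assms] by blast
  then show "topspace (zariski k W) \<subseteq> Grass k W"
    by (auto simp: zero_locus_def)
  have "closedin (zariski k W) (Grass k W)"
    unfolding closedin_zariski[OF assms] by (rule exI[of _ "{}"]) (auto simp: zero_locus_def)
  then show "Grass k W \<subseteq> topspace (zariski k W)"
    by (rule closedin_subset)
qed

lemma frame_of_span: "frame_of k H w \<Longrightarrow> H = cfun.span (w ` {..<k})"
  by (simp add: frame_of_def)

lemma frame_of_inj: "frame_of k H w \<Longrightarrow> frame_of k H' w \<Longrightarrow> H = H'"
  by (simp add: frame_of_def)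

lemma zero_locus_closed_point:
  assumes "pluecker_form k W d F" "H \<in> Grass k W" "frame_of k H w"
  shows "vanishes_on k F {H} \<longleftrightarrow> F w = 0"
proof
  show "F w = 0" if "vanishes_on k F {H}"
    using that assms(3) unfolding vanishes_on_def by blast
  show "vanishes_on k F {H}" if "F w = 0"
    unfolding vanishes_on_def using vanishing_frame_indep[OF assms _ that] by blast
qed

lemma polyfun_det:
  assumes "\<And>i j. i < n \<Longrightarrow> j < n \<Longrightarrow> polyfun N d (\<lambda>x. f x i j)"
  shows "polyfun N (n * d) (\<lambda>x. det (mat n n (\<lambda>(i, j). f x i j)))"
proof -
  have eq: "det (mat n n (\<lambda>(i, j). f x i j))
      = (\<Sum>p\<in>{p. p permutes {0..<n}}. signof p * (\<Prod>i\<in>{0..<n}. f x i (p i)))" for x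
    unfolding det_def
    by (auto intro!: sum.cong prod.cong simp: permutes_in_image)
  have "polyfun N (0 + card {0..<n} * d) (\<lambda>x. signof p * (\<Prod>i\<in>{0..<n}. f x i (p i)))"
    if "p permutes {0..<n}" for p
    using that by (intro polyfun.mult polyfun.const polyfun_prod assms) (auto simp: permutes_in_image)
  then show ?thesis
    unfolding eq by (intro polyfun_sum) simp
qed

lemma pluecker_form_polyfun:
  assumes "pluecker_form k W d F"
    and "\<And>\<phi> l. \<phi> \<in> dual_on cscale W \<Longrightarrow> l < k \<Longrightarrow> polyfun N M (\<lambda>x. \<phi> (w x l))"
  shows "polyfun N (k * M * d) (\<lambda>x. F (w x))"
  using assms(1)
proof induction
  case (const c)
  show ?case by (rule polyfun.const)
next
  case (minor \<phi>)
  then show ?case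
    using assms(2) by (auto intro!: polyfun_det)
next
  case (add d F G)
  then show ?case by (intro polyfun.add)
next
  case (mult d F e G)
  then have "polyfun N (k * M * d + k * M * e) (\<lambda>x. F (w x) * G (w x))"
    by (intro polyfun.mult)
  then show ?case
    by (simp add: algebra_simps)
qed

lemma pluecker_form_zero: "pluecker_form k W d (\<lambda>w. 0)"
proof (induction d)
  case (Suc d)
  have "pluecker_form k W 1 (\<lambda>w. det (mat k k (\<lambda>(i, j). (\<lambda>_. 0) (w j))))"
    by (rule pluecker_form.minor) (simp add: dual_on_def)
  then have "pluecker_form k W (0 + 1) (\<lambda>w. 0 * det (mat k k (\<lambda>(i, j). (\<lambda>_. 0) (w j))))"
    by (intro pluecker_form.mult pluecker_form.const)
  from pluecker_form.mult[OF Suc this] show ?case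
    by simp
qed (rule pluecker_form.const)

lemma pluecker_form_scale: "pluecker_form k W d F \<Longrightarrow> pluecker_form k W d (\<lambda>w. c * F w)"
  using pluecker_form.mult[OF pluecker_form.const[of k W c], of d F] by simp

lemma pluecker_form_sum:
  "(\<And>i. i \<in> A \<Longrightarrow> pluecker_form k W d (F i)) \<Longrightarrow> pluecker_form k W d (\<lambda>w. \<Sum>i\<in>A. c i * F i w)"
proof (induction A rule: infinite_finite_induct)
  case (insert i A)
  then have "pluecker_form k W d (\<lambda>w. c i * F i w + (\<Sum>i\<in>A. c i * F i w))"
    by (intro pluecker_form.add pluecker_form_scale) auto
  then show ?case
    using insert by simp
qed (simp_all add: pluecker_form_zero)

lemma pluecker_form_power: "pluecker_form k W d F \<Longrightarrow> pluecker_form k W (d * m) (\<lambda>w. F w ^ m)"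
proof (induction m)
  case (Suc m)
  then have "pluecker_form k W (d + d * m) (\<lambda>w. F w * F w ^ m)"
    by (intro pluecker_form.mult)
  then show ?case by simp
qed (auto intro: pluecker_form.const)

locale grass_subset =
  fixes k :: nat and W :: "('a \<Rightarrow> complex) set" and V :: "('a \<Rightarrow> complex) set set"
  assumes k_pos: "k > 0" and V_sub: "V \<subseteq> Grass k W"
begin

abbreviation X :: "('a \<Rightarrow> complex) set topology" where
  "X \<equiv> subtopology (zariski k W) V"

abbreviation van :: "((nat \<Rightarrow> 'a \<Rightarrow> complex) \<Rightarrow> complex) \<Rightarrow> ('a \<Rightarrow> complex) set set \<Rightarrow> bool" where
  "van \<equiv> vanishes_on k"

lemma topspace_X: "topspace X = V"
  using V_sub topspace_zariski[OF k_pos, of W] by (simp add: topspace_subtopology Int_absorb1)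

lemma closedin_X: "closedin X Z \<longleftrightarrow> (\<exists>S \<subseteq> pluecker_forms k W. Z = zero_locus k W S \<inter> V)"
  unfolding closedin_subtopology closedin_zariski[OF k_pos] by blast

lemma frame_ex: "H \<in> V \<Longrightarrow> \<exists>w. frame_of k H w"
  using V_sub Grass_frame_exists[OF _ k_pos] by blast

lemma closed_separate:
  assumes "closedin X Z" "H \<in> V" "H \<notin> Z"
  obtains d F where "pluecker_form k W d F" "van F Z" "\<not> van F {H}"
proof -
  obtain S where S: "S \<subseteq> pluecker_forms k W" "Z = zero_locus k W S \<inter> V"
    using assms(1) closedin_X by blast
  then obtain F w where F: "F \<in> S" "frame_of k H w" "F w \<noteq> 0"
    using assms(2,3) V_sub by (auto simp: zero_locus_def)
  moreover from this obtain d where "pluecker_form k W d F"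
    using S by (auto simp: pluecker_forms_def)
  moreover have "van F Z"
    using S(2) F(1) by (auto simp: vanishes_on_def zero_locus_def)
  ultimately show ?thesis
    by (intro that[of d F]) (auto simp: vanishes_on_def)
qed

lemma closedin_form:
  assumes "pluecker_form k W d F" "closedin X Z"
  shows "closedin X {H\<in>Z. van F {H}}"
proof -
  have "Z \<subseteq> V"
    using assms(2) closedin_subset topspace_X by blast
  have "closedin X (zero_locus k W {F} \<inter> V)"
    unfolding closedin_X using assms(1) by (intro exI[of _ "{F}"]) (auto simp: pluecker_forms_def)
  then have "closedin X (Z \<inter> (zero_locus k W {F} \<inter> V))"
    using assms(2) by (rule closedin_Int[rotated])
  moreover have "Z \<inter> (zero_locus k W {F} \<inter> V) = {H\<in>Z. van F {H}}"
    using \<open>Z \<subseteq> V\<close> V_sub by (auto simp: zero_locus_def vanishes_on_def)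
  ultimately show ?thesis
    by simp
qed

lemma prime_on_irreducible:
  assumes Z: "closedin X Z" "irreducible_space (subtopology X Z)"
    and F: "pluecker_form k W d F" and G: "pluecker_form k W e G"
    and FG: "van (\<lambda>w. F w * G w) Z"
  shows "van F Z \<or> van G Z"
proof -
  have "Z \<subseteq> V"
    using Z(1) closedin_subset topspace_X by blast
  have top: "topspace (subtopology X Z) = Z"
    using \<open>Z \<subseteq> V\<close> topspace_X by (metis inf.absorb_iff2 topspace_subtopology)
  have "Z = {H\<in>Z. van F {H}} \<union> {H\<in>Z. van G {H}}"
  proof -
    have "van F {H} \<or> van G {H}" if "H \<in> Z" for H
    proof -
      obtain w where w: "frame_of k H w"
        using frame_ex \<open>H \<in> Z\<close> \<open>Z \<subseteq> V\<close> by blast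
      then have "F w * G w = 0"
        using FG \<open>H \<in> Z\<close> by (auto simp: vanishes_on_def)
      moreover have "H \<in> Grass k W"
        using \<open>H \<in> Z\<close> \<open>Z \<subseteq> V\<close> V_sub by blast
      ultimately show ?thesis
        using zero_locus_closed_point[OF F _ w] zero_locus_closed_point[OF G _ w] by auto
    qed
    then show ?thesis by auto
  qed
  moreover have "closedin (subtopology X Z) {H\<in>Z. van F {H}}"
    "closedin (subtopology X Z) {H\<in>Z. van G {H}}"
    by (rule closedin_subset_topspace[OF closedin_form[OF F Z(1)]], blast)
      (rule closedin_subset_topspace[OF closedin_form[OF G Z(1)]], blast)
  ultimately have "{H\<in>Z. van F {H}} = Z \<or> {H\<in>Z. van G {H}} = Z"
    using Z(2) unfolding irreducible_space_def top by blast
  then show ?thesis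
    by (auto simp: vanishes_on_def)
qed

definition zclosure :: "('a \<Rightarrow> complex) set set \<Rightarrow> ('a \<Rightarrow> complex) set set" where
  "zclosure T = {H\<in>V. \<forall>d F. pluecker_form k W d F \<longrightarrow> van F T \<longrightarrow> van F {H}}"

lemma zclosure_superset: "T \<subseteq> V \<Longrightarrow> T \<subseteq> zclosure T"
  by (auto simp: zclosure_def vanishes_on_def)

lemma zclosure_mono: "T \<subseteq> T' \<Longrightarrow> zclosure T \<subseteq> zclosure T'"
proof
  fix H assume T: "T \<subseteq> T'" and H: "H \<in> zclosure T"
  have "van F {H}" if "pluecker_form k W d F" "van F T'" for d F
  proof -
    have "van F T"
      using that(2) T unfolding vanishes_on_def by (meson subsetD)
    then show ?thesis
      using H that(1) unfolding zclosure_def mem_Collect_eq by meson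
  qed
  then show "H \<in> zclosure T'"
    using H unfolding zclosure_def mem_Collect_eq by meson
qed

lemma van_zclosure:
  assumes "pluecker_form k W d F" "van F T"
  shows "van F (zclosure T)"
proof -
  have "van F {H}" if "H \<in> zclosure T" for H
    using that assms unfolding zclosure_def mem_Collect_eq by meson
  then show ?thesis
    unfolding vanishes_on_def by (meson singletonI)
qed

lemma closedin_zclosure: "closedin X (zclosure T)"
  unfolding closedin_X
proof (intro exI conjI)
  show "{F. (\<exists>d. pluecker_form k W d F) \<and> van F T} \<subseteq> pluecker_forms k W"
    by (auto simp: pluecker_forms_def)
  have "(H \<in> zero_locus k W {F. (\<exists>d. pluecker_form k W d F) \<and> van F T})
      \<longleftrightarrow> (\<forall>d F. pluecker_form k W d F \<longrightarrow> van F T \<longrightarrow> van F {H})" if "H \<in> V" for H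
    using that V_sub unfolding zero_locus_def by (simp add: vanishes_on_def[of k _ "{H}"]) (meson subsetD)
  then show "zclosure T = zero_locus k W {F. (\<exists>d. pluecker_form k W d F) \<and> van F T} \<inter> V"
    unfolding zclosure_def by blast
qed

lemma irreducible_zclosure:
  assumes T: "T \<subseteq> V" "T \<noteq> {}"
    and prime: "\<And>d F e G. pluecker_form k W d F \<Longrightarrow> pluecker_form k W e G \<Longrightarrow>
      van (\<lambda>w. F w * G w) T \<Longrightarrow> van F T \<or> van G T"
  shows "irreducible_space (subtopology X (zclosure T))"
proof -
  have sub: "zclosure T \<subseteq> V"
    by (auto simp: zclosure_def)
  then have top: "topspace (subtopology X (zclosure T)) = zclosure T"
    using topspace_X by (metis inf.absorb_iff2 topspace_subtopology)
  show ?thesis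
    unfolding irreducible_space_def top
  proof (intro conjI allI impI)
    show "zclosure T \<noteq> {}"
      using T zclosure_superset by blast
    fix A B
    assume "closedin (subtopology X (zclosure T)) A" "closedin (subtopology X (zclosure T)) B"
      and AB: "zclosure T = A \<union> B"
    then have A: "closedin X A" and B: "closedin X B"
      using closedin_zclosure closedin_closed_subtopology by blast+
    show "A = zclosure T \<or> B = zclosure T"
    proof (rule ccontr)
      assume "\<not> ?thesis"
      then obtain H K where H: "H \<in> zclosure T" "H \<notin> A" and K: "K \<in> zclosure T" "K \<notin> B"
        using AB by blast
      obtain d F where F: "pluecker_form k W d F" "van F A" "\<not> van F {H}"
        using closed_separate[OF A _ H(2)] H(1) sub by blast
      obtain e G where G: "pluecker_form k W e G" "van G B" "\<not> van G {K}"
        using closed_separate[OF B _ K(2)] K(1) sub by blast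
      have "van (\<lambda>w. F w * G w) (zclosure T)"
        using F(2) G(2) AB by (auto simp: vanishes_on_def)
      then have "van (\<lambda>w. F w * G w) T"
        using zclosure_superset[OF T(1)] by (auto simp: vanishes_on_def)
      then have "van F T \<or> van G T"
        using prime F(1) G(1) by blast
      then have "van F (zclosure T) \<or> van G (zclosure T)"
        using van_zclosure F(1) G(1) by blast
      then show False
        using F(3) G(3) H(1) K(1) by (auto simp: vanishes_on_def)
    qed
  qed
qed

section \<open>Parametrised families\<close>

definition family :: "nat \<Rightarrow> (nat \<Rightarrow> complex) set \<Rightarrow> ((nat \<Rightarrow> complex) \<Rightarrow> nat \<Rightarrow> 'a \<Rightarrow> complex) \<Rightarrow> bool"
  where
  "family N E w \<longleftrightarrow> (\<forall>x\<in>E. \<exists>H\<in>V. frame_of k H (w x)) \<and>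
     (\<forall>d F. pluecker_form k W d F \<longrightarrow> ispoly N (\<lambda>x. F (w x)))"

definition members :: "(nat \<Rightarrow> complex) set \<Rightarrow> ((nat \<Rightarrow> complex) \<Rightarrow> nat \<Rightarrow> 'a \<Rightarrow> complex) \<Rightarrow>
    ('a \<Rightarrow> complex) set set" where
  "members E w = {H. \<exists>x\<in>E. frame_of k H (w x)}"

lemma members_subset: "family N E w \<Longrightarrow> members E w \<subseteq> V"
  unfolding family_def members_def using frame_of_inj by blast

lemma van_members:
  assumes "family N E w" "pluecker_form k W d F"
  shows "van F (members E w) \<longleftrightarrow> (\<forall>x\<in>E. F (w x) = 0)"
proof
  assume "van F (members E w)"
  then show "\<forall>x\<in>E. F (w x) = 0"
    using assms(1) unfolding vanishes_on_def members_def family_def by blast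
next
  assume F: "\<forall>x\<in>E. F (w x) = 0"
  show "van F (members E w)"
    unfolding vanishes_on_def
  proof (intro ballI allI impI)
    fix H w' assume H: "H \<in> members E w" and w': "frame_of k H w'"
    then obtain x where x: "x \<in> E" "frame_of k H (w x)"
      by (auto simp: members_def)
    have "H \<in> Grass k W"
      using H members_subset[OF assms(1)] V_sub by blast
    then show "F w' = 0"
      using vanishing_frame_indep[OF assms(2) _ x(2) w'] F x(1) by blast
  qed
qed

lemma prime_on_members:
  assumes fam: "family N E w" and E: "zopen N A E" "line_closed A"
    and F: "pluecker_form k W d F" and G: "pluecker_form k W e G"
    and FG: "van (\<lambda>w. F w * G w) (members E w)"
  shows "van F (members E w) \<or> van G (members E w)"
proof (rule ccontr)
  assume "\<not> ?thesis"
  then obtain x y where x: "x \<in> E" "F (w x) \<noteq> 0" and y: "y \<in> E" "G (w y) \<noteq> 0"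
    using van_members[OF fam F] van_members[OF fam G] by blast
  have "ispoly N (\<lambda>x. F (w x))" "ispoly N (\<lambda>x. G (w x))"
    using fam F G unfolding family_def by blast+
  from zopen_common_nonzero[OF E this x(1) y(1) x(2) y(2)]
  obtain z where "z \<in> E" "F (w z) \<noteq> 0" "G (w z) \<noteq> 0" .
  then show False
    using FG van_members[OF fam pluecker_form.mult[OF F G]] by auto
qed

lemma irreducible_family:
  assumes "family N E w" "zopen N A E" "line_closed A" "E \<noteq> {}"
  shows "irreducible_space (subtopology X (zclosure (members E w)))"
proof (rule irreducible_zclosure)
  show "members E w \<subseteq> V"
    using members_subset assms(1) .
  show "members E w \<noteq> {}"
    using assms(1,4) unfolding family_def members_def by fastforce
qed (rule prime_on_members[OF assms(1-3)])

lemma irreducible_X: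
  assumes "family N E w" "zopen N A E" "line_closed A" "E \<noteq> {}" "V \<subseteq> members E w"
  shows "irreducible_space X"
proof -
  have "zclosure (members E w) = V"
    using assms(5) zclosure_superset[OF members_subset[OF assms(1)]] by (auto simp: zclosure_def)
  then show ?thesis
    using irreducible_family[OF assms(1-4)] by (simp add: subtopology_subtopology)
qed

section \<open>Lower bound for the dimension\<close>

lemma krull_dim_ge:
  assumes fam: "family N E w" and E: "zopen N UNIV E" and x0: "x0 \<in> E"
    and F: "\<And>j. j < N \<Longrightarrow> \<exists>d. pluecker_form k W d (F j)"
    and u: "\<And>j. j < N \<Longrightarrow> ispoly N (u j)" "\<And>j. j < N \<Longrightarrow> u j x0 \<noteq> 0"
    and Fu: "\<And>j x. j < N \<Longrightarrow> x \<in> E \<Longrightarrow> \<forall>i>j. x i = x0 i \<Longrightarrow> F j (w x) = (x j - x0 j) * u j x"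
  shows "enat N \<le> krull_dim X"
proof -
  define A where "A j = {x. \<forall>i\<ge>j. x i = x0 i}" for j :: nat
  define Z where "Z j = zclosure (members (E \<inter> A j) w)" for j
  have A: "line_closed (A j)" for j
    unfolding A_def by (rule line_closed_flag)
  have zo: "zopen N (A j) (E \<inter> A j)" for j
    using E unfolding zopen_def by blast
  have x0A: "x0 \<in> E \<inter> A j" for j
    using x0 by (simp add: A_def)
  have fam': "family N (E \<inter> A j) w" for j
    using fam by (auto simp: family_def)
  have "closedin X (Z j) \<and> irreducible_space (subtopology X (Z j))" for j
    unfolding Z_def using irreducible_family[OF fam' zo A] x0A closedin_zclosure by blast
  moreover have "Z j \<subset> Z (Suc j)" if "j < N" for j
  proof -
    have "A j \<subseteq> A (Suc j)"
      by (auto simp: A_def)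
    then have "Z j \<subseteq> Z (Suc j)"
      unfolding Z_def by (intro zclosure_mono) (auto simp: members_def)
    moreover have "Z j \<noteq> Z (Suc j)"
    proof
      assume eq: "Z j = Z (Suc j)"
      obtain d where d: "pluecker_form k W d (F j)"
        using F \<open>j < N\<close> by blast
      have "F j (w x) = 0" if "x \<in> E \<inter> A j" for x
      proof -
        have "\<forall>i>j. x i = x0 i" "x j = x0 j"
          using that by (auto simp: A_def)
        then show ?thesis
          using Fu[OF \<open>j < N\<close>, of x] that by simp
      qed
      then have "van (F j) (Z j)"
        unfolding Z_def using van_zclosure[OF d] van_members[OF fam' d] by blast
      moreover have "members (E \<inter> A (Suc j)) w \<subseteq> Z j"
        unfolding eq unfolding Z_def by (rule zclosure_superset[OF members_subset[OF fam']])
      ultimately have "van (F j) (members (E \<inter> A (Suc j)) w)"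
        unfolding vanishes_on_def by blast
      then have zero: "F j (w x) = 0" if "x \<in> E \<inter> A (Suc j)" for x
        using van_members[OF fam' d] that by blast
      \<comment> \<open>a point of the larger flag where both the coordinate and the unit are nonzero\<close>
      obtain \<Delta> where D: "ispoly N \<Delta>" "\<Delta> x0 \<noteq> 0" "\<And>z. \<Delta> z \<noteq> 0 \<Longrightarrow> z \<in> E"
        using E x0 unfolding zopen_def by (metis UNIV_I)
      define y where "y i = (if i = j then x0 i + 1 else x0 i)" for i
      have "ispoly N (\<lambda>x. \<Delta> x * u j x)" "ispoly N (\<lambda>x. x j - x0 j)"
        using D(1) u(1) \<open>j < N\<close> by (auto intro!: poly_intros)
      moreover have "x0 \<in> A (Suc j)" "y \<in> A (Suc j)"
        by (auto simp: A_def y_def)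
      ultimately obtain z where z: "z \<in> A (Suc j)" "\<Delta> z * u j z \<noteq> 0" "z j - x0 j \<noteq> 0"
        using poly_common_nonzero[OF _ _ A, where f = "\<lambda>x. \<Delta> x * u j x"
            and g = "\<lambda>x. x j - x0 j" and x = x0 and y = y]
          D(2) u(2)[OF \<open>j < N\<close>] by (auto simp: y_def)
      then have "z \<in> E" "\<forall>i>j. z i = x0 i"
        using D(3) by (auto simp: A_def)
      with Fu[OF \<open>j < N\<close>, of z] zero[of z] z show False
        by auto
    qed
    ultimately show ?thesis by blast
  qed
  ultimately have "enat N \<in> {enat n | n. \<exists>Z :: nat \<Rightarrow> ('a \<Rightarrow> complex) set set.
     (\<forall>i\<le>n. closedin X (Z i) \<and> irreducible_space (subtopology X (Z i))) \<and>
     (\<forall>i<n. Z i \<subset> Z (Suc i))}"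
    by blast
  then show ?thesis
    unfolding krull_dim_def by (rule Sup_upper)
qed

end

section \<open>Upper bound for the dimension\<close>

lemma functional_extension:
  assumes "cfun.subspace W" "cfun.independent B" "B \<subseteq> W"
  shows "\<exists>\<phi>\<in>dual_on cscale W. \<forall>b\<in>B. \<phi> b = f b"
proof -
  interpret vector_space_pair cscale "(*) :: complex \<Rightarrow> complex \<Rightarrow> complex"
    by unfold_locales (auto simp: algebra_simps)
  obtain g where g: "Vector_Spaces.linear cscale (*) g" "\<forall>b\<in>B. g b = f b"
    using linear_independent_extend[OF assms(2)] by blast
  interpret g: Vector_Spaces.linear cscale "(*)" g
    by fact
  define \<phi> where "\<phi> x = (if x \<in> W then g x else 0)" for x
  have "\<phi> \<in> dual_on cscale W"
    using assms(1) by (auto simp: dual_on_def \<phi>_def g.add g.scale cfun.subspace_add cfun.subspace_scale)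
  moreover have "\<forall>b\<in>B. \<phi> b = f b"
    using g(2) assms(3) by (auto simp: \<phi>_def)
  ultimately show ?thesis
    by blast
qed

lemma frame_dual:
  assumes "cfun.subspace W" "H \<subseteq> W" "frame_of k H w"
  obtains \<phi> where "\<And>i. i < k \<Longrightarrow> \<phi> i \<in> dual_on cscale W"
    "\<And>i j. i < k \<Longrightarrow> j < k \<Longrightarrow> \<phi> i (w j) = (if i = j then 1 else 0)"
proof -
  have w: "inj_on w {..<k}" "cfun.independent (w ` {..<k})" "w ` {..<k} \<subseteq> W"
    using assms frame_of_mem[OF assms(3)] by (auto simp: frame_of_def)
  have "\<exists>\<phi>\<in>dual_on cscale W. \<forall>b\<in>w ` {..<k}. \<phi> b = (if b = w i then 1 else 0)" for i
    using functional_extension[OF assms(1) w(2,3)] .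
  then obtain \<phi> where \<phi>: "\<And>i. \<phi> i \<in> dual_on cscale W"
    "\<And>i j. j < k \<Longrightarrow> \<phi> i (w j) = (if w j = w i then 1 else 0)"
    by (metis imageI lessThan_iff)
  have "\<phi> i (w j) = (if i = j then 1 else 0)" if "i < k" "j < k" for i j
    using \<phi>(2)[OF that(2), of i] w(1) that by (auto dest: inj_onD)
  with \<phi>(1) show ?thesis
    by (rule that)
qed

lemma pluecker_form_degree_0: "pluecker_form k W d F \<Longrightarrow> d = 0 \<Longrightarrow> \<exists>c. F = (\<lambda>w. c)"
proof (induction rule: pluecker_form.induct)
  case (const c)
  show ?case by (rule exI[of _ c]) (rule refl)
next
  case (add d F G)
  then obtain a b where "F = (\<lambda>w. a)" "G = (\<lambda>w. b)" by blast
  then show ?case by (intro exI[of _ "a + b"]) simp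
next
  case (mult d F e G)
  then obtain a b where "F = (\<lambda>w. a)" "G = (\<lambda>w. b)" by fastforce
  then show ?case by (intro exI[of _ "a * b"]) simp
qed simp

context grass_subset
begin

definition nforms :: "('a \<Rightarrow> complex) set set \<Rightarrow> nat \<Rightarrow> nat \<Rightarrow> bool" where
  "nforms Z d m \<longleftrightarrow> (\<exists>G. (\<forall>i<m. pluecker_form k W d (G i)) \<and>
     (\<forall>c. van (\<lambda>w. \<Sum>i<m. c i * G i w) Z \<longrightarrow> (\<forall>i<m. c i = 0)))"

lemma nforms_step:
  assumes Z': "closedin X Z'" "irreducible_space (subtopology X Z')" and Z: "Z \<subseteq> Z'"
    and f: "pluecker_form k W e f" "van f Z" "\<not> van f Z'"
    and a: "nforms Z (d + e) a" and b: "nforms Z' d b"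
  shows "nforms Z' (d + e) (a + b)"
proof -
  obtain G where G: "\<And>i. i < a \<Longrightarrow> pluecker_form k W (d + e) (G i)"
    "\<And>c. van (\<lambda>w. \<Sum>i<a. c i * G i w) Z \<Longrightarrow> \<forall>i<a. c i = 0"
    using a unfolding nforms_def by blast
  obtain G' where G': "\<And>i. i < b \<Longrightarrow> pluecker_form k W d (G' i)"
    "\<And>c. van (\<lambda>w. \<Sum>i<b. c i * G' i w) Z' \<Longrightarrow> \<forall>i<b. c i = 0"
    using b unfolding nforms_def by blast
  define K where "K i w = (if i < a then G i w else G' (i - a) w * f w)" for i w
  have K: "pluecker_form k W (d + e) (K i)" if "i < a + b" for i
  proof (cases "i < a")
    case True
    then have "K i = G i" by (auto simp: K_def)
    then show ?thesis using G True by simp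
  next
    case False
    then have "K i = (\<lambda>w. G' (i - a) w * f w)" by (auto simp: K_def)
    moreover have "pluecker_form k W (d + e) (\<lambda>w. G' (i - a) w * f w)"
      using False that by (intro pluecker_form.mult G' f(1)) auto
    ultimately show ?thesis by simp
  qed
  have split: "(\<Sum>i<a + b. c i * K i w)
      = (\<Sum>i<a. c i * G i w) + (\<Sum>i<b. c (a + i) * G' i w) * f w" for c w
  proof -
    have "(\<Sum>i<a + b. c i * K i w) = (\<Sum>i<a. c i * K i w) + (\<Sum>i<b. c (a + i) * K (a + i) w)"
      by (induction b) (auto simp: algebra_simps)
    also have "(\<Sum>i<b. c (a + i) * K (a + i) w) = (\<Sum>i<b. c (a + i) * G' i w) * f w"
      by (simp add: K_def sum_distrib_right mult.assoc)
    finally show ?thesis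
      by (simp add: K_def)
  qed
  have "\<forall>i<a + b. c i = 0" if c: "van (\<lambda>w. \<Sum>i<a + b. c i * K i w) Z'" for c
  proof -
    have "van (\<lambda>w. \<Sum>i<a. c i * G i w) Z"
      using c f(2) Z unfolding split vanishes_on_def by fastforce
    then have ca: "\<forall>i<a. c i = 0"
      by (rule G(2))
    then have "van (\<lambda>w. (\<Sum>i<b. c (a + i) * G' i w) * f w) Z'"
      using c unfolding split by simp
    moreover have "pluecker_form k W d (\<lambda>w. \<Sum>i<b. c (a + i) * G' i w)"
      by (intro pluecker_form_sum) (simp add: G'(1))
    ultimately have "van (\<lambda>w. \<Sum>i<b. c (a + i) * G' i w) Z'"
      using prime_on_irreducible[OF Z' _ f(1)] f(3) by blast
    then have "\<forall>i<b. c (a + i) = 0"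
      by (rule G'(2))
    show ?thesis
    proof (intro allI impI)
      fix i assume "i < a + b"
      show "c i = 0"
      proof (cases "i < a")
        case False
        then have "i - a < b" "a + (i - a) = i"
          using \<open>i < a + b\<close> by auto
        with \<open>\<forall>i<b. c (a + i) = 0\<close> show ?thesis
          by metis
      qed (use ca in simp)
    qed
  qed
  with K show ?thesis
    unfolding nforms_def by blast
qed

lemma nonvanishing_form:
  assumes W: "cfun.subspace W" and H: "H \<in> V"
  obtains F where "pluecker_form k W d F" "\<not> van F {H}"
proof -
  obtain w where w: "frame_of k H w"
    using frame_ex H by blast
  have "H \<subseteq> W"
    using H V_sub by (auto simp: Grass_def)
  then obtain \<phi> where \<phi>: "\<And>i. i < k \<Longrightarrow> \<phi> i \<in> dual_on cscale W"
    "\<And>i j. i < k \<Longrightarrow> j < k \<Longrightarrow> \<phi> i (w j) = (if i = j then 1 else 0)"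
    using frame_dual[OF W _ w] by blast
  have "mat k k (\<lambda>(i, j). \<phi> i (w j)) = 1\<^sub>m k"
    by (rule eq_matI) (auto simp: \<phi>(2))
  then have "det (mat k k (\<lambda>(i, j). \<phi> i (w j))) ^ d \<noteq> 0"
    by simp
  moreover have "pluecker_form k W (1 * d) (\<lambda>w. det (mat k k (\<lambda>(i, j). \<phi> i (w j))) ^ d)"
    by (intro pluecker_form_power pluecker_form.minor \<phi>(1))
  ultimately show ?thesis
    using that[of "\<lambda>w. det (mat k k (\<lambda>(i, j). \<phi> i (w j))) ^ d"] w
    by (auto simp: vanishes_on_def)
qed

lemma nforms_one:
  assumes W: "cfun.subspace W" and Z: "Z \<subseteq> V" "Z \<noteq> {}"
  shows "nforms Z d 1"
proof -
  obtain H where H: "H \<in> Z" using Z by blast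
  obtain F where F: "pluecker_form k W d F" "\<not> van F {H}"
    using nonvanishing_form[OF W] H Z by blast
  obtain w where w: "frame_of k H w" "F w \<noteq> 0"
    using F(2) unfolding vanishes_on_def by blast
  have "c 0 = 0" if "van (\<lambda>w. \<Sum>i<1. c i * F w) Z" for c :: "nat \<Rightarrow> complex"
  proof -
    have "(\<Sum>i<1. c i * F w) = 0"
      using that w(1) H unfolding vanishes_on_def by blast
    then show ?thesis
      using w(2) by simp
  qed
  then show ?thesis
    unfolding nforms_def by (intro exI[of _ "\<lambda>_. F"]) (simp add: F(1))
qed

lemma nforms_chain:
  fixes Z :: "nat \<Rightarrow> ('a \<Rightarrow> complex) set set"
  assumes W: "cfun.subspace W"
    and Z: "\<And>i. i \<le> n \<Longrightarrow> closedin X (Z i)"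
      "\<And>i. i \<le> n \<Longrightarrow> irreducible_space (subtopology X (Z i))"
    and chain: "\<And>i. i < n \<Longrightarrow> Z i \<subset> Z (Suc i)"
  obtains e where "e > 0" "\<And>m. nforms (Z n) (e * m) ((m + n) choose n)"
proof -
  have sub: "Z i \<subseteq> V" if "i \<le> n" for i
    using Z(1)[OF that] closedin_subset topspace_X by blast
  have ne: "Z i \<noteq> {}" if "i \<le> n" for i
  proof -
    have "topspace (subtopology X (Z i)) \<noteq> {}"
      using Z(2)[OF that] unfolding irreducible_space_def by (rule conjunct1)
    then show ?thesis
      by auto
  qed
  have "\<exists>d f. pluecker_form k W d f \<and> van f (Z i) \<and> \<not> van f (Z (Suc i))" if i: "i < n" for i
  proof -
    obtain H where "H \<in> Z (Suc i)" "H \<notin> Z i"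
      using chain[OF i] by blast
    then obtain d f where "pluecker_form k W d f" "van f (Z i)" "\<not> van f {H}"
      using closed_separate[of "Z i" H] Z(1)[of i] sub[of "Suc i"] i by auto
    then show ?thesis
      using \<open>H \<in> Z (Suc i)\<close> unfolding vanishes_on_def by blast
  qed
  then obtain d f where f: "\<And>i. i < n \<Longrightarrow> pluecker_form k W (d i) (f i)"
    "\<And>i. i < n \<Longrightarrow> van (f i) (Z i)" "\<And>i. i < n \<Longrightarrow> \<not> van (f i) (Z (Suc i))"
    by metis
  \<comment> \<open>pass to powers, to have all the separating forms in one positive degree\<close>
  have d_pos: "d i > 0" if i: "i < n" for i
  proof (rule ccontr)
    assume "\<not> ?thesis"
    then obtain c where c: "f i = (\<lambda>w. c)"
      using pluecker_form_degree_0[OF f(1)[OF i]] by blast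
    obtain H where H: "H \<in> Z i"
      using ne i by fastforce
    moreover obtain w where "frame_of k H w"
      using H frame_ex sub i by (meson less_imp_le_nat subsetD)
    ultimately have "c = 0"
      using f(2)[OF i] unfolding c vanishes_on_def by blast
    then show False
      using f(3)[OF i] unfolding c vanishes_on_def by blast
  qed
  define e where "e = (\<Prod>i<n. d i)"
  have e: "e > 0"
    unfolding e_def using d_pos by (auto intro: prod_pos)
  have "\<exists>g. pluecker_form k W e g \<and> van g (Z i) \<and> \<not> van g (Z (Suc i))" if i: "i < n" for i
  proof -
    have "d i dvd e"
      unfolding e_def using i by (intro dvd_prodI) auto
    then obtain q where q: "e = d i * q" by blast
    then have "q > 0"
      using e by (simp add: gr0I)
    have "pluecker_form k W e (\<lambda>w. f i w ^ q)"
      unfolding q by (rule pluecker_form_power[OF f(1)[OF i]])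
    moreover have "van (\<lambda>w. f i w ^ q) Z' = van (f i) Z'" for Z'
      using \<open>q > 0\<close> by (auto simp: vanishes_on_def)
    ultimately show ?thesis
      using f(2,3)[OF i] by (intro exI[of _ "\<lambda>w. f i w ^ q"]) simp
  qed
  then obtain g where g: "\<And>i. i < n \<Longrightarrow> pluecker_form k W e (g i)"
    "\<And>i. i < n \<Longrightarrow> van (g i) (Z i)" "\<And>i. i < n \<Longrightarrow> \<not> van (g i) (Z (Suc i))"
    by metis
  have "nforms (Z i) (e * m) ((m + i) choose i)" if "i \<le> n" for i m
    using that
  proof (induction i arbitrary: m)
    case 0
    then show ?case
      using nforms_one[OF W sub ne] by simp
  next
    case (Suc i)
    note IH = Suc.IH
    have "i < n" using Suc by simp
    show ?case
    proof (induction m)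
      case 0
      show ?case
        using nforms_one[OF W sub[OF Suc.prems] ne[OF Suc.prems]] by simp
    next
      case (Suc m)
      have "nforms (Z (Suc i)) (e * m + e) (((Suc m + i) choose i) + ((m + Suc i) choose (Suc i)))"
      proof (rule nforms_step)
        show "closedin X (Z (Suc i))" "irreducible_space (subtopology X (Z (Suc i)))"
          using Z \<open>i < n\<close> by auto
        show "Z i \<subseteq> Z (Suc i)"
          using chain \<open>i < n\<close> by blast
        show "nforms (Z i) (e * m + e) ((Suc m + i) choose i)"
          using IH[of "Suc m"] \<open>i < n\<close> by (simp add: algebra_simps)
        show "nforms (Z (Suc i)) (e * m) ((m + Suc i) choose (Suc i))"
          by (rule Suc.IH)
      qed (use g \<open>i < n\<close> in auto)
      then show ?case
        by (simp add: algebra_simps)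
    qed
  qed
  from this[of n] e show ?thesis
    using that by blast
qed

lemma nforms_le:
  assumes poly: "\<And>d F. pluecker_form k W d F \<Longrightarrow> polyfun N (M * d) (\<lambda>x. F (w x))"
    and dense: "\<And>d F. pluecker_form k W d F \<Longrightarrow> \<forall>x. F (w x) = 0 \<Longrightarrow> van F V"
    and "Z \<subseteq> V" "nforms Z d m"
  shows "m \<le> (M * d + 1) ^ N"
proof (rule ccontr)
  assume "\<not> ?thesis"
  then have less: "card (monomials N (M * d)) < m"
    using card_monomials[of N "M * d"] by simp
  obtain G where G: "\<And>i. i < m \<Longrightarrow> pluecker_form k W d (G i)"
    "\<And>c. van (\<lambda>w. \<Sum>i<m. c i * G i w) Z \<Longrightarrow> \<forall>i<m. c i = 0"
    using assms(4) unfolding nforms_def by blast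
  have "(\<lambda>x. G i (w x)) \<in> cfun.span (monomials N (M * d))" if "i < m" for i
    by (intro polyfun_span_monomials poly G(1) that)
  then obtain c where c: "\<exists>i<m. c i \<noteq> 0" "\<And>x. (\<Sum>i<m. c i * G i (w x)) = 0"
    using family_dependent[OF finite_monomials less, of "\<lambda>i x. G i (w x)"] by blast
  have "pluecker_form k W d (\<lambda>w. \<Sum>i<m. c i * G i w)"
    by (intro pluecker_form_sum) (simp add: G(1))
  from dense[OF this] c(2) have "van (\<lambda>w. \<Sum>i<m. c i * G i w) V"
    by blast
  then have "van (\<lambda>w. \<Sum>i<m. c i * G i w) Z"
    using assms(3) unfolding vanishes_on_def by blast
  then show False
    using G(2) c(1) by blast
qed

lemma krull_dim_le:
  assumes W: "cfun.subspace W"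
    and poly: "\<And>d F. pluecker_form k W d F \<Longrightarrow> polyfun N (M * d) (\<lambda>x. F (w x))"
    and dense: "\<And>d F. pluecker_form k W d F \<Longrightarrow> \<forall>x. F (w x) = 0 \<Longrightarrow> van F V"
  shows "krull_dim X \<le> enat N"
  unfolding krull_dim_def
proof (rule Sup_least, safe)
  fix n and Z :: "nat \<Rightarrow> ('a \<Rightarrow> complex) set set"
  assume Z: "\<forall>i\<le>n. closedin X (Z i) \<and> irreducible_space (subtopology X (Z i))"
    "\<forall>i<n. Z i \<subset> Z (Suc i)"
  show "enat n \<le> enat N"
  proof (rule ccontr)
    assume "\<not> ?thesis"
    then have n: "Suc N \<le> n" by simp
    obtain e where e: "e > 0" "\<And>m. nforms (Z (Suc N)) (e * m) ((m + Suc N) choose (Suc N))"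
      using nforms_chain[OF W, of "Suc N" Z] Z n by (metis less_le_trans order_trans)
    have sub: "Z (Suc N) \<subseteq> V"
      using Z(1) n closedin_subset topspace_X by blast
    define c where "c = Suc N ^ Suc N * (M * e + 1) ^ N"
    define m where "m = Suc c"
    have "m ^ Suc N \<le> c * m ^ N"
    proof -
      have "(real (m + Suc N) / real (Suc N)) ^ Suc N \<le> real ((m + Suc N) choose (Suc N))"
        using binomial_ge_n_over_k_pow_k[of "Suc N" "m + Suc N", where 'a = real] by simp
      then have "real (m + Suc N) ^ Suc N
          \<le> real (Suc N) ^ Suc N * real ((m + Suc N) choose (Suc N))"
        by (simp add: power_divide divide_le_eq mult.commute del: binomial_Suc_Suc power_Suc of_nat_Suc)
      then have "(m + Suc N) ^ Suc N \<le> Suc N ^ Suc N * ((m + Suc N) choose (Suc N))"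
        unfolding of_nat_power[symmetric] of_nat_mult[symmetric] of_nat_le_iff .
      moreover have "m ^ Suc N \<le> (m + Suc N) ^ Suc N"
        by (intro power_mono) auto
      moreover have "((m + Suc N) choose (Suc N)) \<le> (M * (e * m) + 1) ^ N"
        by (rule nforms_le[OF poly dense sub e(2)])
      moreover have "(M * (e * m) + 1) ^ N \<le> ((M * e + 1) * m) ^ N"
        by (intro power_mono) (auto simp: m_def algebra_simps)
      ultimately have "m ^ Suc N \<le> Suc N ^ Suc N * ((M * e + 1) * m) ^ N"
        by (meson le_trans mult_le_mono2)
      then show ?thesis
        unfolding c_def power_mult_distrib[of "M * e + 1" m] mult.assoc .
    qed
    then have "m * m ^ N \<le> c * m ^ N"
      by (simp only: power_Suc)
    moreover have "0 < m ^ N"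
      unfolding m_def by (rule zero_less_power) (rule zero_less_Suc)
    ultimately have "m \<le> c"
      by (rule mult_right_le_imp_le)
    then show False
      unfolding m_def by (simp only: not_less_eq_eq[symmetric] order_refl not_True_eq_False)
  qed
qed

end

section \<open>Relations between the products of a frame\<close>

lemma sum_4: "(\<Sum>i<4. f i) = f 0 + f 1 + f 2 + f (3 :: nat)"
  by (simp add: eval_nat_numeral)

lemma independent_family:
  fixes u :: "'i \<Rightarrow> 'a \<Rightarrow> complex"
  assumes "finite I" "\<And>c. (\<And>x. (\<Sum>i\<in>I. c i * u i x) = 0) \<Longrightarrow> \<forall>i\<in>I. c i = 0"
  shows "inj_on u I" "cfun.independent (u ` I)"
proof -
  show inj: "inj_on u I"
  proof (rule inj_onI, rule ccontr)
    fix i j assume ij: "i \<in> I" "j \<in> I" "u i = u j" "i \<noteq> j"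
    define c :: "'i \<Rightarrow> complex" where "c k = (if k = i then 1 else if k = j then -1 else 0)" for k
    have "(\<Sum>k\<in>I. c k * u k x) = (\<Sum>k\<in>{i, j}. c k * u k x)" for x
      using ij assms(1) by (intro sum.mono_neutral_right) (auto simp: c_def)
    then have "(\<Sum>k\<in>I. c k * u k x) = 0" for x
      using ij by (simp add: c_def)
    then have "c i = 0"
      using assms(2) ij(1) by blast
    then show False
      by (simp add: c_def)
  qed
  show "cfun.independent (u ` I)"
  proof
    assume "cfun.dependent (u ` I)"
    then obtain d where d: "\<exists>v\<in>u ` I. d v \<noteq> 0" "(\<Sum>v\<in>u ` I. cscale (d v) v) = 0"
      using cfun.dependent_finite[of "u ` I"] assms(1) by auto
    have "(\<Sum>i\<in>I. cscale (d (u i)) (u i)) = 0"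
      using d(2) inj by (simp add: sum.reindex)
    then have "(\<Sum>i\<in>I. d (u i) * u i x) = 0" for x
      by (auto simp: sum_fun_apply cscale_def dest: fun_cong[of _ _ x])
    then have "\<forall>i\<in>I. d (u i) = 0"
      by (rule assms(2))
    with d(1) show False by blast
  qed
qed

lemma independent_familyD:
  fixes u :: "'i \<Rightarrow> 'a \<Rightarrow> complex"
  assumes "finite I" "inj_on u I" "cfun.independent (u ` I)"
    and "\<And>x. (\<Sum>i\<in>I. c i * u i x) = 0" and "i \<in> I"
  shows "c i = 0"
proof -
  define d where "d v = c (inv_into I u v)" for v
  have "(\<Sum>v\<in>u ` I. cscale (d v) v) = (\<Sum>i\<in>I. cscale (c i) (u i))"
    using assms(2) by (simp add: sum.reindex d_def)
  also have "\<dots> = 0"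
    using assms(4) by (auto simp: fun_eq_iff sum_fun_apply cscale_def)
  finally have "d (u i) = 0"
    using assms(1,3,5) cfun.dependent_finite[of "u ` I"] by blast
  then show ?thesis
    using assms(2,5) by (simp add: d_def)
qed

lemma frame_combination_fun:
  assumes "frame_of k H w" "x \<in> H"
  obtains c where "\<And>t. x t = (\<Sum>l<k. c l * w l t)"
proof -
  obtain c where "x = (\<Sum>l<k. cscale (c l) (w l))"
    using frame_combination[OF assms] by blast
  then have "x t = (\<Sum>l<k. c l * w l t)" for t
    by (simp add: sum_fun_apply cscale_def)
  then show ?thesis
    by (rule that)
qed

lemma combination_mem_span:
  assumes "\<And>t. x t = (\<Sum>l\<in>A. c l * w l t)" "\<And>l. l \<in> A \<Longrightarrow> w l \<in> B"
  shows "x \<in> cfun.span B"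
proof -
  have x: "x = (\<Sum>l\<in>A. cscale (c l) (w l))"
    using assms(1) by (auto simp: fun_eq_iff sum_fun_apply cscale_def)
  show ?thesis
    unfolding x by (intro cfun.span_sum cfun.span_scale cfun.span_base) (rule assms(2))
qed

lemma frame_independent:
  assumes "frame_of k H w" "\<And>t. (\<Sum>l<k. c l * w l t) = 0" "l < k"
  shows "c l = 0"
  using assms independent_familyD[of "{..<k}" w c l] by (auto simp: frame_of_def)

lemma subspace_combination:
  assumes "cfun.subspace H" "\<And>t. x t = (\<Sum>l\<in>A. c l * w l t)" "\<And>l. l \<in> A \<Longrightarrow> w l \<in> H"
  shows "x \<in> H"
proof -
  have "x \<in> cfun.span H"
    by (rule combination_mem_span[OF assms(2,3)])
  then show ?thesis
    using assms(1) by (simp add: cfun.span_eq_iff[THEN iffD2])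
qed

text \<open>A family spanning a space of the right dimension is a frame.\<close>

lemma frame_of_spanning:
  assumes H: "H \<in> Grass k W" "k > 0" and w: "\<And>l. l < k \<Longrightarrow> w l \<in> H"
    and span: "H \<subseteq> cfun.span (w ` {..<k})"
  shows "frame_of k H w"
proof -
  have sub: "cfun.subspace H" and dim: "cfun.dim H = k"
    using H by (auto simp: Grass_def)
  obtain B where B: "B \<subseteq> w ` {..<k}" "cfun.independent B" "w ` {..<k} \<subseteq> cfun.span B"
    using cfun.maximal_independent_subset[of "w ` {..<k}"] by blast
  have "cfun.span B = H"
  proof
    show "cfun.span B \<subseteq> H"
      using B(1) w sub by (intro cfun.span_minimal) auto
    show "H \<subseteq> cfun.span B"
      using span B(3) cfun.span_minimal[OF B(3) cfun.subspace_span] by blast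
  qed
  then have card: "card B = k"
    using cfun.dim_eq_card[of B H] B(2) dim sub by (metis cfun.span_eq_iff)
  have "card (w ` {..<k}) \<le> k"
    using card_image_le[of "{..<k}" w] by simp
  then have "B = w ` {..<k}"
    using card B(1) by (intro card_seteq) auto
  then show ?thesis
    using card B(2) \<open>cfun.span B = H\<close> by (auto simp: frame_of_def intro: eq_card_imp_inj_on)
qed

definition symm :: "nat \<Rightarrow> (nat \<Rightarrow> nat \<Rightarrow> complex) \<Rightarrow> bool" where
  "symm n q \<longleftrightarrow> (\<forall>i<n. \<forall>j<n. q i j = q j i)"

definition nondeg :: "nat \<Rightarrow> (nat \<Rightarrow> nat \<Rightarrow> complex) \<Rightarrow> bool" where
  "nondeg n q \<longleftrightarrow> (\<forall>x. (\<forall>i<n. (\<Sum>j<n. q i j * x j) = 0) \<longrightarrow> (\<forall>j<n. x j = 0))"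

definition rel :: "(nat \<Rightarrow> 'v bivector) \<Rightarrow> (nat \<Rightarrow> nat \<Rightarrow> complex) \<Rightarrow> bool" where
  "rel h r \<longleftrightarrow> (\<forall>t. (\<Sum>i<4. \<Sum>j<4. r i j * wedge (h i) (h j) t) = 0)"

lemma wedge_commute: "wedge \<omega> \<eta> t = wedge \<eta> \<omega> t"
  by (cases t) (simp add: wedge_def algebra_simps)

lemma wedge_sum_left:
  assumes "\<And>t. \<omega> t = (\<Sum>l\<in>A. c l * w l t)"
  shows "wedge \<omega> \<eta> t = (\<Sum>l\<in>A. c l * wedge (w l) \<eta> t)"
  by (cases t) (simp add: wedge_def assms sum_distrib_left sum_distrib_right sum_subtractf
      sum.distrib algebra_simps)

lemma wedge_sum_right:
  assumes "\<And>t. \<eta> t = (\<Sum>l\<in>A. c l * w l t)"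
  shows "wedge \<omega> \<eta> t = (\<Sum>l\<in>A. c l * wedge \<omega> (w l) t)"
  using wedge_sum_left[where \<omega> = \<eta> and \<eta> = \<omega>, OF assms] by (simp add: wedge_commute[of \<omega>])

lemma wedge_sum_sum:
  assumes "\<And>t. \<omega> t = (\<Sum>l\<in>A. c l * w l t)" "\<And>t. \<eta> t = (\<Sum>l\<in>B. d l * z l t)"
  shows "wedge \<omega> \<eta> t = (\<Sum>i\<in>A. \<Sum>j\<in>B. c i * d j * wedge (w i) (z j) t)"
  by (simp add: wedge_sum_left[OF assms(1)] wedge_sum_right[OF assms(2)] sum_distrib_left mult.assoc)

text \<open>The quadratic form on \<open>H\<^sup>*\<close> with the symmetric matrix \<open>r\<close> in the frame \<open>h\<close>.\<close>

definition quad :: "('a \<Rightarrow> complex) set \<Rightarrow> (nat \<Rightarrow> 'a \<Rightarrow> complex) \<Rightarrow> (nat \<Rightarrow> nat \<Rightarrow> complex) \<Rightarrow>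
    (('a \<Rightarrow> complex) \<Rightarrow> complex) \<Rightarrow> complex" where
  "quad H h r = (\<lambda>\<phi>. \<Sum>i<4. \<Sum>j<4. r i j * sym_prod H (h i) (h j) \<phi>)"

lemma dual_combination:
  assumes "\<phi> \<in> dual_on cscale H" "cfun.subspace H" "finite A" "\<And>l. l \<in> A \<Longrightarrow> w l \<in> H"
    and "\<And>t. x t = (\<Sum>l\<in>A. c l * w l t)"
  shows "\<phi> x = (\<Sum>l\<in>A. c l * \<phi> (w l))"
proof -
  have "x = (\<Sum>l\<in>A. cscale (c l) (w l))"
    using assms(5) by (auto simp: fun_eq_iff sum_fun_apply cscale_def)
  then show ?thesis
    using dual_on_sum[OF assms(1,2) order_refl assms(3,4), where c = c] by simp
qed

lemma symm_quadratic_zero: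
  assumes "symm n r" "\<And>x. (\<Sum>i<n. \<Sum>j<n. r i j * (x i * x j)) = 0" "i < n" "j < n"
  shows "r i j = (0::complex)"
proof -
  define Q where "Q x y = (\<Sum>i<n. \<Sum>j<n. r i j * (x i * y j))" for x y :: "nat \<Rightarrow> complex"
  have Q: "Q (\<lambda>k. if k = a then 1 else 0) (\<lambda>k. if k = b then 1 else 0) = r a b"
    if "a < n" "b < n" for a b
  proof -
    have "Q (\<lambda>k. if k = a then 1 else 0) (\<lambda>k. if k = b then 1 else 0)
        = (\<Sum>i<n. \<Sum>j<n. if j = b then (if i = a then r i j else 0) else 0)"
      unfolding Q_def by (intro sum.cong refl) auto
    then show ?thesis
      using that by simp
  qed
  have add: "Q (\<lambda>k. x k + y k) (\<lambda>k. x k + y k) = Q x x + Q y y + Q x y + Q y x" for x y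
    unfolding Q_def by (simp add: algebra_simps sum.distrib)
  have zero: "Q x x = 0" for x
    using assms(2) by (simp add: Q_def)
  show ?thesis
    using add[of "\<lambda>k. if k = i then 1 else 0" "\<lambda>k. if k = j then 1 else 0"] Q assms(1,3,4)
    by (simp add: zero symm_def)
qed

locale grass_frame =
  fixes H :: "'v::ab_group_add bivector set" and h :: "nat \<Rightarrow> 'v bivector" and W
  assumes H: "H \<in> Grass 4 W" and h: "frame_of 4 H h"
begin

lemma sub_H: "cfun.subspace H"
  using H by (simp add: Grass_def)

lemma h_mem: "l < 4 \<Longrightarrow> h l \<in> H"
  using frame_of_mem[OF h] .

lemma quad_apply: "\<phi> \<in> dual_on cscale H \<Longrightarrow> quad H h r \<phi> = (\<Sum>i<4. \<Sum>j<4. r i j * (\<phi> (h i) * \<phi> (h j)))"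
  by (simp add: quad_def sym_prod_def)

lemma frame_functional: "\<exists>\<phi>\<in>dual_on cscale H. \<forall>i<4. \<phi> (h i) = x i"
proof -
  have ind: "cfun.independent (h ` {..<4})" and inj: "inj_on h {..<4}"
    using h by (auto simp: frame_of_def)
  then obtain \<phi> where "\<phi> \<in> dual_on cscale H" "\<forall>b\<in>h ` {..<4}. \<phi> b = x (inv_into {..<4} h b)"
    using functional_extension[OF sub_H ind, of "\<lambda>b. x (inv_into {..<4} h b)"] h_mem by blast
  then show ?thesis
    using inj by (intro bexI[of _ \<phi>]) auto
qed

lemma functional_zero: "\<phi> \<in> dual_on cscale H \<Longrightarrow> (\<And>i. i < 4 \<Longrightarrow> \<phi> (h i) = 0) \<Longrightarrow> \<phi> = 0"
proof
  fix x assume \<phi>: "\<phi> \<in> dual_on cscale H" "\<And>i. i < 4 \<Longrightarrow> \<phi> (h i) = 0"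
  show "\<phi> x = 0 x"
  proof (cases "x \<in> H")
    case True
    obtain c where "\<And>t. x t = (\<Sum>l<4. c l * h l t)"
      using frame_combination_fun[OF h True] by blast
    then have "\<phi> x = (\<Sum>l<4. c l * \<phi> (h l))"
      using h_mem by (intro dual_combination[OF \<phi>(1) sub_H]) auto
    then show ?thesis
      using \<phi>(2) by simp
  next
    case False
    then show ?thesis
      using \<phi>(1) by (simp add: dual_on_def)
  qed
qed

lemma quad_eqD:
  assumes "symm 4 r" "symm 4 r'" "quad H h r = quad H h r'" "i < 4" "j < 4"
  shows "r i j = r' i j"
proof -
  have "(\<Sum>i<4. \<Sum>j<4. (r i j - r' i j) * (x i * x j)) = 0" for x
  proof -
    obtain \<phi> where \<phi>: "\<phi> \<in> dual_on cscale H" "\<forall>i<4. \<phi> (h i) = x i"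
      using frame_functional by blast
    have "(\<Sum>i<4. \<Sum>j<4. (r i j - r' i j) * (x i * x j)) = quad H h r \<phi> - quad H h r' \<phi>"
      using \<phi>(2) by (simp add: quad_apply[OF \<phi>(1)] sum_subtractf left_diff_distrib)
    then show ?thesis
      using assms(3) by simp
  qed
  moreover have "symm 4 (\<lambda>i j. r i j - r' i j)"
    using assms(1,2) by (simp add: symm_def)
  ultimately have "r i j - r' i j = 0"
    using symm_quadratic_zero[where n = 4 and r = "\<lambda>i j. r i j - r' i j"] assms(4,5) by blast
  then show ?thesis by simp
qed

lemma sym_prod_frame:
  assumes "\<And>t. x t = (\<Sum>l<4. a l * h l t)" "\<And>t. y t = (\<Sum>l<4. b l * h l t)"
  shows "sym_prod H x y = quad H h (\<lambda>i j. (a i * b j + a j * b i) / 2)"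
proof
  fix \<phi>
  show "sym_prod H x y \<phi> = quad H h (\<lambda>i j. (a i * b j + a j * b i) / 2) \<phi>"
  proof (cases "\<phi> \<in> dual_on cscale H")
    case True
    have "\<phi> x = (\<Sum>l<4. a l * \<phi> (h l))"
      by (rule dual_combination[OF True sub_H _ _ assms(1)]) (auto intro: h_mem)
    moreover have "\<phi> y = (\<Sum>l<4. b l * \<phi> (h l))"
      by (rule dual_combination[OF True sub_H _ _ assms(2)]) (auto intro: h_mem)
    ultimately show ?thesis
      using True by (simp add: quad_apply sym_prod_def sum_4 field_simps)
  qed (simp add: sym_prod_def quad_def)
qed

lemma Sym2_frame: "Sym2 H = {quad H h r | r. symm 4 r}"
proof
  have "cfun.subspace {quad H h r | r. symm 4 r}"
  proof (rule cfun.subspaceI)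
    have "quad H h (\<lambda>i j. 0) = 0" "symm 4 (\<lambda>i j. 0)"
      by (auto simp: quad_def symm_def fun_eq_iff)
    then show "0 \<in> {quad H h r | r. symm 4 r}" by (metis (mono_tags, lifting) mem_Collect_eq)
  next
    fix x y assume "x \<in> {quad H h r | r. symm 4 r}" "y \<in> {quad H h r | r. symm 4 r}"
    then obtain r r' where "x = quad H h r" "y = quad H h r'" "symm 4 r" "symm 4 r'" by blast
    moreover have "quad H h r + quad H h r' = quad H h (\<lambda>i j. r i j + r' i j)"
      by (auto simp: quad_def fun_eq_iff sum.distrib algebra_simps)
    ultimately show "x + y \<in> {quad H h r | r. symm 4 r}"
      by (auto simp: symm_def)
  next
    fix c x assume "x \<in> {quad H h r | r. symm 4 r}"
    then obtain r where "x = quad H h r" "symm 4 r" by blast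
    moreover have "cscale c (quad H h r) = quad H h (\<lambda>i j. c * r i j)"
      by (auto simp: quad_def fun_eq_iff cscale_def sum_distrib_left mult.assoc)
    ultimately show "cscale c x \<in> {quad H h r | r. symm 4 r}"
      by (auto simp: symm_def)
  qed
  moreover have "{sym_prod H x y | x y. x \<in> H \<and> y \<in> H} \<subseteq> {quad H h r | r. symm 4 r}"
  proof safe
    fix x y assume xy: "x \<in> H" "y \<in> H"
    obtain a where a: "\<And>t. x t = (\<Sum>l<4. a l * h l t)"
      using frame_combination_fun[OF h xy(1)] by blast
    obtain b where b: "\<And>t. y t = (\<Sum>l<4. b l * h l t)"
      using frame_combination_fun[OF h xy(2)] by blast
    show "\<exists>r. sym_prod H x y = quad H h r \<and> symm 4 r"
      using sym_prod_frame[OF a b] by (intro exI conjI) (auto simp: symm_def algebra_simps)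
  qed
  ultimately show "Sym2 H \<subseteq> {quad H h r | r. symm 4 r}"
    unfolding Sym2_def by (rule cfun.span_minimal[rotated])
next
  have mem: "sym_prod H (h i) (h j) \<in> {sym_prod H x y | x y. x \<in> H \<and> y \<in> H}"
    if "i < 4" "j < 4" for i j
    using h_mem that by blast
  have "quad H h r \<in> Sym2 H" for r
    unfolding Sym2_def
  proof (rule combination_mem_span[where A = "{..<4} \<times> {..<4}"
        and c = "\<lambda>p. r (fst p) (snd p)" and w = "\<lambda>p. sym_prod H (h (fst p)) (h (snd p))"])
    show "quad H h r \<phi> = (\<Sum>p\<in>{..<4} \<times> {..<4}. r (fst p) (snd p) * sym_prod H (h (fst p)) (h (snd p)) \<phi>)"
      for \<phi>
      by (simp add: quad_def sum.cartesian_product case_prod_unfold)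
    show "sym_prod H (h (fst p)) (h (snd p)) \<in> {sym_prod H x y | x y. x \<in> H \<and> y \<in> H}"
      if "p \<in> {..<4} \<times> {..<4}" for p
      using that mem by (cases p) simp
  qed
  then show "{quad H h r | r. symm 4 r} \<subseteq> Sym2 H"
    by blast
qed

lemma nondegenerate_quad:
  assumes "symm 4 q"
  shows "nondegenerate_form H (quad H h q) \<longleftrightarrow> nondeg 4 q"
proof -
  have polar: "quad H h q (\<phi> + \<psi>) - quad H h q \<phi> - quad H h q \<psi>
      = 2 * (\<Sum>i<4. (\<Sum>j<4. q i j * \<phi> (h j)) * \<psi> (h i))"
    if "\<phi> \<in> dual_on cscale H" "\<psi> \<in> dual_on cscale H" for \<phi> \<psi>
  proof -
    have "\<phi> + \<psi> \<in> dual_on cscale H"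
      using that by (auto simp: dual_on_def algebra_simps)
    moreover have "q 1 0 = q 0 1" "q 2 0 = q 0 2" "q 3 0 = q 0 3" "q 2 1 = q 1 2" "q 3 1 = q 1 3"
      "q 3 2 = q 2 3"
      using assms by (auto simp: symm_def)
    ultimately show ?thesis
      using that by (simp add: quad_apply sum_4 algebra_simps)
  qed
  show ?thesis
  proof
    assume Q: "nondegenerate_form H (quad H h q)"
    show "nondeg 4 q"
      unfolding nondeg_def
    proof (intro allI impI)
      fix x j assume x: "\<forall>i<4. (\<Sum>j<4. q i j * x j) = 0" and "j < (4::nat)"
      obtain \<phi> where \<phi>: "\<phi> \<in> dual_on cscale H" "\<forall>i<4. \<phi> (h i) = x i"
        using frame_functional by blast
      have "quad H h q (\<phi> + \<psi>) - quad H h q \<phi> - quad H h q \<psi> = 0" if "\<psi> \<in> dual_on cscale H" for \<psi>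
        using polar[OF \<phi>(1) that] x \<phi>(2) by simp
      then have "\<phi> = 0"
        using Q \<phi>(1) unfolding nondegenerate_form_def by blast
      then show "x j = 0"
        using \<phi>(2) \<open>j < 4\<close> by auto
    qed
  next
    assume q: "nondeg 4 q"
    show "nondegenerate_form H (quad H h q)"
      unfolding nondegenerate_form_def
    proof (intro ballI impI)
      fix \<phi> assume \<phi>: "\<phi> \<in> dual_on cscale H"
        and *: "\<forall>\<psi>\<in>dual_on cscale H. quad H h q (\<phi> + \<psi>) - quad H h q \<phi> - quad H h q \<psi> = 0"
      have "(\<Sum>j<4. q i j * \<phi> (h j)) = 0" if "i < 4" for i
      proof -
        obtain \<psi> where \<psi>: "\<psi> \<in> dual_on cscale H" "\<forall>k<4. \<psi> (h k) = (if k = i then 1 else 0)"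
          using frame_functional[of "\<lambda>k. if k = i then 1 else 0"] by blast
        have "0 = (\<Sum>k<4. (\<Sum>j<4. q k j * \<phi> (h j)) * \<psi> (h k))"
          using polar[OF \<phi> \<psi>(1)] * \<psi>(1) by simp
        also have "\<dots> = (\<Sum>k<4. if k = i then (\<Sum>j<4. q k j * \<phi> (h j)) else 0)"
          using \<psi>(2) by (intro sum.cong) auto
        also have "\<dots> = (\<Sum>j<4. q i j * \<phi> (h j))"
          using that by simp
        finally show ?thesis by simp
      qed
      then have "\<forall>j<4. \<phi> (h j) = 0"
        using q[unfolded nondeg_def, rule_format, of "\<lambda>j. \<phi> (h j)"] by blast
      then show "\<phi> = 0"
        using functional_zero[OF \<phi>] by blast
    qed
  qed
qed

lemma natural_map_quad:
  assumes "natural_map H \<mu>"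
  shows "\<mu> (quad H h r) t = (\<Sum>i<4. \<Sum>j<4. r i j * wedge (h i) (h j) t)"
proof -
  interpret \<mu>: Vector_Spaces.linear cscale cscale \<mu>
    using assms by (simp add: natural_map_def)
  have "quad H h r = (\<Sum>i<4. \<Sum>j<4. cscale (r i j) (sym_prod H (h i) (h j)))"
    by (auto simp: quad_def fun_eq_iff sum_fun_apply cscale_def)
  then have "\<mu> (quad H h r) = (\<Sum>i<4. \<Sum>j<4. cscale (r i j) (wedge (h i) (h j)))"
    using assms h_mem by (simp add: \<mu>.sum \<mu>.scale natural_map_def)
  then show ?thesis
    by (simp add: sum_fun_apply cscale_def)
qed

end

definition pairs :: "(nat \<times> nat) set" where
  "pairs = {(i, j). i \<le> j \<and> j < 4}"

lemma pairs_eq: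
  "pairs = {(0,0), (0,1), (0,2), (0,3), (1,1), (1,2), (1,3), (2,2), (2,3), (3,3)}"
proof -
  have "i \<le> j \<and> j < 4 \<longleftrightarrow> i = 0 \<and> j = 0 \<or> i = 0 \<and> j = 1 \<or> i = 0 \<and> j = 2 \<or> i = 0 \<and> j = 3
      \<or> i = 1 \<and> j = 1 \<or> i = 1 \<and> j = 2 \<or> i = 1 \<and> j = 3 \<or> i = 2 \<and> j = 2
      \<or> i = 2 \<and> j = 3 \<or> i = 3 \<and> j = 3" for i j :: nat
    by presburger
  then show ?thesis
    unfolding pairs_def by (simp add: set_eq_iff)
qed

lemma symmetric_sum_pairs:
  fixes f :: "nat \<Rightarrow> nat \<Rightarrow> complex"
  assumes "\<And>i j. i < 4 \<Longrightarrow> j < 4 \<Longrightarrow> f i j = f j i"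
  shows "(\<Sum>i<4. \<Sum>j<4. f i j) = (\<Sum>(i, j)\<in>pairs. (if i = j then 1 else 2) * f i j)"
  using assms[of 1 0] assms[of 2 0] assms[of 3 0] assms[of 2 1] assms[of 3 1] assms[of 3 2]
  unfolding pairs_eq by (simp add: sum_4)

context grass_frame
begin

lemma sym_prod_commute: "sym_prod H x y = sym_prod H y x"
  by (auto simp: sym_prod_def)

lemma sym_prods_independent:
  assumes "\<And>\<phi>. (\<Sum>p\<in>pairs. c p * sym_prod H (h (fst p)) (h (snd p)) \<phi>) = 0"
  shows "\<forall>p\<in>pairs. c p = 0"
proof -
  define r where "r i j = (if i = j then c (i, j) else c (min i j, max i j) / 2)" for i j
  have r: "symm 4 r"
    by (auto simp: symm_def r_def min_def max_def)
  have "quad H h r = quad H h (\<lambda>i j. 0)"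
  proof
    fix \<phi>
    have "quad H h r \<phi> = (\<Sum>(i, j)\<in>pairs. (if i = j then 1 else 2) * (r i j * sym_prod H (h i) (h j) \<phi>))"
      unfolding quad_def using r
      by (intro symmetric_sum_pairs) (auto simp: symm_def sym_prod_commute)
    also have "\<dots> = (\<Sum>p\<in>pairs. c p * sym_prod H (h (fst p)) (h (snd p)) \<phi>)"
      by (intro sum.cong) (auto simp: r_def pairs_def)
    finally show "quad H h r \<phi> = quad H h (\<lambda>i j. 0) \<phi>"
      by (simp add: assms) (simp add: quad_def)
  qed
  then have zero: "r i j = 0" if "i < 4" "j < 4" for i j
    using quad_eqD[OF r, of "\<lambda>i j. 0"] that by (simp add: symm_def)
  show ?thesis
  proof
    fix p assume p: "p \<in> pairs"
    obtain i j where "p = (i, j)" by (cases p)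
    with p zero[of i j] show "c p = 0"
      by (auto simp: r_def pairs_def split: if_splits)
  qed
qed

lemma natural_map_exists: "\<exists>\<mu>. natural_map H \<mu>"
proof -
  define \<sigma> where "\<sigma> p = sym_prod H (h (fst p)) (h (snd p))" for p
  have fin: "finite pairs"
    unfolding pairs_eq by simp
  have ind: "inj_on \<sigma> pairs" "cfun.independent (\<sigma> ` pairs)"
    using independent_family[OF fin, of \<sigma>] sym_prods_independent unfolding \<sigma>_def by blast+
  interpret vector_space_pair
    "cscale :: complex \<Rightarrow> ((('v bivector \<Rightarrow> complex) \<Rightarrow> complex)) \<Rightarrow> _"
    "cscale :: complex \<Rightarrow> 'v fourvector \<Rightarrow> _"
    by unfold_locales
  obtain \<mu> where \<mu>: "Vector_Spaces.linear cscale cscale \<mu>"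
    "\<forall>b\<in>\<sigma> ` pairs. \<mu> b = wedge (h (fst (inv_into pairs \<sigma> b))) (h (snd (inv_into pairs \<sigma> b)))"
    using linear_independent_extend[OF ind(2),
        of "\<lambda>b. wedge (h (fst (inv_into pairs \<sigma> b))) (h (snd (inv_into pairs \<sigma> b)))"] by blast
  interpret \<mu>: Vector_Spaces.linear cscale cscale \<mu>
    by fact
  have le: "\<mu> (sym_prod H (h i) (h j)) = wedge (h i) (h j)" if "i \<le> j" "j < 4" for i j
  proof -
    have p: "(i, j) \<in> pairs" using that by (simp add: pairs_def)
    then have "\<mu> (\<sigma> (i, j)) = wedge (h i) (h j)"
      using \<mu>(2) ind(1) by simp
    then show ?thesis by (simp add: \<sigma>_def)
  qed
  have hh: "\<mu> (sym_prod H (h i) (h j)) = wedge (h i) (h j)" if "i < 4" "j < 4" for i j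
  proof (cases "i \<le> j")
    case False
    then have "\<mu> (sym_prod H (h j) (h i)) = wedge (h j) (h i)"
      using le that by simp
    moreover have "wedge (h j) (h i) = wedge (h i) (h j)"
      using wedge_commute by blast
    ultimately show ?thesis
      by (simp add: sym_prod_commute[of "h i"])
  qed (use le that in auto)
  have "\<mu> (sym_prod H x y) = wedge x y" if xy: "x \<in> H" "y \<in> H" for x y
  proof -
    obtain a where a: "\<And>t. x t = (\<Sum>l<4. a l * h l t)"
      using frame_combination_fun[OF h xy(1)] by blast
    obtain b where b: "\<And>t. y t = (\<Sum>l<4. b l * h l t)"
      using frame_combination_fun[OF h xy(2)] by blast
    have "sym_prod H x y
        = (\<Sum>i<4. \<Sum>j<4. cscale ((a i * b j + a j * b i) / 2) (sym_prod H (h i) (h j)))"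
      unfolding sym_prod_frame[OF a b] by (auto simp: quad_def fun_eq_iff sum_fun_apply cscale_def)
    then have "\<mu> (sym_prod H x y)
        = (\<Sum>i<4. \<Sum>j<4. cscale ((a i * b j + a j * b i) / 2) (wedge (h i) (h j)))"
      by (simp add: \<mu>.sum \<mu>.scale hh)
    then have "\<mu> (sym_prod H x y) t = (\<Sum>i<4. \<Sum>j<4. (a i * b j + a j * b i) / 2 * wedge (h i) (h j) t)" for t
      by (simp add: sum_fun_apply cscale_def)
    moreover have "wedge x y t = (\<Sum>i<4. \<Sum>j<4. (a i * b j + a j * b i) / 2 * wedge (h i) (h j) t)" for t
      unfolding wedge_sum_sum[OF a b]
      using wedge_commute[of "h 1" "h 0" t] wedge_commute[of "h 2" "h 0" t]
        wedge_commute[of "h 3" "h 0" t] wedge_commute[of "h 2" "h 1" t]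
        wedge_commute[of "h 3" "h 1" t] wedge_commute[of "h 3" "h 2" t]
      by (simp add: sum_4 field_simps)
    ultimately show ?thesis
      by auto
  qed
  with \<mu>(1) show ?thesis
    unfolding natural_map_def by blast
qed

lemma variety_V_iff:
  assumes "W = ext2 s"
  shows "H \<in> variety_V s \<longleftrightarrow>
    (\<exists>q. symm 4 q \<and> nondeg 4 q \<and>
      (\<forall>r. symm 4 r \<longrightarrow> (rel h r \<longleftrightarrow> (\<exists>c. \<forall>i<4. \<forall>j<4. r i j = c * q i j))))"
    (is "_ \<longleftrightarrow> ?R")
proof
  have scale: "cscale c (quad H h q) = quad H h (\<lambda>i j. c * q i j)" for c q
    by (auto simp: quad_def fun_eq_iff cscale_def sum_distrib_left mult.assoc)
  have cong: "quad H h r = quad H h r'" if "\<forall>i<4. \<forall>j<4. r i j = r' i j" for r r'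
    using that by (simp add: quad_def)
  have rel_iff: "rel h r \<longleftrightarrow> \<mu> (quad H h r) = 0" if "natural_map H \<mu>" for \<mu> r
    by (auto simp: rel_def fun_eq_iff natural_map_quad[OF that])
  {
    assume "H \<in> variety_V s"
    then obtain \<mu> Q where \<mu>: "natural_map H \<mu>" and Q: "nondegenerate_form H Q"
      "{R \<in> Sym2 H. \<mu> R = 0} = cfun.span {Q}"
      by (auto simp: variety_V_def)
    have "Q \<in> Sym2 H"
      using Q(2) cfun.span_base[of Q "{Q}"] by blast
    then obtain q where q: "symm 4 q" "Q = quad H h q"
      unfolding Sym2_frame by blast
    have "rel h r \<longleftrightarrow> (\<exists>c. \<forall>i<4. \<forall>j<4. r i j = c * q i j)" if r: "symm 4 r" for r
    proof -
      have "rel h r \<longleftrightarrow> quad H h r \<in> {R \<in> Sym2 H. \<mu> R = 0}"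
        using r unfolding rel_iff[OF \<mu>] Sym2_frame by blast
      also have "\<dots> \<longleftrightarrow> (\<exists>c. quad H h r = quad H h (\<lambda>i j. c * q i j))"
        unfolding Q(2) cfun.span_singleton by (auto simp: q(2) scale)
      also have "\<dots> \<longleftrightarrow> (\<exists>c. \<forall>i<4. \<forall>j<4. r i j = c * q i j)"
      proof -
        have "symm 4 (\<lambda>i j. c * q i j)" for c
          using q(1) by (simp add: symm_def)
        then show ?thesis
          using quad_eqD[OF r] cong by (metis (no_types, lifting))
      qed
      finally show ?thesis .
    qed
    moreover have "nondeg 4 q"
      using nondegenerate_quad[OF q(1)] Q(1) q(2) by simp
    ultimately show ?R
      using q(1) by blast
  }
  assume ?R
  then obtain q where q: "symm 4 q" "nondeg 4 q"
    "\<And>r. symm 4 r \<Longrightarrow> rel h r \<longleftrightarrow> (\<exists>c. \<forall>i<4. \<forall>j<4. r i j = c * q i j)"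
    by blast
  obtain \<mu> where \<mu>: "natural_map H \<mu>"
    using natural_map_exists by blast
  interpret \<mu>: Vector_Spaces.linear cscale cscale \<mu>
    using \<mu> by (simp add: natural_map_def)
  define Q where "Q = quad H h q"
  have ker: "{R \<in> Sym2 H. \<mu> R = 0} = cfun.span {Q}"
  proof -
    have "R \<in> {R \<in> Sym2 H. \<mu> R = 0} \<longleftrightarrow> (\<exists>c. R = quad H h (\<lambda>i j. c * q i j))" for R
    proof
      assume "R \<in> {R \<in> Sym2 H. \<mu> R = 0}"
      then obtain r where r: "symm 4 r" "R = quad H h r" "rel h r"
        unfolding Sym2_frame rel_iff[OF \<mu>] by blast
      then obtain c where "\<forall>i<4. \<forall>j<4. r i j = c * q i j"
        using q(3)[OF r(1)] by blast
      then show "\<exists>c. R = quad H h (\<lambda>i j. c * q i j)"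
        using r(2) cong[of r "\<lambda>i j. c * q i j"] by (intro exI[of _ c]) simp
    next
      assume "\<exists>c. R = quad H h (\<lambda>i j. c * q i j)"
      then obtain c where R: "R = quad H h (\<lambda>i j. c * q i j)" by blast
      have sy: "symm 4 (\<lambda>i j. c * q i j)"
        using q(1) by (simp add: symm_def)
      then have "rel h (\<lambda>i j. c * q i j)"
        using q(3)[OF sy] by blast
      then show "R \<in> {R \<in> Sym2 H. \<mu> R = 0}"
        unfolding Sym2_frame using R sy rel_iff[OF \<mu>, of "\<lambda>i j. c * q i j"] by blast
    qed
    then show ?thesis
      unfolding cfun.span_singleton Q_def by (auto simp: scale)
  qed
  \<comment> \<open>drop from the ten products one that occurs in the relation; the other nine are a basis\<close>
  have "\<exists>a b. a < 4 \<and> b < 4 \<and> q a b \<noteq> 0"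
  proof (rule ccontr)
    assume "\<not> ?thesis"
    then have "\<forall>i<4. (\<Sum>j<4. q i j * 1) = 0"
      by simp
    then have "\<forall>j<(4::nat). (1::complex) = 0"
      by (rule q(2)[unfolded nondeg_def, THEN spec[of _ "\<lambda>_. 1"], THEN mp])
    then show False
      by (auto dest: spec[of _ 0])
  qed
  then obtain a0 b0 where "a0 < 4" "b0 < 4" "q a0 b0 \<noteq> 0" by blast
  then have "\<exists>a b. (a, b) \<in> pairs \<and> q a b \<noteq> 0"
  proof (cases "a0 \<le> b0")
    case True
    then show ?thesis
      using \<open>b0 < 4\<close> \<open>q a0 b0 \<noteq> 0\<close> unfolding pairs_def by blast
  next
    case False
    moreover have "q b0 a0 = q a0 b0"
      using q(1) \<open>a0 < 4\<close> \<open>b0 < 4\<close> by (simp add: symm_def)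
    ultimately show ?thesis
      using \<open>a0 < 4\<close> \<open>q a0 b0 \<noteq> 0\<close> by (intro exI[of _ b0] exI[of _ a0]) (simp add: pairs_def)
  qed
  then obtain a b where ab: "(a, b) \<in> pairs" "q a b \<noteq> 0"
    by blast
  define I where "I = pairs - {(a, b)}"
  define u where "u p = wedge (h (fst p)) (h (snd p))" for p :: "nat \<times> nat"
  have fin: "finite pairs" and "card pairs = 10"
    unfolding pairs_eq by simp_all
  then have I: "finite I" "card I = 9"
    using ab(1) by (auto simp: I_def)
  define sy where "sy c i j = (if i = j then c (i, j) else c (min i j, max i j) / 2)"
    for c :: "nat \<times> nat \<Rightarrow> complex" and i j
  have sy: "symm 4 (sy c)" for c
    by (auto simp: symm_def sy_def min_def max_def)
  have sum_sy: "(\<Sum>i<4. \<Sum>j<4. sy c i j * wedge (h i) (h j) t) = (\<Sum>p\<in>pairs. c p * u p t)" for c t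
  proof -
    have "(\<Sum>i<4. \<Sum>j<4. sy c i j * wedge (h i) (h j) t)
        = (\<Sum>(i, j)\<in>pairs. (if i = j then 1 else 2) * (sy c i j * wedge (h i) (h j) t))"
      using sy[of c] by (intro symmetric_sum_pairs) (metis symm_def wedge_commute)
    also have "\<dots> = (\<Sum>p\<in>pairs. c p * u p t)"
      by (intro sum.cong) (auto simp: sy_def pairs_def u_def)
    finally show ?thesis .
  qed
  have indep: "\<forall>p\<in>I. c p = 0" if c: "\<And>t. (\<Sum>p\<in>I. c p * u p t) = 0" for c
  proof -
    define c' where "c' p = (if p = (a, b) then 0 else c p)" for p
    have "(\<Sum>p\<in>pairs. c' p * u p t) = (\<Sum>p\<in>I. c p * u p t)" for t
      unfolding I_def using fin ab(1) by (simp add: sum.remove[of _ "(a, b)"] c'_def)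
    then have "rel h (sy c')"
      unfolding rel_def sum_sy using c by simp
    then obtain d where d: "\<And>i j. i < 4 \<Longrightarrow> j < 4 \<Longrightarrow> sy c' i j = d * q i j"
      using q(3)[OF sy[of c']] by blast
    have "a < 4" "b < 4" "a \<le> b"
      using ab(1) by (auto simp: pairs_def)
    then have "sy c' a b = 0"
      by (simp add: sy_def c'_def min_def max_def)
    then have "d = 0"
      using d[of a b] ab(2) \<open>a < 4\<close> \<open>b < 4\<close> by simp
    then have zero: "sy c' i j = 0" if "i < 4" "j < 4" for i j
      using d that by simp
    show ?thesis
    proof
      fix p assume p: "p \<in> I"
      obtain i j where ij: "p = (i, j)" by (cases p)
      then have "i \<le> j" "j < 4" "(i, j) \<noteq> (a, b)"
        using p by (auto simp: I_def pairs_def)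
      with ij zero[of i j] show "c p = 0"
        by (auto simp: sy_def c'_def split: if_splits)
    qed
  qed
  have "inj_on u I" "cfun.independent (u ` I)"
    using independent_family[OF I(1), of u] indep by blast+
  moreover have "cfun.span (u ` I) = \<mu> ` Sym2 H"
  proof
    have "u p \<in> \<mu> ` Sym2 H" if "p \<in> I" for p
    proof -
      have "fst p < 4" "snd p < 4"
        using that by (auto simp: I_def pairs_def)
      then have "u p = \<mu> (sym_prod H (h (fst p)) (h (snd p)))"
        using \<mu> h_mem by (simp add: natural_map_def u_def)
      moreover have "sym_prod H (h (fst p)) (h (snd p)) \<in> Sym2 H"
        unfolding Sym2_def using h_mem \<open>fst p < 4\<close> \<open>snd p < 4\<close> by (blast intro: cfun.span_base)
      ultimately show ?thesis by blast
    qed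
    moreover have "cfun.subspace (\<mu> ` Sym2 H)"
      unfolding Sym2_def by (rule \<mu>.subspace_image) (rule cfun.subspace_span)
    ultimately show "cfun.span (u ` I) \<subseteq> \<mu> ` Sym2 H"
      by (intro cfun.span_minimal) auto
    show "\<mu> ` Sym2 H \<subseteq> cfun.span (u ` I)"
    proof safe
      fix R assume "R \<in> Sym2 H"
      then obtain r where r: "symm 4 r" "R = quad H h r"
        unfolding Sym2_frame by blast
      define c where "c p = (if fst p = snd p then 1 else 2) *
        (r (fst p) (snd p) - r a b / q a b * q (fst p) (snd p))" for p
      have "rel h q"
        using q(3)[OF q(1)] by (metis mult_1)
      have "\<mu> R t = (\<Sum>p\<in>I. c p * u p t)" for t
      proof -
        have "(\<Sum>i<4. \<Sum>j<4. q i j * wedge (h i) (h j) t) = 0"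
          using \<open>rel h q\<close> unfolding rel_def by blast
        then have "\<mu> R t = (\<Sum>i<4. \<Sum>j<4. r i j * wedge (h i) (h j) t)
            - r a b / q a b * (\<Sum>i<4. \<Sum>j<4. q i j * wedge (h i) (h j) t)"
          unfolding r(2) natural_map_quad[OF \<mu>] by simp
        also have "\<dots> = (\<Sum>i<4. \<Sum>j<4. (r i j - r a b / q a b * q i j) * wedge (h i) (h j) t)"
          by (simp only: sum_distrib_left sum_subtractf[symmetric] left_diff_distrib mult.assoc)
        also have "\<dots> = (\<Sum>(i, j)\<in>pairs. (if i = j then 1 else 2) *
            ((r i j - r a b / q a b * q i j) * wedge (h i) (h j) t))"
        proof (rule symmetric_sum_pairs)
          fix i j :: nat assume "i < 4" "j < 4"
          then have "r i j = r j i" "q i j = q j i"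
            using r(1) q(1) by (simp_all add: symm_def)
          then show "(r i j - r a b / q a b * q i j) * wedge (h i) (h j) t
              = (r j i - r a b / q a b * q j i) * wedge (h j) (h i) t"
            by (simp only: wedge_commute[of "h i" "h j"])
        qed
        also have "\<dots> = (\<Sum>p\<in>pairs. c p * u p t)"
          by (intro sum.cong) (simp_all only: c_def u_def case_prod_unfold mult.assoc)
        also have "\<dots> = (\<Sum>p\<in>I. c p * u p t)"
          unfolding I_def using fin ab by (simp add: sum.remove[of _ "(a, b)"] c_def)
        finally show ?thesis .
      qed
      then show "\<mu> R \<in> cfun.span (u ` I)"
        by (rule combination_mem_span) auto
    qed
  qed
  ultimately have "cfun.dim (\<mu> ` Sym2 H) = 9"
    using I(2) cfun.dim_span_eq_card_independent[of "u ` I"] by (simp add: card_image)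
  moreover have "nondegenerate_form H Q"
    using nondegenerate_quad[OF q(1)] q(2) by (simp add: Q_def)
  ultimately show "H \<in> variety_V s"
    using \<mu> ker H assms unfolding variety_V_def by blast
qed

end

section \<open>Coordinates on bivectors\<close>

definition skew :: "(nat \<Rightarrow> nat \<Rightarrow> complex) \<Rightarrow> bool" where
  "skew m \<longleftrightarrow> (\<forall>i<6. \<forall>j<6. m i j = - m j i)"

lemma skewD: "skew m \<Longrightarrow> i < 6 \<Longrightarrow> j < 6 \<Longrightarrow> m i j = - m j i"
  unfolding skew_def by blast

lemma skewI: "(\<And>i j. i < 6 \<Longrightarrow> j < 6 \<Longrightarrow> m i j = - m j i) \<Longrightarrow> skew m"
  unfolding skew_def by blast

locale six_space =
  fixes s :: "complex \<Rightarrow> 'v::ab_group_add \<Rightarrow> 'v" and v :: "nat \<Rightarrow> 'v" and e :: "nat \<Rightarrow> 'v \<Rightarrow> complex"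
  assumes e_dual: "i < 6 \<Longrightarrow> e i \<in> dual_on s UNIV"
    and e_v: "i < 6 \<Longrightarrow> j < 6 \<Longrightarrow> e i (v j) = (if i = j then 1 else 0)"
    and e_expand: "f \<in> dual_on s UNIV \<Longrightarrow> f x = (\<Sum>i<6. f (v i) * e i x)"

lemma six_space_exists:
  assumes "vector_space s" "vector_space.dim s UNIV = 6"
  shows "\<exists>v e. six_space s v e"
proof -
  interpret vs: vector_space s by fact
  obtain B where B: "vs.independent B" "UNIV \<subseteq> vs.span B" "card B = 6"
    using vs.basis_exists[of UNIV] assms(2) by metis
  then have fin: "finite B"
    by (metis card.infinite zero_neq_numeral)
  obtain v where v: "bij_betw v {0..<6::nat} B"
    using ex_bij_betw_nat_finite[OF fin] B(3) by metis
  define e where "e i x = vs.representation B x (v i)" for i x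
  have vB: "v i \<in> B" if "i < 6" for i
    using v that by (auto simp: bij_betw_def)
  have lin: "f x = (\<Sum>i<6. f (v i) * e i x)" if f: "f \<in> dual_on s UNIV" for f x
  proof -
    have add: "f (a + b) = f a + f b" and scale: "f (s c a) = c * f a" for a b c
      using f by (auto simp: dual_on_def)
    have "f 0 = 0"
      using add[of 0 0] by simp
    then have sum: "f (\<Sum>b\<in>A. s (g b) b) = (\<Sum>b\<in>A. g b * f b)" for A g
      by (induction A rule: infinite_finite_induct) (auto simp: add scale)
    have "f x = f (\<Sum>b\<in>B. s (vs.representation B x b) b)"
    proof -
      have "x \<in> vs.span B"
        using B(2) by blast
      then show ?thesis
        using vs.sum_representation_eq[OF B(1), of x B] fin by simp
    qed
    also have "\<dots> = (\<Sum>b\<in>B. vs.representation B x b * f b)"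
      by (rule sum)
    also have "\<dots> = (\<Sum>i\<in>{0..<6}. vs.representation B x (v i) * f (v i))"
      using sum.reindex_bij_betw[OF v, of "\<lambda>b. vs.representation B x b * f b"] by simp
    finally show ?thesis
      by (simp add: e_def atLeast0LessThan mult.commute)
  qed
  have "six_space s v e"
  proof
    show "e i \<in> dual_on s UNIV" for i
      unfolding dual_on_def e_def using B
      by (auto simp: vs.representation_add vs.representation_scale subset_iff)
    show "e i (v j) = (if i = j then 1 else 0)" if "i < 6" "j < 6" for i j
    proof -
      have "v i = v j \<longleftrightarrow> i = j"
        using v that by (auto simp: bij_betw_def dest: inj_onD)
      then show ?thesis
        using vs.representation_basis[OF B(1) vB[OF that(2)]] by (auto simp: e_def)
    qed
  qed (rule lin)
  then show ?thesis by blast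
qed

context six_space
begin

abbreviation D :: "('v \<Rightarrow> complex) set" where
  "D \<equiv> dual_on s UNIV"

lemma D_combination: "(\<And>l. l \<in> A \<Longrightarrow> w l \<in> D) \<Longrightarrow> (\<lambda>x. \<Sum>l\<in>A. c l * w l x) \<in> D"
  unfolding dual_on_def
  by (auto simp: sum.distrib[symmetric] sum_distrib_left algebra_simps intro!: sum.cong)

definition biv :: "(nat \<Rightarrow> nat \<Rightarrow> complex) \<Rightarrow> 'v bivector" where
  "biv m = (\<lambda>(f, g). if f \<in> D \<and> g \<in> D then \<Sum>i<6. \<Sum>j<6. m i j * (f (v i) * g (v j)) else 0)"

definition co :: "'v bivector \<Rightarrow> nat \<Rightarrow> nat \<Rightarrow> complex" where
  "co \<omega> i j = \<omega> (e i, e j)"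

lemma biv_cong: "(\<And>i j. i < 6 \<Longrightarrow> j < 6 \<Longrightarrow> m i j = m' i j) \<Longrightarrow> biv m = biv m'"
  unfolding biv_def by (intro ext) (auto intro!: sum.cong)

lemma co_biv:
  assumes "i < 6" "j < 6"
  shows "co (biv m) i j = m i j"
proof -
  have "co (biv m) i j = (\<Sum>a<6. \<Sum>b<6. m a b * (e i (v a) * e j (v b)))"
    using assms e_dual by (simp add: co_def biv_def)
  also have "\<dots> = (\<Sum>a<6. \<Sum>b<6. if b = j then (if a = i then m a b else 0) else 0)"
    using assms by (intro sum.cong refl) (auto simp: e_v)
  also have "\<dots> = m i j"
    using assms by simp
  finally show ?thesis .
qed

lemma wedge_vec_biv: "wedge_vec s x y = biv (\<lambda>i j. e i x * e j y - e i y * e j x)"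
proof
  fix t :: "('v \<Rightarrow> complex) \<times> ('v \<Rightarrow> complex)"
  obtain f g where t: "t = (f, g)" by (cases t)
  show "wedge_vec s x y t = biv (\<lambda>i j. e i x * e j y - e i y * e j x) t"
  proof (cases "f \<in> D \<and> g \<in> D")
    case True
    have "f x * g y - f y * g x = (\<Sum>i<6. \<Sum>j<6. (e i x * e j y - e i y * e j x) * (f (v i) * g (v j)))"
      unfolding e_expand[OF conjunct1[OF True], of x] e_expand[OF conjunct1[OF True], of y]
        e_expand[OF conjunct2[OF True], of x] e_expand[OF conjunct2[OF True], of y]
        sum_product sum_subtractf[symmetric]
      by (intro sum.cong refl) (simp add: algebra_simps)
    then show ?thesis
      using True by (simp add: t wedge_vec_def biv_def)
  qed (auto simp: t wedge_vec_def biv_def)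
qed

lemma biv_wedge_vec:
  assumes "skew m"
  shows "biv m t = (\<Sum>p\<in>{..<6} \<times> {..<6}. m (fst p) (snd p) / 2 * wedge_vec s (v (fst p)) (v (snd p)) t)"
proof -
  obtain f g where t: "t = (f, g)" by (cases t)
  show ?thesis
  proof (cases "f \<in> D \<and> g \<in> D")
    case True
    have swap: "(\<Sum>i<6. \<Sum>j<6. m i j / 2 * (f (v j) * g (v i)))
        = - (\<Sum>i<6. \<Sum>j<6. m i j / 2 * (f (v i) * g (v j)))"
    proof -
      have "(\<Sum>i<6. \<Sum>j<6. m i j / 2 * (f (v j) * g (v i)))
          = (\<Sum>j<6. \<Sum>i<6. m i j / 2 * (f (v j) * g (v i)))"
        by (rule sum.swap)
      also have "\<dots> = (\<Sum>j<6. \<Sum>i<6. - (m j i / 2 * (f (v j) * g (v i))))"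
      proof (intro sum.cong refl)
        fix i j :: nat assume "j \<in> {..<6}" "i \<in> {..<6}"
        then show "m i j / 2 * (f (v j) * g (v i)) = - (m j i / 2 * (f (v j) * g (v i)))"
          using skewD[OF assms, of i j] by simp
      qed
      finally show ?thesis
        by (simp add: sum_negf)
    qed
    have "(\<Sum>p\<in>{..<6} \<times> {..<6}. m (fst p) (snd p) / 2 * wedge_vec s (v (fst p)) (v (snd p)) t)
        = (\<Sum>i<6. \<Sum>j<6. m i j / 2 * (f (v i) * g (v j)) - m i j / 2 * (f (v j) * g (v i)))"
      using True by (simp add: t sum.cartesian_product case_prod_unfold wedge_vec_def right_diff_distrib)
    also have "\<dots> = (\<Sum>i<6. \<Sum>j<6. m i j / 2 * (f (v i) * g (v j)))
        + (\<Sum>i<6. \<Sum>j<6. m i j / 2 * (f (v i) * g (v j)))"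
      by (simp only: sum_subtractf swap diff_minus_eq_add)
    also have "\<dots> = biv m t"
      using True by (simp add: t biv_def sum.distrib[symmetric] ac_simps)
    finally show ?thesis by simp
  qed (auto simp: t wedge_vec_def biv_def)
qed

lemma ext2_eq: "ext2 s = {biv m | m. skew m}"
proof
  have "cfun.subspace {biv m | m. skew m}"
  proof (rule cfun.subspaceI)
    have "0 = biv (\<lambda>i j. 0)" "skew (\<lambda>i j. 0)"
      by (auto simp: biv_def skew_def fun_eq_iff)
    then show "0 \<in> {biv m | m. skew m}" by blast
  next
    fix x y assume "x \<in> {biv m | m. skew m}" "y \<in> {biv m | m. skew m}"
    then obtain m m' where "x = biv m" "y = biv m'" "skew m" "skew m'" by blast
    moreover have "biv m + biv m' = biv (\<lambda>i j. m i j + m' i j)"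
      by (auto simp: biv_def fun_eq_iff sum.distrib algebra_simps)
    moreover have "skew (\<lambda>i j. m i j + m' i j)"
    proof (rule skewI)
      fix i j :: nat assume "i < 6" "j < 6"
      then show "m i j + m' i j = - (m j i + m' j i)"
        using skewD[OF \<open>skew m\<close>, of i j] skewD[OF \<open>skew m'\<close>, of i j] by simp
    qed
    ultimately show "x + y \<in> {biv m | m. skew m}" by blast
  next
    fix c x assume "x \<in> {biv m | m. skew m}"
    then obtain m where "x = biv m" "skew m" by blast
    moreover have "cscale c (biv m) = biv (\<lambda>i j. c * m i j)"
      by (auto simp: biv_def fun_eq_iff cscale_def sum_distrib_left algebra_simps)
    moreover have "skew (\<lambda>i j. c * m i j)"
    proof (rule skewI)
      fix i j :: nat assume "i < 6" "j < 6"
      then show "c * m i j = - (c * m j i)"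
        using skewD[OF \<open>skew m\<close>, of i j] by simp
    qed
    ultimately show "cscale c x \<in> {biv m | m. skew m}" by blast
  qed
  moreover have "wedge_vec s x y \<in> {biv m | m. skew m}" for x y
  proof -
    have "skew (\<lambda>i j. e i x * e j y - e i y * e j x)"
      by (rule skewI) simp
    then show ?thesis
      unfolding wedge_vec_biv by blast
  qed
  then have "{wedge_vec s x y | x y. True} \<subseteq> {biv m | m. skew m}"
    by blast
  ultimately show "ext2 s \<subseteq> {biv m | m. skew m}"
    unfolding ext2_def by (rule cfun.span_minimal[rotated])
next
  have "biv m \<in> ext2 s" if "skew m" for m
    unfolding ext2_def using biv_wedge_vec[OF that] by (rule combination_mem_span) blast
  then show "{biv m | m. skew m} \<subseteq> ext2 s" by blast
qed

lemma biv_ext2: "skew m \<Longrightarrow> biv m \<in> ext2 s"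
  by (auto simp: ext2_eq)

lemma biv_co: "\<omega> \<in> ext2 s \<Longrightarrow> biv (co \<omega>) = \<omega>"
  unfolding ext2_eq using co_biv by (auto intro: biv_cong)

lemma skew_co: "\<omega> \<in> ext2 s \<Longrightarrow> skew (co \<omega>)"
proof (rule skewI)
  fix i j :: nat assume "\<omega> \<in> ext2 s" "i < 6" "j < 6"
  then obtain m where "\<omega> = biv m" "skew m" by (auto simp: ext2_eq)
  then show "co \<omega> i j = - co \<omega> j i"
    using skewD[OF \<open>skew m\<close>, of i j] \<open>i < 6\<close> \<open>j < 6\<close> by (simp add: co_biv)
qed

lemma subspace_ext2: "cfun.subspace (ext2 s)"
  unfolding ext2_def by (rule cfun.subspace_span)

lemma ext2_outside: "\<omega> \<in> ext2 s \<Longrightarrow> f \<notin> D \<or> g \<notin> D \<Longrightarrow> \<omega> (f, g) = 0"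
  by (auto simp: ext2_eq biv_def)

lemma ext2_swap:
  assumes "\<omega> \<in> ext2 s"
  shows "\<omega> (f, g) = - \<omega> (g, f)"
proof -
  obtain m where m: "skew m" "\<omega> = biv m"
    using assms by (auto simp: ext2_eq)
  have "(\<Sum>i<6. \<Sum>j<6. m i j * (f (v i) * g (v j))) = (\<Sum>j<6. \<Sum>i<6. m i j * (f (v i) * g (v j)))"
    by (rule sum.swap)
  also have "\<dots> = (\<Sum>j<6. \<Sum>i<6. - (m j i * (g (v j) * f (v i))))"
  proof (intro sum.cong refl)
    fix i j :: nat assume "j \<in> {..<6}" "i \<in> {..<6}"
    then show "m i j * (f (v i) * g (v j)) = - (m j i * (g (v j) * f (v i)))"
      using skewD[OF m(1), of i j] by simp
  qed
  finally show ?thesis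
    by (auto simp: m biv_def sum_negf)
qed

lemma ext2_same: "\<omega> \<in> ext2 s \<Longrightarrow> \<omega> (f, f) = 0"
  using ext2_swap[of \<omega> f f] by simp

lemma ext2_linear:
  assumes "\<omega> \<in> ext2 s" "\<And>l. l \<in> A \<Longrightarrow> w l \<in> D" "\<And>x. f x = (\<Sum>l\<in>A. c l * w l x)"
  shows "\<omega> (f, g) = (\<Sum>l\<in>A. c l * \<omega> (w l, g))"
proof -
  obtain m where m: "skew m" "\<omega> = biv m"
    using assms by (auto simp: ext2_eq)
  have f: "f \<in> D"
  proof -
    have "f = (\<lambda>x. \<Sum>l\<in>A. c l * w l x)"
      using assms(3) by (rule ext)
    then show ?thesis
      using D_combination[of A w c] assms(2) by simp
  qed
  show ?thesis
  proof (cases "g \<in> D")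
    case True
    have "\<omega> (f, g) = (\<Sum>i<6. \<Sum>j<6. m i j * ((\<Sum>l\<in>A. c l * w l (v i)) * g (v j)))"
      using f True by (simp add: m biv_def assms(3))
    also have "\<dots> = (\<Sum>i<6. \<Sum>j<6. \<Sum>l\<in>A. c l * (m i j * (w l (v i) * g (v j))))"
      by (simp add: sum_distrib_left sum_distrib_right algebra_simps)
    also have "\<dots> = (\<Sum>i<6. \<Sum>l\<in>A. \<Sum>j<6. c l * (m i j * (w l (v i) * g (v j))))"
      by (intro sum.cong refl sum.swap)
    also have "\<dots> = (\<Sum>l\<in>A. \<Sum>i<6. \<Sum>j<6. c l * (m i j * (w l (v i) * g (v j))))"
      by (rule sum.swap)
    also have "\<dots> = (\<Sum>l\<in>A. c l * \<omega> (w l, g))"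
      using True assms(2) by (intro sum.cong refl) (simp add: m biv_def sum_distrib_left)
    finally show ?thesis .
  qed (simp add: ext2_outside[OF assms(1)])
qed

lemma wedge_outside:
  assumes "\<omega> \<in> ext2 s" "\<eta> \<in> ext2 s" "a \<notin> D \<or> b \<notin> D \<or> c \<notin> D \<or> d \<notin> D"
  shows "wedge \<omega> \<eta> (a, b, c, d) = 0"
  using assms(3) by (auto simp: wedge_def ext2_outside[OF assms(1)] ext2_outside[OF assms(2)])

lemma wedge_swaps:
  assumes "\<omega> \<in> ext2 s" "\<eta> \<in> ext2 s"
  shows "wedge \<omega> \<eta> (b, a, c, d) = - wedge \<omega> \<eta> (a, b, c, d)"
    and "wedge \<omega> \<eta> (a, c, b, d) = - wedge \<omega> \<eta> (a, b, c, d)"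
    and "wedge \<omega> \<eta> (a, b, d, c) = - wedge \<omega> \<eta> (a, b, c, d)"
  using ext2_swap[OF assms(1), of b a] ext2_swap[OF assms(2), of b a]
    ext2_swap[OF assms(1), of c b] ext2_swap[OF assms(2), of c b]
    ext2_swap[OF assms(1), of d c] ext2_swap[OF assms(2), of d c]
  by (simp_all add: wedge_def)

lemma wedge_linear:
  assumes "\<omega> \<in> ext2 s" "\<eta> \<in> ext2 s"
    and "\<And>l. l \<in> A \<Longrightarrow> w l \<in> D" "\<And>x. f x = (\<Sum>l\<in>A. c l * w l x)"
  shows "wedge \<omega> \<eta> (f, x, y, z) = (\<Sum>l\<in>A. c l * wedge \<omega> \<eta> (w l, x, y, z))"
proof -
  have L: "\<omega> (f, g) = (\<Sum>l\<in>A. c l * \<omega> (w l, g))" "\<eta> (f, g) = (\<Sum>l\<in>A. c l * \<eta> (w l, g))" for g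
    by (auto intro!: ext2_linear[where A = A and c = c and w = w] assms)
  show ?thesis
    unfolding wedge_def prod.case
    unfolding L
    by (simp add: sum_distrib_left sum_distrib_right algebra_simps sum.distrib sum_subtractf)
qed

lemma wedge_sum_zero:
  assumes \<omega>: "\<And>i. i \<in> I \<Longrightarrow> \<omega> i \<in> ext2 s" "\<And>i. i \<in> I \<Longrightarrow> \<eta> i \<in> ext2 s"
    and zero: "\<And>a b c d. a < b \<Longrightarrow> b < c \<Longrightarrow> c < d \<Longrightarrow> d < 6 \<Longrightarrow>
      (\<Sum>i\<in>I. k i * wedge (\<omega> i) (\<eta> i) (e a, e b, e c, e d)) = 0"
  shows "(\<Sum>i\<in>I. k i * wedge (\<omega> i) (\<eta> i) t) = 0"
proof -
  define G where "G a b c d = (\<Sum>i\<in>I. k i * wedge (\<omega> i) (\<eta> i) (a, b, c, d))" for a b c d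
  have sw: "G b a c d = - G a b c d" "G a c b d = - G a b c d" "G a b d c = - G a b c d" for a b c d
  proof -
    have "wedge (\<omega> i) (\<eta> i) (b, a, c, d) = - wedge (\<omega> i) (\<eta> i) (a, b, c, d)"
      "wedge (\<omega> i) (\<eta> i) (a, c, b, d) = - wedge (\<omega> i) (\<eta> i) (a, b, c, d)"
      "wedge (\<omega> i) (\<eta> i) (a, b, d, c) = - wedge (\<omega> i) (\<eta> i) (a, b, c, d)" if "i \<in> I" for i
      by (rule wedge_swaps[OF \<omega>(1)[OF that] \<omega>(2)[OF that]])+
    note * = this
    show "G b a c d = - G a b c d" "G a c b d = - G a b c d" "G a b d c = - G a b c d"
      unfolding G_def sum_negf[symmetric] mult_minus_right[symmetric]
      by (rule sum.cong[OF refl], simp only: *)+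
  qed
  have lin: "G f b c d = (\<Sum>a<6. f (v a) * G (e a) b c d)" if f: "f \<in> D" for f b c d
  proof -
    have "G f b c d = (\<Sum>i\<in>I. k i * (\<Sum>a<6. f (v a) * wedge (\<omega> i) (\<eta> i) (e a, b, c, d)))"
      unfolding G_def
    proof (rule sum.cong[OF refl])
      fix i assume "i \<in> I"
      have "wedge (\<omega> i) (\<eta> i) (f, b, c, d) = (\<Sum>a<6. f (v a) * wedge (\<omega> i) (\<eta> i) (e a, b, c, d))"
        by (rule wedge_linear[OF \<omega>(1)[OF \<open>i \<in> I\<close>] \<omega>(2)[OF \<open>i \<in> I\<close>] _ e_expand[OF f]])
          (simp add: e_dual)
      then show "k i * wedge (\<omega> i) (\<eta> i) (f, b, c, d)
          = k i * (\<Sum>a<6. f (v a) * wedge (\<omega> i) (\<eta> i) (e a, b, c, d))"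
        by (rule arg_cong)
    qed
    also have "\<dots> = (\<Sum>i\<in>I. \<Sum>a<6. f (v a) * (k i * wedge (\<omega> i) (\<eta> i) (e a, b, c, d)))"
      by (simp add: sum_distrib_left mult.left_commute)
    also have "\<dots> = (\<Sum>a<6. \<Sum>i\<in>I. f (v a) * (k i * wedge (\<omega> i) (\<eta> i) (e a, b, c, d)))"
      by (rule sum.swap)
    finally show ?thesis
      by (simp add: G_def sum_distrib_left)
  qed
  have same: "G a a c d = 0" "G a b b d = 0" "G a b c c = 0" for a b c d
    using sw(1)[of a a c d] sw(2)[of a b b d] sw(3)[of a b c c] by simp_all
  have sorted: "G (e a) (e b) (e c) (e d) = 0" if "a < b" "b < c" "c < d" "d < 6" for a b c d
    using zero[OF that] by (simp add: G_def)
  have 1: "G (e a) (e b) (e c) (e d) = 0" if "b < c" "c < d" "a < 6" "d < 6" for a b c d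
  proof -
    consider "a < b" | "a = b" | "b < a" "a < c" | "a = c" | "c < a" "a < d" | "a = d" | "d < a"
      by linarith
    then show ?thesis
    proof cases
      case 3
      then show ?thesis using sw(1)[of "e b" "e a"] sorted[of b a c d] that by simp
    next
      case 4
      then show ?thesis using sw(1)[of "e b" "e a"] same(2)[of "e b" "e c" "e d"] by simp
    next
      case 5
      then show ?thesis
        using sw(1)[of "e b" "e a" "e c" "e d"] sw(2)[of "e b" "e c" "e a" "e d"] sorted[of b c a d] that
        by simp
    next
      case 6
      then show ?thesis
        using sw(1)[of "e b" "e a" "e c" "e d"] sw(2)[of "e b" "e c" "e a" "e d"] same(3)[of "e b" "e c" "e d"]
        by simp
    next
      case 7
      then show ?thesis
        using sw(1)[of "e b" "e a" "e c" "e d"] sw(2)[of "e b" "e c" "e a" "e d"]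
          sw(3)[of "e b" "e c" "e d" "e a"] sorted[of b c d a] that by simp
    qed (use sorted[of a b c d] same(1) that in auto)
  qed
  have 2: "G (e a) (e b) (e c) (e d) = 0" if "c < d" "a < 6" "b < 6" "d < 6" for a b c d
  proof -
    consider "b < c" | "b = c" | "c < b" "b < d" | "b = d" | "d < b"
      by linarith
    then show ?thesis
    proof cases
      case 3
      then show ?thesis using sw(2)[of "e a" "e c" "e b" "e d"] 1[of c b d a] that by simp
    next
      case 4
      then show ?thesis using sw(2)[of "e a" "e c" "e b" "e d"] same(3)[of "e a" "e c" "e d"] by simp
    next
      case 5
      then show ?thesis
        using sw(2)[of "e a" "e c" "e b" "e d"] sw(3)[of "e a" "e c" "e d" "e b"] 1[of c d b a] that
        by simp
    qed (use 1[of b c d a] same(2) that in auto)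
  qed
  have 3: "G (e a) (e b) (e c) (e d) = 0" if "a < 6" "b < 6" "c < 6" "d < 6" for a b c d
  proof -
    consider "c < d" | "c = d" | "d < c" by linarith
    then show ?thesis
      using 2[of c d a b] 2[of d c a b] same(3) sw(3)[of "e a" "e b" "e d" "e c"] that by cases auto
  qed
  have 4: "G f (e b) (e c) (e d) = 0" if "f \<in> D" "b < 6" "c < 6" "d < 6" for f b c d
    unfolding lin[OF that(1)] using 3 that by simp
  have 5: "G f g (e c) (e d) = 0" if "f \<in> D" "g \<in> D" "c < 6" "d < 6" for f g c d
  proof -
    have "G (e a) f (e c) (e d) = 0" if "a < 6" for a
      using sw(1)[of f "e a" "e c" "e d"] 4[OF \<open>f \<in> D\<close> that \<open>c < 6\<close> \<open>d < 6\<close>] by simp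
    then have "G g f (e c) (e d) = 0"
      unfolding lin[OF that(2)] by simp
    then show ?thesis using sw(1)[of f g] by simp
  qed
  have 6: "G f g h (e d) = 0" if "f \<in> D" "g \<in> D" "h \<in> D" "d < 6" for f g h d
  proof -
    have "G (e a) f g (e d) = 0" if "a < 6" for a
      using sw(1)[of f "e a" g "e d"] sw(2)[of f g "e a" "e d"]
        5[OF \<open>f \<in> D\<close> \<open>g \<in> D\<close> that \<open>d < 6\<close>] by simp
    then have "G h f g (e d) = 0"
      unfolding lin[OF that(3)] by simp
    then show ?thesis using sw(1)[of f h g "e d"] sw(2)[of f g h "e d"] by simp
  qed
  have 7: "G f g h k = 0" if "f \<in> D" "g \<in> D" "h \<in> D" "k \<in> D" for f g h k
  proof -
    have "G (e a) f g h = 0" if "a < 6" for a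
      using sw(1)[of f "e a" g h] sw(2)[of f g "e a" h] sw(3)[of f g h "e a"]
        6[OF \<open>f \<in> D\<close> \<open>g \<in> D\<close> \<open>h \<in> D\<close> that] by simp
    then have "G k f g h = 0"
      unfolding lin[OF that(4)] by simp
    then show ?thesis
      using sw(1)[of f k g h] sw(2)[of f g k h] sw(3)[of f g h k] by simp
  qed
  obtain f g h k' where t: "t = (f, g, h, k')" by (cases t)
  show ?thesis
  proof (cases "f \<in> D \<and> g \<in> D \<and> h \<in> D \<and> k' \<in> D")
    case True
    then show ?thesis using 7[of f g h k'] by (simp add: t G_def)
  next
    case False
    then show ?thesis
      unfolding t by (intro sum.neutral ballI) (simp add: wedge_outside[OF \<omega>])
  qed
qed

text \<open>Evaluation of bivectors at a fixed pair of functionals is a linear form on \<open>\<And>\<^sup>2V\<close>.\<close>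

definition eval_at :: "('v \<Rightarrow> complex) \<times> ('v \<Rightarrow> complex) \<Rightarrow> 'v bivector \<Rightarrow> complex" where
  "eval_at t \<omega> = (if \<omega> \<in> ext2 s then \<omega> t else 0)"

lemma eval_at_dual: "eval_at t \<in> dual_on cscale (ext2 s)"
  using subspace_ext2
  by (auto simp: dual_on_def eval_at_def cscale_def[of _ _ , symmetric] cfun.subspace_add
      cfun.subspace_scale) (simp add: cscale_def)

lemma dual_ext2_expand:
  assumes "\<phi> \<in> dual_on cscale (ext2 s)" "\<omega> \<in> ext2 s"
  shows "\<phi> \<omega> = (\<Sum>p\<in>{..<6} \<times> {..<6}. co \<omega> (fst p) (snd p) / 2 * \<phi> (wedge_vec s (v (fst p)) (v (snd p))))"
proof (rule dual_combination[OF assms(1) subspace_ext2])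
  show "\<omega> t = (\<Sum>p\<in>{..<6} \<times> {..<6}. co \<omega> (fst p) (snd p) / 2 * wedge_vec s (v (fst p)) (v (snd p)) t)"
    for t
    using biv_wedge_vec[OF skew_co[OF assms(2)], of t] unfolding biv_co[OF assms(2)] .
  show "wedge_vec s (v (fst p)) (v (snd p)) \<in> ext2 s" for p
    unfolding ext2_def by (rule cfun.span_base) blast
qed simp

lemma pluecker_form_frame_poly:
  assumes w: "\<And>x l. l < 4 \<Longrightarrow> w x l \<in> ext2 s"
    and poly: "\<And>l i j. l < 4 \<Longrightarrow> i < 6 \<Longrightarrow> j < 6 \<Longrightarrow> ispoly N (\<lambda>x. co (w x l) i j)"
  obtains M where "\<And>d F. pluecker_form 4 (ext2 s) d F \<Longrightarrow> polyfun N (M * d) (\<lambda>x. F (w x))"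
proof -
  have "\<exists>M. polyfun N M (\<lambda>x. co (w x l) i j)" if "l < 4" "i < 6" "j < 6" for l i j
    using poly[OF that] unfolding ispoly_def .
  then obtain M where M: "\<And>l i j. l < 4 \<Longrightarrow> i < 6 \<Longrightarrow> j < 6 \<Longrightarrow> polyfun N (M l i j) (\<lambda>x. co (w x l) i j)"
    by metis
  define K where "K = (\<Sum>l<4. \<Sum>i<6. \<Sum>j<6. M l i j)"
  have le: "M l i j \<le> K" if "l < 4" "i < 6" "j < 6" for l i j
  proof -
    have "M l i j \<le> (\<Sum>j<6. M l i j)"
      by (rule member_le_sum) (use that in auto)
    also have "\<dots> \<le> (\<Sum>i<6. \<Sum>j<6. M l i j)"
      by (rule member_le_sum[of i _ "\<lambda>i. \<Sum>j<6. M l i j"]) (use that in auto)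
    also have "\<dots> \<le> K"
      unfolding K_def by (rule member_le_sum[of l _ "\<lambda>l. \<Sum>i<6. \<Sum>j<6. M l i j"]) (use that in auto)
    finally show ?thesis .
  qed
  have "polyfun N K (\<lambda>x. \<phi> (w x l))" if \<phi>: "\<phi> \<in> dual_on cscale (ext2 s)" and "l < 4" for \<phi> l
  proof -
    have "polyfun N (K + 0) (\<lambda>x. co (w x l) (fst p) (snd p) * (\<phi> (wedge_vec s (v (fst p)) (v (snd p))) / 2))"
      if "p \<in> {..<6} \<times> {..<6}" for p
      using that \<open>l < 4\<close> le by (intro polyfun.mult polyfun.const polyfun.mono[OF M]) auto
    then have "polyfun N K (\<lambda>x. \<Sum>p\<in>{..<6} \<times> {..<6}.
        co (w x l) (fst p) (snd p) * (\<phi> (wedge_vec s (v (fst p)) (v (snd p))) / 2))"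
      by (intro polyfun_sum) simp
    then show ?thesis
      unfolding dual_ext2_expand[OF \<phi> w[OF \<open>l < 4\<close>]] by simp
  qed
  then have "polyfun N (4 * K * d) (\<lambda>x. F (w x))" if "pluecker_form 4 (ext2 s) d F" for d F
    by (rule pluecker_form_polyfun[OF that])
  then show ?thesis
    by (rule that)
qed

end

section \<open>The algebra of skew matrices of size six\<close>




definition w4 :: "(nat \<Rightarrow> nat \<Rightarrow> complex) \<Rightarrow> (nat \<Rightarrow> nat \<Rightarrow> complex) \<Rightarrow> nat \<Rightarrow> nat \<Rightarrow> nat \<Rightarrow> nat \<Rightarrow> complex" where
  "w4 m n a b c d = m a b * n c d - m a c * n b d + m a d * n b c
     + m b c * n a d - m b d * n a c + m c d * n a b"

definition Pf :: "(nat \<Rightarrow> nat \<Rightarrow> complex) \<Rightarrow> complex" where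
  "Pf m = m 0 1 * (m 2 3 * m 4 5 - m 2 4 * m 3 5 + m 2 5 * m 3 4)
        - m 0 2 * (m 1 3 * m 4 5 - m 1 4 * m 3 5 + m 1 5 * m 3 4)
        + m 0 3 * (m 1 2 * m 4 5 - m 1 4 * m 2 5 + m 1 5 * m 2 4)
        - m 0 4 * (m 1 2 * m 3 5 - m 1 3 * m 2 5 + m 1 5 * m 2 3)
        + m 0 5 * (m 1 2 * m 3 4 - m 1 3 * m 2 4 + m 1 4 * m 2 3)"

definition star :: "(nat \<Rightarrow> nat \<Rightarrow> nat \<Rightarrow> nat \<Rightarrow> complex) \<Rightarrow> nat \<Rightarrow> nat \<Rightarrow> complex" where
  "star k i j =
    [[0, k 2 3 4 5, - k 1 3 4 5, k 1 2 4 5, - k 1 2 3 5, k 1 2 3 4],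
     [- k 2 3 4 5, 0, k 0 3 4 5, - k 0 2 4 5, k 0 2 3 5, - k 0 2 3 4],
     [k 1 3 4 5, - k 0 3 4 5, 0, k 0 1 4 5, - k 0 1 3 5, k 0 1 3 4],
     [- k 1 2 4 5, k 0 2 4 5, - k 0 1 4 5, 0, k 0 1 2 5, - k 0 1 2 4],
     [k 1 2 3 5, - k 0 2 3 5, k 0 1 3 5, - k 0 1 2 5, 0, k 0 1 2 3],
     [- k 1 2 3 4, k 0 2 3 4, - k 0 1 3 4, k 0 1 2 4, - k 0 1 2 3, 0]] ! i ! j"

lemma sum_6: "(\<Sum>i<6. f i) = f 0 + f 1 + f 2 + f 3 + f 4 + f (5 :: nat)"
  by (simp add: eval_nat_numeral)

definition t3 :: "(nat \<Rightarrow> nat \<Rightarrow> complex) \<Rightarrow> (nat \<Rightarrow> nat \<Rightarrow> nat \<Rightarrow> nat \<Rightarrow> complex) \<Rightarrow> complex" where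
  "t3 m k = m 0 1 * k 2 3 4 5 - m 0 2 * k 1 3 4 5 + m 0 3 * k 1 2 4 5 - m 0 4 * k 1 2 3 5
     + m 0 5 * k 1 2 3 4 + m 1 2 * k 0 3 4 5 - m 1 3 * k 0 2 4 5 + m 1 4 * k 0 2 3 5
     - m 1 5 * k 0 2 3 4 + m 2 3 * k 0 1 4 5 - m 2 4 * k 0 1 3 5 + m 2 5 * k 0 1 3 4
     + m 3 4 * k 0 1 2 5 - m 3 5 * k 0 1 2 4 + m 4 5 * k 0 1 2 3"

definition Mop :: "(nat \<Rightarrow> nat \<Rightarrow> complex) \<Rightarrow> (nat \<Rightarrow> nat \<Rightarrow> nat \<Rightarrow> nat \<Rightarrow> complex) \<Rightarrow> nat \<Rightarrow> nat \<Rightarrow> complex" where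
  "Mop m k i j = 2 * (\<Sum>a<6. \<Sum>b<6. m i a * star k a b * m b j) + t3 m k * m i j"

lemma skew_table:
  assumes "skew m"
  shows "m 0 0 = 0" "m 1 1 = 0" "m 2 2 = 0" "m 3 3 = 0" "m 4 4 = 0" "m 5 5 = (0 :: complex)"
    "m 1 0 = - m 0 1" "m 2 0 = - m 0 2" "m 3 0 = - m 0 3" "m 4 0 = - m 0 4" "m 5 0 = - m 0 5"
    "m 2 1 = - m 1 2" "m 3 1 = - m 1 3" "m 4 1 = - m 1 4" "m 5 1 = - m 1 5"
    "m 3 2 = - m 2 3" "m 4 2 = - m 2 4" "m 5 2 = - m 2 5"
    "m 4 3 = - m 3 4" "m 5 3 = - m 3 5" "m 5 4 = - m 4 5"
proof -
  have "m i i = 0" if "i < 6" for i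
    using skewD[OF assms that that] by simp
  then show "m 0 0 = 0" "m 1 1 = 0" "m 2 2 = 0" "m 3 3 = 0" "m 4 4 = 0" "m 5 5 = 0"
    by simp_all
qed (rule skewD[OF assms]; simp)+

lemma star_table:
  "star k 0 0 = 0" "star k 1 1 = 0" "star k 2 2 = 0" "star k 3 3 = 0" "star k 4 4 = 0" "star k 5 5 = 0"
  "star k 0 1 = k 2 3 4 5" "star k 0 2 = - k 1 3 4 5" "star k 0 3 = k 1 2 4 5"
  "star k 0 4 = - k 1 2 3 5" "star k 0 5 = k 1 2 3 4" "star k 1 2 = k 0 3 4 5"
  "star k 1 3 = - k 0 2 4 5" "star k 1 4 = k 0 2 3 5" "star k 1 5 = - k 0 2 3 4"
  "star k 2 3 = k 0 1 4 5" "star k 2 4 = - k 0 1 3 5" "star k 2 5 = k 0 1 3 4"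
  "star k 3 4 = k 0 1 2 5" "star k 3 5 = - k 0 1 2 4" "star k 4 5 = k 0 1 2 3"
  "star k 1 0 = - k 2 3 4 5" "star k 2 0 = k 1 3 4 5" "star k 3 0 = - k 1 2 4 5"
  "star k 4 0 = k 1 2 3 5" "star k 5 0 = - k 1 2 3 4" "star k 2 1 = - k 0 3 4 5"
  "star k 3 1 = k 0 2 4 5" "star k 4 1 = - k 0 2 3 5" "star k 5 1 = k 0 2 3 4"
  "star k 3 2 = - k 0 1 4 5" "star k 4 2 = k 0 1 3 5" "star k 5 2 = - k 0 1 3 4"
  "star k 4 3 = - k 0 1 2 5" "star k 5 3 = k 0 1 2 4" "star k 5 4 = - k 0 1 2 3"
  by (simp_all add: star_def nth_Cons_numeral numeral_nat)

lemma upper_entries: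
  obtains a01 a02 a03 a04 a05 a12 a13 a14 a15 a23 a24 a25 a34 a35 a45
  where "m 0 1 = a01" "m 0 2 = a02" "m 0 3 = a03" "m 0 4 = a04" "m 0 5 = a05" "m 1 2 = a12" "m 1 3 = a13" "m 1 4 = a14" "m 1 5 = a15" "m 2 3 = a23" "m 2 4 = a24" "m 2 5 = a25" "m 3 4 = a34" "m 3 5 = a35" "m 4 5 = a45"
  by simp

lemma skew_entries:
  assumes "skew m"
  obtains a01 a02 a03 a04 a05 a12 a13 a14 a15 a23 a24 a25 a34 a35 a45
  where "m 0 1 = a01" "m 0 2 = a02" "m 0 3 = a03" "m 0 4 = a04" "m 0 5 = a05" "m 1 2 = a12" "m 1 3 = a13" "m 1 4 = a14" "m 1 5 = a15" "m 2 3 = a23" "m 2 4 = a24" "m 2 5 = a25" "m 3 4 = a34" "m 3 5 = a35" "m 4 5 = a45"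
    "m 1 0 = - a01" "m 2 0 = - a02" "m 3 0 = - a03" "m 4 0 = - a04" "m 5 0 = - a05" "m 2 1 = - a12" "m 3 1 = - a13" "m 4 1 = - a14" "m 5 1 = - a15" "m 3 2 = - a23" "m 4 2 = - a24" "m 5 2 = - a25" "m 4 3 = - a34" "m 5 3 = - a35" "m 5 4 = - a45"
    "m 0 0 = 0" "m 1 1 = 0" "m 2 2 = 0" "m 3 3 = 0" "m 4 4 = 0" "m 5 5 = 0"
  using skew_table[OF assms] by simp

lemma fourform_entries:
  obtains a0123 a0124 a0125 a0134 a0135 a0145 a0234 a0235 a0245 a0345 a1234 a1235 a1245 a1345 a2345
  where "k 0 1 2 3 = a0123" "k 0 1 2 4 = a0124" "k 0 1 2 5 = a0125" "k 0 1 3 4 = a0134" "k 0 1 3 5 = a0135" "k 0 1 4 5 = a0145" "k 0 2 3 4 = a0234" "k 0 2 3 5 = a0235" "k 0 2 4 5 = a0245" "k 0 3 4 5 = a0345" "k 1 2 3 4 = a1234" "k 1 2 3 5 = a1235" "k 1 2 4 5 = a1245" "k 1 3 4 5 = a1345" "k 2 3 4 5 = a2345"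
  by simp

lemma less_6_cases: "(i :: nat) < 6 \<Longrightarrow> i = 0 \<or> i = 1 \<or> i = 2 \<or> i = 3 \<or> i = 4 \<or> i = 5"
  by linarith

lemma sorted_pairs_6:
  assumes "(i :: nat) < j" "j < 6"
  shows "i = 0 \<and> j = 1 \<or> i = 0 \<and> j = 2 \<or> i = 0 \<and> j = 3 \<or> i = 0 \<and> j = 4 \<or> i = 0 \<and> j = 5 \<or> i = 1 \<and> j = 2 \<or> i = 1 \<and> j = 3 \<or> i = 1 \<and> j = 4 \<or> i = 1 \<and> j = 5 \<or> i = 2 \<and> j = 3 \<or> i = 2 \<and> j = 4 \<or> i = 2 \<and> j = 5 \<or> i = 3 \<and> j = 4 \<or> i = 3 \<and> j = 5 \<or> i = 4 \<and> j = 5"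
  using assms by presburger

lemma sorted_quads_6:
  assumes "(a :: nat) < b" "b < c" "c < d" "d < 6"
  shows "a = 0 \<and> b = 1 \<and> c = 2 \<and> d = 3 \<or> a = 0 \<and> b = 1 \<and> c = 2 \<and> d = 4 \<or> a = 0 \<and> b = 1 \<and> c = 2 \<and> d = 5 \<or> a = 0 \<and> b = 1 \<and> c = 3 \<and> d = 4 \<or> a = 0 \<and> b = 1 \<and> c = 3 \<and> d = 5 \<or> a = 0 \<and> b = 1 \<and> c = 4 \<and> d = 5 \<or> a = 0 \<and> b = 2 \<and> c = 3 \<and> d = 4 \<or> a = 0 \<and> b = 2 \<and> c = 3 \<and> d = 5 \<or> a = 0 \<and> b = 2 \<and> c = 4 \<and> d = 5 \<or> a = 0 \<and> b = 3 \<and> c = 4 \<and> d = 5 \<or> a = 1 \<and> b = 2 \<and> c = 3 \<and> d = 4 \<or> a = 1 \<and> b = 2 \<and> c = 3 \<and> d = 5 \<or> a = 1 \<and> b = 2 \<and> c = 4 \<and> d = 5 \<or> a = 1 \<and> b = 3 \<and> c = 4 \<and> d = 5 \<or> a = 2 \<and> b = 3 \<and> c = 4 \<and> d = 5"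
  using assms by presburger

lemma Mop_wedge:
  assumes "skew m" "skew n" "i < j" "j < 6"
  shows "Mop m (w4 m n) i j = 2 * Pf m * n i j"
proof -
  obtain a01 a02 a03 a04 a05 a12 a13 a14 a15 a23 a24 a25 a34 a35 a45
    where m: "m 0 1 = a01" "m 0 2 = a02" "m 0 3 = a03" "m 0 4 = a04" "m 0 5 = a05" "m 1 2 = a12" "m 1 3 = a13" "m 1 4 = a14" "m 1 5 = a15" "m 2 3 = a23" "m 2 4 = a24" "m 2 5 = a25" "m 3 4 = a34" "m 3 5 = a35" "m 4 5 = a45"
    "m 1 0 = - a01" "m 2 0 = - a02" "m 3 0 = - a03" "m 4 0 = - a04" "m 5 0 = - a05" "m 2 1 = - a12" "m 3 1 = - a13" "m 4 1 = - a14" "m 5 1 = - a15" "m 3 2 = - a23" "m 4 2 = - a24" "m 5 2 = - a25" "m 4 3 = - a34" "m 5 3 = - a35" "m 5 4 = - a45"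
    "m 0 0 = 0" "m 1 1 = 0" "m 2 2 = 0" "m 3 3 = 0" "m 4 4 = 0" "m 5 5 = 0"
    using skew_entries[OF assms(1)] .
  obtain b01 b02 b03 b04 b05 b12 b13 b14 b15 b23 b24 b25 b34 b35 b45
    where n: "n 0 1 = b01" "n 0 2 = b02" "n 0 3 = b03" "n 0 4 = b04" "n 0 5 = b05" "n 1 2 = b12" "n 1 3 = b13" "n 1 4 = b14" "n 1 5 = b15" "n 2 3 = b23" "n 2 4 = b24" "n 2 5 = b25" "n 3 4 = b34" "n 3 5 = b35" "n 4 5 = b45"
    using upper_entries[of n] .
  note * = Mop_def sum_6 star_table w4_def Pf_def t3_def m n
  have "Mop m (w4 m n) 0 1 = 2 * Pf m * n 0 1" "Mop m (w4 m n) 0 2 = 2 * Pf m * n 0 2" "Mop m (w4 m n) 0 3 = 2 * Pf m * n 0 3" "Mop m (w4 m n) 0 4 = 2 * Pf m * n 0 4" "Mop m (w4 m n) 0 5 = 2 * Pf m * n 0 5" "Mop m (w4 m n) 1 2 = 2 * Pf m * n 1 2" "Mop m (w4 m n) 1 3 = 2 * Pf m * n 1 3" "Mop m (w4 m n) 1 4 = 2 * Pf m * n 1 4" "Mop m (w4 m n) 1 5 = 2 * Pf m * n 1 5" "Mop m (w4 m n) 2 3 = 2 * Pf m * n 2 3" "Mop m (w4 m n) 2 4 = 2 * Pf m * n 2 4" "Mop m (w4 m n) 2 5 = 2 * Pf m * n 2 5" "Mop m (w4 m n) 3 4 = 2 * Pf m * n 3 4" "Mop m (w4 m n) 3 5 =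 2 * Pf m * n 3 5" "Mop m (w4 m n) 4 5 = 2 * Pf m * n 4 5"
    unfolding * by Groebner_Basis.algebra+
  with sorted_pairs_6[OF assms(3,4)] show ?thesis by (elim disjE conjE) (simp_all only:)
qed

lemma wedge_Mop:
  assumes "skew m" "a < b" "b < c" "c < d" "d < 6"
  shows "w4 m (Mop m k) a b c d = 2 * Pf m * k a b c d"
proof -
  obtain a01 a02 a03 a04 a05 a12 a13 a14 a15 a23 a24 a25 a34 a35 a45
    where m: "m 0 1 = a01" "m 0 2 = a02" "m 0 3 = a03" "m 0 4 = a04" "m 0 5 = a05" "m 1 2 = a12" "m 1 3 = a13" "m 1 4 = a14" "m 1 5 = a15" "m 2 3 = a23" "m 2 4 = a24" "m 2 5 = a25" "m 3 4 = a34" "m 3 5 = a35" "m 4 5 = a45"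
    "m 1 0 = - a01" "m 2 0 = - a02" "m 3 0 = - a03" "m 4 0 = - a04" "m 5 0 = - a05" "m 2 1 = - a12" "m 3 1 = - a13" "m 4 1 = - a14" "m 5 1 = - a15" "m 3 2 = - a23" "m 4 2 = - a24" "m 5 2 = - a25" "m 4 3 = - a34" "m 5 3 = - a35" "m 5 4 = - a45"
    "m 0 0 = 0" "m 1 1 = 0" "m 2 2 = 0" "m 3 3 = 0" "m 4 4 = 0" "m 5 5 = 0"
    using skew_entries[OF assms(1)] .
  obtain a0123 a0124 a0125 a0134 a0135 a0145 a0234 a0235 a0245 a0345 a1234 a1235 a1245 a1345 a2345
    where k: "k 0 1 2 3 = a0123" "k 0 1 2 4 = a0124" "k 0 1 2 5 = a0125" "k 0 1 3 4 = a0134" "k 0 1 3 5 = a0135" "k 0 1 4 5 = a0145" "k 0 2 3 4 = a0234" "k 0 2 3 5 = a0235" "k 0 2 4 5 = a0245" "k 0 3 4 5 = a0345" "k 1 2 3 4 = a1234" "k 1 2 3 5 = a1235" "k 1 2 4 5 = a1245" "k 1 3 4 5 = a1345" "k 2 3 4 5 = a2345"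
    using fourform_entries[of k] .
  note * = w4_def Mop_def sum_6 star_table Pf_def t3_def m k
  have "w4 m (Mop m k) 0 1 2 3 = 2 * Pf m * k 0 1 2 3" "w4 m (Mop m k) 0 1 2 4 = 2 * Pf m * k 0 1 2 4" "w4 m (Mop m k) 0 1 2 5 = 2 * Pf m * k 0 1 2 5" "w4 m (Mop m k) 0 1 3 4 = 2 * Pf m * k 0 1 3 4" "w4 m (Mop m k) 0 1 3 5 = 2 * Pf m * k 0 1 3 5" "w4 m (Mop m k) 0 1 4 5 = 2 * Pf m * k 0 1 4 5" "w4 m (Mop m k) 0 2 3 4 = 2 * Pf m * k 0 2 3 4" "w4 m (Mop m k) 0 2 3 5 = 2 * Pf m * k 0 2 3 5" "w4 m (Mop m k) 0 2 4 5 = 2 * Pf m * k 0 2 4 5" "w4 m (Mop m k) 0 3 4 5 = 2 * Pf m * k 0 3 4 5" "w4 m (Mop m k) 1 2 3 4 = 2 * Pf m * k 1 2 3 4" "w4 m (Mop m k) 1 2 3 5 = 2 * Pf m * k 1 2 3 5" "w4 m (Mop m k) 1 2 4 5 = 2 * Pf m * k 1 2 4 5" "w4 m (Mop m k) 1 3 4 5 = 2 * Pf m * k 1 3 4 5" "w4 m (Mop m k) 2 3 4 5 = 2 * Pf m * k 2 3 4 5"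
    unfolding * by Groebner_Basis.algebra+
  with sorted_quads_6[OF assms(2-5)] show ?thesis by (elim disjE conjE) (simp_all only:)
qed

lemma star_square:
  assumes "skew m" "p < 6" "j < 6"
  shows "(\<Sum>i<6. star (w4 m m) p i * m i j) = (if p = j then - 2 * Pf m else 0)"
proof -
  obtain a01 a02 a03 a04 a05 a12 a13 a14 a15 a23 a24 a25 a34 a35 a45
    where m: "m 0 1 = a01" "m 0 2 = a02" "m 0 3 = a03" "m 0 4 = a04" "m 0 5 = a05" "m 1 2 = a12" "m 1 3 = a13" "m 1 4 = a14" "m 1 5 = a15" "m 2 3 = a23" "m 2 4 = a24" "m 2 5 = a25" "m 3 4 = a34" "m 3 5 = a35" "m 4 5 = a45"
    "m 1 0 = - a01" "m 2 0 = - a02" "m 3 0 = - a03" "m 4 0 = - a04" "m 5 0 = - a05" "m 2 1 = - a12" "m 3 1 = - a13" "m 4 1 = - a14" "m 5 1 = - a15" "m 3 2 = - a23" "m 4 2 = - a24" "m 5 2 = - a25" "m 4 3 = - a34" "m 5 3 = - a35" "m 5 4 = - a45"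
    "m 0 0 = 0" "m 1 1 = 0" "m 2 2 = 0" "m 3 3 = 0" "m 4 4 = 0" "m 5 5 = 0"
    using skew_entries[OF assms(1)] .
  note * = sum_6 star_table w4_def Pf_def m
  have tab: "(\<Sum>i<6. star (w4 m m) 0 i * m i 0) = - 2 * Pf m" "(\<Sum>i<6. star (w4 m m) 0 i * m i 1) = 0" "(\<Sum>i<6. star (w4 m m) 0 i * m i 2) = 0" "(\<Sum>i<6. star (w4 m m) 0 i * m i 3) = 0" "(\<Sum>i<6. star (w4 m m) 0 i * m i 4) = 0" "(\<Sum>i<6. star (w4 m m) 0 i * m i 5) = 0" "(\<Sum>i<6. star (w4 m m) 1 i * m i 0) = 0" "(\<Sum>i<6. star (w4 m m) 1 i * m i 1) = - 2 * Pf m" "(\<Sum>i<6. star (w4 m m) 1 i * m i 2) = 0" "(\<Sum>i<6. star (w4 m m) 1 i * m i 3) = 0" "(\<Sum>i<6. star (w4 m m) 1 i * m i 4) = 0" "(\<Sum>i<6. star (w4 m m) 1 i * m i 5) = 0" "(\<Sum>i<6. star (w4 m m) 2 i * m i 0) = 0" "(\<Sum>i<6. star (w4 m m) 2 i * m i 1) = 0" "(\<Sum>i<6. star (w4 m m) 2 i * m i 2) = - 2 * Pf m" "(\<Sum>i<6. star (w4 m m) 2 i * m i 3) = 0" "(\<Sum>i<6. star (w4 m m) 2 i * m i 4) = 0" "(\<Sum>i<6. star (w4 m m) 2 i * m i 5) = 0" "(\<Sum>i<6. star (w4 m m) 3 i * m i 0) = 0" "(\<Sum>i<6. star (w4 m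 m) 3 i * m i 1) = 0" "(\<Sum>i<6. star (w4 m m) 3 i * m i 2) = 0" "(\<Sum>i<6. star (w4 m m) 3 i * m i 3) = - 2 * Pf m" "(\<Sum>i<6. star (w4 m m) 3 i * m i 4) = 0" "(\<Sum>i<6. star (w4 m m) 3 i * m i 5) = 0" "(\<Sum>i<6. star (w4 m m) 4 i * m i 0) = 0" "(\<Sum>i<6. star (w4 m m) 4 i * m i 1) = 0" "(\<Sum>i<6. star (w4 m m) 4 i * m i 2) = 0" "(\<Sum>i<6. star (w4 m m) 4 i * m i 3) = 0" "(\<Sum>i<6. star (w4 m m) 4 i * m i 4) = - 2 * Pf m" "(\<Sum>i<6. star (w4 m m) 4 i * m i 5) = 0" "(\<Sum>i<6. star (w4 m m) 5 i * m i 0) = 0" "(\<Sum>i<6. star (w4 m m) 5 i * m i 1) = 0" "(\<Sum>i<6. star (w4 m m) 5 i * m i 2) = 0" "(\<Sum>i<6. star (w4 m m) 5 i * m i 3) = 0" "(\<Sum>i<6. star (w4 m m) 5 i * m i 4) = 0" "(\<Sum>i<6. star (w4 m m) 5 i * m i 5) = - 2 * Pf m"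
    unfolding * by Groebner_Basis.algebra+
  have "(\<Sum>i<6. star (w4 m m) 0 i * m i 0) = (if (0 :: nat) = 0 then - 2 * Pf m else 0)" "(\<Sum>i<6. star (w4 m m) 0 i * m i 1) = (if (0 :: nat) = 1 then - 2 * Pf m else 0)" "(\<Sum>i<6. star (w4 m m) 0 i * m i 2) = (if (0 :: nat) = 2 then - 2 * Pf m else 0)" "(\<Sum>i<6. star (w4 m m) 0 i * m i 3) = (if (0 :: nat) = 3 then - 2 * Pf m else 0)" "(\<Sum>i<6. star (w4 m m) 0 i * m i 4) = (if (0 :: nat) = 4 then - 2 * Pf m else 0)" "(\<Sum>i<6. star (w4 m m) 0 i * m i 5) = (if (0 :: nat) = 5 then - 2 * Pf m else 0)" "(\<Sum>i<6. star (w4 m m) 1 i * m i 0) = (if (1 :: nat) = 0 then - 2 * Pf m else 0)" "(\<Sum>i<6. star (w4 m m) 1 i * m i 1) = (if (1 :: nat) = 1 then - 2 * Pf m else 0)" "(\<Sum>i<6. star (w4 m m) 1 i * m i 2) = (if (1 :: nat) = 2 then - 2 * Pf m else 0)" "(\<Sum>i<6. star (w4 m m) 1 i * m i 3) = (if (1 :: nat) = 3 then - 2 * Pf m else 0)" "(\<Sum>i<6. star (w4 m m) 1 i * m i 4) = (if (1 :: nat) = 4 then - 2 * Pf m else 0)" "(\<Sum>i<6. star (w4 m m) 1 i * m i 5) = (if (1 :: nat) = 5 then - 2 * Pf m else 0)" "(\<Sum>i<6. star (w4 m m) 2 i * m i 0) = (if (2 :: nat) = 0 then - 2 * Pf m else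 0)" "(\<Sum>i<6. star (w4 m m) 2 i * m i 1) = (if (2 :: nat) = 1 then - 2 * Pf m else 0)" "(\<Sum>i<6. star (w4 m m) 2 i * m i 2) = (if (2 :: nat) = 2 then - 2 * Pf m else 0)" "(\<Sum>i<6. star (w4 m m) 2 i * m i 3) = (if (2 :: nat) = 3 then - 2 * Pf m else 0)" "(\<Sum>i<6. star (w4 m m) 2 i * m i 4) = (if (2 :: nat) = 4 then - 2 * Pf m else 0)" "(\<Sum>i<6. star (w4 m m) 2 i * m i 5) = (if (2 :: nat) = 5 then - 2 * Pf m else 0)" "(\<Sum>i<6. star (w4 m m) 3 i * m i 0) = (if (3 :: nat) = 0 then - 2 * Pf m else 0)" "(\<Sum>i<6. star (w4 m m) 3 i * m i 1) = (if (3 :: nat) = 1 then - 2 * Pf m else 0)" "(\<Sum>i<6. star (w4 m m) 3 i * m i 2) = (if (3 :: nat) = 2 then - 2 * Pf m else 0)" "(\<Sum>i<6. star (w4 m m) 3 i * m i 3) = (if (3 :: nat) = 3 then - 2 * Pf m else 0)" "(\<Sum>i<6. star (w4 m m) 3 i * m i 4) = (if (3 :: nat) = 4 then - 2 * Pf m else 0)" "(\<Sum>i<6. star (w4 m m) 3 i * m i 5) = (if (3 :: nat) = 5 then - 2 * Pf m else 0)" "(\<Sum>i<6. star (w4 m m) 4 i * m i 0) = (if (4 :: nat) = 0 then - 2 * Pf m else 0)" "(\<Sum>i<6. star (w4 m m) 4 i * m i 1) = (if (4 :: nat) = 1 then - 2 * Pf m else 0)" "(\<Sum>i<6. star (w4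 m m) 4 i * m i 2) = (if (4 :: nat) = 2 then - 2 * Pf m else 0)" "(\<Sum>i<6. star (w4 m m) 4 i * m i 3) = (if (4 :: nat) = 3 then - 2 * Pf m else 0)" "(\<Sum>i<6. star (w4 m m) 4 i * m i 4) = (if (4 :: nat) = 4 then - 2 * Pf m else 0)" "(\<Sum>i<6. star (w4 m m) 4 i * m i 5) = (if (4 :: nat) = 5 then - 2 * Pf m else 0)" "(\<Sum>i<6. star (w4 m m) 5 i * m i 0) = (if (5 :: nat) = 0 then - 2 * Pf m else 0)" "(\<Sum>i<6. star (w4 m m) 5 i * m i 1) = (if (5 :: nat) = 1 then - 2 * Pf m else 0)" "(\<Sum>i<6. star (w4 m m) 5 i * m i 2) = (if (5 :: nat) = 2 then - 2 * Pf m else 0)" "(\<Sum>i<6. star (w4 m m) 5 i * m i 3) = (if (5 :: nat) = 3 then - 2 * Pf m else 0)" "(\<Sum>i<6. star (w4 m m) 5 i * m i 4) = (if (5 :: nat) = 4 then - 2 * Pf m else 0)" "(\<Sum>i<6. star (w4 m m) 5 i * m i 5) = (if (5 :: nat) = 5 then - 2 * Pf m else 0)"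
    unfolding tab by simp_all
  note tab' = this
  show ?thesis
    using less_6_cases[OF assms(2)] less_6_cases[OF assms(3)]
    by (elim disjE; hypsubst) (rule tab')+
qed

lemma Pf_cube: "t3 m (w4 m m) = 6 * Pf m"
proof -
  obtain a01 a02 a03 a04 a05 a12 a13 a14 a15 a23 a24 a25 a34 a35 a45
    where m: "m 0 1 = a01" "m 0 2 = a02" "m 0 3 = a03" "m 0 4 = a04" "m 0 5 = a05" "m 1 2 = a12" "m 1 3 = a13" "m 1 4 = a14" "m 1 5 = a15" "m 2 3 = a23" "m 2 4 = a24" "m 2 5 = a25" "m 3 4 = a34" "m 3 5 = a35" "m 4 5 = a45"
    using upper_entries[of m] .
  show ?thesis
    unfolding t3_def w4_def Pf_def m by Groebner_Basis.algebra
qed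

lemma t3_commute: "t3 l (w4 m n) = t3 m (w4 l n)"
proof -
  obtain a01 a02 a03 a04 a05 a12 a13 a14 a15 a23 a24 a25 a34 a35 a45
    where l: "l 0 1 = a01" "l 0 2 = a02" "l 0 3 = a03" "l 0 4 = a04" "l 0 5 = a05" "l 1 2 = a12" "l 1 3 = a13" "l 1 4 = a14" "l 1 5 = a15" "l 2 3 = a23" "l 2 4 = a24" "l 2 5 = a25" "l 3 4 = a34" "l 3 5 = a35" "l 4 5 = a45"
    using upper_entries[of l] .
  obtain b01 b02 b03 b04 b05 b12 b13 b14 b15 b23 b24 b25 b34 b35 b45
    where m: "m 0 1 = b01" "m 0 2 = b02" "m 0 3 = b03" "m 0 4 = b04" "m 0 5 = b05" "m 1 2 = b12" "m 1 3 = b13" "m 1 4 = b14" "m 1 5 = b15" "m 2 3 = b23" "m 2 4 = b24" "m 2 5 = b25" "m 3 4 = b34" "m 3 5 = b35" "m 4 5 = b45"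
    using upper_entries[of m] .
  obtain c01 c02 c03 c04 c05 c12 c13 c14 c15 c23 c24 c25 c34 c35 c45
    where n: "n 0 1 = c01" "n 0 2 = c02" "n 0 3 = c03" "n 0 4 = c04" "n 0 5 = c05" "n 1 2 = c12" "n 1 3 = c13" "n 1 4 = c14" "n 1 5 = c15" "n 2 3 = c23" "n 2 4 = c24" "n 2 5 = c25" "n 3 4 = c34" "n 3 5 = c35" "n 4 5 = c45"
    using upper_entries[of n] .
  show ?thesis
    unfolding t3_def w4_def l m n by Groebner_Basis.algebra
qed

lemma w4_commute: "w4 m n = w4 n m"
  by (intro ext) (simp add: w4_def)

lemma t3_sum_left: "t3 (\<lambda>i j. \<Sum>l\<in>A. c l * M l i j) k = (\<Sum>l\<in>A. c l * t3 (M l) k)"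
  by (induction A rule: infinite_finite_induct) (simp_all add: t3_def algebra_simps)

lemma t3_sum_right:
  "t3 m (\<lambda>a b c d. \<Sum>l\<in>A. x l * K l a b c d) = (\<Sum>l\<in>A. x l * t3 m (K l))"
  by (induction A rule: infinite_finite_induct) (simp_all add: t3_def algebra_simps)

lemma w4_sum_left:
  "w4 (\<lambda>i j. \<Sum>l\<in>A. x l * M l i j) n = (\<lambda>a b c d. \<Sum>l\<in>A. x l * w4 (M l) n a b c d)"
  by (induction A rule: infinite_finite_induct) (auto simp: w4_def algebra_simps fun_eq_iff)

lemma t3_sum_middle:
  "t3 m (w4 (\<lambda>i j. \<Sum>l\<in>A. x l * M l i j) n) = (\<Sum>l\<in>A. x l * t3 m (w4 (M l) n))"
  unfolding w4_sum_left t3_sum_right ..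

lemma t3_cubic:
  "6 * Pf (\<lambda>a b. \<Sum>i\<in>A. x i * M i a b)
    = (\<Sum>i\<in>A. \<Sum>j\<in>A. \<Sum>k\<in>A. x i * x j * x k * t3 (M i) (w4 (M j) (M k)))"
proof -
  define S where "S = (\<lambda>a b. \<Sum>i\<in>A. x i * M i a b)"
  have right: "t3 m (w4 n S) = (\<Sum>k\<in>A. x k * t3 m (w4 n (M k)))" for m n
    unfolding w4_commute[of n] S_def by (rule t3_sum_middle)
  have middle: "t3 m (w4 S n) = (\<Sum>k\<in>A. x k * t3 m (w4 (M k) n))" for m n
    unfolding S_def by (rule t3_sum_middle)
  have "6 * Pf S = t3 S (w4 S S)"
    by (rule Pf_cube[symmetric])
  also have "\<dots> = (\<Sum>i\<in>A. x i * t3 (M i) (w4 S S))"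
    unfolding S_def by (rule t3_sum_left)
  also have "\<dots> = (\<Sum>i\<in>A. x i * (\<Sum>j\<in>A. x j * (\<Sum>k\<in>A. x k * t3 (M i) (w4 (M j) (M k)))))"
    unfolding middle unfolding right ..
  finally show ?thesis
    by (simp add: S_def sum_distrib_left mult.assoc)
qed

section \<open>Linear algebra over the complex numbers\<close>

lemma mat_mult_entry:
  assumes "i < n" "j < n"
  shows "(mat n n (\<lambda>(i, j). A i j) * mat n n (\<lambda>(i, j). B i j)) $$ (i, j) = (\<Sum>k<n. A i k * B k j)"
  using assms by (simp add: scalar_prod_def atLeast0LessThan)

lemma left_inverse_right:
  fixes A B :: "nat \<Rightarrow> nat \<Rightarrow> complex"
  assumes "\<And>i j. i < n \<Longrightarrow> j < n \<Longrightarrow> (\<Sum>k<n. A i k * B k j) = (if i = j then 1 else 0)"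
    and "i < n" "j < n"
  shows "(\<Sum>k<n. B i k * A k j) = (if i = j then 1 else 0)"
proof -
  have "mat n n (\<lambda>(i, j). A i j) * mat n n (\<lambda>(i, j). B i j) = 1\<^sub>m n"
  proof (rule eq_matI)
    fix i j assume "i < dim_row (1\<^sub>m n :: complex mat)" "j < dim_col (1\<^sub>m n :: complex mat)"
    then have "i < n" "j < n" by simp_all
    then show "(mat n n (\<lambda>(i, j). A i j) * mat n n (\<lambda>(i, j). B i j)) $$ (i, j) = 1\<^sub>m n $$ (i, j)"
      by (subst mat_mult_entry) (simp_all add: assms(1))
  qed simp_all
  then have "mat n n (\<lambda>(i, j). B i j) * mat n n (\<lambda>(i, j). A i j) = 1\<^sub>m n"
    using mat_mult_left_right_inverse[of "mat n n (\<lambda>(i, j). A i j)" n "mat n n (\<lambda>(i, j). B i j)"] by simp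
  then show ?thesis
    using mat_mult_entry[OF assms(2,3), of B A] assms(2,3) by simp
qed

lemma det_nonzero_of_trivial_kernel:
  fixes A :: "nat \<Rightarrow> nat \<Rightarrow> complex"
  assumes "\<And>c. (\<And>j. j < n \<Longrightarrow> (\<Sum>i<n. c i * A i j) = 0) \<Longrightarrow> \<forall>i<n. c i = 0"
  shows "det (mat n n (\<lambda>(i, j). A i j)) \<noteq> 0"
proof
  define M where "M = mat n n (\<lambda>(i, j). A j i)"
  assume "det (mat n n (\<lambda>(i, j). A i j)) = 0"
  moreover have "transpose_mat (mat n n (\<lambda>(i, j). A i j)) = M"
    unfolding M_def by (rule eq_matI) auto
  ultimately have "det M = 0"
    by (metis det_transpose mat_carrier)
  then obtain x where x: "x \<in> carrier_vec n" "x \<noteq> 0\<^sub>v n" "M *\<^sub>v x = 0\<^sub>v n"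
    using det_0_iff_vec_prod_zero[of M n] by (auto simp: M_def)
  have "(\<Sum>i<n. x $ i * A i j) = 0" if "j < n" for j
  proof -
    have "(M *\<^sub>v x) $ j = (\<Sum>i<n. A i j * x $ i)"
      using that x(1) by (simp add: M_def scalar_prod_def atLeast0LessThan)
    then show ?thesis
      using x(3) that by (simp add: mult.commute)
  qed
  then have "\<forall>i<n. x $ i = 0"
    by (rule assms)
  then have "x = 0\<^sub>v n"
    using x(1) by (intro eq_vecI) auto
  with x(2) show False ..
qed

lemma trivial_kernel_of_det_nonzero:
  fixes A :: "nat \<Rightarrow> nat \<Rightarrow> complex"
  assumes "det (mat n n (\<lambda>(i, j). A i j)) \<noteq> 0"
    and "\<And>j. j < n \<Longrightarrow> (\<Sum>i<n. c i * A i j) = 0" and "i < n"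
  shows "c i = 0"
proof -
  define M where "M = mat n n (\<lambda>(i, j). A j i)"
  have "transpose_mat (mat n n (\<lambda>(i, j). A i j)) = M"
    unfolding M_def by (rule eq_matI) auto
  then have "det M \<noteq> 0"
    using assms(1) by (metis det_transpose mat_carrier)
  moreover have "M *\<^sub>v vec n c = 0\<^sub>v n"
    using assms(2) by (intro eq_vecI) (auto simp: M_def scalar_prod_def atLeast0LessThan mult.commute)
  moreover have "M \<in> carrier_mat n n"
    by (simp add: M_def)
  ultimately have "vec n c = 0\<^sub>v n"
    using det_0_iff_vec_prod_zero[of M n] by (metis vec_carrier)
  then have "vec n c $ i = 0\<^sub>v n $ i" by simp
  then show ?thesis
    using assms(3) by simp
qed

lemma inverse_exists:
  fixes A :: "nat \<Rightarrow> nat \<Rightarrow> complex"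
  assumes "det (mat n n (\<lambda>(i, j). A i j)) \<noteq> 0"
  obtains B where "\<And>i j. i < n \<Longrightarrow> j < n \<Longrightarrow> (\<Sum>k<n. A i k * B k j) = (if i = j then 1 else 0)"
    "\<And>i j. i < n \<Longrightarrow> j < n \<Longrightarrow> (\<Sum>k<n. B i k * A k j) = (if i = j then 1 else 0)"
proof -
  define M where "M = mat n n (\<lambda>(i, j). A i j)"
  define B where "B i j = adj_mat M $$ (i, j) / det M" for i j
  have M: "M \<in> carrier_mat n n"
    by (simp add: M_def)
  have "(\<Sum>k<n. A i k * B k j) = (if i = j then 1 else 0)" if "i < n" "j < n" for i j
  proof -
    have "(\<Sum>k<n. A i k * B k j) = (\<Sum>k<n. M $$ (i, k) * adj_mat M $$ (k, j)) / det M"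
      using that by (simp add: B_def M_def sum_divide_distrib)
    also have "(\<Sum>k<n. M $$ (i, k) * adj_mat M $$ (k, j)) = (M * adj_mat M) $$ (i, j)"
      using that M adj_mat(1)[OF M] by (simp add: scalar_prod_def atLeast0LessThan)
    also have "\<dots> = det M * (if i = j then 1 else 0)"
      using that adj_mat(2)[OF M] by simp
    finally show ?thesis
      using assms by (simp add: M_def)
  qed
  then show ?thesis
    using left_inverse_right[of n A B] that by blast
qed

lemma binary_quadratic_zero:
  fixes A B C :: complex
  obtains u w where "u \<noteq> 0 \<or> w \<noteq> 0" "A * u\<^sup>2 + B * (u * w) + C * w\<^sup>2 = 0"
proof (cases "A = 0")
  case True
  then show ?thesis
    by (intro that[of 1 0]) auto
next
  case False
  define d where "d = csqrt (B\<^sup>2 - 4 * A * C)"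
  have d: "d\<^sup>2 = B\<^sup>2 - 4 * A * C"
    by (simp add: d_def)
  have "A * ((d - B) / (2 * A))\<^sup>2 + B * ((d - B) / (2 * A) * 1) + C * 1\<^sup>2
      = (d\<^sup>2 - B\<^sup>2 + 4 * A * C) / (4 * A)"
    using False by (simp add: power2_eq_square field_simps)
  also have "\<dots> = 0"
    by (simp add: d)
  finally show ?thesis
    by (intro that[of "(d - B) / (2 * A)" 1]) auto
qed

lemma rank_one_factorization:
  fixes z :: "nat \<Rightarrow> nat \<Rightarrow> complex"
  assumes "z 0 0 * z 1 1 = z 0 1 * z 1 0" "z 0 0 \<noteq> 0 \<or> z 0 1 \<noteq> 0 \<or> z 1 0 \<noteq> 0 \<or> z 1 1 \<noteq> 0"
  obtains p r a b where "p \<noteq> 0 \<or> r \<noteq> 0" "a \<noteq> 0 \<or> b \<noteq> 0"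
    "z 0 0 = p * a" "z 0 1 = p * b" "z 1 0 = r * a" "z 1 1 = r * b"
proof -
  consider "z 0 0 \<noteq> 0" | "z 0 0 = 0" "z 0 1 \<noteq> 0" | "z 0 0 = 0" "z 0 1 = 0"
    by blast
  then show ?thesis
  proof cases
    case 1
    then show ?thesis
      using assms(1) by (intro that[of 1 "z 1 0 / z 0 0" "z 0 0" "z 0 1"]) (auto simp: field_simps)
  next
    case 2
    then show ?thesis
      using assms(1) by (intro that[of 1 "z 1 1 / z 0 1" 0 "z 0 1"]) auto
  next
    case 3
    then show ?thesis
      using assms(2) by (intro that[of 0 1 "z 1 0" "z 1 1"]) auto
  qed
qed

lemma dependent_pair:
  fixes f g :: "'a \<Rightarrow> complex"
  assumes "\<And>x y. f x * g y = f y * g x"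
  obtains a b where "a \<noteq> 0 \<or> b \<noteq> 0" "\<And>x. a * f x + b * g x = 0"
proof (cases "\<exists>x. f x \<noteq> 0")
  case True
  then obtain x0 where "f x0 \<noteq> 0" by blast
  then show ?thesis
    using assms[of x0] by (intro that[of "g x0" "- f x0"]) (auto simp: algebra_simps)
qed (intro that[of 1 0], auto)

text \<open>
  The equation says \<open>X \<and> Y' = Y \<and> X'\<close>. Then the four functions satisfy two independent linear
  relations: if the bivector is zero, one between \<open>X\<close> and \<open>Y'\<close> and one between \<open>Y\<close> and \<open>X'\<close>;
  otherwise all four lie in its plane. A pencil of two-by-two matrices contains a singular one.
\<close>

lemma pencil_with_common_kernel:
  fixes X Y X' Y' :: "'a \<Rightarrow> complex"
  assumes "\<And>x y. X x * Y' y - X y * Y' x = Y x * X' y - Y y * X' x"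
  obtains p r a b where "p \<noteq> 0 \<or> r \<noteq> 0" "a \<noteq> 0 \<or> b \<noteq> 0"
    "\<And>x. p * (a * X x + b * X' x) + r * (a * Y x + b * Y' x) = 0"
proof -
  have "\<exists>z :: nat \<Rightarrow> nat \<Rightarrow> complex. z 0 0 * z 1 1 = z 0 1 * z 1 0 \<and>
      (z 0 0 \<noteq> 0 \<or> z 0 1 \<noteq> 0 \<or> z 1 0 \<noteq> 0 \<or> z 1 1 \<noteq> (0 :: complex)) \<and>
      (\<forall>x. z 0 0 * X x + z 0 1 * X' x + z 1 0 * Y x + z 1 1 * Y' x = 0)"
    (is "\<exists>z. ?P z")
  proof (cases "\<exists>x y. X x * Y' y - X y * Y' x \<noteq> 0")
    case True
    then obtain x0 y0 where \<delta>: "X x0 * Y' y0 - X y0 * Y' x0 \<noteq> 0" by blast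
    define \<delta> where "\<delta> = X x0 * Y' y0 - X y0 * Y' x0"
    define a1 where "a1 = Y x0 * Y' y0 - Y y0 * Y' x0"
    define b1 where "b1 = X x0 * Y y0 - X y0 * Y x0"
    define a2 where "a2 = X' x0 * Y' y0 - X' y0 * Y' x0"
    define b2 where "b2 = X x0 * X' y0 - X y0 * X' x0"
    have Y: "\<delta> * Y x = a1 * X x + b1 * Y' x" and X': "\<delta> * X' x = a2 * X x + b2 * Y' x" for x
    proof -
      note E = assms[of x0 y0] assms[of x x0] assms[of x y0]
      show "\<delta> * Y x = a1 * X x + b1 * Y' x"
        using E unfolding \<delta>_def a1_def b1_def by Groebner_Basis.algebra
      show "\<delta> * X' x = a2 * X x + b2 * Y' x"
        using E unfolding \<delta>_def a2_def b2_def by Groebner_Basis.algebra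
    qed
    obtain u w where uw: "u \<noteq> 0 \<or> w \<noteq> 0"
      "(a1 * b1) * u\<^sup>2 + (a1 * b2 + a2 * b1 - \<delta>\<^sup>2) * (u * w) + (a2 * b2) * w\<^sup>2 = 0"
      using binary_quadratic_zero .
    define z :: "nat \<Rightarrow> nat \<Rightarrow> complex" where
      "z i j = (if i = 0 \<and> j = 0 then - (u * a1 + w * a2) else if i = 0 then w * \<delta>
        else if j = 0 then u * \<delta> else - (u * b1 + w * b2))" for i j
    have "?P z"
    proof (intro conjI allI)
      show "z 0 0 * z 1 1 = z 0 1 * z 1 0"
        using uw(2) by (simp add: z_def power2_eq_square algebra_simps)
      show "z 0 0 \<noteq> 0 \<or> z 0 1 \<noteq> 0 \<or> z 1 0 \<noteq> 0 \<or> z 1 1 \<noteq> 0"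
        using uw(1) \<delta> by (auto simp: z_def \<delta>_def)
      fix x
      have "z 0 0 * X x + z 0 1 * X' x + z 1 0 * Y x + z 1 1 * Y' x
          = u * (\<delta> * Y x - (a1 * X x + b1 * Y' x)) + w * (\<delta> * X' x - (a2 * X x + b2 * Y' x))"
        by (simp add: z_def algebra_simps)
      then show "z 0 0 * X x + z 0 1 * X' x + z 1 0 * Y x + z 1 1 * Y' x = 0"
        by (simp add: Y X')
    qed
    then show ?thesis by blast
  next
    case False
    then have "X x * Y' y = X y * Y' x" "Y x * X' y = Y y * X' x" for x y
      using assms[of x y] by simp_all
    then obtain a b c d where ab: "a \<noteq> 0 \<or> b \<noteq> 0" "\<And>x. a * X x + b * Y' x = 0"
      and cd: "c \<noteq> 0 \<or> d \<noteq> 0" "\<And>x. c * Y x + d * X' x = 0"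
      using dependent_pair[of X Y'] dependent_pair[of Y X'] by metis
    obtain u w where uw: "u \<noteq> 0 \<or> w \<noteq> 0" "(a * b) * u\<^sup>2 + 0 * (u * w) + (- (c * d)) * w\<^sup>2 = 0"
      using binary_quadratic_zero .
    define z :: "nat \<Rightarrow> nat \<Rightarrow> complex" where
      "z i j = (if i = 0 \<and> j = 0 then u * a else if i = 0 then w * d
        else if j = 0 then w * c else u * b)" for i j
    have "?P z"
    proof (intro conjI allI)
      show "z 0 0 * z 1 1 = z 0 1 * z 1 0"
        using uw(2) by (simp add: z_def power2_eq_square algebra_simps)
      show "z 0 0 \<noteq> 0 \<or> z 0 1 \<noteq> 0 \<or> z 1 0 \<noteq> 0 \<or> z 1 1 \<noteq> 0"
        using uw(1) ab(1) cd(1) by (auto simp: z_def)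
      fix x
      have "z 0 0 * X x + z 0 1 * X' x + z 1 0 * Y x + z 1 1 * Y' x
          = u * (a * X x + b * Y' x) + w * (c * Y x + d * X' x)"
        by (simp add: z_def algebra_simps)
      then show "z 0 0 * X x + z 0 1 * X' x + z 1 0 * Y x + z 1 1 * Y' x = 0"
        by (simp add: ab cd)
    qed
    then show ?thesis by blast
  qed
  then obtain z :: "nat \<Rightarrow> nat \<Rightarrow> complex" where z: "z 0 0 * z 1 1 = z 0 1 * z 1 0"
    "z 0 0 \<noteq> 0 \<or> z 0 1 \<noteq> 0 \<or> z 1 0 \<noteq> 0 \<or> z 1 1 \<noteq> 0"
    "\<And>x. z 0 0 * X x + z 0 1 * X' x + z 1 0 * Y x + z 1 1 * Y' x = 0"
    by blast
  obtain p r a b where f: "p \<noteq> 0 \<or> r \<noteq> 0" "a \<noteq> 0 \<or> b \<noteq> 0"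
    "z 0 0 = p * a" "z 0 1 = p * b" "z 1 0 = r * a" "z 1 1 = r * b"
    using rank_one_factorization[OF z(1,2)] .
  show ?thesis
  proof (rule that[OF f(1,2)])
    show "p * (a * X x + b * X' x) + r * (a * Y x + b * Y' x) = 0" for x
      using z(3)[of x] unfolding f by (simp add: algebra_simps)
  qed
qed

lemma cubic_zero:
  fixes c0 c1 c2 c3 :: complex
  assumes "\<And>t. c0 + c1 * t + c2 * t\<^sup>2 + c3 * t ^ 3 = 0"
  shows "c0 = 0" "c1 = 0" "c2 = 0" "c3 = 0"
  using assms[of 0] assms[of 1] assms[of "-1"] assms[of 2] by (simp_all, Groebner_Basis.algebra+)

section \<open>Quadratic forms in four variables\<close>

lemma less_4_cases: "(i :: nat) < 4 \<Longrightarrow> i = 0 \<or> i = 1 \<or> i = 2 \<or> i = 3"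
  by linarith

lemma hyperbolic_form:
  assumes q: "symm 4 q" "nondeg 4 q"
  obtains u z :: "nat \<Rightarrow> nat \<Rightarrow> complex" where
    "\<And>i j. i < 4 \<Longrightarrow> j < 4 \<Longrightarrow> q i j = u 0 i * u 1 j + u 1 i * u 0 j + u 2 i * u 3 j + u 3 i * u 2 j"
    "\<And>i j. i < 4 \<Longrightarrow> j < 4 \<Longrightarrow> (\<Sum>k<4. z i k * u k j) = (if i = j then 1 else 0)"
proof -
  define b where "b x y = (\<Sum>i<4. \<Sum>j<4. q i j * (x i * y j))" for x y :: "nat \<Rightarrow> complex"
  have sym: "b x y = b y x" for x y
  proof -
    have "b x y = (\<Sum>j<4. \<Sum>i<4. q i j * (x i * y j))"
      unfolding b_def by (rule sum.swap)
    also have "\<dots> = b y x"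
      unfolding b_def
    proof (intro sum.cong refl)
      fix i j :: nat assume "i \<in> {..<4}" "j \<in> {..<4}"
      then have "q j i = q i j" using q(1) by (simp add: symm_def)
      then show "q j i * (x j * y i) = q i j * (y i * x j)" by simp
    qed
    finally show ?thesis .
  qed
  have lin: "b (\<lambda>i. a * x i + c * y i) w = a * b x w + c * b y w" for a c x y w
    unfolding b_def by (simp add: algebra_simps sum.distrib sum_distrib_left)
  have lin': "b w (\<lambda>i. a * x i + c * y i) = a * b w x + c * b w y" for a c x y w
    using lin[of a x c y w] by (simp add: sym)
  have partner: "\<exists>y. b x y = 1 \<and> b y y = 0" if x: "\<exists>i<4. x i \<noteq> 0" "b x x = 0" for x
  proof -
    obtain i where i: "i < 4" "(\<Sum>j<4. q i j * x j) \<noteq> 0"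
      using q(2) x(1) unfolding nondeg_def by blast
    define y0 where "y0 j = (if j = i then 1 else 0 :: complex)" for j :: nat
    have "b y0 x = (\<Sum>k<4. if k = i then (\<Sum>j<4. q k j * x j) else 0)"
      unfolding b_def y0_def by (intro sum.cong) auto
    then have c: "b x y0 \<noteq> 0"
      using i by (simp add: sym[of x])
    define y1 where "y1 j = (1 / b x y0) * y0 j + 0 * y0 j" for j
    have y1: "b x y1 = 1"
      unfolding y1_def lin' using c by simp
    define y where "y j = 1 * y1 j + (- b y1 y1 / 2) * x j" for j
    have "b x y = 1"
      unfolding y_def lin' using y1 x(2) by simp
    moreover have "b y y = 0"
      unfolding y_def lin lin' using y1 x(2) sym[of y1 x] by simp
    ultimately show ?thesis by blast
  qed
  have isotropic: "\<exists>\<alpha> \<beta>. (\<alpha> \<noteq> 0 \<or> \<beta> \<noteq> 0) \<and> b (\<lambda>i. \<alpha> * x i + \<beta> * y i) (\<lambda>i. \<alpha> * x i + \<beta> * y i) = 0" for x y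
  proof -
    obtain \<alpha> \<beta> where *: "\<alpha> \<noteq> 0 \<or> \<beta> \<noteq> 0" "b x x * \<alpha>\<^sup>2 + 2 * b x y * (\<alpha> * \<beta>) + b y y * \<beta>\<^sup>2 = 0"
      using binary_quadratic_zero .
    have "b (\<lambda>i. \<alpha> * x i + \<beta> * y i) (\<lambda>i. \<alpha> * x i + \<beta> * y i)
        = b x x * \<alpha>\<^sup>2 + 2 * b x y * (\<alpha> * \<beta>) + b y y * \<beta>\<^sup>2"
      unfolding lin lin' sym[of y x] by (simp add: power2_eq_square algebra_simps)
    with * show ?thesis by auto
  qed
  obtain \<alpha> \<beta> :: complex where ab: "\<alpha> \<noteq> 0 \<or> \<beta> \<noteq> 0"
    "b (\<lambda>i. \<alpha> * (if i = 0 then 1 else 0) + \<beta> * (if i = 1 then 1 else 0))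
       (\<lambda>i. \<alpha> * (if i = 0 then 1 else 0) + \<beta> * (if i = 1 then 1 else 0)) = 0"
    using isotropic[of "\<lambda>i. if i = 0 then 1 else 0" "\<lambda>i. if i = 1 then 1 else 0"] by blast
  define x where "x i = \<alpha> * (if i = 0 then 1 else 0) + \<beta> * (if i = 1 then 1 else 0)" for i :: nat
  have "x 0 = \<alpha>" "x 1 = \<beta>"
    by (simp_all add: x_def)
  then have "x (if \<alpha> = 0 then 1 else 0) \<noteq> 0" "(if \<alpha> = 0 then 1 else 0) < (4 :: nat)"
    using ab(1) by simp_all
  then have x: "\<exists>i<4. x i \<noteq> 0" "b x x = 0"
    using ab(2)[folded x_def[abs_def]] by blast+
  obtain y where y: "b x y = 1" "b y y = 0"
    using partner[OF x] by blast
  have row: "b w x' = (\<Sum>j<4. (\<Sum>i<4. q i j * w i) * x' j)" for w x'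
    unfolding b_def by (subst sum.swap) (simp add: sum_distrib_left sum_distrib_right algebra_simps)
  \<comment> \<open>two independent vectors orthogonal to the hyperbolic plane of \<open>x\<close> and \<open>y\<close>\<close>
  obtain z1 where z1: "\<exists>j<4. z1 j \<noteq> 0"
    "\<And>i. i < (2 :: nat) \<Longrightarrow> (\<Sum>j<4. (\<Sum>a<4. q a j * (if i = 0 then x a else y a)) * z1 j) = 0"
    by (rule homogeneous_system[of 2 4 "\<lambda>i j. \<Sum>a<4. q a j * (if i = 0 then x a else y a)"])
      (simp, rule that)
  have z1': "b x z1 = 0" "b y z1 = 0"
    using z1(2)[of 0] z1(2)[of 1] by (simp_all add: row)
  obtain n where n: "n < 4" "z1 n \<noteq> 0"
    using z1(1) by blast
  obtain z2 where z2: "\<exists>j<4. z2 j \<noteq> 0"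
    "\<And>i. i < (3 :: nat) \<Longrightarrow> (\<Sum>j<4. (if i = 2 then if j = n then 1 else 0
      else \<Sum>a<4. q a j * (if i = 0 then x a else y a)) * z2 j) = 0"
    by (rule homogeneous_system[of 3 4 "\<lambda>i j. if i = 2 then if j = n then 1 else 0
      else \<Sum>a<4. q a j * (if i = 0 then x a else y a)"]) (simp, rule that)
  have z2': "b x z2 = 0" "b y z2 = 0"
    using z2(2)[of 0] z2(2)[of 1] by (simp_all add: row)
  have "(\<Sum>j<4. (if j = n then 1 else 0) * z2 j) = z2 n"
    using n(1) by (simp add: if_distrib[of "\<lambda>c. c * _"] cong: if_cong)
  then have z2n: "z2 n = 0"
    using z2(2)[of 2] by simp
  obtain \<gamma> \<delta> where cd: "\<gamma> \<noteq> 0 \<or> \<delta> \<noteq> 0"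
    "b (\<lambda>i. \<gamma> * z1 i + \<delta> * z2 i) (\<lambda>i. \<gamma> * z1 i + \<delta> * z2 i) = 0"
    using isotropic[of z1 z2] by blast
  define x' where "x' i = \<gamma> * z1 i + \<delta> * z2 i" for i
  have x'_perp: "b x x' = 0" "b y x' = 0"
    unfolding x'_def lin' using z1' z2' by simp_all
  have "\<exists>i<4. x' i \<noteq> 0"
  proof (cases "\<gamma> = 0")
    case True
    with z2(1) cd(1) show ?thesis by (auto simp: x'_def)
  next
    case False
    then show ?thesis using n z2n by (auto simp: x'_def)
  qed
  moreover have x'_iso: "b x' x' = 0"
    using cd(2) unfolding x'_def .
  ultimately obtain y0 where y0: "b x' y0 = 1" "b y0 y0 = 0"
    using partner by blast
  define y1 where "y1 i = 1 * (1 * y0 i + (- b y0 y) * x i) + (- b y0 x) * y i" for i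
  have y1: "b x' y1 = 1" "b x y1 = 0" "b y y1 = 0"
    unfolding y1_def lin' using y0 x y x'_perp sym[of y x] sym[of x' x] sym[of x' y] sym[of y0 x]
      sym[of y0 y] by simp_all
  define y' where "y' i = 1 * y1 i + (- b y1 y1 / 2) * x' i" for i
  have y': "b x' y' = 1" "b x y' = 0" "b y y' = 0" "b y' y' = 0"
    unfolding y'_def lin lin' using y1 x'_perp x'_iso sym[of y1 x'] by simp_all
  define g where "g k = (if k = 0 then x else if k = 1 then y else if k = 2 then x' else y')" for k :: nat
  define \<kappa> where "\<kappa> k = (if k = 0 then 1 else if k = 1 then 0 else if k = 2 then 3 else (2 :: nat))" for k :: nat
  define u where "u k i = (\<Sum>a<4. q i a * g k a)" for k i
  have gram: "b (g (\<kappa> k)) (g l) = (if k = l then 1 else 0)" if "k < 4" "l < 4" for k l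
    using less_4_cases[OF that(1)] less_4_cases[OF that(2)] x(2) y x'_perp x'_iso y'
      sym[of y x] sym[of x' x] sym[of x' y] sym[of y' x] sym[of y' y] sym[of y' x']
    by (elim disjE) (simp_all add: g_def \<kappa>_def)
  have "(\<Sum>i<4. g (\<kappa> k) i * u l i) = (if k = l then 1 else 0)" if "k < 4" "l < 4" for k l
  proof -
    have "(\<Sum>i<4. g (\<kappa> k) i * u l i) = b (g (\<kappa> k)) (g l)"
      by (simp add: u_def b_def sum_distrib_left algebra_simps)
    then show ?thesis using gram[OF that] by simp
  qed
  then have inv: "(\<Sum>k<4. u k i * g (\<kappa> k) j) = (if i = j then 1 else 0)" if "i < 4" "j < 4" for i j
    using left_inverse_right[of 4 "\<lambda>k i. g (\<kappa> k) i" "\<lambda>i l. u l i", OF _ that] by simp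
  show ?thesis
  proof (rule that[of u "\<lambda>i k. g (\<kappa> k) i"])
    fix i j :: nat assume ij: "i < 4" "j < 4"
    have "q i j = q j i"
      using q(1) ij by (simp add: symm_def)
    also have "\<dots> = (\<Sum>a<4. q j a * (\<Sum>k<4. u k i * g (\<kappa> k) a))"
      using ij by (simp add: inv if_distrib[of "\<lambda>c. _ * c"] cong: if_cong)
    also have "\<dots> = (\<Sum>a<4. \<Sum>k<4. u k i * (q j a * g (\<kappa> k) a))"
      by (simp add: sum_distrib_left algebra_simps)
    also have "\<dots> = (\<Sum>k<4. u k i * u (\<kappa> k) j)"
      by (subst sum.swap) (simp add: u_def sum_distrib_left)
    finally show "q i j = u 0 i * u 1 j + u 1 i * u 0 j + u 2 i * u 3 j + u 3 i * u 2 j"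
      by (simp add: sum_4 \<kappa>_def)
    show "(\<Sum>k<4. g (\<kappa> k) i * u k j) = (if i = j then 1 else 0)"
      using inv[OF ij(2,1)] by (simp add: mult.commute eq_commute)
  qed
qed

section \<open>Changing frames and counting relations\<close>

lemma frame_change:
  assumes H: "H \<in> Grass 4 W" and h: "frame_of 4 H h"
    and h': "\<And>k t. k < 4 \<Longrightarrow> h' k t = (\<Sum>l<4. c k l * h l t)"
    and h'': "\<And>k t. k < 4 \<Longrightarrow> h k t = (\<Sum>l<4. d k l * h' l t)"
  shows "frame_of 4 H h'"
proof (rule frame_of_spanning[OF H])
  have sub: "cfun.subspace H"
    using H by (simp add: Grass_def)
  show "h' l \<in> H" if "l < 4" for l
    using h'[OF that] by (rule subspace_combination[OF sub]) (use frame_of_mem[OF h] in auto)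
  have "h k \<in> cfun.span (h' ` {..<4})" if "k < 4" for k
    using h''[OF that] by (rule combination_mem_span) auto
  then have "cfun.span (h ` {..<4}) \<subseteq> cfun.span (h' ` {..<4})"
    by (intro cfun.span_minimal) auto
  then show "H \<subseteq> cfun.span (h' ` {..<4})"
    using frame_of_span[OF h] by simp
qed simp

text \<open>The symmetric matrices of size four form a space of dimension ten.\<close>

lemma symmetric_solution:
  fixes F :: "nat \<Rightarrow> nat \<Rightarrow> nat \<Rightarrow> complex"
  assumes "m < 10"
  obtains r where "symm 4 r" "\<exists>i<4. \<exists>j<4. r i j \<noteq> 0"
    "\<And>l. l < m \<Longrightarrow> (\<Sum>i<4. \<Sum>j<4. F l i j * r i j) = 0"
proof -
  define T where "T i j = [[0, 1, 2, 3], [1, 4, 5, 6], [2, 5, 7, 8], [3, 6, 8, 9 :: nat]] ! i ! j" for i j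
  have T: "T i j = T j i" "T i j < 10" if "i < 4" "j < 4" for i j
    using less_4_cases[OF that(1)] less_4_cases[OF that(2)]
    by (elim disjE; simp add: T_def numeral_nat)+
  have T_surj: "\<exists>i<4. \<exists>j<4. T i j = k" if "k < 10" for k
  proof -
    have "k = T 0 0 \<or> k = T 0 1 \<or> k = T 0 2 \<or> k = T 0 3 \<or> k = T 1 1 \<or> k = T 1 2 \<or> k = T 1 3
        \<or> k = T 2 2 \<or> k = T 2 3 \<or> k = T 3 3"
    proof -
      have "k = 0 \<or> k = 1 \<or> k = 2 \<or> k = 3 \<or> k = 4 \<or> k = 5 \<or> k = 6 \<or> k = 7 \<or> k = 8 \<or> k = 9"
        using that by presburger
      moreover have "T 0 0 = 0" "T 0 1 = 1" "T 0 2 = 2" "T 0 3 = 3" "T 1 1 = 4" "T 1 2 = 5"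
        "T 1 3 = 6" "T 2 2 = 7" "T 2 3 = 8" "T 3 3 = 9"
        unfolding T_def by (simp_all add: numeral_nat)
      ultimately show ?thesis by presburger
    qed
    moreover have "(0 :: nat) < 4" "(1 :: nat) < 4" "(2 :: nat) < 4" "(3 :: nat) < 4"
      by simp_all
    ultimately show ?thesis by metis
  qed
  define A where "A l k = (\<Sum>i<4. \<Sum>j<4. if T i j = k then F l i j else 0)" for l k
  obtain x where x: "\<exists>k<10. x k \<noteq> 0" "\<And>l. l < m \<Longrightarrow> (\<Sum>k<10. A l k * x k) = 0"
    using homogeneous_system[OF assms] by metis
  have sum: "(\<Sum>i<4. \<Sum>j<4. F l i j * x (T i j)) = (\<Sum>k<10. A l k * x k)" for l
  proof -
    have "(\<Sum>k<10. A l k * x k) = (\<Sum>k<10. \<Sum>i<4. \<Sum>j<4. if T i j = k then F l i j * x k else 0)"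
      unfolding A_def sum_distrib_right by (intro sum.cong refl) auto
    also have "\<dots> = (\<Sum>i<4. \<Sum>k<10. \<Sum>j<4. if T i j = k then F l i j * x k else 0)"
      by (rule sum.swap)
    also have "\<dots> = (\<Sum>i<4. \<Sum>j<4. \<Sum>k<10. if T i j = k then F l i j * x k else 0)"
      by (intro sum.cong refl sum.swap)
    also have "\<dots> = (\<Sum>i<4. \<Sum>j<4. F l i j * x (T i j))"
      using T(2) by (intro sum.cong refl) simp
    finally show ?thesis by simp
  qed
  show ?thesis
  proof (rule that)
    show "symm 4 (\<lambda>i j. x (T i j))"
      unfolding symm_def using T(1) by metis
    show "\<exists>i<4. \<exists>j<4. x (T i j) \<noteq> 0"
      using x(1) T_surj by metis
  qed (use x(2) sum in simp)
qed

lemma no_degenerate_relation: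
  assumes H: "H \<in> variety_V s" and g: "frame_of 4 H g"
    and r: "symm 4 r" "rel g r" "\<And>i. i < 4 \<Longrightarrow> r i 3 = 0"
  shows "i < 4 \<Longrightarrow> j < 4 \<Longrightarrow> r i j = 0"
proof -
  have "H \<in> Grass 4 (ext2 s)"
    using H by (simp add: variety_V_def)
  then interpret grass_frame H g "ext2 s"
    using g by unfold_locales
  obtain q where q: "symm 4 q" "nondeg 4 q"
    "\<forall>r. symm 4 r \<longrightarrow> (rel g r \<longleftrightarrow> (\<exists>c. \<forall>i<4. \<forall>j<4. r i j = c * q i j))"
    using assms(1) unfolding variety_V_iff[OF refl] by blast
  then obtain c where c: "\<forall>i<4. \<forall>j<4. r i j = c * q i j"
    using r(1,2) by blast
  have "c = 0"
  proof (rule ccontr)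
    assume "c \<noteq> 0"
    then have "q i 3 = 0" if "i < 4" for i
      using c r(3)[OF that] that by simp
    then have "\<forall>i<4. (\<Sum>j<4. q i j * (if j = 3 then 1 else 0)) = 0"
      by (simp add: sum_4)
    then have "\<forall>j<(4::nat). (if j = 3 then 1 else 0 :: complex) = 0"
      using q(2)[unfolded nondeg_def, THEN spec, of "\<lambda>j. if j = 3 then 1 else 0"] by blast
    then show False
      by (auto dest: spec[of _ 3])
  qed
  then show "i < 4 \<Longrightarrow> j < 4 \<Longrightarrow> r i j = 0"
    using c by simp
qed

text \<open>Since there is only one relation, ten products cannot satisfy it subject to nine conditions
  among which one kills a coefficient that occurs.\<close>

lemma products_span_too_little:
  assumes H: "H \<in> variety_V s" and g: "frame_of 4 H g"
    and m: "(m :: nat) < 9" and F: "\<And>r. symm 4 r \<Longrightarrow>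
      (\<And>l. l < m \<Longrightarrow> (\<Sum>i<4. \<Sum>j<4. F l i j * r i j) = 0) \<Longrightarrow> rel g r"
  shows False
proof -
  have "H \<in> Grass 4 (ext2 s)"
    using H by (simp add: variety_V_def)
  then interpret grass_frame H g "ext2 s"
    using g by unfold_locales
  obtain q where q: "symm 4 q" "nondeg 4 q"
    "\<forall>r. symm 4 r \<longrightarrow> (rel g r \<longleftrightarrow> (\<exists>c. \<forall>i<4. \<forall>j<4. r i j = c * q i j))"
    using assms(1) unfolding variety_V_iff[OF refl] by blast
  have "\<exists>a<4. \<exists>b<4. q a b \<noteq> 0"
  proof (rule ccontr)
    assume "\<not> ?thesis"
    then have "\<forall>i<4. (\<Sum>j<4. q i j * 1) = 0" by simp
    then have "\<forall>j<(4::nat). (1::complex) = 0"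
      by (rule q(2)[unfolded nondeg_def, THEN spec[of _ "\<lambda>_. 1"], THEN mp])
    then show False by (auto dest: spec[of _ 0])
  qed
  then obtain a b where ab: "a < 4" "b < 4" "q a b \<noteq> 0" by blast
  obtain r where r: "symm 4 r" "\<exists>i<4. \<exists>j<4. r i j \<noteq> 0"
    "\<And>l. l < Suc m \<Longrightarrow> (\<Sum>i<4. \<Sum>j<4. (if l = m then if i = a \<and> j = b then 1 else 0 else F l i j) * r i j) = 0"
    using symmetric_solution[of "Suc m" "\<lambda>l i j. if l = m then if i = a \<and> j = b then 1 else 0 else F l i j"] m
    by auto
  have "rel g r"
  proof (rule F[OF r(1)])
    show "(\<Sum>i<4. \<Sum>j<4. F l i j * r i j) = 0" if "l < m" for l
      using r(3)[of l] that by simp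
  qed
  then obtain c where c: "\<forall>i<4. \<forall>j<4. r i j = c * q i j"
    using q(3) r(1) by blast
  have "(\<Sum>i<4. \<Sum>j<4. (if i = a \<and> j = b then 1 else 0) * r i j)
      = (\<Sum>i<4. \<Sum>j<4. if j = b then (if i = a then r i j else 0) else 0)"
    by (intro sum.cong refl) simp
  also have "\<dots> = r a b"
    using ab by simp
  finally have "r a b = 0"
    using r(3)[of m] by simp
  then have "c = 0"
    using c ab by auto
  then show False
    using c r(2) by auto
qed

section \<open>Four-spaces all of whose elements are degenerate\<close>

definition mt :: "(nat \<Rightarrow> 'v \<Rightarrow> complex) \<Rightarrow> 'v bivector \<Rightarrow> nat \<Rightarrow> nat \<Rightarrow> complex" where
  "mt f \<omega> i j = \<omega> (f i, f j)"

lemma wedge_mt: "wedge \<omega> \<eta> (f a, f b, f c, f d) = w4 (mt f \<omega>) (mt f \<eta>) a b c d"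
  by (simp add: wedge_def w4_def mt_def)

lemma mt_sum:
  assumes "\<And>t. \<omega> t = (\<Sum>l\<in>A. x l * h l t)"
  shows "mt f \<omega> = (\<lambda>a b. \<Sum>l\<in>A. x l * mt f (h l) a b)"
  by (intro ext) (simp add: mt_def assms)

lemma binary_cubic_zero:
  fixes c :: "nat \<Rightarrow> nat \<Rightarrow> complex"
  assumes "\<And>s t. (c 0 0 + c 0 1 * t + c 0 2 * t\<^sup>2 + c 0 3 * t ^ 3)
      + (c 1 0 + c 1 1 * t + c 1 2 * t\<^sup>2 + c 1 3 * t ^ 3) * s
      + (c 2 0 + c 2 1 * t + c 2 2 * t\<^sup>2 + c 2 3 * t ^ 3) * s\<^sup>2
      + (c 3 0 + c 3 1 * t + c 3 2 * t\<^sup>2 + c 3 3 * t ^ 3) * s ^ 3 = 0"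
    and "i < 4" "j < 4"
  shows "c i j = 0"
proof -
  have row: "c i 0 + c i 1 * t + c i 2 * t\<^sup>2 + c i 3 * t ^ 3 = 0" if "i < 4" for i t
    using cubic_zero[OF assms(1)[of t], rule_format] less_4_cases[OF that] by blast
  show ?thesis
    using cubic_zero[OF row[OF assms(2)]] less_4_cases[OF assms(3)] by blast
qed

text \<open>
  On a hyperbolic frame \<open>h\<close> a cubic form is harmonic if \<open>N k 0 1 = N k 2 3\<close>; the isotropic vectors
  are the \<open>h\<^sub>0 + s h\<^sub>2 + t h\<^sub>3 + s t h\<^sub>1\<close>. A cubic form that vanishes at these is divisible by the quadric,
  and no nonzero multiple of the quadric by a linear form is harmonic.
\<close>

lemma harmonic_cubic_zero:
  fixes N :: "nat \<Rightarrow> nat \<Rightarrow> nat \<Rightarrow> complex"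
  assumes sym: "\<And>i j k. N i j k = N j i k" "\<And>i j k. N i j k = N i k j"
    and harmonic: "\<And>k. N k 0 1 = N k 2 3"
    and zero: "\<And>s t. (\<Sum>i<4. \<Sum>j<4. \<Sum>k<4.
      ([1, s * t, s, t] ! i) * ([1, s * t, s, t] ! j) * ([1, s * t, s, t] ! k) * N i j k) = 0"
    and "i < 4" "j < 4" "k < 4"
  shows "N i j k = 0"
proof -
  define c where "c a b = [[N 0 0 0, 3 * N 0 0 3, 3 * N 0 3 3, N 3 3 3],
    [3 * N 0 0 2, 3 * N 0 0 1 + 6 * N 0 2 3, 6 * N 0 1 3 + 3 * N 2 3 3, 3 * N 1 3 3],
    [3 * N 0 2 2, 6 * N 0 1 2 + 3 * N 2 2 3, 3 * N 0 1 1 + 6 * N 1 2 3, 3 * N 1 1 3],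
    [N 2 2 2, 3 * N 1 2 2, 3 * N 1 1 2, N 1 1 1]] ! a ! b" for a b :: nat
  have nth: "[1, s * t, s, t] ! 0 = 1" "[1, s * t, s, t] ! 1 = s * t" "[1, s * t, s, t] ! 2 = s"
    "[1, s * t, s, t] ! 3 = t" for s t :: complex
    by (simp_all add: numeral_nat)
  have p: "N 1 0 0 = N 0 0 1" "N 0 1 0 = N 0 0 1" "N 2 0 0 = N 0 0 2" "N 0 2 0 = N 0 0 2"
    "N 3 0 0 = N 0 0 3" "N 0 3 0 = N 0 0 3" "N 1 0 1 = N 0 1 1" "N 1 1 0 = N 0 1 1"
    "N 0 2 1 = N 0 1 2" "N 1 0 2 = N 0 1 2" "N 1 2 0 = N 0 1 2" "N 2 0 1 = N 0 1 2" "N 2 1 0 = N 0 1 2"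
    "N 0 3 1 = N 0 1 3" "N 1 0 3 = N 0 1 3" "N 1 3 0 = N 0 1 3" "N 3 0 1 = N 0 1 3" "N 3 1 0 = N 0 1 3"
    "N 2 0 2 = N 0 2 2" "N 2 2 0 = N 0 2 2"
    "N 0 3 2 = N 0 2 3" "N 2 0 3 = N 0 2 3" "N 2 3 0 = N 0 2 3" "N 3 0 2 = N 0 2 3" "N 3 2 0 = N 0 2 3"
    "N 3 0 3 = N 0 3 3" "N 3 3 0 = N 0 3 3" "N 2 1 1 = N 1 1 2" "N 1 2 1 = N 1 1 2"
    "N 3 1 1 = N 1 1 3" "N 1 3 1 = N 1 1 3" "N 2 1 2 = N 1 2 2" "N 2 2 1 = N 1 2 2"
    "N 1 3 2 = N 1 2 3" "N 2 1 3 = N 1 2 3" "N 2 3 1 = N 1 2 3" "N 3 1 2 = N 1 2 3" "N 3 2 1 = N 1 2 3"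
    "N 3 1 3 = N 1 3 3" "N 3 3 1 = N 1 3 3" "N 3 2 2 = N 2 2 3" "N 2 3 2 = N 2 2 3"
    "N 3 2 3 = N 2 3 3" "N 3 3 2 = N 2 3 3"
    by (metis sym)+
  have c: "c 0 0 = N 0 0 0" "c 0 1 = 3 * N 0 0 3" "c 0 2 = 3 * N 0 3 3" "c 0 3 = N 3 3 3"
    "c 1 0 = 3 * N 0 0 2" "c 1 1 = 3 * N 0 0 1 + 6 * N 0 2 3" "c 1 2 = 6 * N 0 1 3 + 3 * N 2 3 3"
    "c 1 3 = 3 * N 1 3 3" "c 2 0 = 3 * N 0 2 2" "c 2 1 = 6 * N 0 1 2 + 3 * N 2 2 3"
    "c 2 2 = 3 * N 0 1 1 + 6 * N 1 2 3" "c 2 3 = 3 * N 1 1 3" "c 3 0 = N 2 2 2" "c 3 1 = 3 * N 1 2 2"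
    "c 3 2 = 3 * N 1 1 2" "c 3 3 = N 1 1 1"
    unfolding c_def by (simp_all add: numeral_nat)
  have c0: "c a b = 0" if "a < 4" "b < 4" for a b
  proof (rule binary_cubic_zero[OF _ that])
    fix s t
    show "(c 0 0 + c 0 1 * t + c 0 2 * t\<^sup>2 + c 0 3 * t ^ 3)
      + (c 1 0 + c 1 1 * t + c 1 2 * t\<^sup>2 + c 1 3 * t ^ 3) * s
      + (c 2 0 + c 2 1 * t + c 2 2 * t\<^sup>2 + c 2 3 * t ^ 3) * s\<^sup>2
      + (c 3 0 + c 3 1 * t + c 3 2 * t\<^sup>2 + c 3 3 * t ^ 3) * s ^ 3 = 0"
      using zero[of s t] unfolding sum_4 nth p c
      by (simp add: power2_eq_square power3_eq_cube algebra_simps)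
  qed
  have z: "N 0 0 0 = 0" "N 0 0 3 = 0" "N 0 3 3 = 0" "N 3 3 3 = 0" "N 0 0 2 = 0"
    "3 * N 0 0 1 + 6 * N 0 2 3 = 0" "6 * N 0 1 3 + 3 * N 2 3 3 = 0" "N 1 3 3 = 0" "N 0 2 2 = 0"
    "6 * N 0 1 2 + 3 * N 2 2 3 = 0" "3 * N 0 1 1 + 6 * N 1 2 3 = 0" "N 1 1 3 = 0" "N 2 2 2 = 0"
    "N 1 2 2 = 0" "N 1 1 2 = 0" "N 1 1 1 = 0"
    using c0[of 0 0] c0[of 0 1] c0[of 0 2] c0[of 0 3] c0[of 1 0] c0[of 1 1] c0[of 1 2] c0[of 1 3]
      c0[of 2 0] c0[of 2 1] c0[of 2 2] c0[of 2 3] c0[of 3 0] c0[of 3 1] c0[of 3 2] c0[of 3 3]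
    unfolding c by simp_all
  have h: "N 0 0 1 = N 0 2 3" "N 0 1 1 = N 1 2 3" "N 0 1 2 = N 2 2 3" "N 0 1 3 = N 2 3 3"
    using harmonic[of 0] harmonic[of 1] harmonic[of 2] harmonic[of 3] unfolding p by simp_all
  have z': "N 0 0 1 = 0" "N 0 2 3 = 0" "N 0 1 1 = 0" "N 1 2 3 = 0" "N 0 1 2 = 0" "N 2 2 3 = 0"
    "N 0 1 3 = 0" "N 2 3 3 = 0"
    using z(6,7,10,11) unfolding h by simp_all
  show ?thesis
    using less_4_cases[OF assms(5)] less_4_cases[OF assms(6)] less_4_cases[OF assms(7)]
    by (elim disjE; hypsubst; simp only: p z(1-5,8,9,12-16) z')
qed

context six_space
begin

lemma co_mt: "co = mt e"
  by (intro ext) (simp add: co_def mt_def)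

lemma skew_mt: "\<omega> \<in> ext2 s \<Longrightarrow> skew (mt f \<omega>)"
  using ext2_swap by (intro skewI) (simp add: mt_def)

definition hyper :: "'v bivector set \<Rightarrow> (nat \<Rightarrow> 'v bivector) \<Rightarrow> bool" where
  "hyper H h \<longleftrightarrow> frame_of 4 H h \<and> (\<forall>t. wedge (h 0) (h 1) t = wedge (h 2) (h 3) t)"

lemma variety_Grass: "H \<in> variety_V s \<Longrightarrow> H \<in> Grass 4 (ext2 s)"
  by (simp add: variety_V_def)

lemma frame_ext2:
  assumes "H \<in> variety_V s" "frame_of 4 H g" "l < 4"
  shows "g l \<in> ext2 s"
  using variety_Grass[OF assms(1)] frame_of_mem[OF assms(2,3)] by (auto simp: Grass_def)

lemma hyper_exists:
  assumes "H \<in> variety_V s"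
  shows "\<exists>h. hyper H h"
proof -
  have G: "H \<in> Grass 4 (ext2 s)"
    using variety_Grass assms .
  then obtain g where g: "frame_of 4 H g"
    using Grass_frame_exists by (metis zero_less_numeral)
  interpret grass_frame H g "ext2 s"
    using G g by unfold_locales
  obtain q where q: "symm 4 q" "nondeg 4 q"
    "\<forall>r. symm 4 r \<longrightarrow> (rel g r \<longleftrightarrow> (\<exists>c. \<forall>i<4. \<forall>j<4. r i j = c * q i j))"
    using assms unfolding variety_V_iff[OF refl] by blast
  have "\<exists>c. \<forall>i<4. \<forall>j<4. q i j = c * q i j"
    by (rule exI[of _ 1]) simp
  then have "rel g q"
    using q(1,3) by blast
  obtain u z :: "nat \<Rightarrow> nat \<Rightarrow> complex" where uz:
    "\<And>i j. i < 4 \<Longrightarrow> j < 4 \<Longrightarrow> q i j = u 0 i * u 1 j + u 1 i * u 0 j + u 2 i * u 3 j + u 3 i * u 2 j"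
    "\<And>i j. i < 4 \<Longrightarrow> j < 4 \<Longrightarrow> (\<Sum>k<4. z i k * u k j) = (if i = j then 1 else 0)"
    by (rule hyperbolic_form[OF q(1,2)]) (rule that)
  define \<epsilon> :: "nat \<Rightarrow> complex" where "\<epsilon> k = (if k = 3 then - 1 else 1)" for k
  define h' where "h' k t = (\<Sum>i<4. (\<epsilon> k * u k i) * g i t)" for k t
  have \<epsilon>: "\<epsilon> k * \<epsilon> k = 1" for k
    by (simp add: \<epsilon>_def)
  have "frame_of 4 H h'"
  proof (rule frame_change[OF G g])
    show "h' k t = (\<Sum>l<4. (\<epsilon> k * u k l) * g l t)" for k t
      by (simp add: h'_def)
    show "g k t = (\<Sum>l<4. (z k l * \<epsilon> l) * h' l t)" if "k < 4" for k t
    proof -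
      have "(\<Sum>l<4. (z k l * \<epsilon> l) * h' l t) = (\<Sum>l<4. \<Sum>i<4. (\<epsilon> l * \<epsilon> l) * (z k l * u l i * g i t))"
        by (simp add: h'_def sum_distrib_left algebra_simps)
      also have "\<dots> = (\<Sum>i<4. \<Sum>l<4. z k l * u l i * g i t)"
        unfolding \<epsilon> by (subst sum.swap) simp
      also have "\<dots> = (\<Sum>i<4. (\<Sum>l<4. z k l * u l i) * g i t)"
        by (simp add: sum_distrib_right)
      also have "\<dots> = (\<Sum>i<4. if k = i then g i t else 0)"
        using uz(2)[OF that] by (intro sum.cong) auto
      finally show ?thesis
        using that by simp
    qed
  qed
  moreover have "wedge (h' 0) (h' 1) t = wedge (h' 2) (h' 3) t" for t
  proof -
    define W where "W i j = wedge (g i) (g j) t" for i j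
    have W: "wedge (h' k) (h' l) t = (\<Sum>i<4. \<Sum>j<4. (\<epsilon> k * u k i) * (\<epsilon> l * u l j) * W i j)" for k l
      unfolding W_def by (rule wedge_sum_sum) (simp_all add: h'_def)
    have Wc: "W i j = W j i" for i j
      unfolding W_def by (rule wedge_commute)
    have "0 = (\<Sum>i<4. \<Sum>j<4. q i j * W i j)"
      using \<open>rel g q\<close> unfolding rel_def W_def by (metis (no_types))
    also have "\<dots> = (\<Sum>i<4. \<Sum>j<4. (u 0 i * u 1 j + u 1 i * u 0 j + u 2 i * u 3 j + u 3 i * u 2 j) * W i j)"
      by (intro sum.cong refl) (simp add: uz(1))
    also have "\<dots> = wedge (h' 0) (h' 1) t + wedge (h' 1) (h' 0) t - wedge (h' 2) (h' 3) t - wedge (h' 3) (h' 2) t"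
      unfolding W by (simp add: \<epsilon>_def algebra_simps sum.distrib sum_negf)
    also have "\<dots> = 2 * (wedge (h' 0) (h' 1) t - wedge (h' 2) (h' 3) t)"
      unfolding wedge_commute[of "h' 1" "h' 0"] wedge_commute[of "h' 3" "h' 2"] by simp
    finally show ?thesis
      by simp
  qed
  ultimately show ?thesis
    unfolding hyper_def by blast
qed

lemma hyper_move:
  assumes H: "H \<in> Grass 4 (ext2 s)" and h: "hyper H h"
  obtains h' where "hyper H h'" "\<And>u. h' 0 u = (\<Sum>i<4. ([1, a * b, a, b] ! i) * h i u)"
proof -
  define c where "c k l = [[1, a * b, a, b], [0, 1, 0, 0], [0, b, 1, 0], [0, a, 0, 1]] ! k ! l" for k l :: nat
  define d where "d k l = [[1, a * b, - a, - b], [0, 1, 0, 0], [0, - b, 1, 0], [0, - a, 0, 1]] ! k ! l" for k l :: nat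
  define h' where "h' k u = (\<Sum>l<4. c k l * h l u)" for k u
  have h'_eq: "h' 0 u = h 0 u + a * b * h 1 u + a * h 2 u + b * h 3 u" "h' 1 u = h 1 u"
    "h' 2 u = b * h 1 u + h 2 u" "h' 3 u = a * h 1 u + h 3 u" for u
    by (simp_all add: h'_def sum_4 c_def numeral_nat)
  have fr: "frame_of 4 H h"
    using h by (simp add: hyper_def)
  have "frame_of 4 H h'"
  proof (rule frame_change[OF H fr])
    show "h' k u = (\<Sum>l<4. c k l * h l u)" for k u
      by (simp add: h'_def)
    show "h k u = (\<Sum>l<4. d k l * h' l u)" if "k < 4" for k u
      using less_4_cases[OF that] unfolding sum_4 h'_eq
      by (elim disjE) (simp_all add: d_def numeral_nat algebra_simps)
  qed
  moreover have "wedge (h' 0) (h' 1) t = wedge (h' 2) (h' 3) t" for t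
  proof -
    obtain x y z w where t: "t = (x, y, z, w)" by (cases t)
    have "wedge (h 0) (h 1) t = wedge (h 2) (h 3) t"
      using h unfolding hyper_def by blast
    then show ?thesis
      unfolding t wedge_def prod.case h'_eq by (simp add: algebra_simps)
  qed
  ultimately have "hyper H h'"
    unfolding hyper_def by blast
  moreover have "h' 0 u = (\<Sum>i<4. ([1, a * b, a, b] ! i) * h i u)" for u
    by (simp add: h'_def c_def)
  ultimately show ?thesis
    using that by blast
qed

lemma all_Pf_zero:
  assumes H: "H \<in> variety_V s" and bad: "\<And>h. hyper H h \<Longrightarrow> Pf (co (h 0)) = 0" and "\<omega> \<in> H"
  shows "Pf (co \<omega>) = 0"
proof -
  have G: "H \<in> Grass 4 (ext2 s)"
    using variety_Grass H .
  obtain h where h: "hyper H h"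
    using hyper_exists H by blast
  define N where "N i j k = t3 (co (h i)) (w4 (co (h j)) (co (h k)))" for i j k
  have N: "N i j k = 0" if "i < 4" "j < 4" "k < 4" for i j k
  proof (rule harmonic_cubic_zero[OF _ _ _ _ that])
    show "N i j k = N j i k" for i j k
      unfolding N_def by (rule t3_commute)
    show "N i j k = N i k j" for i j k
      unfolding N_def by (subst w4_commute) (rule refl)
    have "w4 (co (h 0)) (co (h 1)) = w4 (co (h 2)) (co (h 3))"
      using h unfolding hyper_def co_mt by (intro ext) (simp flip: wedge_mt)
    then show "N k 0 1 = N k 2 3" for k
      by (simp add: N_def)
    fix a b
    obtain h' where h': "hyper H h'" "\<And>u. h' 0 u = (\<Sum>i<4. ([1, a * b, a, b] ! i) * h i u)"
      using hyper_move[OF G h, of a b] by blast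
    have "6 * Pf (co (h' 0)) = (\<Sum>i<4. \<Sum>j<4. \<Sum>k<4.
        ([1, a * b, a, b] ! i) * ([1, a * b, a, b] ! j) * ([1, a * b, a, b] ! k) * N i j k)"
      unfolding co_mt mt_sum[OF h'(2)] t3_cubic N_def ..
    then show "(\<Sum>i<4. \<Sum>j<4. \<Sum>k<4.
        ([1, a * b, a, b] ! i) * ([1, a * b, a, b] ! j) * ([1, a * b, a, b] ! k) * N i j k) = 0"
      using bad[OF h'(1)] by simp
  qed
  have fr: "frame_of 4 H h"
    using h by (simp add: hyper_def)
  obtain x where x: "\<And>t. \<omega> t = (\<Sum>l<4. x l * h l t)"
    by (rule frame_combination_fun[OF fr \<open>\<omega> \<in> H\<close>]) (rule that)
  have "6 * Pf (co \<omega>) = (\<Sum>i<4. \<Sum>j<4. \<Sum>k<4. x i * x j * x k * N i j k)"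
    unfolding co_mt mt_sum[OF x] t3_cubic N_def ..
  also have "\<dots> = 0"
    by (intro sum.neutral ballI) (simp add: N)
  finally show ?thesis by simp
qed

text \<open>A bivector is degenerate if some nonzero functional contracts it to zero.\<close>

definition kills :: "('v \<Rightarrow> complex) \<Rightarrow> 'v bivector \<Rightarrow> bool" where
  "kills k \<omega> \<longleftrightarrow> (\<forall>g. \<omega> (k, g) = 0)"

lemma kills_combination:
  assumes "\<omega> \<in> ext2 s" "\<And>j. j < 6 \<Longrightarrow> (\<Sum>i<6. a i * co \<omega> i j) = 0"
  shows "kills (\<lambda>x. \<Sum>i<6. a i * e i x) \<omega>"
proof -
  define k where "k x = (\<Sum>i<6. a i * e i x)" for x
  have lin: "\<omega> (k, g) = (\<Sum>i<6. a i * \<omega> (e i, g))" for g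
    using e_dual by (intro ext2_linear[OF assms(1)]) (auto simp: k_def)
  have "\<omega> (k, g) = 0" for g
  proof (cases "g \<in> D")
    case True
    have "\<omega> (g, k) = (\<Sum>j<6. g (v j) * \<omega> (e j, k))"
      by (rule ext2_linear[OF assms(1) _ e_expand[OF True]]) (simp add: e_dual)
    also have "\<dots> = 0"
    proof (intro sum.neutral ballI)
      fix j :: nat assume "j \<in> {..<6}"
      then have "\<omega> (k, e j) = 0"
        using assms(2) unfolding lin co_def by simp
      then show "g (v j) * \<omega> (e j, k) = 0"
        using ext2_swap[OF assms(1), of "e j" k] by simp
    qed
    finally show ?thesis
      using ext2_swap[OF assms(1), of g k] by simp
  qed (simp add: ext2_outside[OF assms(1)])
  then show ?thesis
    unfolding kills_def k_def[abs_def, symmetric] by blast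
qed

lemma e_independent:
  assumes "\<And>x. (\<Sum>i<6. a i * e i x) = 0" "i < 6"
  shows "a i = 0"
proof -
  have "(\<Sum>j<6. a j * e j (v i)) = (\<Sum>j<6. if j = i then a j else 0)"
    using assms(2) by (intro sum.cong) (auto simp: e_v)
  then show ?thesis
    using assms by simp
qed

lemma Pf_zero_degenerate:
  assumes \<omega>: "\<omega> \<in> ext2 s" and Pf: "Pf (co \<omega>) = 0"
  shows "\<exists>k\<in>D. k \<noteq> (\<lambda>x. 0) \<and> kills k \<omega>"
proof -
  define m where "m = co \<omega>"
  have m: "skew m"
    using skew_co[OF \<omega>] by (simp add: m_def)
  have "\<exists>a. (\<exists>i<6. a i \<noteq> 0) \<and> kills (\<lambda>x. \<Sum>i<6. a i * e i x) \<omega>"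
  proof (cases "\<exists>p<6. \<exists>i<6. star (w4 m m) p i \<noteq> 0")
    case True
    then obtain p i where p: "p < 6" "i < 6" "star (w4 m m) p i \<noteq> 0" by blast
    have "kills (\<lambda>x. \<Sum>i<6. star (w4 m m) p i * e i x) \<omega>"
      using star_square[OF m p(1)] Pf by (intro kills_combination[OF \<omega>]) (simp add: m_def)
    with p show ?thesis by blast
  next
    case False
    then have st: "star (w4 m m) p i = 0" if "p < 6" "i < 6" for p i
      using that by blast
    have "w4 m m a b c d = 0" if "a < b" "b < c" "c < d" "d < 6" for a b c d
      using sorted_quads_6[OF that] st[of 4 5] st[of 3 5] st[of 3 4] st[of 2 5] st[of 2 4] st[of 2 3]
        st[of 1 5] st[of 1 4] st[of 1 3] st[of 1 2] st[of 0 5] st[of 0 4] st[of 0 3] st[of 0 2] st[of 0 1]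
      unfolding star_table by (elim disjE conjE) simp_all
    then have "(\<Sum>i\<in>{0::nat}. 1 * wedge \<omega> \<omega> t) = 0" for t
      using \<omega> wedge_sum_zero[of "{0::nat}" "\<lambda>_. \<omega>" "\<lambda>_. \<omega>" "\<lambda>_. 1" t]
      by (simp add: m_def co_mt wedge_mt)
    then have sq: "wedge \<omega> \<omega> t = 0" for t by simp
    show ?thesis
    proof (cases "\<exists>a<6. \<exists>b<6. m a b \<noteq> 0")
      case True
      then obtain a b where ab: "a < 6" "b < 6" "m a b \<noteq> 0" by blast
      then have "a \<noteq> b"
        using ext2_same[OF \<omega>] by (auto simp: m_def co_def)
      obtain k where k: "k < 6" "k \<noteq> a" "k \<noteq> b"
      proof -
        define k where "k = (if a \<noteq> 0 \<and> b \<noteq> 0 then 0 else if a \<noteq> 1 \<and> b \<noteq> 1 then 1 else (2 :: nat))"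
        have "k < 6" "k \<noteq> a" "k \<noteq> b"
          by (auto simp: k_def)
        then show ?thesis by (rule that)
      qed
      define l where "l i = (if i = k then m a b else if i = b then - m a k else if i = a then m b k else 0)" for i
      have "(\<Sum>i<6. l i * co \<omega> i j) = 0" if "j < 6" for j
      proof -
        have "(\<Sum>i<6. l i * m i j) = (\<Sum>i\<in>{k, b, a}. l i * m i j)"
          using ab k by (intro sum.mono_neutral_right) (auto simp: l_def)
        also have "\<dots> = m a b * m k j - m a k * m b j + m b k * m a j"
          using ab k \<open>a \<noteq> b\<close> by (simp add: l_def)
        also have "\<dots> = wedge \<omega> \<omega> (e a, e b, e k, e j) / 2"
          by (simp add: wedge_def m_def co_def)
        finally show ?thesis
          by (simp add: sq m_def)
      qed
      then have "kills (\<lambda>x. \<Sum>i<6. l i * e i x) \<omega>"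
        by (rule kills_combination[OF \<omega>])
      moreover have "l k \<noteq> 0"
        using ab by (simp add: l_def)
      ultimately show ?thesis
        using k(1) by blast
    next
      case False
      then have "kills (\<lambda>x. \<Sum>i<6. (\<lambda>_. 1) i * e i x) \<omega>"
        by (intro kills_combination[OF \<omega>]) (simp add: m_def)
      then show ?thesis
        by (intro exI[of _ "\<lambda>_. 1"] conjI) (auto intro: exI[of _ 0])
    qed
  qed
  then obtain a i where a: "i < 6" "a i \<noteq> 0" "kills (\<lambda>x. \<Sum>i<6. a i * e i x) \<omega>" by blast
  moreover have "(\<lambda>x. \<Sum>i<6. a i * e i x) \<noteq> (\<lambda>x. 0)"
    using e_independent[of a i] a(1,2) by metis
  moreover have "(\<lambda>x. \<Sum>i<6. a i * e i x) \<in> D"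
    using e_dual by (intro D_combination) auto
  ultimately show ?thesis by blast
qed

lemma degenerate_Pf_zero:
  assumes \<omega>: "\<omega> \<in> ext2 s" and k: "k \<in> D" "k \<noteq> (\<lambda>x. 0)" "kills k \<omega>" and f: "\<And>i. i < 6 \<Longrightarrow> f i \<in> D"
  shows "Pf (mt f \<omega>) = 0"
proof -
  \<comment> \<open>the six functionals and \<open>k\<close> are linearly dependent\<close>
  obtain c where c: "\<exists>j<7. c j \<noteq> 0"
    "\<And>i. i < 6 \<Longrightarrow> (\<Sum>j<7. (if j = 6 then k (v i) else f j (v i)) * c j) = 0"
    using homogeneous_system[of 6 7 "\<lambda>i j. if j = 6 then k (v i) else f j (v i)"] by auto
  have sum7: "(\<Sum>j<7. F j) = (\<Sum>j<6. F j) + F (6 :: nat)" for F :: "nat \<Rightarrow> complex"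
    by (simp add: eval_nat_numeral)
  have at_v: "(\<Sum>j<6. c j * f j (v i)) = - c 6 * k (v i)" if "i < 6" for i
  proof -
    have "(\<Sum>j<6. (if j = 6 then k (v i) else f j (v i)) * c j) = (\<Sum>j<6. c j * f j (v i))"
      by (intro sum.cong) auto
    then show ?thesis
      using c(2)[OF that] unfolding sum7 by (simp add: add_eq_0_iff mult.commute)
  qed
  define g where "g x = (\<Sum>j<6. c j * f j x)" for x
  have "g \<in> D"
    unfolding g_def using f by (intro D_combination) auto
  then have g: "g x = - c 6 * k x" for x
    unfolding e_expand[OF \<open>g \<in> D\<close>, of x] e_expand[OF k(1), of x] sum_distrib_left
    using at_v by (intro sum.cong) (auto simp: g_def)
  have "\<exists>j<6. c j \<noteq> 0"
  proof (rule ccontr)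
    assume "\<not> ?thesis"
    then have 0: "\<And>j. j < 6 \<Longrightarrow> c j = 0" by blast
    then have "g x = 0" for x by (simp add: g_def)
    moreover have "c 6 \<noteq> 0"
    proof
      assume "c 6 = 0"
      obtain j where "j < 7" "c j \<noteq> 0" using c(1) by blast
      then show False using 0[of j] \<open>c 6 = 0\<close> by (cases "j = 6") auto
    qed
    ultimately have "k x = 0" for x
      using g[of x] by simp
    then show False using k(2) by auto
  qed
  then obtain p where p: "p < 6" "c p \<noteq> 0" by blast
  have kern: "(\<Sum>i<6. c i * mt f \<omega> i j) = 0" for j
  proof -
    have "\<omega> (g, f j) = (\<Sum>i<6. c i * \<omega> (f i, f j))"
      using f by (intro ext2_linear[OF \<omega>]) (auto simp: g_def)
    moreover have "\<omega> (g, f j) = (\<Sum>i\<in>{0::nat}. (- c 6) * \<omega> (k, f j))"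
      using k(1) g by (intro ext2_linear[OF \<omega>, where w = "\<lambda>_. k"]) auto
    ultimately show ?thesis
      using k(3) by (simp add: kills_def mt_def)
  qed
  define m where "m = mt f \<omega>"
  have m: "skew m"
    using skew_mt[OF \<omega>] by (simp add: m_def)
  have "- 2 * Pf m * c p = (\<Sum>j<6. (if p = j then - 2 * Pf m else 0) * c j)"
    using p(1) by (simp add: if_distrib[of "\<lambda>x. x * _"] cong: if_cong)
  also have "\<dots> = (\<Sum>j<6. (\<Sum>i<6. star (w4 m m) p i * m i j) * c j)"
    using star_square[OF m p(1)] by (intro sum.cong) auto
  also have "\<dots> = (\<Sum>i<6. star (w4 m m) p i * (\<Sum>j<6. m i j * c j))"
    unfolding sum_distrib_right sum_distrib_left by (subst sum.swap) (simp add: mult.assoc)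
  also have "\<dots> = 0"
  proof (intro sum.neutral ballI)
    fix i :: nat assume "i \<in> {..<6}"
    have "(\<Sum>j<6. m i j * c j) = - (\<Sum>j<6. c j * m j i)"
      unfolding sum_negf[symmetric]
    proof (rule sum.cong[OF refl])
      fix j :: nat assume "j \<in> {..<6}"
      then show "m i j * c j = - (c j * m j i)"
        using skewD[OF m, of i j] \<open>i \<in> {..<6}\<close> by simp
    qed
    then show "star (w4 m m) p i * (\<Sum>j<6. m i j * c j) = 0"
      using kern by (simp add: m_def)
  qed
  finally show ?thesis
    using p(2) by (simp add: m_def)
qed

lemma trilinear_zero:
  assumes H: "H \<in> variety_V s" and zero: "\<And>\<omega>. \<omega> \<in> H \<Longrightarrow> Pf (co \<omega>) = 0"
    and \<omega>: "\<omega> \<in> H" "\<eta> \<in> H" "\<zeta> \<in> H" and f: "\<And>i. i < 6 \<Longrightarrow> f i \<in> D"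
  shows "t3 (mt f \<omega>) (w4 (mt f \<eta>) (mt f \<zeta>)) = 0"
proof -
  have sub: "cfun.subspace H" "H \<subseteq> ext2 s"
    using variety_Grass[OF H] by (auto simp: Grass_def)
  define h where "h i = (if i = 0 then \<omega> else if i = 1 then \<eta> else \<zeta>)" for i :: nat
  have h: "h i \<in> H" for i
    using \<omega> by (simp add: h_def)
  define N where "N i j k = t3 (mt f (h i)) (w4 (mt f (h j)) (mt f (h k)))" for i j k
  have P: "(\<Sum>i<3. \<Sum>j<3. \<Sum>k<3. x i * x j * x k * N i j k) = 0" for x
  proof -
    define \<tau> where "\<tau> t = (\<Sum>i<3. x i * h i t)" for t
    have "\<tau> \<in> H"
      by (rule subspace_combination[OF sub(1) \<tau>_def]) (rule h)
    then obtain k where "k \<in> D" "k \<noteq> (\<lambda>x. 0)" "kills k \<tau>"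
      using Pf_zero_degenerate zero sub(2) by blast
    then have "Pf (mt f \<tau>) = 0"
      using degenerate_Pf_zero f \<open>\<tau> \<in> H\<close> sub(2) by blast
    moreover have "mt f \<tau> = (\<lambda>a b. \<Sum>i<3. x i * mt f (h i) a b)"
      by (rule mt_sum) (simp add: \<tau>_def)
    ultimately have "6 * Pf (\<lambda>a b. \<Sum>i<3. x i * mt f (h i) a b) = 0"
      by simp
    then show ?thesis
      unfolding t3_cubic N_def .
  qed
  have sum3: "(\<Sum>i<3. F i) = F 0 + F 1 + F (2 :: nat)" for F :: "nat \<Rightarrow> complex"
    by (simp add: eval_nat_numeral)
  have s1: "N i j k = N j i k" and s2: "N i j k = N i k j" for i j k
    unfolding N_def by (rule t3_commute) (subst w4_commute, rule refl)
  have p: "N 0 2 1 = N 0 1 2" "N 1 0 2 = N 0 1 2" "N 1 2 0 = N 0 1 2" "N 2 0 1 = N 0 1 2" "N 2 1 0 = N 0 1 2"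
    "N 0 1 0 = N 0 0 1" "N 1 0 0 = N 0 0 1" "N 0 2 0 = N 0 0 2" "N 2 0 0 = N 0 0 2"
    "N 1 0 1 = N 0 1 1" "N 1 1 0 = N 0 1 1" "N 2 0 2 = N 0 2 2" "N 2 2 0 = N 0 2 2"
    "N 1 2 1 = N 1 1 2" "N 2 1 1 = N 1 1 2" "N 2 1 2 = N 1 2 2" "N 2 2 1 = N 1 2 2"
    by (metis s1 s2)+
  note E = P[of "\<lambda>i. 1"] P[of "\<lambda>i. if i = 2 then 0 else 1"] P[of "\<lambda>i. if i = 1 then 0 else 1"]
    P[of "\<lambda>i. if i = 0 then 0 else 1"] P[of "\<lambda>i. if i = 0 then 1 else 0"] P[of "\<lambda>i. if i = 1 then 1 else 0"]
    P[of "\<lambda>i. if i = 2 then 1 else 0"]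
  obtain n012 n001 n002 n011 n022 n112 n122 where V: "N 0 1 2 = n012" "N 0 0 1 = n001" "N 0 0 2 = n002"
    "N 0 1 1 = n011" "N 0 2 2 = n022" "N 1 1 2 = n112" "N 1 2 2 = n122"
    by simp
  have "6 * n012 = 0"
    using E unfolding sum3 p V by (simp, Groebner_Basis.algebra)
  then have "N 0 1 2 = 0"
    unfolding V by simp
  then show ?thesis
    by (simp add: N_def h_def)
qed

lemma change_basis:
  assumes f: "\<And>i. i < 6 \<Longrightarrow> f i \<in> D"
    and ind: "\<And>c. (\<And>x. (\<Sum>i<6. c i * f i x) = 0) \<Longrightarrow> \<forall>i<6. c i = 0"
  shows "\<exists>v'. six_space s v' f"
proof -
  have "\<forall>i<6. c i = 0" if c: "\<And>j. j < 6 \<Longrightarrow> (\<Sum>i<6. c i * f i (v j)) = 0" for c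
  proof (rule ind)
    fix x
    have "(\<lambda>x. \<Sum>i<6. c i * f i x) \<in> D"
      using f by (intro D_combination) auto
    then show "(\<Sum>i<6. c i * f i x) = 0"
      using e_expand[of "\<lambda>x. \<Sum>i<6. c i * f i x" x] c by simp
  qed
  then have "det (mat 6 6 (\<lambda>(i, j). f i (v j))) \<noteq> 0"
    by (rule det_nonzero_of_trivial_kernel)
  then obtain B where B: "\<And>i j. i < 6 \<Longrightarrow> j < 6 \<Longrightarrow> (\<Sum>k<6. f i (v k) * B k j) = (if i = j then 1 else 0)"
    "\<And>i j. i < 6 \<Longrightarrow> j < 6 \<Longrightarrow> (\<Sum>k<6. B i k * f k (v j)) = (if i = j then 1 else 0)"
    using inverse_exists[of 6 "\<lambda>i j. f i (v j)"] by blast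
  define v' where "v' j = (\<Sum>k<6. s (B k j) (v k))" for j
  have at_v': "g (v' j) = (\<Sum>k<6. B k j * g (v k))" if g: "g \<in> D" for g j
  proof -
    have add: "g (x + y) = g x + g y" and scale: "g (s c x) = c * g x" for x y c
      using g by (auto simp: dual_on_def)
    have "g 0 = 0" using add[of 0 0] by simp
    then have "g (\<Sum>k\<in>A. s (B k j) (v k)) = (\<Sum>k\<in>A. B k j * g (v k))" for A :: "nat set"
      by (induction A rule: infinite_finite_induct) (auto simp: add scale)
    then show ?thesis by (simp add: v'_def)
  qed
  have "six_space s v' f"
  proof
    show "f i (v' j) = (if i = j then 1 else 0)" if "i < 6" "j < 6" for i j
      using B(1)[OF that] at_v'[OF f[OF that(1)], of j] by (simp add: mult.commute)
    show "g x = (\<Sum>i<6. g (v' i) * f i x)" if g: "g \<in> D" for g x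
    proof -
      define g' where "g' x = (\<Sum>i<6. g (v' i) * f i x)" for x
      have "g' \<in> D"
        unfolding g'_def using f by (intro D_combination) auto
      have "g' (v j) = g (v j)" if "j < 6" for j
      proof -
        have "g' (v j) = (\<Sum>i<6. \<Sum>k<6. g (v k) * (B k i * f i (v j)))"
          unfolding g'_def at_v'[OF g] by (simp add: sum_distrib_right sum_distrib_left algebra_simps)
        also have "\<dots> = (\<Sum>k<6. g (v k) * (\<Sum>i<6. B k i * f i (v j)))"
          by (subst sum.swap) (simp add: sum_distrib_left)
        also have "\<dots> = (\<Sum>k<6. if k = j then g (v k) else 0)"
          using B(2) that by (intro sum.cong) auto
        finally show ?thesis using that by simp
      qed
      then have "g' x = g x"
        using e_expand[OF \<open>g' \<in> D\<close>, of x] e_expand[OF g, of x] by simp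
      then show ?thesis by (simp add: g'_def)
    qed
  qed (rule f)
  then show ?thesis by blast
qed

end

lemma skew_entries_5:
  assumes "skew m" "\<And>i. i < 6 \<Longrightarrow> m i 5 = 0"
  obtains a01 a02 a03 a04 a12 a13 a14 a23 a24 a34
  where "m 0 1 = a01" "m 0 2 = a02" "m 0 3 = a03" "m 0 4 = a04" "m 1 2 = a12" "m 1 3 = a13" "m 1 4 = a14" "m 2 3 = a23" "m 2 4 = a24" "m 3 4 = a34"
    "m 1 0 = - a01" "m 2 0 = - a02" "m 3 0 = - a03" "m 4 0 = - a04" "m 2 1 = - a12" "m 3 1 = - a13" "m 4 1 = - a14" "m 3 2 = - a23" "m 4 2 = - a24" "m 4 3 = - a34"
    "m 0 0 = 0" "m 1 1 = 0" "m 2 2 = 0" "m 3 3 = 0" "m 4 4 = 0" "m 5 5 = 0"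
    "m 0 5 = 0" "m 5 0 = 0" "m 1 5 = 0" "m 5 1 = 0" "m 2 5 = 0" "m 5 2 = 0" "m 3 5 = 0" "m 5 3 = 0" "m 4 5 = 0" "m 5 4 = 0"
proof -
  have "m i 5 = 0" "m 5 i = 0" if "i < 6" for i
    using assms(2)[OF that] skewD[OF assms(1), of 5 i] that by simp_all
  then show thesis
    using that[of "m 0 1" "m 0 2" "m 0 3" "m 0 4" "m 1 2" "m 1 3" "m 1 4" "m 2 3" "m 2 4" "m 3 4"]
      skew_table[OF assms(1)] by simp
qed

text \<open>The vector of Pfaffian minors of a skew matrix of size five, which spans its kernel.\<close>

definition minors :: "(nat \<Rightarrow> nat \<Rightarrow> nat \<Rightarrow> nat \<Rightarrow> complex) \<Rightarrow> nat \<Rightarrow> complex" where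
  "minors k j = [k 1 2 3 4, - k 0 2 3 4, k 0 1 3 4, - k 0 1 2 4, k 0 1 2 3, 0] ! j"

lemma minors_table: "minors k 0 = k 1 2 3 4" "minors k 1 = - k 0 2 3 4" "minors k 2 = k 0 1 3 4"
  "minors k 3 = - k 0 1 2 4" "minors k 4 = k 0 1 2 3" "minors k 5 = 0"
  by (simp_all add: minors_def numeral_nat)

lemma minors_kernel:
  assumes m: "skew m" "\<And>i. i < 6 \<Longrightarrow> m i 5 = 0" and n: "skew n" "\<And>i. i < 6 \<Longrightarrow> n i 5 = 0" and "j < 6"
  shows "(\<Sum>i<6. minors (w4 m m) i * m i j) = 0"
    and "2 * (\<Sum>i<6. minors (w4 m n) i * m i j) + (\<Sum>i<6. minors (w4 m m) i * n i j) = 0"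
proof -
  obtain a01 a02 a03 a04 a12 a13 a14 a23 a24 a34
    where m: "m 0 1 = a01" "m 0 2 = a02" "m 0 3 = a03" "m 0 4 = a04" "m 1 2 = a12" "m 1 3 = a13" "m 1 4 = a14" "m 2 3 = a23" "m 2 4 = a24" "m 3 4 = a34"
    "m 1 0 = - a01" "m 2 0 = - a02" "m 3 0 = - a03" "m 4 0 = - a04" "m 2 1 = - a12" "m 3 1 = - a13" "m 4 1 = - a14" "m 3 2 = - a23" "m 4 2 = - a24" "m 4 3 = - a34"
    "m 0 0 = 0" "m 1 1 = 0" "m 2 2 = 0" "m 3 3 = 0" "m 4 4 = 0" "m 5 5 = 0"
    "m 0 5 = 0" "m 5 0 = 0" "m 1 5 = 0" "m 5 1 = 0" "m 2 5 = 0" "m 5 2 = 0" "m 3 5 = 0" "m 5 3 = 0" "m 4 5 = 0" "m 5 4 = 0"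
    using skew_entries_5[OF m] .
  obtain b01 b02 b03 b04 b12 b13 b14 b23 b24 b34
    where n: "n 0 1 = b01" "n 0 2 = b02" "n 0 3 = b03" "n 0 4 = b04" "n 1 2 = b12" "n 1 3 = b13" "n 1 4 = b14" "n 2 3 = b23" "n 2 4 = b24" "n 3 4 = b34"
    "n 1 0 = - b01" "n 2 0 = - b02" "n 3 0 = - b03" "n 4 0 = - b04" "n 2 1 = - b12" "n 3 1 = - b13" "n 4 1 = - b14" "n 3 2 = - b23" "n 4 2 = - b24" "n 4 3 = - b34"
    "n 0 0 = 0" "n 1 1 = 0" "n 2 2 = 0" "n 3 3 = 0" "n 4 4 = 0" "n 5 5 = 0"
    "n 0 5 = 0" "n 5 0 = 0" "n 1 5 = 0" "n 5 1 = 0" "n 2 5 = 0" "n 5 2 = 0" "n 3 5 = 0" "n 5 3 = 0" "n 4 5 = 0" "n 5 4 = 0"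
    using skew_entries_5[OF n] .
  note * = sum_6 minors_table w4_def m n
  have "(\<Sum>i<6. minors (w4 m m) i * m i 0) = 0" "(\<Sum>i<6. minors (w4 m m) i * m i 1) = 0"
    "(\<Sum>i<6. minors (w4 m m) i * m i 2) = 0" "(\<Sum>i<6. minors (w4 m m) i * m i 3) = 0"
    "(\<Sum>i<6. minors (w4 m m) i * m i 4) = 0" "(\<Sum>i<6. minors (w4 m m) i * m i 5) = 0"
    unfolding * by Groebner_Basis.algebra+
  then show "(\<Sum>i<6. minors (w4 m m) i * m i j) = 0"
    using less_6_cases[OF \<open>j < 6\<close>] by (elim disjE; hypsubst)
  have "2 * (\<Sum>i<6. minors (w4 m n) i * m i 0) + (\<Sum>i<6. minors (w4 m m) i * n i 0) = 0"
    "2 * (\<Sum>i<6. minors (w4 m n) i * m i 1) + (\<Sum>i<6. minors (w4 m m) i * n i 1) = 0"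
    "2 * (\<Sum>i<6. minors (w4 m n) i * m i 2) + (\<Sum>i<6. minors (w4 m m) i * n i 2) = 0"
    "2 * (\<Sum>i<6. minors (w4 m n) i * m i 3) + (\<Sum>i<6. minors (w4 m m) i * n i 3) = 0"
    "2 * (\<Sum>i<6. minors (w4 m n) i * m i 4) + (\<Sum>i<6. minors (w4 m m) i * n i 4) = 0"
    "2 * (\<Sum>i<6. minors (w4 m n) i * m i 5) + (\<Sum>i<6. minors (w4 m m) i * n i 5) = 0"
    unfolding * by Groebner_Basis.algebra+
  then show "2 * (\<Sum>i<6. minors (w4 m n) i * m i j) + (\<Sum>i<6. minors (w4 m m) i * n i j) = 0"
    using less_6_cases[OF \<open>j < 6\<close>] by (elim disjE; hypsubst)
qed

lemma kernel_proportional: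
  assumes m: "skew m" "\<And>i. i < 6 \<Longrightarrow> m i 5 = 0" and x: "\<And>j. j < 6 \<Longrightarrow> (\<Sum>i<6. x i * m i j) = 0"
    and "i < 5" "j < 5"
  shows "x i * minors (w4 m m) j = x j * minors (w4 m m) i"
proof -
  obtain a01 a02 a03 a04 a12 a13 a14 a23 a24 a34
    where m: "m 0 1 = a01" "m 0 2 = a02" "m 0 3 = a03" "m 0 4 = a04" "m 1 2 = a12" "m 1 3 = a13" "m 1 4 = a14" "m 2 3 = a23" "m 2 4 = a24" "m 3 4 = a34"
    "m 1 0 = - a01" "m 2 0 = - a02" "m 3 0 = - a03" "m 4 0 = - a04" "m 2 1 = - a12" "m 3 1 = - a13" "m 4 1 = - a14" "m 3 2 = - a23" "m 4 2 = - a24" "m 4 3 = - a34"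
    "m 0 0 = 0" "m 1 1 = 0" "m 2 2 = 0" "m 3 3 = 0" "m 4 4 = 0" "m 5 5 = 0"
    "m 0 5 = 0" "m 5 0 = 0" "m 1 5 = 0" "m 5 1 = 0" "m 2 5 = 0" "m 5 2 = 0" "m 3 5 = 0" "m 5 3 = 0" "m 4 5 = 0" "m 5 4 = 0"
    using skew_entries_5[OF m] .
  note E = x[of 0] x[of 1] x[of 2] x[of 3] x[of 4]
  note * = minors_table w4_def m
  have E: "x 1 * (- a01) + x 2 * (- a02) + x 3 * (- a03) + x 4 * (- a04) = 0"
    "x 0 * a01 + x 2 * (- a12) + x 3 * (- a13) + x 4 * (- a14) = 0"
    "x 0 * a02 + x 1 * a12 + x 3 * (- a23) + x 4 * (- a24) = 0"
    "x 0 * a03 + x 1 * a13 + x 2 * a23 + x 4 * (- a34) = 0"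
    "x 0 * a04 + x 1 * a14 + x 2 * a24 + x 3 * a34 = 0"
    using E unfolding sum_6 m by simp_all
  obtain x0 x1 x2 x3 x4 where X: "x 0 = x0" "x 1 = x1" "x 2 = x2" "x 3 = x3" "x 4 = x4"
    by simp
  note E = E[unfolded X]
  have "x 0 * minors (w4 m m) 1 = x 1 * minors (w4 m m) 0" "x 0 * minors (w4 m m) 2 = x 2 * minors (w4 m m) 0" "x 0 * minors (w4 m m) 3 = x 3 * minors (w4 m m) 0" "x 0 * minors (w4 m m) 4 = x 4 * minors (w4 m m) 0" "x 1 * minors (w4 m m) 2 = x 2 * minors (w4 m m) 1" "x 1 * minors (w4 m m) 3 = x 3 * minors (w4 m m) 1" "x 1 * minors (w4 m m) 4 = x 4 * minors (w4 m m) 1" "x 2 * minors (w4 m m) 3 = x 3 * minors (w4 m m) 2" "x 2 * minors (w4 m m) 4 = x 4 * minors (w4 m m) 2" "x 3 * minors (w4 m m) 4 = x 4 * minors (w4 m m) 3"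
    unfolding * X using E by Groebner_Basis.algebra+
  note props = this
  have "i = 0 \<or> i = 1 \<or> i = 2 \<or> i = 3 \<or> i = 4" "j = 0 \<or> j = 1 \<or> j = 2 \<or> j = 3 \<or> j = 4"
    using assms(4,5) by presburger+
  then show ?thesis
    by (elim disjE) (simp_all only: props)
qed

lemma frame_combine:
  assumes H: "H \<in> Grass 4 W" and g: "frame_of 4 H g" and ab: "a \<noteq> 0 \<or> b \<noteq> 0"
  obtains g' where "frame_of 4 H g'" "\<And>t. g' 0 t = g 0 t" "\<And>t. g' 1 t = g 1 t"
    "\<And>t. g' 2 t = a * g 2 t + b * g 3 t"
proof -
  define c :: "nat \<Rightarrow> nat \<Rightarrow> complex" where
    "c k l = [[1, 0, 0, 0], [0, 1, 0, 0], [0, 0, a, b], if a = 0 then [0, 0, 1, 0] else [0, 0, 0, 1]] ! k ! l" for k l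
  define d :: "nat \<Rightarrow> nat \<Rightarrow> complex" where
    "d k l = [[1, 0, 0, 0], [0, 1, 0, 0], if a = 0 then [0, 0, 0, 1] else [0, 0, 1 / a, - b / a],
      if a = 0 then [0, 0, 1 / b, 0] else [0, 0, 0, 1]] ! k ! l" for k l
  define g' where "g' k t = (\<Sum>l<4. c k l * g l t)" for k t
  have g'_eq: "g' 0 t = g 0 t" "g' 1 t = g 1 t" "g' 2 t = a * g 2 t + b * g 3 t"
    "g' 3 t = (if a = 0 then g 2 t else g 3 t)" for t
    by (simp_all add: g'_def sum_4 c_def numeral_nat)
  have "frame_of 4 H g'"
  proof (rule frame_change[OF H g])
    show "g' k t = (\<Sum>l<4. c k l * g l t)" for k t
      by (simp add: g'_def)
    show "g k t = (\<Sum>l<4. d k l * g' l t)" if "k < 4" for k t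
      using less_4_cases[OF that] ab unfolding sum_4 g'_eq
      by (cases "a = 0"; elim disjE) (simp_all add: d_def numeral_nat field_simps)
  qed
  then show ?thesis
    using that g'_eq by blast
qed

context six_space
begin

definition tri_zero :: "'v bivector set \<Rightarrow> bool" where
  "tri_zero H \<longleftrightarrow> (\<forall>\<omega>\<in>H. \<forall>\<eta>\<in>H. \<forall>\<zeta>\<in>H. \<forall>f. (\<forall>i<6. f i \<in> D) \<longrightarrow>
     t3 (mt f \<omega>) (w4 (mt f \<eta>) (mt f \<zeta>)) = 0)"

lemma rel_from_coordinates:
  assumes "H \<in> variety_V s" "frame_of 4 H g"
    and "\<And>a b c d. a < b \<Longrightarrow> b < c \<Longrightarrow> c < d \<Longrightarrow> d < 6 \<Longrightarrow>
      (\<Sum>i<4. \<Sum>j<4. r i j * w4 (co (g i)) (co (g j)) a b c d) = 0"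
  shows "rel g r"
  unfolding rel_def
proof
  fix t
  have "(\<Sum>p\<in>{..<4} \<times> {..<4}. r (fst p) (snd p) * wedge (g (fst p)) (g (snd p)) t) = 0"
  proof (rule wedge_sum_zero)
    show "g (fst p) \<in> ext2 s" "g (snd p) \<in> ext2 s" if "p \<in> {..<4} \<times> {..<4}" for p
      using frame_ext2[OF assms(1,2)] that by auto
    show "(\<Sum>p\<in>{..<4} \<times> {..<4}. r (fst p) (snd p) * wedge (g (fst p)) (g (snd p)) (e a, e b, e c, e d)) = 0"
      if "a < b" "b < c" "c < d" "d < 6" for a b c d
      using assms(3)[OF that] unfolding wedge_mt co_mt by (simp add: sum.cartesian_product case_prod_unfold)
  qed
  then show "(\<Sum>i<4. \<Sum>j<4. r i j * wedge (g i) (g j) t) = 0"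
    by (simp add: sum.cartesian_product case_prod_unfold)
qed

text \<open>Three elements killed by a common functional have six products in a space of dimension five.\<close>

lemma no_three_with_common_kernel:
  assumes H: "H \<in> variety_V s" and g: "frame_of 4 H g"
    and kill: "\<And>l i. l < 3 \<Longrightarrow> i < 6 \<Longrightarrow> co (g l) i 5 = 0"
  shows False
proof -
  define F where "F l i j = (if l < 5 then minors (w4 (co (g i)) (co (g j))) l
    else if j = 3 \<and> i = l - 5 then 1 else 0)" for l i j :: nat
  obtain r where r: "symm 4 r" "\<exists>i<4. \<exists>j<4. r i j \<noteq> 0"
    "\<And>l. l < 9 \<Longrightarrow> (\<Sum>i<4. \<Sum>j<4. F l i j * r i j) = 0"
    using symmetric_solution[of 9 F] by auto
  have r3: "r i 3 = 0" if "i < 4" for i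
  proof -
    have "(\<Sum>i'<4. \<Sum>j<4. F (i + 5) i' j * r i' j) = (\<Sum>i'<4. \<Sum>j<4. if j = 3 then (if i' = i then r i' j else 0) else 0)"
      by (intro sum.cong refl) (auto simp: F_def)
    also have "\<dots> = r i 3"
      using that by simp
    finally show ?thesis
      using r(3)[of "i + 5"] that by simp
  qed
  have r3': "r 3 j = 0" if "j < 4" for j
    using r3[OF that] r(1) that by (simp add: symm_def)
  have skew: "skew (co (g i))" if "i < 4" for i
    using skew_co frame_ext2[OF H g that] by blast
  have "rel g r"
  proof (rule rel_from_coordinates[OF H g])
    fix a b c d :: nat assume abcd: "a < b" "b < c" "c < d" "d < 6"
    show "(\<Sum>i<4. \<Sum>j<4. r i j * w4 (co (g i)) (co (g j)) a b c d) = 0"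
    proof (cases "d = 5")
      case True
      have "r i j * w4 (co (g i)) (co (g j)) a b c d = 0" if "i < 4" "j < 4" for i j
      proof (cases "i = 3 \<or> j = 3")
        case False
        then have "i < 3" "j < 3" using that by auto
        then show ?thesis
          using kill[of i] kill[of j] abcd by (simp add: True w4_def)
      qed (use r3 r3' that in auto)
      then show ?thesis
        by (intro sum.neutral ballI) (simp only: lessThan_iff)
    next
      case False
      then have "a = 0 \<and> b = 1 \<and> c = 2 \<and> d = 3 \<or> a = 0 \<and> b = 1 \<and> c = 2 \<and> d = 4
          \<or> a = 0 \<and> b = 1 \<and> c = 3 \<and> d = 4 \<or> a = 0 \<and> b = 2 \<and> c = 3 \<and> d = 4 \<or> a = 1 \<and> b = 2 \<and> c = 3 \<and> d = 4"
        using abcd by presburger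
      then show ?thesis
        using r(3)[of 0] r(3)[of 1] r(3)[of 2] r(3)[of 3] r(3)[of 4]
        unfolding F_def minors_table
        by (elim disjE conjE) (simp_all add: sum_negf minors_table mult.commute)
    qed
  qed
  then show False
    using no_degenerate_relation[OF H g r(1) _ r3] r(2) by blast
qed

lemma adapted_basis_contradiction:
  assumes H: "H \<in> variety_V s" and T: "tri_zero H" and g: "frame_of 4 H g"
    and m: "co (g 0) 0 2 = - 1" "co (g 0) 1 3 = - 1"
      "co (g 0) 0 3 = 0" "co (g 0) 0 4 = 0" "co (g 0) 0 5 = 0" "co (g 0) 1 2 = 0" "co (g 0) 1 4 = 0" "co (g 0) 1 5 = 0" "co (g 0) 2 3 = 0" "co (g 0) 2 4 = 0" "co (g 0) 2 5 = 0" "co (g 0) 3 4 = 0" "co (g 0) 3 5 = 0" "co (g 0) 4 5 = 0"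
    and n: "co (g 1) 0 3 = 1" "co (g 1) 1 4 = 1"
      "co (g 1) 0 2 = 0" "co (g 1) 0 4 = 0" "co (g 1) 0 5 = 0" "co (g 1) 1 2 = 0" "co (g 1) 1 3 = 0" "co (g 1) 1 5 = 0" "co (g 1) 2 3 = 0" "co (g 1) 2 4 = 0" "co (g 1) 2 5 = 0" "co (g 1) 3 4 = 0" "co (g 1) 3 5 = 0" "co (g 1) 4 5 = 0"
  shows False
proof -
  have G: "H \<in> Grass 4 (ext2 s)"
    using variety_Grass H .
  have T': "t3 (co \<omega>) (w4 (co \<eta>) (co \<zeta>)) = 0" if "\<omega> \<in> H" "\<eta> \<in> H" "\<zeta> \<in> H" for \<omega> \<eta> \<zeta>
    using T e_dual that unfolding tri_zero_def co_mt by blast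
  have g0: "g 0 \<in> H" and g1: "g 1 \<in> H"
    using frame_of_mem[OF g] by auto
  have z: "co x 4 5 = 0" "co x 3 5 = 0" "co x 2 5 = 0" if x: "x \<in> H" for x
  proof -
    show "co x 4 5 = 0"
      using T'[OF x g0 g0] unfolding t3_def w4_def m by simp
    show "co x 3 5 = 0"
      using T'[OF x g0 g1] unfolding t3_def w4_def m n by simp
    show "co x 2 5 = 0"
      using T'[OF x g1 g1] unfolding t3_def w4_def n by simp
  qed
  have E1: "co x 1 5 * co y 3 4 + co x 3 4 * co y 1 5 + co x 0 5 * co y 2 4 + co x 2 4 * co y 0 5 = 0"
    if "x \<in> H" "y \<in> H" for x y
    using T'[OF g0 that] unfolding t3_def w4_def m z[OF that(1)] z[OF that(2)] by (simp add: algebra_simps)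
  have E2: "co x 1 5 * co y 2 4 + co x 2 4 * co y 1 5 + co x 0 5 * co y 2 3 + co x 2 3 * co y 0 5 = 0"
    if "x \<in> H" "y \<in> H" for x y
    using T'[OF g1 that] unfolding t3_def w4_def n z[OF that(1)] z[OF that(2)] by (simp add: algebra_simps)
  define p where "p i = co (g i) 0 5" for i
  define q where "q i = co (g i) 1 5" for i
  show False
  proof (cases "p 2 * q 3 = p 3 * q 2")
    case True
    define f1 where "f1 i = (if i then p 2 else q 2)" for i
    define f2 where "f2 i = (if i then p 3 else q 3)" for i
    have "f1 x * f2 y = f1 y * f2 x" for x y
      using True by (cases x; cases y) (simp_all add: f1_def f2_def mult.commute)
    then obtain a b where ab: "a \<noteq> 0 \<or> b \<noteq> 0" "\<And>x. a * f1 x + b * f2 x = 0"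
      using dependent_pair[of f1 f2] by blast
    obtain g' where g': "frame_of 4 H g'" "\<And>t. g' 0 t = g 0 t" "\<And>t. g' 1 t = g 1 t"
      "\<And>t. g' 2 t = a * g 2 t + b * g 3 t"
      using frame_combine[OF G g ab(1)] by blast
    have "co (g' l) i 5 = 0" if "l < 3" "i < 6" for l i
    proof -
      have "g' l \<in> H"
        using frame_of_mem[OF g'(1)] that(1) by simp
      note z = z[OF this]
      have "co (g' l) 5 5 = 0"
        using skew_table(6)[OF skew_co[OF frame_ext2[OF H g'(1)], of l]] that(1) by simp
      moreover have "co (g' l) 0 5 = 0" "co (g' l) 1 5 = 0"
      proof -
        have l: "l = 0 \<or> l = 1 \<or> l = 2"
          using that(1) by presburger
        have old: "co (g' 0) i 5 = co (g 0) i 5" "co (g' 1) i 5 = co (g 1) i 5" for i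
          by (simp_all only: co_def g'(2,3))
        have new: "co (g' 2) 0 5 = a * f1 True + b * f2 True" "co (g' 2) 1 5 = a * f1 False + b * f2 False"
          by (simp_all add: co_def g'(4) f1_def f2_def p_def q_def)
        show "co (g' l) 0 5 = 0" "co (g' l) 1 5 = 0"
          using l by (elim disjE; simp only: old new ab(2) m n)+
      qed
      ultimately show ?thesis
        using less_6_cases[OF that(2)] z by (elim disjE) simp_all
    qed
    then show False
      by (rule no_three_with_common_kernel[OF H g'(1)])
  next
    case False
    define \<delta> where "\<delta> = p 2 * q 3 - p 3 * q 2"
    have \<delta>: "\<delta> \<noteq> 0"
      using False by (simp add: \<delta>_def)
    define c :: "nat \<Rightarrow> nat \<Rightarrow> complex" where
      "c k l = [[1, 0, 0, 0], [0, 1, 0, 0], [0, 0, q 3 / \<delta>, - q 2 / \<delta>], [0, 0, - p 3 / \<delta>, p 2 / \<delta>]] ! k ! l" for k l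
    define d :: "nat \<Rightarrow> nat \<Rightarrow> complex" where
      "d k l = [[1, 0, 0, 0], [0, 1, 0, 0], [0, 0, p 2, q 2], [0, 0, p 3, q 3]] ! k ! l" for k l
    define g' where "g' k t = (\<Sum>l<4. c k l * g l t)" for k t
    have g'_eq: "g' 0 t = g 0 t" "g' 1 t = g 1 t" "g' 2 t = (q 3 * g 2 t - q 2 * g 3 t) / \<delta>"
      "g' 3 t = (p 2 * g 3 t - p 3 * g 2 t) / \<delta>" for t
      by (simp_all add: g'_def sum_4 c_def numeral_nat diff_divide_distrib algebra_simps)
    have g_eq: "g 2 t = p 2 * g' 2 t + q 2 * g' 3 t" "g 3 t = p 3 * g' 2 t + q 3 * g' 3 t" for t
    proof -
      have "p 2 * g' 2 t + q 2 * g' 3 t = \<delta> * g 2 t / \<delta>" "p 3 * g' 2 t + q 3 * g' 3 t = \<delta> * g 3 t / \<delta>"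
        unfolding g'_eq by (simp_all add: \<delta>_def add_divide_distrib[symmetric] algebra_simps)
      then show "g 2 t = p 2 * g' 2 t + q 2 * g' 3 t" "g 3 t = p 3 * g' 2 t + q 3 * g' 3 t"
        using \<delta> by simp_all
    qed
    have g': "frame_of 4 H g'"
    proof (rule frame_change[OF G g])
      show "g' k t = (\<Sum>l<4. c k l * g l t)" for k t
        by (simp add: g'_def)
      show "g k t = (\<Sum>l<4. d k l * g' l t)" if "k < 4" for k t
        using less_4_cases[OF that] g_eq unfolding sum_4 g'_eq(1,2)
        by (elim disjE) (simp_all add: d_def numeral_nat)
    qed
    have x: "g' 2 \<in> H" and y: "g' 3 \<in> H"
      using frame_of_mem[OF g'] by auto
    have xy: "co (g' 2) 0 5 = 1" "co (g' 2) 1 5 = 0" "co (g' 3) 0 5 = 0" "co (g' 3) 1 5 = 1"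
      using \<delta> unfolding co_def g'_eq by (simp_all add: p_def q_def co_def \<delta>_def)
    have xy0: "co (g' 2) 2 4 = 0" "co (g' 2) 2 3 = 0" "co (g' 3) 3 4 = 0" "co (g' 3) 2 4 = 0"
      using E1[OF x x] E2[OF x x] E1[OF y y] E2[OF y y] unfolding xy by simp_all
    have xy1: "co (g' 2) 3 4 = 0" "co (g' 3) 2 3 = 0"
      using E1[OF x y] E2[OF x y] unfolding xy xy0 by simp_all
    have old: "co (g' 0) = co (g 0)" "co (g' 1) = co (g 1)"
      by (intro ext; simp only: co_def g'_eq)+
    have zz: "co (g' l) 2 3 = 0" "co (g' l) 2 4 = 0" "co (g' l) 2 5 = 0" "co (g' l) 3 4 = 0"
      "co (g' l) 3 5 = 0" "co (g' l) 4 5 = 0" if "l < 4" for l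
      using less_4_cases[OF that] by (elim disjE; simp only: old m n xy0 xy1 z[OF x] z[OF y])+
    define F where "F l i j = (let w = w4 (co (g' i)) (co (g' j)) in
      [w 0 1 2 3, w 0 1 2 4, w 0 1 2 5, w 0 1 3 4, w 0 1 3 5, w 0 1 4 5] ! l)" for l i j
    show False
    proof (rule products_span_too_little[OF H g', of 6 F])
      fix r assume r: "symm 4 r" "\<And>l. l < 6 \<Longrightarrow> (\<Sum>i<4. \<Sum>j<4. F l i j * r i j) = 0"
      show "rel g' r"
      proof (rule rel_from_coordinates[OF H g'])
        fix a b c d :: nat assume abcd: "a < b" "b < c" "c < d" "d < 6"
        show "(\<Sum>i<4. \<Sum>j<4. r i j * w4 (co (g' i)) (co (g' j)) a b c d) = 0"
        proof (cases "b = 1")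
          case True
          then have "a = 0 \<and> b = 1 \<and> (c = 2 \<and> d = 3 \<or> c = 2 \<and> d = 4 \<or> c = 2 \<and> d = 5 \<or> c = 3 \<and> d = 4
              \<or> c = 3 \<and> d = 5 \<or> c = 4 \<and> d = 5)"
            using abcd by presburger
          then show ?thesis
            using r(2)[of 0] r(2)[of 1] r(2)[of 2] r(2)[of 3] r(2)[of 4] r(2)[of 5]
            by (elim conjE disjE) (simp_all add: F_def Let_def numeral_nat mult.commute)
        next
          case False
          have "w4 (co (g' i)) (co (g' j)) a b c d = 0" if "i < 4" "j < 4" for i j
            using sorted_quads_6[OF abcd] False zz[OF that(1)] zz[OF that(2)]
            unfolding w4_def by (elim disjE conjE) simp_all
          then show ?thesis by simp
        qed
      qed
    qed simp
  qed
qed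

end

context six_space
begin

lemma no_two_with_common_kernel:
  assumes H: "H \<in> variety_V s" and T: "tri_zero H" and g: "frame_of 4 H g"
    and kill: "\<And>i. i < 6 \<Longrightarrow> co (g 0) i 5 = 0" "\<And>i. i < 6 \<Longrightarrow> co (g 1) i 5 = 0"
  shows False
proof -
  define m where "m = co (g 0)"
  define n where "n = co (g 1)"
  have g0: "g 0 \<in> ext2 s" and g1: "g 1 \<in> ext2 s"
    using frame_ext2[OF H g] by auto
  have m: "skew m" "\<And>i. i < 6 \<Longrightarrow> m i 5 = 0" and n: "skew n" "\<And>i. i < 6 \<Longrightarrow> n i 5 = 0"
    using skew_co g0 g1 kill by (simp_all add: m_def n_def)
  define l0 where "l0 = minors (w4 m m)"
  define l1 where "l1 i = 2 * minors (w4 m n) i" for i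
  define l2 where "l2 = minors (w4 n n)"
  have l5: "l0 5 = 0" "l1 5 = 0" "l2 5 = 0"
    by (simp_all add: l0_def l1_def l2_def minors_table)
  \<comment> \<open>the kernel of \<open>\<omega> + t \<eta>\<close> contains \<open>l\<^sub>0 + t l\<^sub>1 + t\<^sup>2 l\<^sub>2\<close>\<close>
  have k0: "(\<Sum>i<6. l0 i * m i j) = 0" and k2: "(\<Sum>i<6. l2 i * n i j) = 0" if "j < 6" for j
    using minors_kernel(1)[OF m n that] minors_kernel(1)[OF n m that] by (simp_all add: l0_def l2_def)
  have k1: "(\<Sum>i<6. l0 i * n i j) = - (\<Sum>i<6. l1 i * m i j)" if "j < 6" for j
    using minors_kernel(2)[OF m n that]
    by (simp add: l0_def l1_def sum_distrib_left mult.assoc add_eq_0_iff)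
  have k1': "(\<Sum>i<6. l1 i * n i j) = - (\<Sum>i<6. l2 i * m i j)" if "j < 6" for j
    using minors_kernel(2)[OF n m that] unfolding w4_commute[of n m]
    by (simp add: l2_def l1_def sum_distrib_left mult.assoc add_eq_0_iff)
  have indep: "\<alpha> = 0 \<and> \<beta> = 0 \<and> \<gamma> = 0"
    if zero: "\<And>i. i < 5 \<Longrightarrow> \<alpha> * l0 i + \<beta> * l1 i + \<gamma> * l2 i = 0" for \<alpha> \<beta> \<gamma>
  proof -
    define r where "r i j = (if i = 0 \<and> j = 0 then \<alpha> else if i = 0 \<and> j = 1 \<or> i = 1 \<and> j = 0 then \<beta>
      else if i = 1 \<and> j = 1 then \<gamma> else 0)" for i j :: nat
    have sy: "symm 4 r"
      by (auto simp: symm_def r_def)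
    have "rel g r"
    proof (rule rel_from_coordinates[OF H g])
      fix a b c d :: nat assume abcd: "a < b" "b < c" "c < d" "d < 6"
      have sum: "(\<Sum>i<4. \<Sum>j<4. r i j * w4 (co (g i)) (co (g j)) a b c d)
          = \<alpha> * w4 m m a b c d + \<beta> * (2 * w4 m n a b c d) + \<gamma> * w4 n n a b c d"
        unfolding sum_4 r_def using w4_commute[of m n] by (simp add: m_def n_def)
      show "(\<Sum>i<4. \<Sum>j<4. r i j * w4 (co (g i)) (co (g j)) a b c d) = 0"
      proof (cases "d = 5")
        case True
        then show ?thesis
          unfolding sum using m(2) n(2) abcd by (simp add: w4_def)
      next
        case False
        then have "a = 0 \<and> b = 1 \<and> c = 2 \<and> d = 3 \<or> a = 0 \<and> b = 1 \<and> c = 2 \<and> d = 4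
            \<or> a = 0 \<and> b = 1 \<and> c = 3 \<and> d = 4 \<or> a = 0 \<and> b = 2 \<and> c = 3 \<and> d = 4 \<or> a = 1 \<and> b = 2 \<and> c = 3 \<and> d = 4"
          using abcd by presburger
        moreover have "\<alpha> * w4 m m 1 2 3 4 + \<beta> * (2 * w4 m n 1 2 3 4) + \<gamma> * w4 n n 1 2 3 4 = 0"
          using zero[of 0] unfolding l0_def l1_def l2_def minors_table by simp
        moreover have "\<alpha> * w4 m m 0 2 3 4 + \<beta> * (2 * w4 m n 0 2 3 4) + \<gamma> * w4 n n 0 2 3 4 = 0"
        proof -
          have "\<alpha> * - x + \<beta> * (2 * - y) + \<gamma> * - z = 0 \<Longrightarrow> \<alpha> * x + \<beta> * (2 * y) + \<gamma> * z = 0" for x y z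
            by Groebner_Basis.algebra
          from this[OF zero[of 1, unfolded l0_def l1_def l2_def minors_table]] show ?thesis by simp
        qed
        moreover have "\<alpha> * w4 m m 0 1 3 4 + \<beta> * (2 * w4 m n 0 1 3 4) + \<gamma> * w4 n n 0 1 3 4 = 0"
          using zero[of 2] unfolding l0_def l1_def l2_def minors_table by simp
        moreover have "\<alpha> * w4 m m 0 1 2 4 + \<beta> * (2 * w4 m n 0 1 2 4) + \<gamma> * w4 n n 0 1 2 4 = 0"
        proof -
          have "\<alpha> * - x + \<beta> * (2 * - y) + \<gamma> * - z = 0 \<Longrightarrow> \<alpha> * x + \<beta> * (2 * y) + \<gamma> * z = 0" for x y z
            by Groebner_Basis.algebra
          from this[OF zero[of 3, unfolded l0_def l1_def l2_def minors_table]] show ?thesis by simp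
        qed
        moreover have "\<alpha> * w4 m m 0 1 2 3 + \<beta> * (2 * w4 m n 0 1 2 3) + \<gamma> * w4 n n 0 1 2 3 = 0"
          using zero[of 4] unfolding l0_def l1_def l2_def minors_table by simp
        ultimately show ?thesis
          unfolding sum by (elim disjE conjE; (hypsubst, assumption | simp only:))
      qed
    qed
    moreover have "r i 3 = 0" if "i < 4" for i
      by (simp add: r_def)
    ultimately have "r i j = 0" if "i < 4" "j < 4" for i j
      using no_degenerate_relation[OF H g sy] that by blast
    from this[of 0 0] this[of 0 1] this[of 1 1] show ?thesis
      by (simp add: r_def)
  qed
  define A where "A j = (\<Sum>i<6. l2 i * m i j)" for j
  define B where "B j = (\<Sum>i<6. l1 i * m i j)" for j
  have AB: "\<alpha> = 0 \<and> \<beta> = 0" if zero: "\<And>j. j < 6 \<Longrightarrow> \<alpha> * A j + \<beta> * B j = 0" for \<alpha> \<beta>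
  proof -
    define x where "x i = \<alpha> * l2 i + \<beta> * l1 i" for i
    have "(\<Sum>i<6. x i * m i j) = 0" if "j < 6" for j
      using zero[OF that] by (simp add: x_def A_def B_def sum_distrib_left sum.distrib algebra_simps)
    then have pr: "x i * l0 j = x j * l0 i" if "i < 5" "j < 5" for i j
      using kernel_proportional[OF m, of x i j] that by (simp add: l0_def)
    have "\<exists>k<5. l0 k \<noteq> 0"
    proof (rule ccontr)
      assume "\<not> ?thesis"
      then show False
        using indep[of 1 0 0] by simp
    qed
    then obtain k where k: "k < 5" "l0 k \<noteq> 0" by blast
    have "(- x k / l0 k) * l0 i + \<beta> * l1 i + \<alpha> * l2 i = 0" if "i < 5" for i
      using pr[OF that k(1)] k(2) by (simp add: x_def field_simps)
    then show ?thesis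
      using indep[of "- x k / l0 k" \<beta> \<alpha>] by blast
  qed
  have "\<exists>j<6. \<exists>k<6. A j * B k - A k * B j \<noteq> 0"
  proof (rule ccontr)
    assume no: "\<not> ?thesis"
    define A' where "A' j = (if j < 6 then A j else 0)" for j
    define B' where "B' j = (if j < 6 then B j else 0)" for j
    have "A' j * B' k = A' k * B' j" for j k
      using no by (auto simp: A'_def B'_def)
    then obtain \<alpha> \<beta> where ab: "\<alpha> \<noteq> 0 \<or> \<beta> \<noteq> 0" "\<And>x. \<alpha> * A' x + \<beta> * B' x = 0"
      using dependent_pair[of A' B'] by blast
    have "\<alpha> * A j + \<beta> * B j = 0" if "j < 6" for j
      using ab(2)[of j] that by (simp add: A'_def B'_def)
    then show False
      using AB ab(1) by blast
  qed
  then obtain j0 k0 where jk: "j0 < 6" "k0 < 6" "A j0 * B k0 - A k0 * B j0 \<noteq> 0" by blast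
  define \<delta> where "\<delta> = A j0 * B k0 - A k0 * B j0"
  define y0 where "y0 i = ((if i = j0 then B k0 else 0) - (if i = k0 then B j0 else 0)) / \<delta>" for i
  define y1 where "y1 i = ((if i = k0 then A j0 else 0) - (if i = j0 then A k0 else 0)) / \<delta>" for i
  define dot where "dot y z = (\<Sum>i<6. y i * z i)" for y z :: "nat \<Rightarrow> complex"
  have dot_y0: "dot F y0 = (F j0 * B k0 - F k0 * B j0) / \<delta>" and
    dot_y1: "dot F y1 = (F k0 * A j0 - F j0 * A k0) / \<delta>" for F
  proof -
    have "dot F y0 = ((\<Sum>i<6. if i = j0 then F i * B k0 else 0) - (\<Sum>i<6. if i = k0 then F i * B j0 else 0)) / \<delta>"
      unfolding dot_def y0_def sum_subtractf[symmetric] sum_divide_distrib by (intro sum.cong) (auto simp: algebra_simps)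
    then show "dot F y0 = (F j0 * B k0 - F k0 * B j0) / \<delta>"
      using jk by simp
    have "dot F y1 = ((\<Sum>i<6. if i = k0 then F i * A j0 else 0) - (\<Sum>i<6. if i = j0 then F i * A k0 else 0)) / \<delta>"
      unfolding dot_def y1_def sum_subtractf[symmetric] sum_divide_distrib by (intro sum.cong) (auto simp: algebra_simps)
    then show "dot F y1 = (F k0 * A j0 - F j0 * A k0) / \<delta>"
      using jk by simp
  qed
  have dots: "dot A y0 = 1" "dot A y1 = 0" "dot B y0 = 0" "dot B y1 = 1"
    using jk(3) by (simp_all add: dot_y0 dot_y1 \<delta>_def mult.commute)
  define c where "c r = (if r = 0 then y0 else if r = 1 then y1 else if r = 2 then l2 else if r = 3 then l1
    else if r = 4 then l0 else (\<lambda>i. if i = 5 then 1 else 0))" for r :: nat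
  have c: "c 0 = y0" "c 1 = y1" "c 2 = l2" "c 3 = l1" "c 4 = l0" "c 5 = (\<lambda>i. if i = 5 then 1 else 0)"
    by (simp_all add: c_def)
  define f where "f r x = (\<Sum>i<6. c r i * e i x)" for r x
  have f: "f r \<in> D" for r
    unfolding f_def using e_dual by (intro D_combination) auto
  define row where "row M y j = (\<Sum>i<6. y i * M i j)" for M :: "nat \<Rightarrow> nat \<Rightarrow> complex" and y :: "nat \<Rightarrow> complex" and j
  have pairing: "\<omega> (f r, f q) = dot (row (co \<omega>) (c r)) (c q)" if "\<omega> \<in> ext2 s" for \<omega> r q
  proof -
    have lin: "\<omega> (f r, x) = (\<Sum>i<6. c r i * \<omega> (e i, x))" for r x
      by (rule ext2_linear[OF that _ f_def]) (simp add: e_dual)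
    have "\<omega> (f r, f q) = - \<omega> (f q, f r)"
      by (rule ext2_swap[OF that])
    also have "\<dots> = (\<Sum>j<6. c q j * - \<omega> (e j, f r))"
      unfolding lin by (simp add: sum_negf)
    also have "\<dots> = (\<Sum>j<6. c q j * \<omega> (f r, e j))"
      by (intro sum.cong refl) (simp add: ext2_swap[OF that, of "f r"])
    finally show ?thesis
      unfolding lin dot_def row_def co_def by (simp add: mult.commute)
  qed
  have dot_anti: "dot (row M y) z = - dot (row M z) y" if "skew M" for M y z
  proof -
    have "dot (row M y) z = (\<Sum>i<6. \<Sum>j<6. z i * (y j * M j i))"
      by (simp add: dot_def row_def sum_distrib_left sum_distrib_right mult.commute)
    also have "\<dots> = (\<Sum>j<6. \<Sum>i<6. z i * (y j * M j i))"
      by (rule sum.swap)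
    also have "\<dots> = (\<Sum>j<6. \<Sum>i<6. - (z i * M i j * y j))"
    proof (intro sum.cong refl)
      fix i j :: nat assume "j \<in> {..<6}" "i \<in> {..<6}"
      then have "M j i = - M i j" using skewD[OF that, of j i] by simp
      then show "z i * (y j * M j i) = - (z i * M i j * y j)" by simp
    qed
    finally show ?thesis
      by (simp add: dot_def row_def sum_negf sum_distrib_right)
  qed
  have dot_self: "dot (row M y) y = 0" if "skew M" for M y
    using dot_anti[OF that, of y y] by simp
  have dot_cong: "dot F y = dot F' y" if "\<And>j. j < 6 \<Longrightarrow> F j = F' j" for F F' y
    unfolding dot_def using that by (intro sum.cong) auto
  have dot_neg: "dot (\<lambda>j. - F j) y = - dot F y" for F y
    by (simp add: dot_def sum_negf)
  have dot_zero: "dot (\<lambda>j. 0) y = 0" for y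
    by (simp add: dot_def)
  have e5: "row M (c 5) j = 0" if "M 5 j = 0" for M j
  proof -
    have "row M (c 5) j = (\<Sum>i<6. if i = 5 then M i j else 0)"
      unfolding row_def c by (intro sum.cong) auto
    then show ?thesis using that by simp
  qed
  have m5: "m 5 j = 0" "n 5 j = 0" if "j < 6" for j
    using skewD[OF m(1), of 5 j] skewD[OF n(1), of 5 j] m(2)[OF that] n(2)[OF that] that by simp_all
  have M: "dot (row m l2) y = dot A y" "dot (row m l1) y = dot B y" "dot (row m l0) y = 0"
    "dot (row m (c 5)) y = 0" for y
    using dot_cong[of "row m l0" "\<lambda>_. 0" y] dot_cong[of "row m (c 5)" "\<lambda>_. 0" y] k0 e5 m5
    by (simp_all add: dot_zero row_def[abs_def] A_def[abs_def] B_def[abs_def])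
  have N: "dot (row n l2) y = 0" "dot (row n l1) y = - dot A y" "dot (row n l0) y = - dot B y"
    "dot (row n (c 5)) y = 0" for y
    using dot_cong[of "row n l2" "\<lambda>_. 0" y] dot_cong[of "row n (c 5)" "\<lambda>_. 0" y]
      dot_cong[of "row n l1" "\<lambda>j. - A j" y] dot_cong[of "row n l0" "\<lambda>j. - B j" y] k1 k1' k2 e5 m5
    by (simp_all add: dot_zero dot_neg row_def A_def B_def A_def[abs_def] B_def[abs_def])
  have AB0: "dot A l2 = 0" "dot A l1 = 0" "dot A l0 = 0" "dot A (c 5) = 0"
    "dot B l2 = 0" "dot B l1 = 0" "dot B l0 = 0" "dot B (c 5) = 0"
  proof -
    show 1: "dot A l2 = 0" "dot B l1 = 0"
      using dot_self[OF m(1)] M by metis+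
    show 2: "dot A l1 = 0"
      using dot_self[OF n(1), of l1] N by simp
    show "dot B l2 = 0"
      using dot_anti[OF m(1), of l1 l2] M 2 by simp
    show "dot A l0 = 0" "dot B l0 = 0" "dot A (c 5) = 0" "dot B (c 5) = 0"
      using dot_anti[OF m(1), of l2 l0] dot_anti[OF m(1), of l1 l0] dot_anti[OF m(1), of l2 "c 5"]
        dot_anti[OF m(1), of l1 "c 5"] M by simp_all
  qed
  have ind: "\<forall>r<6. d r = 0" if d: "\<And>x. (\<Sum>r<6. d r * f r x) = 0" for d
  proof -
    have coeff: "(\<Sum>r<6. d r * c r i) = 0" if "i < 6" for i
    proof (rule e_independent[OF _ that])
      fix x
      have "(\<Sum>i<6. (\<Sum>r<6. d r * c r i) * e i x) = (\<Sum>r<6. \<Sum>i<6. d r * c r i * e i x)"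
        by (simp add: sum_distrib_right) (rule sum.swap)
      also have "\<dots> = (\<Sum>r<6. d r * f r x)"
        by (simp add: f_def sum_distrib_left mult.assoc)
      finally show "(\<Sum>i<6. (\<Sum>r<6. d r * c r i) * e i x) = 0"
        using d by simp
    qed
    have comb: "(\<Sum>r<6. d r * dot F (c r)) = 0" for F
    proof -
      have "(\<Sum>r<6. d r * dot F (c r)) = (\<Sum>r<6. \<Sum>i<6. F i * (d r * c r i))"
        by (simp add: dot_def sum_distrib_left mult.left_commute)
      also have "\<dots> = (\<Sum>i<6. F i * (\<Sum>r<6. d r * c r i))"
        by (subst sum.swap) (simp add: sum_distrib_left)
      also have "\<dots> = 0"
        using coeff by simp
      finally show ?thesis .
    qed
    have "d 0 = 0" "d 1 = 0"
      using comb[of A] comb[of B] unfolding sum_6 c(1-5) dots AB0 by simp_all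
    moreover from this have "d 5 = 0"
      using coeff[of 5] unfolding sum_6 c l5 by simp
    moreover from calculation have "d 4 * l0 i + d 3 * l1 i + d 2 * l2 i = 0" if "i < 5" for i
      using coeff[of i] that unfolding sum_6 c by (simp add: algebra_simps)
    then have "d 4 = 0 \<and> d 3 = 0 \<and> d 2 = 0"
      by (rule indep)
    ultimately show ?thesis
      using less_6_cases by metis
  qed
  obtain v' where "six_space s v' f"
    using change_basis[of f, OF f ind] by blast
  then interpret b: six_space s v' f .
  have bm: "b.co (g 0) r q = dot (row m (c r)) (c q)" and bn: "b.co (g 1) r q = dot (row n (c r)) (c q)" for r q
    unfolding b.co_def pairing[OF g0] pairing[OF g1] m_def n_def by simp_all
  have bm': "b.co (g 0) r q = - dot (row m (c q)) (c r)" and bn': "b.co (g 1) r q = - dot (row n (c q)) (c r)" for r q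
    unfolding bm bn by (rule dot_anti, fact)+
  show False
  proof (rule b.adapted_basis_contradiction[OF H T g])
    show "b.co (g 0) 0 2 = - 1" "b.co (g 0) 1 3 = - 1" "b.co (g 0) 0 3 = 0" "b.co (g 0) 0 4 = 0"
      "b.co (g 0) 0 5 = 0" "b.co (g 0) 1 2 = 0" "b.co (g 0) 1 4 = 0" "b.co (g 0) 1 5 = 0"
      "b.co (g 0) 2 3 = 0" "b.co (g 0) 2 4 = 0" "b.co (g 0) 2 5 = 0" "b.co (g 0) 3 4 = 0"
      "b.co (g 0) 3 5 = 0" "b.co (g 0) 4 5 = 0"
      unfolding bm' c(1-5) M dots AB0 by simp_all
    show "b.co (g 1) 0 3 = 1" "b.co (g 1) 1 4 = 1" "b.co (g 1) 0 2 = 0" "b.co (g 1) 0 4 = 0"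
      "b.co (g 1) 0 5 = 0" "b.co (g 1) 1 2 = 0" "b.co (g 1) 1 3 = 0" "b.co (g 1) 1 5 = 0"
      "b.co (g 1) 2 3 = 0" "b.co (g 1) 2 4 = 0" "b.co (g 1) 2 5 = 0" "b.co (g 1) 3 4 = 0"
      "b.co (g 1) 3 5 = 0" "b.co (g 1) 4 5 = 0"
      unfolding bn' c(1-5) N dots AB0 by simp_all
  qed
qed

lemma hyper_contradiction:
  assumes H: "H \<in> variety_V s" and T: "tri_zero H" and h: "hyper H h"
  shows False
proof -
  have G: "H \<in> Grass 4 (ext2 s)" and fr: "frame_of 4 H h"
    using variety_Grass H h by (auto simp: hyper_def)
  have ext: "h l \<in> ext2 s" if "l < 4" for l
    using frame_ext2[OF H fr that] .
  define \<omega> where "\<omega> = h 0"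
  have \<omega>: "\<omega> \<in> ext2 s" "\<omega> \<in> H"
    using ext frame_of_mem[OF fr] by (simp_all add: \<omega>_def)
  define m where "m = co \<omega>"
  have m: "skew m"
    using skew_co[OF \<omega>(1)] by (simp add: m_def)
  have "\<exists>a b c d. a < b \<and> b < c \<and> c < d \<and> d < 6 \<and> w4 m m a b c d \<noteq> 0"
  proof (rule ccontr)
    assume no: "\<not> ?thesis"
    define r where "r i j = (if i = 0 \<and> j = 0 then 1 else 0 :: complex)" for i j :: nat
    have "symm 4 r"
      by (auto simp: symm_def r_def)
    moreover have "rel h r"
    proof (rule rel_from_coordinates[OF H fr])
      fix a b c d :: nat assume "a < b" "b < c" "c < d" "d < 6"
      then have "w4 (co (h 0)) (co (h 0)) a b c d = 0"
        using no by (auto simp: m_def \<omega>_def)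
      then show "(\<Sum>i<4. \<Sum>j<4. r i j * w4 (co (h i)) (co (h j)) a b c d) = 0"
        unfolding sum_4 r_def by simp
    qed
    moreover have "r i 3 = 0" for i
      by (simp add: r_def)
    ultimately have "r 0 0 = 0"
      using no_degenerate_relation[OF H fr] by simp
    then show False
      by (simp add: r_def)
  qed
  then obtain a b c d where abcd: "a < b" "b < c" "c < d" "d < 6" "w4 m m a b c d \<noteq> 0" by blast
  define W where "W w x y z = wedge \<omega> \<omega> (w, x, y, z)" for w x y z
  have W0: "W (e a) (e b) (e c) (e d) \<noteq> 0"
    using abcd(5) by (simp add: W_def m_def co_mt wedge_mt)
  obtain p q where pq: "p < 6" "q < 6" "p \<noteq> q" "p \<notin> {a, b, c, d}" "q \<notin> {a, b, c, d}"
  proof -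
    have "card {a, b, c, d} = 4"
      using abcd(1-3) by simp
    then have "card ({..<6} - {a, b, c, d}) = 2"
      using abcd(1-4) by (subst card_Diff_subset) auto
    then obtain p q where "{..<6} - {a, b, c, d} = {p, q}" "p \<noteq> q"
      by (auto simp: card_2_iff)
    then show ?thesis
      using that[of p q] by blast
  qed
  define K where "K x y = W (e a) (e b) (e c) (e d) * x y - W (e a) (e b) (e c) x * e d y
    + W (e a) (e b) (e d) x * e c y - W (e a) (e c) (e d) x * e b y + W (e b) (e c) (e d) x * e a y"
    for x y
  have lt: "a < 6" "b < 6" "c < 6" "d < 6"
    using abcd by auto
  have K_D: "K x \<in> D" if "x \<in> D" for x
    using that e_dual[OF lt(1)] e_dual[OF lt(2)] e_dual[OF lt(3)] e_dual[OF lt(4)]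
    unfolding K_def[abs_def] dual_on_def by (auto simp: algebra_simps)
  have K_eval: "\<eta> (K x, y) = W (e a) (e b) (e c) (e d) * \<eta> (x, y) - W (e a) (e b) (e c) x * \<eta> (e d, y)
    + W (e a) (e b) (e d) x * \<eta> (e c, y) - W (e a) (e c) (e d) x * \<eta> (e b, y) + W (e b) (e c) (e d) x * \<eta> (e a, y)"
    if "x \<in> D" "\<eta> \<in> ext2 s" for x y \<eta>
  proof -
    define w where "w l = [x, e d, e c, e b, e a] ! l" for l
    define k where "k l = [W (e a) (e b) (e c) (e d), - W (e a) (e b) (e c) x, W (e a) (e b) (e d) x,
      - W (e a) (e c) (e d) x, W (e b) (e c) (e d) x] ! l" for l
    have s5: "(\<Sum>l<5. F l) = F 0 + F 1 + F 2 + F 3 + F (4 :: nat)" for F :: "nat \<Rightarrow> complex"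
      by (simp add: eval_nat_numeral)
    have wk: "w 0 = x" "w 1 = e d" "w 2 = e c" "w 3 = e b" "w 4 = e a"
      "k 0 = W (e a) (e b) (e c) (e d)" "k 1 = - W (e a) (e b) (e c) x" "k 2 = W (e a) (e b) (e d) x"
      "k 3 = - W (e a) (e c) (e d) x" "k 4 = W (e b) (e c) (e d) x"
      by (simp_all add: w_def k_def numeral_nat)
    have "\<eta> (K x, y) = (\<Sum>l<5. k l * \<eta> (w l, y))"
    proof (rule ext2_linear[OF that(2)])
      show "K x z = (\<Sum>l<5. k l * w l z)" for z
        unfolding s5 wk K_def by simp
      show "w l \<in> D" if "l \<in> {..<5}" for l
      proof -
        have "l = 0 \<or> l = 1 \<or> l = 2 \<or> l = 3 \<or> l = 4"
          using that unfolding lessThan_iff by presburger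
        then show ?thesis
          using \<open>x \<in> D\<close> e_dual lt wk(1-5) by metis
      qed
    qed
    then show ?thesis
      unfolding s5 wk by simp
  qed
  have K_kills: "\<omega> (K x, y) = 0" if x: "x \<in> D" for x y
  proof (cases "y \<in> D")
    case True
    define f where "f i = [e a, e b, e c, e d, x, y] ! i" for i
    have f: "f 0 = e a" "f 1 = e b" "f 2 = e c" "f 3 = e d" "f 4 = x" "f 5 = y"
      by (simp_all add: f_def numeral_nat)
    have fD: "f i \<in> D" if "i < 6" for i
      using less_6_cases[OF that] f e_dual lt x True by metis
    have "t3 (mt f \<omega>) (w4 (mt f \<omega>) (mt f \<omega>)) = 0"
      using T \<omega>(2) fD unfolding tri_zero_def by blast
    moreover have "\<omega> (K x, y) = 2 * Pf (mt f \<omega>)"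
      unfolding K_eval[OF x \<omega>(1)] Pf_def mt_def f W_def wedge_def prod.case by (simp add: algebra_simps)
    ultimately show ?thesis
      unfolding Pf_cube by simp
  next
    case False
    then show ?thesis by (simp add: ext2_outside[OF \<omega>(1)])
  qed
  define k1 where "k1 = K (e p)"
  define k2 where "k2 = K (e q)"
  have k1: "k1 \<in> D" "\<omega> (k1, y) = 0" and k2: "k2 \<in> D" "\<omega> (k2, y) = 0" for y
    using K_D K_kills e_dual pq by (simp_all add: k1_def k2_def)
  \<comment> \<open>every element of \<open>H\<close> vanishes on the kernel of \<open>\<omega>\<close>\<close>
  have on_kernel: "\<eta> (k1, k2) = 0" if "\<eta> \<in> H" for \<eta>
  proof -
    define f where "f i = [e a, e b, e c, e d, k1, k2] ! i" for i
    have f: "f 0 = e a" "f 1 = e b" "f 2 = e c" "f 3 = e d" "f 4 = k1" "f 5 = k2"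
      by (simp_all add: f_def numeral_nat)
    have fD: "f i \<in> D" if "i < 6" for i
      using less_6_cases[OF that] f e_dual lt k1(1) k2(1) by metis
    have "t3 (mt f \<eta>) (w4 (mt f \<omega>) (mt f \<omega>)) = 0"
      using T \<omega>(2) that fD unfolding tri_zero_def by blast
    moreover have "\<omega> (x, k1) = 0" "\<omega> (x, k2) = 0" for x
      using k1(2) k2(2) ext2_swap[OF \<omega>(1), of x] by simp_all
    ultimately have "\<eta> (k1, k2) * W (e a) (e b) (e c) (e d) = 0"
      unfolding t3_def w4_def mt_def f W_def wedge_def prod.case by (simp add: k1(2) k2(2))
    then show ?thesis
      using W0 by simp
  qed
  have "h 2 (k1, x) * h 3 (k2, y) - h 2 (k1, y) * h 3 (k2, x)
      = h 2 (k2, x) * h 3 (k1, y) - h 2 (k2, y) * h 3 (k1, x)" for x y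
  proof -
    have "wedge (h 0) (h 1) (k1, k2, x, y) = wedge (h 2) (h 3) (k1, k2, x, y)"
      using h unfolding hyper_def by blast
    moreover have "wedge (h 0) (h 1) (k1, k2, x, y) = 0"
      using k1(2) k2(2) on_kernel[of "h 1"] frame_of_mem[OF fr, of 1]
      by (simp add: wedge_def \<omega>_def)
    ultimately have "wedge (h 2) (h 3) (k1, k2, x, y) = 0"
      by (simp only:)
    moreover have "h 2 (k1, k2) = 0" "h 3 (k1, k2) = 0"
      using on_kernel frame_of_mem[OF fr] by simp_all
    moreover have "z * a - p * b + r * c + d * u - g * v + i * z' = 0 \<Longrightarrow> z = 0 \<Longrightarrow> z' = 0
        \<Longrightarrow> p * b - r * c = d * u - g * v" for z a p b r c d u g v i z' :: complex
      by Groebner_Basis.algebra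
    ultimately show ?thesis
      unfolding wedge_def prod.case by blast
  qed
  then obtain P R \<alpha> \<beta> where *: "P \<noteq> 0 \<or> R \<noteq> 0" "\<alpha> \<noteq> 0 \<or> \<beta> \<noteq> 0"
    "\<And>x. P * (\<alpha> * h 2 (k1, x) + \<beta> * h 3 (k1, x)) + R * (\<alpha> * h 2 (k2, x) + \<beta> * h 3 (k2, x)) = 0"
    using pencil_with_common_kernel[of "\<lambda>x. h 2 (k1, x)" "\<lambda>y. h 3 (k2, y)" "\<lambda>x. h 2 (k2, x)" "\<lambda>y. h 3 (k1, y)"]
    by blast
  define k where "k x = P * k1 x + R * k2 x" for x
  have k_lin: "\<eta> (k, y) = P * \<eta> (k1, y) + R * \<eta> (k2, y)" if "\<eta> \<in> ext2 s" for \<eta> y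
  proof -
    have "\<eta> (k, y) = (\<Sum>l<(2::nat). (if l = 0 then P else R) * \<eta> (if l = 0 then k1 else k2, y))"
      using k1(1) k2(1) by (intro ext2_linear[OF that]) (auto simp: k_def eval_nat_numeral)
    then show ?thesis
      by (simp add: eval_nat_numeral)
  qed
  have "k \<in> D"
    using k1(1) k2(1) unfolding k_def[abs_def] dual_on_def by (auto simp: algebra_simps)
  \<comment> \<open>take \<open>\<omega>\<close> and the new element of the pencil as the first two members of a frame\<close>
  obtain g where g: "frame_of 4 H g" "\<And>t. g 0 t = h 0 t" "\<And>t. g 1 t = \<alpha> * h 2 t + \<beta> * h 3 t"
  proof -
    obtain g' where g': "frame_of 4 H g'" "\<And>t. g' 0 t = h 0 t" "\<And>t. g' 2 t = \<alpha> * h 2 t + \<beta> * h 3 t"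
      using frame_combine[OF G fr *(2)] by metis
    define \<pi> where "\<pi> k = (if k = 1 then 2 else if k = 2 then 1 else k)" for k :: nat
    have "frame_of 4 H (\<lambda>k. g' (\<pi> k))"
    proof (rule frame_change[OF G g'(1)])
      show "g' (\<pi> k) t = (\<Sum>l<4. (if l = \<pi> k then 1 else 0) * g' l t)" if "k < 4" for k t
      proof -
        have "(\<Sum>l<4. (if l = \<pi> k then 1 else 0) * g' l t) = (\<Sum>l<4. if l = \<pi> k then g' l t else 0)"
          by (intro sum.cong) auto
        then show ?thesis
          using that by (simp add: \<pi>_def)
      qed
      show "g' k t = (\<Sum>l<4. (if l = \<pi> k then 1 else 0) * g' (\<pi> l) t)" if "k < 4" for k t
      proof -
        have "(\<Sum>l<4. (if l = \<pi> k then 1 else 0) * g' (\<pi> l) t) = (\<Sum>l<4. if l = \<pi> k then g' (\<pi> l) t else 0)"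
          by (intro sum.cong) auto
        moreover have "\<pi> k < 4" "\<pi> (\<pi> k) = k"
          using that by (auto simp: \<pi>_def)
        ultimately show ?thesis
          by simp
      qed
    qed
    then show ?thesis
      by (rule that) (simp_all add: \<pi>_def g'(2,3))
  qed
  have kill_k: "g 0 (k, y) = 0" "g 1 (k, y) = 0" for y
  proof -
    show "g 0 (k, y) = 0"
      unfolding g(2) k_lin[OF ext[of 0, simplified]] using k1(2) k2(2) by (simp add: \<omega>_def)
    show "g 1 (k, y) = 0"
      unfolding g(3) k_lin[OF ext[of 2, simplified]] k_lin[OF ext[of 3, simplified]]
      using *(3)[of y] by (simp add: algebra_simps)
  qed
  have k_at: "k (v p) = P * W (e a) (e b) (e c) (e d)" "k (v q) = R * W (e a) (e b) (e c) (e d)"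
    using pq lt e_v by (auto simp: k_def k1_def k2_def K_def)
  define i0 where "i0 = (if P \<noteq> 0 then p else q)"
  have i0: "i0 < 6" "k (v i0) \<noteq> 0"
    using *(1) W0 pq k_at by (auto simp: i0_def)
  define f where "f i = (if i = 5 then k else if i = i0 then e 5 else e i)" for i
  have f: "f i \<in> D" if "i < 6" for i
    using that \<open>k \<in> D\<close> e_dual by (simp add: f_def)
  have ind: "\<forall>i<6. d i = 0" if d: "\<And>x. (\<Sum>i<6. d i * f i x) = 0" for d
  proof -
    have "d i * f i (v i0) = 0" if "i < 6" "i \<noteq> 5" for i
      using that i0 e_v by (auto simp: f_def)
    then have "(\<Sum>i<6. d i * f i (v i0)) = (\<Sum>i\<in>{5}. d i * f i (v i0))"
      by (intro sum.mono_neutral_right) auto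
    then have d5: "d 5 = 0"
      using d[of "v i0"] i0 by (simp add: f_def)
    define d' where "d' i = (if i = i0 then 0 else if i = 5 then d i0 else d i)" for i
    show ?thesis
    proof (cases "i0 = 5")
      case True
      have "(\<Sum>i<6. d i * e i x) = (\<Sum>i<6. d i * f i x)" for x
        using d5 True by (intro sum.cong) (auto simp: f_def)
      then show ?thesis
        using e_independent[of d] d by simp
    next
      case False
      have "(\<Sum>i<6. d' i * e i x) = 0" for x
      proof -
        have "(\<Sum>i<6. d' i * e i x) = (\<Sum>i\<in>{..<6} - {5, i0}. d i * e i x) + d i0 * e 5 x"
        proof -
          have "(\<Sum>i<6. d' i * e i x) = (\<Sum>i\<in>{..<6} - {5, i0}. d' i * e i x) + (\<Sum>i\<in>{5, i0}. d' i * e i x)"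
            using i0 by (intro sum.subset_diff) auto
          also have "(\<Sum>i\<in>{..<6} - {5, i0}. d' i * e i x) = (\<Sum>i\<in>{..<6} - {5, i0}. d i * e i x)"
            by (intro sum.cong) (auto simp: d'_def)
          finally show ?thesis
            using False by (simp add: d'_def)
        qed
        also have "\<dots> = (\<Sum>i<6. d i * f i x)"
        proof -
          have "(\<Sum>i<6. d i * f i x) = (\<Sum>i\<in>{..<6} - {5, i0}. d i * f i x) + (\<Sum>i\<in>{5, i0}. d i * f i x)"
            using i0 by (intro sum.subset_diff) auto
          also have "(\<Sum>i\<in>{..<6} - {5, i0}. d i * f i x) = (\<Sum>i\<in>{..<6} - {5, i0}. d i * e i x)"
            by (intro sum.cong) (auto simp: f_def)
          finally show ?thesis
            using False d5 by (simp add: f_def)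
        qed
        finally show ?thesis
          using d by simp
      qed
      then have z: "d' i = 0" if "i < 6" for i
        using e_independent[of d'] that by blast
      show ?thesis
      proof (intro allI impI)
        fix i :: nat assume "i < 6"
        show "d i = 0"
          using z[OF \<open>i < 6\<close>] z[of 5] d5 False by (auto simp: d'_def split: if_splits)
      qed
    qed
  qed
  obtain v' where "six_space s v' f"
    using change_basis[of f, OF f ind] by blast
  then interpret b: six_space s v' f .
  have "b.co (g 0) i 5 = 0" "b.co (g 1) i 5 = 0" for i
    using kill_k ext2_swap[OF frame_ext2[OF H g(1), of 0], of "f i" k]
      ext2_swap[OF frame_ext2[OF H g(1), of 1], of "f i" k]
    by (simp_all add: b.co_def f_def)
  then show False
    using b.no_two_with_common_kernel[OF H T g(1)] by blast
qed

text \<open>Every member of the variety has a hyperbolic frame that starts with a nondegenerate bivector.\<close>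

theorem nondegenerate_hyper_frame:
  assumes H: "H \<in> variety_V s"
  shows "\<exists>h. hyper H h \<and> Pf (co (h 0)) \<noteq> 0"
proof (rule ccontr)
  assume no: "\<not> ?thesis"
  then have "Pf (co \<omega>) = 0" if "\<omega> \<in> H" for \<omega>
    using all_Pf_zero[OF H _ that] by blast
  then have "tri_zero H"
    unfolding tri_zero_def using trilinear_zero[OF H] by blast
  then show False
    using hyper_contradiction[OF H] hyper_exists[OF H] by blast
qed

end

section \<open>Openness of the variety along polynomial families of frames\<close>

lemma evaluation_points:
  fixes f :: "nat \<Rightarrow> 'a \<Rightarrow> complex"
  assumes "\<And>c. (\<And>t. (\<Sum>i<n. c i * f i t) = 0) \<Longrightarrow> \<forall>i<n. c i = 0"
  obtains p where "det (mat n n (\<lambda>(i, j). f i (p j))) \<noteq> 0"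
proof -
  have "\<exists>p. \<forall>c. (\<forall>j<n. (\<Sum>i<n. c i * f i (p j)) = 0) \<longrightarrow> (\<forall>i<n. c i = 0)"
    using assms
  proof (induction n)
    case (Suc n)
    have "\<forall>i<n. c i = 0" if "\<And>t. (\<Sum>i<n. c i * f i t) = 0" for c
      using Suc.prems[of "c(n := 0)"] that by (simp add: less_Suc_eq)
    then obtain p where p: "\<And>c. (\<And>j. j < n \<Longrightarrow> (\<Sum>i<n. c i * f i (p j)) = 0) \<Longrightarrow> \<forall>i<n. c i = 0"
      using Suc.IH by blast
    obtain d where d: "\<exists>j<Suc n. d j \<noteq> 0" "\<And>j. j < n \<Longrightarrow> (\<Sum>i<Suc n. f i (p j) * d i) = 0"
      using homogeneous_system[of n "Suc n" "\<lambda>j i. f i (p j)"] by blast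
    have dn: "d n \<noteq> 0"
    proof
      assume "d n = 0"
      then have "\<forall>i<n. d i = 0"
        using d(2) by (intro p) (simp add: mult.commute)
      with d(1) \<open>d n = 0\<close> show False
        by (auto simp: less_Suc_eq)
    qed
    obtain t where t: "(\<Sum>i<Suc n. d i * f i t) \<noteq> 0"
      using Suc.prems[of d] d(1) by blast
    show ?case
    proof (intro exI allI impI)
      fix c i assume c: "\<forall>j<Suc n. (\<Sum>i<Suc n. c i * f i ((p(n := t)) j)) = 0" and i: "i < Suc n"
      define k where "k = c n / d n"
      have *: "\<forall>i<n. c i - k * d i = 0"
      proof (rule p)
        fix j assume j: "j < n"
        have "(\<Sum>i<n. (c i - k * d i) * f i (p j))
            = (\<Sum>i<Suc n. c i * f i (p j)) - k * (\<Sum>i<Suc n. f i (p j) * d i)"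
          using dn by (simp add: k_def sum_subtractf sum_distrib_left algebra_simps)
        moreover have "(\<Sum>i<Suc n. c i * f i (p j)) = 0"
          using c[rule_format, of j] j by (simp del: sum.lessThan_Suc)
        ultimately show "(\<Sum>i<n. (c i - k * d i) * f i (p j)) = 0"
          unfolding d(2)[OF j] by (simp only: mult_zero_right diff_self)
      qed
      have ck: "c i = k * d i" if "i < Suc n" for i
        using * that dn by (cases "i = n") (simp_all add: k_def less_Suc_eq)
      have "(\<Sum>i<Suc n. c i * f i t) = 0"
        using c by (metis fun_upd_same lessI)
      moreover have "(\<Sum>i<Suc n. c i * f i t) = k * (\<Sum>i<Suc n. d i * f i t)"
        unfolding sum_distrib_left by (intro sum.cong refl) (simp add: ck)
      ultimately have "k = 0"
        using t by simp
      then show "c i = 0"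
        using ck[OF i] by simp
    qed
  qed simp
  then obtain p where p: "\<And>c. (\<And>j. j < n \<Longrightarrow> (\<Sum>i<n. c i * f i (p j)) = 0) \<Longrightarrow> \<forall>i<n. c i = 0"
    by blast
  show ?thesis
    by (rule that[of p], rule det_nonzero_of_trivial_kernel) (rule p)
qed

lemma independence_open:
  fixes f :: "(nat \<Rightarrow> complex) \<Rightarrow> 'i \<Rightarrow> 'a \<Rightarrow> complex"
  assumes I: "finite I" and poly: "\<And>i t. i \<in> I \<Longrightarrow> ispoly N (\<lambda>x. f x i t)"
    and ind: "\<And>c. (\<And>t. (\<Sum>i\<in>I. c i * f x0 i t) = 0) \<Longrightarrow> \<forall>i\<in>I. c i = 0"
  obtains \<Delta> where "ispoly N \<Delta>" "\<Delta> x0 \<noteq> 0"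
    "\<And>x c i. \<Delta> x \<noteq> 0 \<Longrightarrow> (\<And>t. (\<Sum>i\<in>I. c i * f x i t) = 0) \<Longrightarrow> i \<in> I \<Longrightarrow> c i = 0"
proof -
  define n where "n = card I"
  obtain b where b: "bij_betw b {..<n} I"
    using ex_bij_betw_nat_finite[OF I] by (auto simp: n_def atLeast0LessThan)
  then have bI: "b k \<in> I" if "k < n" for k
    using that by (auto simp: bij_betw_def)
  have re: "(\<Sum>k<n. c (b k) * f x (b k) t) = (\<Sum>i\<in>I. c i * f x i t)" for c x t
    by (rule sum.reindex_bij_betw[OF b, of "\<lambda>i. c i * f x i t"])
  have "\<forall>k<n. c k = 0" if c: "\<And>t. (\<Sum>k<n. c k * f x0 (b k) t) = 0" for c
  proof -
    define d where "d i = c (inv_into {..<n} b i)" for i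
    have d: "d (b k) = c k" if "k < n" for k
      using that b by (simp add: d_def bij_betw_def)
    have "(\<Sum>i\<in>I. d i * f x0 i t) = 0" for t
      using c[of t] unfolding re[symmetric] by (simp add: d)
    then show ?thesis
      using ind[of d] d bI by metis
  qed
  then obtain p where p: "det (mat n n (\<lambda>(i, j). f x0 (b i) (p j))) \<noteq> 0"
    using evaluation_points[where n = n and f = "\<lambda>k. f x0 (b k)"] by blast
  show ?thesis
  proof (rule that[of "\<lambda>x. det (mat n n (\<lambda>(i, j). f x (b i) (p j)))"])
    show "ispoly N (\<lambda>x. det (mat n n (\<lambda>(i, j). f x (b i) (p j))))"
      by (intro ispoly_det poly bI)
    show "c i = 0" if "det (mat n n (\<lambda>(i, j). f x (b i) (p j))) \<noteq> 0"
      and c: "\<And>t. (\<Sum>i\<in>I. c i * f x i t) = 0" and i: "i \<in> I" for x c i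
    proof -
      obtain k where k: "k < n" "i = b k"
        using b i by (auto simp: bij_betw_def)
      have "c (b k) = 0"
        by (rule trivial_kernel_of_det_nonzero[OF that(1) _ k(1), of "\<lambda>k. c (b k)"]) (simp add: re c)
      then show ?thesis
        using k by simp
    qed
  qed (rule p)
qed

lemma rel_pairs:
  assumes "symm 4 r"
  shows "rel h r \<longleftrightarrow> (\<forall>t. (\<Sum>p\<in>pairs. ((if fst p = snd p then 1 else 2) * r (fst p) (snd p))
    * wedge (h (fst p)) (h (snd p)) t) = 0)"
proof -
  have "(\<Sum>i<4. \<Sum>j<4. r i j * wedge (h i) (h j) t)
      = (\<Sum>(i, j)\<in>pairs. (if i = j then 1 else 2) * (r i j * wedge (h i) (h j) t))" for t
    by (rule symmetric_sum_pairs) (use assms in \<open>simp add: symm_def wedge_commute\<close>)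
  then show ?thesis
    unfolding rel_def by (simp add: case_prod_unfold mult.assoc)
qed

lemma finite_pairs: "finite pairs"
  by (simp add: pairs_eq)

lemma symm_eq_zero:
  assumes "symm 4 r" "\<And>p. p \<in> pairs \<Longrightarrow> r (fst p) (snd p) = 0" "i < 4" "j < 4"
  shows "r i j = 0"
  using assms(1) assms(2)[of "(i, j)"] assms(2)[of "(j, i)"] assms(3,4)
  by (cases "i \<le> j") (auto simp: pairs_def symm_def)

lemma nondeg_nonzero:
  assumes "symm 4 q" "nondeg 4 q"
  obtains p where "p \<in> pairs" "q (fst p) (snd p) \<noteq> 0"
proof -
  have "\<not> (\<forall>i<4. \<forall>j<4. q i j = 0)"
    using assms(2)[unfolded nondeg_def, THEN spec, of "\<lambda>_. 1"] by force
  then show ?thesis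
    using symm_eq_zero[OF assms(1)] that by blast
qed

context six_space
begin

lemma ispoly_eval:
  assumes "\<And>x. w x \<in> ext2 s" "\<And>i j. i < 6 \<Longrightarrow> j < 6 \<Longrightarrow> ispoly N (\<lambda>x. co (w x) i j)"
  shows "ispoly N (\<lambda>x. w x t)"
proof -
  obtain f g where t: "t = (f, g)"
    by fastforce
  have "w x t = (if f \<in> D \<and> g \<in> D then \<Sum>i<6. \<Sum>j<6. co (w x) i j * (f (v i) * g (v j)) else 0)" for x
    unfolding t by (subst biv_co[OF assms(1), symmetric]) (simp add: biv_def)
  moreover have "ispoly N (\<lambda>x. if f \<in> D \<and> g \<in> D then \<Sum>i<6. \<Sum>j<6. co (w x) i j * (f (v i) * g (v j)) else 0)"
    by (intro poly_intros assms(2)) auto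
  ultimately show ?thesis
    by simp
qed

lemma variety_open:
  assumes ext: "\<And>x l. l < 4 \<Longrightarrow> w x l \<in> ext2 s"
    and poly: "\<And>l i j. l < 4 \<Longrightarrow> i < 6 \<Longrightarrow> j < 6 \<Longrightarrow> ispoly N (\<lambda>x. co (w x l) i j)"
    and D0: "ispoly N \<Delta>0"
    and q: "\<And>x. \<Delta>0 x \<noteq> 0 \<Longrightarrow> symm 4 (q x) \<and> nondeg 4 (q x) \<and> rel (w x) (q x)"
    and x0: "\<Delta>0 x0 \<noteq> 0" "H0 \<in> variety_V s" "frame_of 4 H0 (w x0)"
  obtains \<Delta> where "ispoly N \<Delta>" "\<Delta> x0 \<noteq> 0"
    "\<And>x. \<Delta> x \<noteq> 0 \<Longrightarrow> \<Delta>0 x \<noteq> 0 \<and> (\<exists>H\<in>variety_V s. frame_of 4 H (w x))"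
proof -
  interpret g0: grass_frame H0 "w x0" "ext2 s"
    by unfold_locales (use variety_Grass x0 in auto)
  obtain q0 where q0: "symm 4 q0" "nondeg 4 q0"
    and rel0: "\<And>r. symm 4 r \<Longrightarrow> rel (w x0) r \<Longrightarrow> \<exists>c. \<forall>i<4. \<forall>j<4. r i j = c * q0 i j"
    using x0(2) unfolding g0.variety_V_iff[OF refl] by blast
  obtain p0 where p0: "p0 \<in> pairs" "q0 (fst p0) (snd p0) \<noteq> 0"
    using nondeg_nonzero[OF q0] .
  define P where "P = pairs - {p0}"
  define f where "f x p t = wedge (w x (fst p)) (w x (snd p)) t" for x p t
  have lt: "fst p < 4 \<and> snd p < 4" if "p \<in> pairs" for p
    using that by (auto simp: pairs_def)
  have pairs: "pairs = insert p0 P" "p0 \<notin> P" "finite P"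
    using p0(1) finite_pairs by (auto simp: P_def)
  have ev: "ispoly N (\<lambda>x. w x l t)" if "l < 4" for l t
    by (rule ispoly_eval) (use ext poly that in auto)
  have f_poly: "ispoly N (\<lambda>x. f x p t)" if "p \<in> P" for p t
    using lt[of p] that pairs(1) unfolding f_def wedge_def
    by (cases t) (auto intro!: poly_intros ev)
  have f_ind: "\<forall>p\<in>P. c p = 0" if c: "\<And>t. (\<Sum>p\<in>P. c p * f x0 p t) = 0" for c
  proof -
    define r where "r i j = (if (min i j, max i j) \<in> P then c (min i j, max i j) else 0)
      / (if i = j then 1 else 2)" for i j
    have r: "(if fst p = snd p then 1 else 2) * r (fst p) (snd p) = (if p \<in> P then c p else 0)"
      if "p \<in> pairs" for p
      using that by (cases p) (auto simp: r_def pairs_def min_def max_def)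
    have "symm 4 r"
      by (simp add: symm_def r_def min.commute max.commute)
    moreover have "rel (w x0) r"
      unfolding rel_pairs[OF \<open>symm 4 r\<close>]
    proof
      fix t
      have "(\<Sum>p\<in>pairs. ((if fst p = snd p then 1 else 2) * r (fst p) (snd p)) * f x0 p t)
          = (\<Sum>p\<in>pairs. (if p \<in> P then c p else 0) * f x0 p t)"
        by (intro sum.cong refl) (simp only: r)
      also have "\<dots> = (\<Sum>p\<in>P. (if p \<in> P then c p else 0) * f x0 p t)"
        unfolding pairs(1) using pairs(2,3) by simp
      also have "\<dots> = 0"
        using c[of t] by simp
      finally show "(\<Sum>p\<in>pairs. ((if fst p = snd p then 1 else 2) * r (fst p) (snd p))
          * wedge (w x0 (fst p)) (w x0 (snd p)) t) = 0"
        by (simp only: f_def)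
    qed
    ultimately obtain \<kappa> where \<kappa>: "\<forall>i<4. \<forall>j<4. r i j = \<kappa> * q0 i j"
      using rel0 by blast
    have "r (fst p0) (snd p0) = 0"
      using r[OF p0(1)] pairs(2) by (simp split: if_splits)
    then have "\<kappa> = 0"
      using \<kappa> lt[OF p0(1)] p0(2) by simp
    then have z: "r i j = 0" if "i < 4" "j < 4" for i j
      using \<kappa> that by simp
    show ?thesis
      using r lt z pairs(1) by (metis insertI2 mult_zero_right)
  qed
  obtain \<Delta>1 where D1: "ispoly N \<Delta>1" "\<Delta>1 x0 \<noteq> 0"
    "\<And>x c p. \<Delta>1 x \<noteq> 0 \<Longrightarrow> (\<And>t. (\<Sum>p\<in>P. c p * f x p t) = 0) \<Longrightarrow> p \<in> P \<Longrightarrow> c p = 0"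
    by (rule independence_open[OF pairs(3), of N f x0]) (use f_poly f_ind that in blast)+
  have w_ind: "\<forall>l\<in>{..<4}. c l = 0" if "\<And>t. (\<Sum>l<4. c l * w x0 l t) = 0" for c
    using frame_independent[OF x0(3) that] by blast
  obtain \<Delta>2 where D2: "ispoly N \<Delta>2" "\<Delta>2 x0 \<noteq> 0"
    "\<And>x c l. \<Delta>2 x \<noteq> 0 \<Longrightarrow> (\<And>t. (\<Sum>l<4. c l * w x l t) = 0) \<Longrightarrow> l \<in> {..<4} \<Longrightarrow> c l = 0"
    by (rule independence_open[of "{..<4}" N w x0]) (use ev w_ind that in auto)
  show ?thesis
  proof (rule that[of "\<lambda>x. \<Delta>0 x * (\<Delta>1 x * \<Delta>2 x)"])
    show "ispoly N (\<lambda>x. \<Delta>0 x * (\<Delta>1 x * \<Delta>2 x))"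
      by (intro poly_intros D0 D1 D2)
    show "\<Delta>0 x0 * (\<Delta>1 x0 * \<Delta>2 x0) \<noteq> 0"
      using x0(1) D1(2) D2(2) by simp
    fix x assume "\<Delta>0 x * (\<Delta>1 x * \<Delta>2 x) \<noteq> 0"
    then have x: "\<Delta>0 x \<noteq> 0" "\<Delta>1 x \<noteq> 0" "\<Delta>2 x \<noteq> 0"
      by auto
    define H where "H = cfun.span (w x ` {..<4})"
    have ind: "inj_on (w x) {..<4}" "cfun.independent (w x ` {..<4})"
      using independent_family[of "{..<4}" "w x"] D2(3)[OF x(3)] by blast+
    have frame: "frame_of 4 H (w x)"
      using ind by (simp add: frame_of_def H_def)
    have "cfun.dim H = 4"
      using cfun.dim_eq_card_independent[OF ind(2)] card_image[OF ind(1)] by (simp add: H_def cfun.dim_span)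
    moreover have "H \<subseteq> ext2 s"
      unfolding H_def by (rule cfun.span_minimal) (use ext subspace_ext2 in auto)
    ultimately have "H \<in> Grass 4 (ext2 s)"
      by (simp add: Grass_def H_def)
    then interpret g: grass_frame H "w x" "ext2 s"
      by unfold_locales (use frame in auto)
    have zero: "r i j = 0" if r: "symm 4 r" "rel (w x) r" "r (fst p0) (snd p0) = 0" and ij: "i < 4" "j < 4" for r i j
    proof (rule symm_eq_zero[OF r(1) _ ij])
      fix p assume p: "p \<in> pairs"
      show "r (fst p) (snd p) = 0"
      proof (cases "p = p0")
        case False
        have "(\<Sum>p\<in>P. ((if fst p = snd p then 1 else 2) * r (fst p) (snd p)) * f x p t) = 0" for t
          using r(2)[unfolded rel_pairs[OF r(1)], THEN spec, of t] r(3) pairs(2,3)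
          unfolding pairs(1) f_def by simp
        moreover have "p \<in> P"
          using p False by (simp add: P_def)
        ultimately have "(if fst p = snd p then 1 else 2) * r (fst p) (snd p) = 0"
          by (rule D1(3)[OF x(2), of "\<lambda>p. (if fst p = snd p then 1 else 2) * r (fst p) (snd p)"])
        then show ?thesis
          by (simp split: if_splits)
      qed (simp add: r(3))
    qed
    have Q: "symm 4 (q x)" "nondeg 4 (q x)" "rel (w x) (q x)"
      using q[OF x(1)] by auto
    have q_p0: "q x (fst p0) (snd p0) \<noteq> 0"
      using zero[OF Q(1,3)] lt nondeg_nonzero[OF Q(1,2)] by metis
    have scale: "rel (w x) (\<lambda>i j. r i j + c * q x i j)" if "rel (w x) r" for r c
      using that Q(3) unfolding rel_def
      by (simp only: distrib_right sum.distrib mult.assoc sum_distrib_left[symmetric] mult_zero_right add_0_right) blast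
    have "H \<in> variety_V s"
      unfolding g.variety_V_iff[OF refl]
    proof (intro exI[of _ "q x"] conjI Q(1,2) allI impI iffI)
      fix r assume r: "symm 4 r" "rel (w x) r"
      define c where "c = r (fst p0) (snd p0) / q x (fst p0) (snd p0)"
      have "r i j + (- c) * q x i j = 0" if "i < 4" "j < 4" for i j
      proof (rule zero[OF _ scale[OF r(2)] _ that])
        show "symm 4 (\<lambda>i j. r i j + - c * q x i j)"
          using r(1) Q(1) by (simp add: symm_def)
      qed (use q_p0 in \<open>simp add: c_def\<close>)
      then show "\<exists>c. \<forall>i<4. \<forall>j<4. r i j = c * q x i j"
        by (intro exI[of _ c]) (simp add: add_eq_0_iff)
    next
      fix r assume "\<exists>c. \<forall>i<4. \<forall>j<4. r i j = c * q x i j"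
      then obtain c where c: "\<And>i j. i < 4 \<Longrightarrow> j < 4 \<Longrightarrow> r i j = c * q x i j"
        by blast
      have "(\<Sum>i<4. \<Sum>j<4. r i j * wedge (w x i) (w x j) t) = c * (\<Sum>i<4. \<Sum>j<4. q x i j * wedge (w x i) (w x j) t)" for t
        by (simp add: c sum_distrib_left mult.assoc)
      then show "rel (w x) r"
        using Q(3) unfolding rel_def by simp
    qed
    then show "\<Delta>0 x \<noteq> 0 \<and> (\<exists>H\<in>variety_V s. frame_of 4 H (w x))"
      using x(1) frame by blast
  qed
qed

sublocale V: grass_subset 4 "ext2 s" "variety_V s"
  by unfold_locales (auto simp: variety_V_def)

lemma variety_family:
  assumes ext: "\<And>x l. l < 4 \<Longrightarrow> w x l \<in> ext2 s"
    and poly: "\<And>l i j. l < 4 \<Longrightarrow> i < 6 \<Longrightarrow> j < 6 \<Longrightarrow> ispoly N (\<lambda>x. co (w x l) i j)"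
    and D0: "ispoly N \<Delta>0"
    and q: "\<And>x. \<Delta>0 x \<noteq> 0 \<Longrightarrow> symm 4 (q x) \<and> nondeg 4 (q x) \<and> rel (w x) (q x)"
  defines "E \<equiv> {x. \<Delta>0 x \<noteq> 0 \<and> (\<exists>H\<in>variety_V s. frame_of 4 H (w x))}"
  shows "V.family N E w" "zopen N UNIV E"
proof -
  obtain M where M: "\<And>d F. pluecker_form 4 (ext2 s) d F \<Longrightarrow> polyfun N (M * d) (\<lambda>x. F (w x))"
    by (rule pluecker_form_frame_poly[of w N]) (use ext poly that in auto)
  then show "V.family N E w"
    unfolding V.family_def E_def ispoly_def by blast
  show "zopen N UNIV E"
    unfolding zopen_def
  proof (intro conjI ballI)
    fix x0 assume "x0 \<in> E"
    then obtain H0 where x0: "\<Delta>0 x0 \<noteq> 0" "H0 \<in> variety_V s" "frame_of 4 H0 (w x0)"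
      by (auto simp: E_def)
    show "\<exists>\<Delta>. ispoly N \<Delta> \<and> \<Delta> x0 \<noteq> 0 \<and> (\<forall>z\<in>UNIV. \<Delta> z \<noteq> 0 \<longrightarrow> z \<in> E)"
    proof (rule variety_open[of w N \<Delta>0 q x0 H0])
      show "w x l \<in> ext2 s" if "l < 4" for x l
        by (rule ext[OF that])
      show "ispoly N (\<lambda>x. co (w x l) i j)" if "l < 4" "i < 6" "j < 6" for l i j
        by (rule poly[OF that])
      show "symm 4 (q x) \<and> nondeg 4 (q x) \<and> rel (w x) (q x)" if "\<Delta>0 x \<noteq> 0" for x
        by (rule q[OF that])
      fix \<Delta> assume "ispoly N \<Delta>" "\<Delta> x0 \<noteq> 0"
        "\<And>x. \<Delta> x \<noteq> 0 \<Longrightarrow> \<Delta>0 x \<noteq> 0 \<and> (\<exists>H\<in>variety_V s. frame_of 4 H (w x))"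
      then show ?thesis
        by (auto simp: E_def)
    qed (rule D0 x0)+
  qed simp
qed

end

section \<open>A dominating family and irreducibility\<close>

lemma star_skew: "i < 6 \<Longrightarrow> j < 6 \<Longrightarrow> star k j i = - star k i j"
  by (elim less_6_cases[THEN disjE] disjE) (simp_all only: star_table minus_minus minus_zero)

lemma skew_Mop:
  assumes "skew m"
  shows "skew (Mop m k)"
proof (rule skewI)
  fix i j :: nat assume ij: "i < 6" "j < 6"
  have "(\<Sum>a<6. \<Sum>b<6. m j a * star k a b * m b i) = (\<Sum>b<6. \<Sum>a<6. m j a * star k a b * m b i)"
    by (rule sum.swap)
  also have "\<dots> = (\<Sum>b<6. \<Sum>a<6. - (m i b * star k b a * m a j))"
  proof (intro sum.cong refl)
    fix a b assume "a \<in> {..<6::nat}" "b \<in> {..<6::nat}"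
    then have "m j a = - m a j" "m b i = - m i b" "star k a b = - star k b a"
      using skewD[OF assms, of j a] skewD[OF assms, of b i] star_skew[of b a k] ij by auto
    then show "m j a * star k a b * m b i = - (m i b * star k b a * m a j)"
      by simp
  qed
  finally show "Mop m k i j = - Mop m k j i"
    using skewD[OF assms ij] unfolding Mop_def by (simp add: sum_negf)
qed

lemma Mop_cong:
  assumes "\<And>a b c d. a < b \<Longrightarrow> b < c \<Longrightarrow> c < d \<Longrightarrow> d < 6 \<Longrightarrow> k a b c d = k' a b c d"
  shows "Mop m k = Mop m k'"
proof -
  have "star k = star k'" "t3 m k = t3 m k'"
    by (simp_all add: star_def[abs_def] t3_def assms)
  then show ?thesis
    by (intro ext) (simp add: Mop_def)
qed

definition Sk :: "(nat \<Rightarrow> complex) \<Rightarrow> nat \<Rightarrow> nat \<Rightarrow> nat \<Rightarrow> complex" where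
  "Sk y o' i j = y (o' + (6 * i + j)) - y (o' + (6 * j + i))"

lemma skew_Sk: "skew (Sk y k)"
  by (simp add: skewI Sk_def)

lemma ispoly_Sk: "k + 36 \<le> N \<Longrightarrow> i < 6 \<Longrightarrow> j < 6 \<Longrightarrow> ispoly N (\<lambda>y. Sk y k i j)"
  unfolding Sk_def by (intro poly_intros) auto

lemma ispoly_w4:
  assumes "\<And>i j. i < 6 \<Longrightarrow> j < 6 \<Longrightarrow> ispoly N (\<lambda>y. m y i j)" "\<And>i j. i < 6 \<Longrightarrow> j < 6 \<Longrightarrow> ispoly N (\<lambda>y. n y i j)"
    and "a < 6" "b < 6" "c < 6" "d < 6"
  shows "ispoly N (\<lambda>y. w4 (m y) (n y) a b c d)"
  unfolding w4_def using assms by (intro poly_intros) auto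

lemma ispoly_star:
  assumes "\<And>a b c d. a < 6 \<Longrightarrow> b < 6 \<Longrightarrow> c < 6 \<Longrightarrow> d < 6 \<Longrightarrow> ispoly N (\<lambda>y. k y a b c d)" "i < 6" "j < 6"
  shows "ispoly N (\<lambda>y. star (k y) i j)"
  using less_6_cases[OF assms(2)] less_6_cases[OF assms(3)]
  by (elim disjE) (simp_all add: star_table poly_intros assms(1) del: One_nat_def)

lemma ispoly_t3:
  assumes "\<And>i j. i < 6 \<Longrightarrow> j < 6 \<Longrightarrow> ispoly N (\<lambda>y. m y i j)"
    and "\<And>a b c d. a < 6 \<Longrightarrow> b < 6 \<Longrightarrow> c < 6 \<Longrightarrow> d < 6 \<Longrightarrow> ispoly N (\<lambda>y. k y a b c d)"
  shows "ispoly N (\<lambda>y. t3 (m y) (k y))"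
  unfolding t3_def by (intro poly_intros assms) auto

lemma ispoly_Pf:
  assumes "\<And>i j. i < 6 \<Longrightarrow> j < 6 \<Longrightarrow> ispoly N (\<lambda>y. m y i j)"
  shows "ispoly N (\<lambda>y. Pf (m y))"
  unfolding Pf_def by (intro poly_intros assms) auto

lemma ispoly_Mop:
  assumes "\<And>i j. i < 6 \<Longrightarrow> j < 6 \<Longrightarrow> ispoly N (\<lambda>y. m y i j)"
    and "\<And>a b c d. a < 6 \<Longrightarrow> b < 6 \<Longrightarrow> c < 6 \<Longrightarrow> d < 6 \<Longrightarrow> ispoly N (\<lambda>y. k y a b c d)" "i < 6" "j < 6"
  shows "ispoly N (\<lambda>y. Mop (m y) (k y) i j)"
  unfolding Mop_def by (intro poly_intros assms ispoly_star ispoly_t3) (use assms in auto)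

definition \<Phi>m :: "(nat \<Rightarrow> complex) \<Rightarrow> nat \<Rightarrow> nat \<Rightarrow> nat \<Rightarrow> complex" where
  "\<Phi>m y l = (if l = 0 then Sk y 0 else if l = 1 then Mop (Sk y 0) (w4 (Sk y 36) (Sk y 72))
     else if l = 2 then Sk y 36 else Sk y 72)"

lemma skew_Phi: "skew (\<Phi>m y l)"
  by (simp add: \<Phi>m_def skew_Sk skew_Mop)

lemma ispoly_Phi: "i < 6 \<Longrightarrow> j < 6 \<Longrightarrow> ispoly 108 (\<lambda>y. \<Phi>m y l i j)"
  unfolding \<Phi>m_def
  by (cases "l = 0"; cases "l = 1"; cases "l = 2")
     (simp_all add: ispoly_Sk ispoly_Mop ispoly_w4 del: One_nat_def)

text \<open>The quadratic form \<open>x\<^sub>0 x\<^sub>1 - p x\<^sub>2 x\<^sub>3\<close>, doubled.\<close>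

definition hypq :: "complex \<Rightarrow> nat \<Rightarrow> nat \<Rightarrow> complex" where
  "hypq p i j = (if i = 0 \<and> j = 1 \<or> i = 1 \<and> j = 0 then 1
     else if i = 2 \<and> j = 3 \<or> i = 3 \<and> j = 2 then - p else 0)"

lemma symm_hypq: "symm 4 (hypq p)"
  by (auto simp: symm_def hypq_def)

lemma nondeg_hypq:
  assumes "p \<noteq> 0"
  shows "nondeg 4 (hypq p)"
  unfolding nondeg_def
proof (intro allI impI)
  fix x :: "nat \<Rightarrow> complex" and i :: nat
  assume x: "\<forall>i<4. (\<Sum>j<4. hypq p i j * x j) = 0" and "i < 4"
  then show "x i = 0"
    using assms x[rule_format, of 0] x[rule_format, of 1] x[rule_format, of 2] x[rule_format, of 3]
      less_4_cases[OF \<open>i < 4\<close>] by (auto simp: sum_4 hypq_def)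
qed

context six_space
begin

definition \<Phi> :: "(nat \<Rightarrow> complex) \<Rightarrow> nat \<Rightarrow> 'v bivector" where
  "\<Phi> y l = biv (\<Phi>m y l)"

lemma co_Phi: "i < 6 \<Longrightarrow> j < 6 \<Longrightarrow> co (\<Phi> y l) i j = \<Phi>m y l i j"
  by (simp add: \<Phi>_def co_biv)

lemma w4_co_cong:
  assumes "\<And>i j. i < 6 \<Longrightarrow> j < 6 \<Longrightarrow> m i j = m' i j" "\<And>i j. i < 6 \<Longrightarrow> j < 6 \<Longrightarrow> n i j = n' i j"
    and "a < 6" "b < 6" "c < 6" "d < 6"
  shows "w4 m n a b c d = w4 m' n' a b c d"
  using assms by (simp add: w4_def)

lemma wedge_biv:
  assumes "a < b" "b < c" "c < d" "d < 6"
  shows "wedge (biv m) (biv n) (e a, e b, e c, e d) = w4 m n a b c d"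
proof -
  have "wedge (biv m) (biv n) (e a, e b, e c, e d) = w4 (co (biv m)) (co (biv n)) a b c d"
    by (simp add: wedge_mt co_mt)
  also have "\<dots> = w4 m n a b c d"
    by (rule w4_co_cong) (use assms co_biv in auto)
  finally show ?thesis .
qed

lemma rel_Phi: "rel (\<Phi> y) (hypq (2 * Pf (Sk y 0)))"
proof -
  have "(\<Sum>i<(2::nat). (if i = 0 then 1 else - (2 * Pf (Sk y 0))) * wedge (\<Phi> y (2 * i)) (\<Phi> y (2 * i + 1)) t) = 0" for t
  proof (rule wedge_sum_zero)
    show "\<Phi> y (2 * i) \<in> ext2 s" "\<Phi> y (2 * i + 1) \<in> ext2 s" for i
      by (simp_all only: \<Phi>_def biv_ext2 skew_Phi)
    fix a b c d :: nat assume *: "a < b" "b < c" "c < d" "d < 6"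
    have "wedge (\<Phi> y 0) (\<Phi> y 1) (e a, e b, e c, e d) = 2 * Pf (Sk y 0) * w4 (Sk y 36) (Sk y 72) a b c d"
      unfolding \<Phi>_def wedge_biv[OF *] using wedge_Mop[OF skew_Sk * ] by (simp add: \<Phi>m_def)
    moreover have "wedge (\<Phi> y 2) (\<Phi> y 3) (e a, e b, e c, e d) = w4 (Sk y 36) (Sk y 72) a b c d"
      unfolding \<Phi>_def wedge_biv[OF *] by (simp add: \<Phi>m_def)
    ultimately show "(\<Sum>i<(2::nat). (if i = 0 then 1 else - (2 * Pf (Sk y 0)))
        * wedge (\<Phi> y (2 * i)) (\<Phi> y (2 * i + 1)) (e a, e b, e c, e d)) = 0"
      by (simp add: eval_nat_numeral)
  qed
  then have "wedge (\<Phi> y 0) (\<Phi> y 1) t = 2 * Pf (Sk y 0) * wedge (\<Phi> y 2) (\<Phi> y 3) t" for t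
    by (simp add: eval_nat_numeral)
  then show ?thesis
    unfolding rel_def sum_4 hypq_def using wedge_commute[of "\<Phi> y 1" "\<Phi> y 0"] wedge_commute[of "\<Phi> y 3" "\<Phi> y 2"]
    by simp
qed

definition E\<Phi> :: "(nat \<Rightarrow> complex) set" where
  "E\<Phi> = {y. Pf (Sk y 0) \<noteq> 0 \<and> (\<exists>H\<in>variety_V s. frame_of 4 H (\<Phi> y))}"

lemma family_Phi: "V.family 108 E\<Phi> \<Phi>" "zopen 108 UNIV E\<Phi>"
proof -
  have ext: "\<Phi> y l \<in> ext2 s" for y l
    by (simp add: \<Phi>_def biv_ext2 skew_Phi)
  have poly: "ispoly 108 (\<lambda>y. co (\<Phi> y l) i j)" if "i < 6" "j < 6" for l i j
    using that by (simp add: co_Phi ispoly_Phi)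
  have D0: "ispoly 108 (\<lambda>y. Pf (Sk y 0))"
    by (intro ispoly_Pf ispoly_Sk) auto
  have q: "symm 4 (hypq (2 * Pf (Sk y 0))) \<and> nondeg 4 (hypq (2 * Pf (Sk y 0)))
      \<and> rel (\<Phi> y) (hypq (2 * Pf (Sk y 0)))" if "Pf (Sk y 0) \<noteq> 0" for y
    using that by (simp add: symm_hypq nondeg_hypq rel_Phi)
  show "V.family 108 E\<Phi> \<Phi>" "zopen 108 UNIV E\<Phi>"
    unfolding E\<Phi>_def
    by (rule variety_family[of \<Phi> 108 "\<lambda>y. Pf (Sk y 0)" "\<lambda>y. hypq (2 * Pf (Sk y 0))"]; (rule ext poly D0 q; assumption))+
qed

lemma Phi_surjective:
  assumes H: "H \<in> variety_V s"
  shows "\<exists>y\<in>E\<Phi>. frame_of 4 H (\<Phi> y)"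
proof -
  obtain h where h: "hyper H h" and pf: "Pf (co (h 0)) \<noteq> 0"
    using nondegenerate_hyper_frame[OF H] by blast
  have fr: "frame_of 4 H h"
    using h by (simp add: hyper_def)
  have ext: "h l \<in> ext2 s" if "l < 4" for l
    using frame_ext2[OF H fr that] .
  have sk: "skew (co (h l))" if "l < 4" for l
    using skew_co[OF ext[OF that]] .
  define y where "y n = (if n < 36 then co (h 0) (n div 6) (n mod 6)
    else if n < 72 then co (h 2) ((n - 36) div 6) ((n - 36) mod 6)
    else co (h 3) ((n - 72) div 6) ((n - 72) mod 6)) / 2" for n
  have dm: "(6 * i + j) div 6 = i" "(6 * i + j) mod 6 = j" if "j < 6" for i j :: nat
    using that by auto
  have S: "Sk y 0 i j = co (h 0) i j" "Sk y 36 i j = co (h 2) i j" "Sk y 72 i j = co (h 3) i j" if "i < 6" "j < 6" for i j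
    using that skewD[OF sk[of 0], of j i] skewD[OF sk[of 2], of j i] skewD[OF sk[of 3], of j i]
    by (simp_all add: Sk_def y_def dm)
  have Pf_eq: "Pf (Sk y 0) = Pf (co (h 0))"
    by (simp add: Pf_def S del: One_nat_def)
  have w4_eq: "w4 (Sk y 36) (Sk y 72) a b c d = w4 (co (h 0)) (co (h 1)) a b c d"
    if *: "a < b" "b < c" "c < d" "d < 6" for a b c d
  proof -
    have "w4 (Sk y 36) (Sk y 72) a b c d = w4 (co (h 2)) (co (h 3)) a b c d"
      by (rule w4_co_cong) (use * S in auto)
    also have "\<dots> = w4 (co (h 0)) (co (h 1)) a b c d"
      using h unfolding hyper_def co_mt wedge_mt[symmetric] by simp
    finally show ?thesis .
  qed
  have M1: "Mop (Sk y 0) (w4 (Sk y 36) (Sk y 72)) i j = 2 * Pf (co (h 0)) * co (h 1) i j" if "i < 6" "j < 6" for i j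
  proof -
    have M: "Mop (Sk y 0) (w4 (Sk y 36) (Sk y 72)) = Mop (Sk y 0) (w4 (Sk y 0) (co (h 1)))"
    proof (rule Mop_cong)
      fix a b c d :: nat assume *: "a < b" "b < c" "c < d" "d < 6"
      have "w4 (Sk y 0) (co (h 1)) a b c d = w4 (co (h 0)) (co (h 1)) a b c d"
        by (rule w4_co_cong) (use * S in auto)
      then show "w4 (Sk y 36) (Sk y 72) a b c d = w4 (Sk y 0) (co (h 1)) a b c d"
        using w4_eq[OF *] by simp
    qed
    have upper: "Mop (Sk y 0) (w4 (Sk y 36) (Sk y 72)) i j = 2 * Pf (co (h 0)) * co (h 1) i j"
      if "i < j" "j < 6" for i j
      unfolding M using Mop_wedge[OF skew_Sk sk[of 1] that] Pf_eq by simp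
    have s1: "skew (co (h 1))"
      by (rule sk) simp
    consider "i < j" | "i = j" | "j < i" by linarith
    then show ?thesis
    proof cases
      case 2
      then show ?thesis
        using skewD[OF skew_Mop[OF skew_Sk], OF that] skewD[OF s1 that] by simp
    next
      case 3
      then show ?thesis
        using skewD[OF skew_Mop[OF skew_Sk], OF that] skewD[OF s1 that] upper[OF 3] that by simp
    qed (use upper that in auto)
  qed
  have biv_h: "biv (co (h l)) = h l" if "l < 4" for l
    using biv_co[OF ext[OF that]] .
  have P: "\<Phi> y 0 = h 0" "\<Phi> y 2 = h 2" "\<Phi> y 3 = h 3"
    unfolding \<Phi>_def \<Phi>m_def
    using biv_cong[of "Sk y 0" "co (h 0)"] biv_cong[of "Sk y 36" "co (h 2)"] biv_cong[of "Sk y 72" "co (h 3)"]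
    by (simp_all add: S biv_h)
  have P1: "\<Phi> y 1 t = 2 * Pf (co (h 0)) * h 1 t" for t
  proof -
    have "\<Phi> y 1 = biv (\<lambda>i j. 2 * Pf (co (h 0)) * co (h 1) i j)"
      unfolding \<Phi>_def \<Phi>m_def by (simp, intro biv_cong) (simp add: M1)
    moreover have "biv (\<lambda>i j. 2 * Pf (co (h 0)) * co (h 1) i j) t = 2 * Pf (co (h 0)) * biv (co (h 1)) t"
      by (simp add: biv_def sum_distrib_left mult.assoc split: prod.split)
    ultimately show ?thesis
      by (simp add: biv_h)
  qed
  define c where "c l = (if l = 1 then 2 * Pf (co (h 0)) else 1)" for l :: nat
  have c0: "c l \<noteq> 0" for l
    using pf by (simp add: c_def)
  have Ph: "\<Phi> y l t = c l * h l t" if "l < 4" for l t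
    using less_4_cases[OF that] P P1 by (elim disjE) (simp_all only: c_def, simp_all)
  have "frame_of 4 H (\<Phi> y)"
  proof (rule frame_change[OF variety_Grass[OF H] fr])
    show "\<Phi> y k t = (\<Sum>l<4. (if l = k then c k else 0) * h l t)" if "k < 4" for k t
      using Ph[OF that] less_4_cases[OF that] by (elim disjE) (simp_all add: sum_4)
    show "h k t = (\<Sum>l<4. (if l = k then 1 / c k else 0) * \<Phi> y l t)" if "k < 4" for k t
      using Ph[OF that] less_4_cases[OF that] c0[of k] by (elim disjE) (simp_all add: sum_4)
  qed
  moreover have "y \<in> E\<Phi>"
    using calculation H pf Pf_eq unfolding E\<Phi>_def by auto
  ultimately show ?thesis
    by blast
qed

lemma irreducible_variety:
  assumes "H0 \<in> variety_V s"
  shows "irreducible_space (variety_V_top s)"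
proof -
  have "irreducible_space V.X"
  proof (rule V.irreducible_X[OF family_Phi line_closed_UNIV])
    show "E\<Phi> \<noteq> {}"
      using Phi_surjective[OF assms] by blast
    show "variety_V s \<subseteq> V.members E\<Phi> \<Phi>"
      using Phi_surjective by (auto simp: V.members_def)
  qed
  then show ?thesis
    by (simp add: variety_V_top_def)
qed

end

section \<open>Matrices of size three\<close>

lemma sum_3: "(\<Sum>i<3. f i) = f 0 + f 1 + f (2 :: nat)"
  by (simp add: eval_nat_numeral)

lemma less_3_cases: "(i :: nat) < 3 \<Longrightarrow> i = 0 \<or> i = 1 \<or> i = 2"
  by linarith

definition nx :: "nat \<Rightarrow> nat" where
  "nx i = (if i = 0 then 1 else if i = 1 then 2 else 0)"

lemma nx: "nx 0 = 1" "nx 1 = 2" "nx 2 = 0"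
  by (simp_all add: nx_def)

definition adj3 :: "(nat \<Rightarrow> nat \<Rightarrow> complex) \<Rightarrow> nat \<Rightarrow> nat \<Rightarrow> complex" where
  "adj3 M i j = M (nx j) (nx i) * M (nx (nx j)) (nx (nx i)) - M (nx j) (nx (nx i)) * M (nx (nx j)) (nx i)"

definition det3 :: "(nat \<Rightarrow> nat \<Rightarrow> complex) \<Rightarrow> complex" where
  "det3 M = (\<Sum>k<3. M 0 k * adj3 M k 0)"

lemma adj3_table:
  "adj3 M 0 0 = M 1 1 * M 2 2 - M 1 2 * M 2 1" "adj3 M 0 1 = M 2 1 * M 0 2 - M 2 2 * M 0 1"
  "adj3 M 0 2 = M 0 1 * M 1 2 - M 0 2 * M 1 1" "adj3 M 1 0 = M 1 2 * M 2 0 - M 1 0 * M 2 2"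
  "adj3 M 1 1 = M 2 2 * M 0 0 - M 2 0 * M 0 2" "adj3 M 1 2 = M 0 2 * M 1 0 - M 0 0 * M 1 2"
  "adj3 M 2 0 = M 1 0 * M 2 1 - M 1 1 * M 2 0" "adj3 M 2 1 = M 2 0 * M 0 1 - M 2 1 * M 0 0"
  "adj3 M 2 2 = M 0 0 * M 1 1 - M 0 1 * M 1 0"
  by (simp_all only: adj3_def nx)

lemma adj3_right: "i < 3 \<Longrightarrow> j < 3 \<Longrightarrow> (\<Sum>k<3. M i k * adj3 M k j) = (if i = j then det3 M else 0)"
  by (elim less_3_cases[THEN disjE] disjE)
     (simp_all add: sum_3 adj3_table det3_def algebra_simps del: One_nat_def)

lemma adj3_left: "i < 3 \<Longrightarrow> j < 3 \<Longrightarrow> (\<Sum>k<3. adj3 M i k * M k j) = (if i = j then det3 M else 0)"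
  by (elim less_3_cases[THEN disjE] disjE)
     (simp_all add: sum_3 adj3_table det3_def algebra_simps del: One_nat_def)

lemma adj3_symm: "(\<And>i j. i < 3 \<Longrightarrow> j < 3 \<Longrightarrow> M i j = M j i) \<Longrightarrow> i < 3 \<Longrightarrow> j < 3 \<Longrightarrow> adj3 M i j = adj3 M j i"
  by (simp add: adj3_def nx_def mult.commute)

lemma sum_apply_inverse:
  fixes P Q :: "nat \<Rightarrow> nat \<Rightarrow> complex"
  assumes "\<And>j. j < n \<Longrightarrow> (\<Sum>k<n. Q i k * P k j) = (if i = j then c else 0)" "i < n"
  shows "(\<Sum>k<n. Q i k * (\<Sum>j<n. P k j * x j)) = c * x i"
proof -
  have "(\<Sum>k<n. Q i k * (\<Sum>j<n. P k j * x j)) = (\<Sum>k<n. \<Sum>j<n. Q i k * P k j * x j)"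
    by (simp add: sum_distrib_left mult.assoc)
  also have "\<dots> = (\<Sum>j<n. \<Sum>k<n. Q i k * P k j * x j)"
    by (rule sum.swap)
  also have "\<dots> = (\<Sum>j<n. (\<Sum>k<n. Q i k * P k j) * x j)"
    by (simp add: sum_distrib_right)
  also have "\<dots> = (\<Sum>j<n. if i = j then c * x j else 0)"
    by (intro sum.cong refl) (simp add: assms(1))
  also have "\<dots> = c * x i"
    using assms(2) by simp
  finally show ?thesis .
qed

section \<open>The relation in block form\<close>

text \<open>
  Split the six coordinates into two triples. Suppose that the components of \<open>h\<^sub>0, h\<^sub>1, h\<^sub>2\<close> in the
  exterior square of the first triple form the standard basis, and that those of \<open>g\<close> vanish. Then
  \<open>\<Sum> Q\<^sub>i\<^sub>j h\<^sub>i h\<^sub>j + g\<^sup>2 = 0\<close> is a system of equations for \<open>h'\<^sub>i = \<Sum> Q\<^sub>i\<^sub>j h\<^sub>j\<close> that can be solved step by step: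
  three linear equations for the mixed components, explicit formulas for the last components of \<open>h'\<close>, and
  three linear equations for the last component of \<open>g\<close>.
\<close>

locale block_frame =
  fixes h h' :: "nat \<Rightarrow> nat \<Rightarrow> nat \<Rightarrow> complex" and g :: "nat \<Rightarrow> nat \<Rightarrow> complex" and Q :: "nat \<Rightarrow> nat \<Rightarrow> complex"
  assumes Q: "i < 3 \<Longrightarrow> j < 3 \<Longrightarrow> Q i j = Q j i"
    and h': "i < 3 \<Longrightarrow> a < b \<Longrightarrow> b < 6 \<Longrightarrow> h' i a b = (\<Sum>j<3. Q i j * h j a b)"
    and h01: "i < 3 \<Longrightarrow> h i 0 1 = (if i = 2 then 1 else 0)"
    and h02: "i < 3 \<Longrightarrow> h i 0 2 = (if i = 1 then -1 else 0)"
    and h12: "i < 3 \<Longrightarrow> h i 1 2 = (if i = 0 then 1 else 0)"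
    and g0: "g 0 1 = 0" "g 0 2 = 0" "g 1 2 = 0"
begin

definition T :: "nat \<Rightarrow> nat \<Rightarrow> nat \<Rightarrow> nat \<Rightarrow> complex" where
  "T a b c d = (\<Sum>i<3. h i a b * h' i c d)"

lemma T_symm: "a < b \<Longrightarrow> b < 6 \<Longrightarrow> c < d \<Longrightarrow> d < 6 \<Longrightarrow> T a b c d = T c d a b"
proof -
  assume *: "a < b" "b < 6" "c < d" "d < 6"
  have "T a b c d = (\<Sum>i<3. \<Sum>j<3. h i a b * (Q i j * h j c d))"
    unfolding T_def by (simp add: h' * sum_distrib_left)
  also have "\<dots> = (\<Sum>j<3. \<Sum>i<3. h i a b * (Q i j * h j c d))"
    by (rule sum.swap)
  also have "\<dots> = (\<Sum>j<3. h j c d * (\<Sum>i<3. Q j i * h i a b))"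
    unfolding sum_distrib_left by (intro sum.cong refl) (simp add: Q[of _ _] Q mult.left_commute mult.commute)
  also have "\<dots> = T c d a b"
    unfolding T_def by (simp add: h' *)
  finally show ?thesis .
qed

lemma T_table:
  shows "T 0 1 c d = h' 2 c d" "T 0 2 c d = - h' 1 c d" "T 1 2 c d = h' 0 c d"
  unfolding T_def sum_3 using h01[of 0] h01[of 1] h01[of 2] h02[of 0] h02[of 1] h02[of 2]
    h12[of 0] h12[of 1] h12[of 2] by simp_all

definition E :: "nat \<Rightarrow> nat \<Rightarrow> nat \<Rightarrow> nat \<Rightarrow> complex" where
  "E a b c d = (\<Sum>i<3. w4 (h i) (h' i) a b c d) + w4 g g a b c d"

lemma E_T:
  assumes "a < b" "b < c" "c < d" "d < 6"
  shows "E a b c d = 2 * (T a b c d - T a c b d + T a d b c + (g a b * g c d - g a c * g b d + g a d * g b c))"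
proof -
  have "E a b c d = T a b c d + T c d a b - (T a c b d + T b d a c) + (T a d b c + T b c a d)
      + 2 * (g a b * g c d - g a c * g b d + g a d * g b c)"
    unfolding E_def T_def w4_def sum_3 by (simp add: algebra_simps)
  then show ?thesis
    using T_symm[of c d a b] T_symm[of b d a c] T_symm[of b c a d] assms by simp
qed

definition N :: "nat \<Rightarrow> nat \<Rightarrow> nat \<Rightarrow> nat \<Rightarrow> complex" where
  "N a b c d = T a c b d - T a d b c + (g a c * g b d - g a d * g b c)"

definition L :: "nat \<Rightarrow> complex" where
  "L k = T k 3 4 5 - T k 4 3 5 + T k 5 3 4 + (g k 3 * g 4 5 - g k 4 * g 3 5 + g k 5 * g 3 4)"

lemma E_first: "3 \<le> d \<Longrightarrow> d < 6 \<Longrightarrow> E 0 1 2 d = 2 * (h' 2 2 d + h' 1 1 d + h' 0 0 d)"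
  using E_T[of 0 1 2 d] T_symm[of 0 d 1 2] T_table[of 2 d] T_table[of 1 d] T_table[of 0 d] g0
  by (simp del: One_nat_def)

lemma E_middle:
  assumes "3 \<le> c" "c < d" "d < 6"
  shows "E 0 1 c d = 2 * (h' 2 c d - N 0 1 c d)" "E 0 2 c d = 2 * (- h' 1 c d - N 0 2 c d)"
    "E 1 2 c d = 2 * (h' 0 c d - N 1 2 c d)"
  using E_T[of 0 1 c d] E_T[of 0 2 c d] E_T[of 1 2 c d] T_table[of c d] g0 assms
  by (simp_all add: N_def del: One_nat_def)

lemma E_last: "k < 3 \<Longrightarrow> E k 3 4 5 = 2 * L k"
  using E_T[of k 3 4 5] by (simp add: L_def)

lemma E_zero_iff:
  "(\<forall>a b c d. a < b \<longrightarrow> b < c \<longrightarrow> c < d \<longrightarrow> d < 6 \<longrightarrow> E a b c d = 0) \<longleftrightarrow>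
    (\<forall>d. 3 \<le> d \<longrightarrow> d < 6 \<longrightarrow> h' 0 0 d + h' 1 1 d + h' 2 2 d = 0) \<and>
    (\<forall>c d. 3 \<le> c \<longrightarrow> c < d \<longrightarrow> d < 6 \<longrightarrow> h' 0 c d = N 1 2 c d \<and> h' 1 c d = - N 0 2 c d \<and> h' 2 c d = N 0 1 c d) \<and>
    (\<forall>k<3. L k = 0)" (is "?E \<longleftrightarrow> ?F \<and> ?M \<and> ?L")
proof
  assume E: ?E
  have ?F
  proof (intro allI impI)
    fix d :: nat assume d: "3 \<le> d" "d < 6"
    have "E 0 1 2 d = 0"
      using E d by simp
    then show "h' 0 0 d + h' 1 1 d + h' 2 2 d = 0"
      unfolding E_first[OF d] by Groebner_Basis.algebra
  qed
  moreover have ?M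
  proof (intro allI impI)
    fix c d :: nat assume cd: "3 \<le> c" "c < d" "d < 6"
    have "E 0 1 c d = 0" "E 0 2 c d = 0" "E 1 2 c d = 0"
      using E cd by simp_all
    then show "h' 0 c d = N 1 2 c d \<and> h' 1 c d = - N 0 2 c d \<and> h' 2 c d = N 0 1 c d"
      unfolding E_middle[OF cd] by (intro conjI; Groebner_Basis.algebra)
  qed
  moreover have ?L
  proof (intro allI impI)
    fix k :: nat assume k: "k < 3"
    have "E k 3 4 5 = 0"
      using E k by simp
    then show "L k = 0"
      unfolding E_last[OF k] by simp
  qed
  ultimately show "?F \<and> ?M \<and> ?L"
    by blast
next
  assume FML: "?F \<and> ?M \<and> ?L"
  have F: "E 0 1 2 d = 0" if "3 \<le> d" "d < 6" for d
    unfolding E_first[OF that] using FML that by (simp add: algebra_simps)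
  have M: "E 0 1 c d = 0" "E 0 2 c d = 0" "E 1 2 c d = 0" if "3 \<le> c" "c < d" "d < 6" for c d
    unfolding E_middle[OF that] using FML that by simp_all
  have L: "E k 3 4 5 = 0" if "k < 3" for k
    unfolding E_last[OF that] using FML that by simp
  show ?E
  proof (intro allI impI)
    fix a b c d :: nat assume *: "a < b" "b < c" "c < d" "d < 6"
    then have "a = 0 \<and> b = 1 \<and> c = 2 \<and> 3 \<le> d \<or> (a = 0 \<and> b = 1 \<or> a = 0 \<and> b = 2 \<or> a = 1 \<and> b = 2) \<and> 3 \<le> c
        \<or> a < 3 \<and> b = 3 \<and> c = 4 \<and> d = 5"
      by presburger
    then show "E a b c d = 0"
      using F[of d] M[of c d] L[of a] * by blast
  qed
qed

end

section \<open>A rational parametrisation\<close>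

definition mk :: "(nat \<Rightarrow> complex) \<Rightarrow> nat \<Rightarrow> nat \<Rightarrow> complex" where
  "mk c a b = (if a = 0 \<and> b = 1 then c 2 else if a = 0 \<and> b = 2 then - c 1 else if a = 1 \<and> b = 2 then c 0 else 0)"

definition vc :: "(nat \<Rightarrow> nat \<Rightarrow> complex) \<Rightarrow> nat \<Rightarrow> complex" where
  "vc m l = (if l = 0 then m 1 2 else if l = 1 then - m 0 2 else m 0 1)"

lemma vc_mk: "l < 3 \<Longrightarrow> vc (mk c) l = c l"
  by (elim less_3_cases[THEN disjE] disjE) (simp_all add: vc_def mk_def)

lemma mk_vc: "a < b \<Longrightarrow> b < 3 \<Longrightarrow> mk (vc m) a b = m a b"
proof -
  assume "a < b" "b < 3"
  then have "a = 0 \<and> b = 1 \<or> a = 0 \<and> b = 2 \<or> a = 1 \<and> b = 2"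
    by linarith
  then show ?thesis
    by (elim disjE conjE) (simp_all add: vc_def mk_def)
qed

definition bm :: "(nat \<Rightarrow> complex) \<Rightarrow> (nat \<Rightarrow> nat \<Rightarrow> complex) \<Rightarrow> (nat \<Rightarrow> nat \<Rightarrow> complex) \<Rightarrow> nat \<Rightarrow> nat \<Rightarrow> complex" where
  "bm \<alpha> \<beta> \<gamma> a b = (let u = (\<lambda>a b. if b < 3 then mk \<alpha> a b else if a < 3 then \<beta> a (b - 3) else \<gamma> (a - 3) (b - 3))
     in if a < b then u a b else if b < a then - u b a else 0)"

lemma skew_bm: "skew (bm \<alpha> \<beta> \<gamma>)"
  by (simp add: skewI bm_def Let_def)

lemma bm_blocks:
  "a < b \<Longrightarrow> b < 3 \<Longrightarrow> bm \<alpha> \<beta> \<gamma> a b = mk \<alpha> a b"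
  "a < 3 \<Longrightarrow> 3 \<le> b \<Longrightarrow> bm \<alpha> \<beta> \<gamma> a b = \<beta> a (b - 3)"
  "3 \<le> a \<Longrightarrow> a < b \<Longrightarrow> bm \<alpha> \<beta> \<gamma> a b = \<gamma> (a - 3) (b - 3)"
  by (simp_all add: bm_def)

definition PP :: "(nat \<Rightarrow> complex) \<Rightarrow> nat \<Rightarrow> nat \<Rightarrow> complex" where
  "PP x i j = x (min i j * (5 - min i j) div 2 + max i j)"

definition XX :: "(nat \<Rightarrow> complex) \<Rightarrow> nat \<Rightarrow> nat \<Rightarrow> nat \<Rightarrow> complex" where
  "XX x i k l = (if k = 0 \<and> l = 0 then 0 else x (6 + 8 * i + (3 * k + l - 1)))"

definition BB :: "(nat \<Rightarrow> complex) \<Rightarrow> nat \<Rightarrow> nat \<Rightarrow> complex" where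
  "BB x k l = (if k = 0 \<and> l = 0 then 1 else x (30 + (3 * k + l - 1)))"

definition YY :: "(nat \<Rightarrow> complex) \<Rightarrow> nat \<Rightarrow> nat \<Rightarrow> nat \<Rightarrow> complex" where
  "YY x i k l = (\<Sum>j<3. adj3 (PP x) i j * XX x j k l)"

definition be' :: "(nat \<Rightarrow> complex) \<Rightarrow> nat \<Rightarrow> nat \<Rightarrow> nat \<Rightarrow> complex" where
  "be' x i k l = YY x i k l - (if k = l then \<Sum>j<3. YY x j j i else 0)"

definition be :: "(nat \<Rightarrow> complex) \<Rightarrow> nat \<Rightarrow> nat \<Rightarrow> nat \<Rightarrow> complex" where
  "be x i k l = (\<Sum>j<3. PP x i j * be' x j k l)"

definition NN :: "(nat \<Rightarrow> nat \<Rightarrow> nat \<Rightarrow> complex) \<Rightarrow> (nat \<Rightarrow> nat \<Rightarrow> nat \<Rightarrow> complex) \<Rightarrow> (nat \<Rightarrow> nat \<Rightarrow> complex) \<Rightarrow>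
    nat \<Rightarrow> nat \<Rightarrow> nat \<Rightarrow> nat \<Rightarrow> complex" where
  "NN \<beta> \<beta>' b p q c d = (\<Sum>i<3. \<beta> i p c * \<beta>' i q d) - (\<Sum>i<3. \<beta> i p d * \<beta>' i q c) + (b p c * b q d - b p d * b q c)"

definition ga' :: "(nat \<Rightarrow> complex) \<Rightarrow> nat \<Rightarrow> nat \<Rightarrow> nat \<Rightarrow> complex" where
  "ga' x i c d = vc (\<lambda>p q. NN (be x) (be' x) (BB x) p q c d) i"

definition ga :: "(nat \<Rightarrow> complex) \<Rightarrow> nat \<Rightarrow> nat \<Rightarrow> nat \<Rightarrow> complex" where
  "ga x i c d = (\<Sum>j<3. PP x i j * ga' x j c d)"

definition SS :: "(nat \<Rightarrow> complex) \<Rightarrow> nat \<Rightarrow> complex" where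
  "SS x k = (\<Sum>i<3. \<Sum>l<3. be x i k l * vc (ga' x i) l)"

definition g4 :: "(nat \<Rightarrow> complex) \<Rightarrow> nat \<Rightarrow> complex" where
  "g4 x l = - (\<Sum>k<3. adj3 (BB x) l k * SS x k)"

definition \<psi>m :: "(nat \<Rightarrow> complex) \<Rightarrow> nat \<Rightarrow> nat \<Rightarrow> nat \<Rightarrow> complex" where
  "\<psi>m x l = (if l < 3 then bm (\<lambda>r. if r = l then 1 else 0) (be x l) (ga x l)
     else bm (\<lambda>_. 0) (\<lambda>p c. det3 (BB x) * BB x p c) (mk (g4 x)))"

lemma skew_psi: "skew (\<psi>m x l)"
  by (simp add: \<psi>m_def skew_bm)

lemma PP_symm: "PP x i j = PP x j i"
  by (simp add: PP_def min.commute max.commute)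

lemma ispoly_adj3: "(\<And>i j. i < 3 \<Longrightarrow> j < 3 \<Longrightarrow> ispoly K (\<lambda>x. M x i j)) \<Longrightarrow> ispoly K (\<lambda>x. adj3 (M x) i j)"
  unfolding adj3_def by (intro poly_intros) (auto simp: nx_def)

lemma ispoly_det3: "(\<And>i j. i < 3 \<Longrightarrow> j < 3 \<Longrightarrow> ispoly K (\<lambda>x. M x i j)) \<Longrightarrow> ispoly K (\<lambda>x. det3 (M x))"
  unfolding det3_def by (intro poly_intros ispoly_adj3) auto

lemma ispoly_PP: "i < 3 \<Longrightarrow> j < 3 \<Longrightarrow> ispoly 38 (\<lambda>x. PP x i j)"
proof -
  assume "i < 3" "j < 3"
  then have "min i j * (5 - min i j) div 2 + max i j < 38"
    by (elim less_3_cases[THEN disjE] disjE) simp_all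
  then show ?thesis
    unfolding PP_def by (rule ispoly_var)
qed

lemma ispoly_XX: "i < 3 \<Longrightarrow> k < 3 \<Longrightarrow> l < 3 \<Longrightarrow> ispoly 38 (\<lambda>x. XX x i k l)"
  unfolding XX_def by (intro poly_intros) auto

lemma ispoly_BB: "k < 3 \<Longrightarrow> l < 3 \<Longrightarrow> ispoly 38 (\<lambda>x. BB x k l)"
  unfolding BB_def by (intro poly_intros) auto

lemma ispoly_YY: "i < 3 \<Longrightarrow> k < 3 \<Longrightarrow> l < 3 \<Longrightarrow> ispoly 38 (\<lambda>x. YY x i k l)"
  unfolding YY_def by (intro poly_intros ispoly_adj3 ispoly_PP ispoly_XX) auto

lemma ispoly_be': "i < 3 \<Longrightarrow> k < 3 \<Longrightarrow> l < 3 \<Longrightarrow> ispoly 38 (\<lambda>x. be' x i k l)"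
  unfolding be'_def by (intro poly_intros ispoly_YY) auto

lemma ispoly_be: "i < 3 \<Longrightarrow> k < 3 \<Longrightarrow> l < 3 \<Longrightarrow> ispoly 38 (\<lambda>x. be x i k l)"
  unfolding be_def by (intro poly_intros ispoly_PP ispoly_be') auto

lemma ispoly_ga': "c < 3 \<Longrightarrow> d < 3 \<Longrightarrow> ispoly 38 (\<lambda>x. ga' x i c d)"
  unfolding ga'_def vc_def NN_def
  by (cases "i = 0"; cases "i = 1") (auto intro!: poly_intros ispoly_be ispoly_be' ispoly_BB)

lemma ispoly_ga: "i < 3 \<Longrightarrow> c < 3 \<Longrightarrow> d < 3 \<Longrightarrow> ispoly 38 (\<lambda>x. ga x i c d)"
  unfolding ga_def by (intro poly_intros ispoly_PP ispoly_ga') auto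

lemma ispoly_SS: "k < 3 \<Longrightarrow> ispoly 38 (\<lambda>x. SS x k)"
  unfolding SS_def vc_def by (intro poly_intros ispoly_be) (auto intro!: poly_intros ispoly_ga')

lemma ispoly_g4: "ispoly 38 (\<lambda>x. g4 x l)"
  unfolding g4_def by (intro poly_intros ispoly_adj3 ispoly_BB ispoly_SS) auto

lemma ispoly_bm:
  assumes "\<And>r. r < 3 \<Longrightarrow> ispoly K (\<lambda>x. \<alpha> x r)" "\<And>a b. a < 3 \<Longrightarrow> b < 3 \<Longrightarrow> ispoly K (\<lambda>x. \<beta> x a b)"
    and "\<And>a b. a < 3 \<Longrightarrow> b < 3 \<Longrightarrow> ispoly K (\<lambda>x. \<gamma> x a b)" "a < 6" "b < 6"
  shows "ispoly K (\<lambda>x. bm (\<alpha> x) (\<beta> x) (\<gamma> x) a b)"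
proof -
  have "ispoly K (\<lambda>x. mk (\<alpha> x) a b)" "ispoly K (\<lambda>x. mk (\<alpha> x) b a)"
    unfolding mk_def using assms(1) by (auto intro!: poly_intros)
  then show ?thesis
    unfolding bm_def Let_def using assms(2-5) by (auto intro!: poly_intros)
qed

lemma ispoly_psi:
  assumes "a < 6" "b < 6"
  shows "ispoly 38 (\<lambda>x. \<psi>m x l a b)"
proof (cases "l < 3")
  case True
  then show ?thesis
    unfolding \<psi>m_def using assms by (auto intro!: ispoly_bm poly_intros ispoly_be ispoly_ga)
next
  case False
  have "ispoly 38 (\<lambda>x. mk (g4 x) a b)" for a b
    unfolding mk_def by (auto intro!: poly_intros ispoly_g4)
  then show ?thesis
    unfolding \<psi>m_def using assms False by (auto intro!: ispoly_bm poly_intros ispoly_det3 ispoly_BB)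
qed

text \<open>The matrix of the relation between the members of the frame \<open>\<psi>m\<close>.\<close>

definition qm :: "(nat \<Rightarrow> complex) \<Rightarrow> nat \<Rightarrow> nat \<Rightarrow> complex" where
  "qm x i j = (if i < 3 \<and> j < 3 then adj3 (PP x) i j / det3 (PP x)
     else if i = 3 \<and> j = 3 then 1 / (det3 (BB x))\<^sup>2 else 0)"

lemma symm_qm: "symm 4 (qm x)"
  using adj3_symm[of "PP x"] PP_symm[of x] by (auto simp: symm_def qm_def)

lemma nondeg_qm:
  assumes "det3 (PP x) \<noteq> 0" "det3 (BB x) \<noteq> 0"
  shows "nondeg 4 (qm x)"
  unfolding nondeg_def
proof (intro allI impI)
  fix z :: "nat \<Rightarrow> complex" and i :: nat
  assume z: "\<forall>i<4. (\<Sum>j<4. qm x i j * z j) = 0" and "i < 4"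
  have four: "(\<Sum>j<4. f j) = (\<Sum>j<3. f j) + f 3" for f :: "nat \<Rightarrow> complex"
    by (simp add: sum_4 sum_3)
  have z3: "z 3 = 0"
    using z[rule_format, of 3] assms(2) unfolding four by (simp add: qm_def)
  have zero: "(\<Sum>j<3. adj3 (PP x) i j * z j) = 0" if "i < 3" for i
  proof -
    have "(\<Sum>j<3. qm x i j * z j) = 0"
      using z[rule_format, of i] that z3 unfolding four by simp
    moreover have "(\<Sum>j<3. qm x i j * z j) = (\<Sum>j<3. adj3 (PP x) i j * z j) / det3 (PP x)"
      unfolding sum_divide_distrib by (intro sum.cong refl) (simp add: qm_def that)
    ultimately show ?thesis
      using assms(1) by simp
  qed
  have "det3 (PP x) * z i = 0" if "i < 3" for i
  proof -
    have "det3 (PP x) * z i = (\<Sum>k<3. PP x i k * (\<Sum>j<3. adj3 (PP x) k j * z j))"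
      by (rule sum_apply_inverse[symmetric]) (use adj3_right[OF that] that in auto)
    then show ?thesis
      using zero by simp
  qed
  then show "z i = 0"
    using z3 assms(1) \<open>i < 4\<close> by (cases "i = 3") auto
qed

lemma psi_relation:
  assumes P: "det3 (PP x) \<noteq> 0" and B: "det3 (BB x) \<noteq> 0" and abcd: "a < b" "b < c" "c < d" "d < 6"
  shows "(\<Sum>i<4. \<Sum>j<4. qm x i j * w4 (\<psi>m x i) (\<psi>m x j) a b c d) = 0"
proof -
  define Q where "Q i j = adj3 (PP x) i j / det3 (PP x)" for i j
  define h where "h i = \<psi>m x i" for i
  define h' where "h' i a b = (\<Sum>j<3. Q i j * h j a b)" for i a b
  define g where "g a b = \<psi>m x 3 a b / det3 (BB x)" for a b
  interpret block_frame h h' g Q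
  proof
    show "Q i j = Q j i" if "i < 3" "j < 3" for i j
      using adj3_symm[of "PP x" i j] PP_symm that by (simp add: Q_def)
  qed (auto simp: h'_def h_def g_def \<psi>m_def bm_blocks mk_def)
  have QP: "(\<Sum>j<3. Q i j * (\<Sum>k<3. PP x j k * y k)) = y i" if "i < 3" for i y
  proof -
    have "(\<Sum>j<3. Q i j * (\<Sum>k<3. PP x j k * y k)) = 1 * y i"
    proof (rule sum_apply_inverse[OF _ that])
      fix j :: nat assume j: "j < 3"
      have "(\<Sum>k<3. Q i k * PP x k j) = (\<Sum>k<3. adj3 (PP x) i k * PP x k j) / det3 (PP x)"
        by (simp add: Q_def sum_divide_distrib)
      then show "(\<Sum>k<3. Q i k * PP x k j) = (if i = j then 1 else 0)"
        using adj3_left[OF that j] P by simp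
    qed
    then show ?thesis by simp
  qed
  have h_be: "h i k c = be x i k (c - 3)" if "i < 3" "k < 3" "3 \<le> c" for i k c
    using that by (simp add: h_def \<psi>m_def bm_blocks)
  have h'_be: "h' i k c = be' x i k (c - 3)" if "i < 3" "k < 3" "3 \<le> c" for i k c
    using that QP[OF that(1), of "\<lambda>j. be' x j k (c - 3)"] by (simp add: h'_def h_be be_def)
  have h'_ga: "h' i c d = ga' x i (c - 3) (d - 3)" if "i < 3" "3 \<le> c" "c < d" for i c d
    using that QP[OF that(1), of "\<lambda>j. ga' x j (c - 3) (d - 3)"]
    by (simp add: h'_def h_def \<psi>m_def bm_blocks ga_def)
  have g_BB: "g k c = BB x k (c - 3)" if "k < 3" "3 \<le> c" for k c
    using that B by (simp add: g_def \<psi>m_def bm_blocks)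
  have g_g4: "g (3 + c) (3 + d) = mk (g4 x) c d / det3 (BB x)" if "c < d" for c d
    using that by (simp add: g_def \<psi>m_def bm_blocks)
  have N_NN: "N p q c d = NN (be x) (be' x) (BB x) p q (c - 3) (d - 3)" if "p < 3" "q < 3" "3 \<le> c" "3 \<le> d" for p q c d
    using that by (simp add: N_def NN_def T_def h_be h'_be g_BB)
  have "\<forall>a b c d. a < b \<longrightarrow> b < c \<longrightarrow> c < d \<longrightarrow> d < 6 \<longrightarrow> E a b c d = 0"
    unfolding E_zero_iff
  proof (intro conjI allI impI)
    fix d :: nat assume d: "3 \<le> d" "d < 6"
    define e where "e = d - 3"
    have e: "e < 3" using d by (simp add: e_def)
    have "be' x 0 0 e + be' x 1 1 e + be' x 2 2 e = 0"
      using less_3_cases[OF e] by (elim disjE) (simp_all add: be'_def sum_3)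
    then show "h' 0 0 d + h' 1 1 d + h' 2 2 d = 0"
      using d by (simp add: h'_be e_def del: One_nat_def)
  next
    fix c d :: nat assume cd: "3 \<le> c" "c < d" "d < 6"
    show "h' 0 c d = N 1 2 c d" "h' 1 c d = - N 0 2 c d" "h' 2 c d = N 0 1 c d"
      using cd by (simp_all add: h'_ga N_NN ga'_def vc_def del: One_nat_def)
  next
    fix k :: nat assume k: "k < 3"
    have g: "g 3 4 = g4 x 2 / det3 (BB x)" "g 3 5 = - g4 x 1 / det3 (BB x)" "g 4 5 = g4 x 0 / det3 (BB x)"
      using g_g4[of 0 1] g_g4[of 0 2] g_g4[of 1 2] by (simp_all add: mk_def)
    have gk: "g k 3 = BB x k 0" "g k 4 = BB x k 1" "g k 5 = BB x k 2"
      using k by (simp_all add: g_BB)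
    have "T k 3 4 5 - T k 4 3 5 + T k 5 3 4 = (\<Sum>i<3. be x i k 0 * ga' x i 1 2 - be x i k 1 * ga' x i 0 2 + be x i k 2 * ga' x i 0 1)"
      using k by (simp add: T_def h_be h'_ga sum.distrib sum_subtractf)
    also have "\<dots> = SS x k"
      unfolding SS_def by (intro sum.cong refl) (simp add: sum_3 vc_def)
    finally have T: "T k 3 4 5 - T k 4 3 5 + T k 5 3 4 = SS x k" .
    have "(\<Sum>l<3. BB x k l * (\<Sum>j<3. adj3 (BB x) l j * SS x j)) = det3 (BB x) * SS x k"
      by (rule sum_apply_inverse) (use adj3_right[OF k] k in auto)
    then have "(\<Sum>l<3. BB x k l * g4 x l) = - (det3 (BB x) * SS x k)"
      by (simp add: g4_def sum_negf)
    then have "BB x k 0 * g4 x 0 + BB x k 1 * g4 x 1 + BB x k 2 * g4 x 2 = - (det3 (BB x) * SS x k)"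
      by (simp only: sum_3)
    then show "L k = 0"
      unfolding L_def T g gk using B by (simp add: field_simps)
  qed
  then have "E a b c d = 0"
    using abcd by blast
  moreover have "(\<Sum>i<4. \<Sum>j<4. qm x i j * w4 (\<psi>m x i) (\<psi>m x j) a b c d) = E a b c d"
  proof -
    have "w4 (h i) (h' i) a b c d = (\<Sum>j<3. Q i j * w4 (h i) (h j) a b c d)" for i
      unfolding w4_def h'_def sum_3 by (simp add: algebra_simps)
    moreover have "w4 g g a b c d = w4 (\<psi>m x 3) (\<psi>m x 3) a b c d / (det3 (BB x))\<^sup>2"
      unfolding w4_def g_def by (simp add: power2_eq_square add_divide_distrib diff_divide_distrib)
    ultimately show ?thesis
      unfolding E_def by (simp add: sum_4 sum_3 qm_def Q_def h_def)
  qed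
  ultimately show ?thesis
    by simp
qed

lemma det3_adj3: "det3 (adj3 M) = (det3 M)\<^sup>2"
  unfolding det3_def sum_3 adj3_table power2_eq_square by Groebner_Basis.algebra

lemma det3_scale: "det3 (\<lambda>i j. k * M i j) = k ^ 3 * det3 M"
  unfolding det3_def sum_3 adj3_table power3_eq_cube by Groebner_Basis.algebra

lemma det3_cong: "(\<And>i j. i < 3 \<Longrightarrow> j < 3 \<Longrightarrow> M i j = M' i j) \<Longrightarrow> det3 M = det3 M'"
  by (simp add: det3_def sum_3 adj3_table del: One_nat_def)

lemma adj3_cong: "(\<And>i j. i < 3 \<Longrightarrow> j < 3 \<Longrightarrow> M i j = M' i j) \<Longrightarrow> adj3 M i j = adj3 M' i j"
  by (simp add: adj3_def nx_def)

lemma parameters_exist: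
  assumes P: "\<And>i j. i < 3 \<Longrightarrow> j < 3 \<Longrightarrow> P i j = P j i"
    and \<xi>: "\<And>i. \<xi> i 0 0 = 0" and b: "b 0 0 = (1 :: complex)"
  obtains x where "\<And>i j. i < 3 \<Longrightarrow> j < 3 \<Longrightarrow> PP x i j = P i j"
    "\<And>i k l. i < 3 \<Longrightarrow> k < 3 \<Longrightarrow> l < 3 \<Longrightarrow> XX x i k l = \<xi> i k l"
    "\<And>k l. k < 3 \<Longrightarrow> l < 3 \<Longrightarrow> BB x k l = b k l"
proof -
  define x where "x n = (if n = 0 then P 0 0 else if n = 1 then P 0 1 else if n = 2 then P 0 2
    else if n = 3 then P 1 1 else if n = 4 then P 1 2 else if n = 5 then P 2 2
    else if n < 30 then \<xi> ((n - 6) div 8) (((n - 6) mod 8 + 1) div 3) (((n - 6) mod 8 + 1) mod 3)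
    else b ((n - 29) div 3) ((n - 29) mod 3))" for n
  show ?thesis
  proof (rule that[of x])
    show "PP x i j = P i j" if "i < 3" "j < 3" for i j
      using less_3_cases[OF that(1)] less_3_cases[OF that(2)] P[of 1 0] P[of 2 0] P[of 2 1]
      by (elim disjE; hypsubst) (simp_all add: PP_def x_def)
    show "XX x i k l = \<xi> i k l" if "i < 3" "k < 3" "l < 3" for i k l
    proof (cases "k = 0 \<and> l = 0")
      case False
      define m where "m = 3 * k + l - 1"
      have m: "m < 8" "m + 1 = 3 * k + l"
        using False that by (auto simp: m_def)
      have "(6 + 8 * i + m - 6) div 8 = i" "(6 + 8 * i + m - 6) mod 8 = m"
        using m(1) by auto
      then have "x (6 + 8 * i + m) = \<xi> i ((m + 1) div 3) ((m + 1) mod 3)"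
        using m(1) that(1) by (simp add: x_def)
      also have "\<dots> = \<xi> i k l"
        unfolding m(2) using that(3) by simp
      finally show ?thesis
        using False by (auto simp: XX_def m_def)
    qed (simp add: XX_def \<xi>)
    show "BB x k l = b k l" if "k < 3" "l < 3" for k l
    proof (cases "k = 0 \<and> l = 0")
      case False
      define m where "m = 3 * k + l - 1"
      have m: "m + 1 = 3 * k + l"
        using False by (auto simp: m_def)
      have "30 + m - 29 = 3 * k + l"
        using m by simp
      then have "x (30 + m) = b k l"
        using that(2) by (simp add: x_def)
      then show ?thesis
        using False by (auto simp: BB_def m_def)
    qed (simp add: BB_def b)
  qed
qed

text \<open>The parameters with vanishing second and identity third group.\<close>

locale special_parameters =
  fixes x :: "nat \<Rightarrow> complex"
  assumes XX0: "i < 3 \<Longrightarrow> k < 3 \<Longrightarrow> l < 3 \<Longrightarrow> XX x i k l = 0"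
    and BB1: "k < 3 \<Longrightarrow> l < 3 \<Longrightarrow> BB x k l = (if k = l then 1 else 0)"
begin

lemma YY0: "k < 3 \<Longrightarrow> l < 3 \<Longrightarrow> YY x i k l = 0"
  by (simp add: YY_def XX0)

lemma be'0: "i < 3 \<Longrightarrow> k < 3 \<Longrightarrow> l < 3 \<Longrightarrow> be' x i k l = 0"
  by (simp add: be'_def YY0)

lemma be0: "k < 3 \<Longrightarrow> l < 3 \<Longrightarrow> be x i k l = 0"
  by (simp add: be_def be'0)

lemma det_BB: "det3 (BB x) = 1"
  by (simp add: det3_def sum_3 adj3_table BB1 del: One_nat_def)

lemma SS0: "k < 3 \<Longrightarrow> SS x k = 0"
  by (simp add: SS_def be0)

lemma g40: "g4 x l = 0"
  by (simp add: g4_def SS0)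

lemma ga'_table:
  "ga' x i 1 2 = (if i = 0 then 1 else 0)" "ga' x i 0 2 = (if i = 1 then -1 else 0)"
  "ga' x i 0 1 = (if i = 0 \<or> i = 1 then 0 else 1)"
  by (simp_all add: ga'_def vc_def NN_def be0 be'0 BB1 del: One_nat_def)

lemma ga_table:
  "ga x i 1 2 = PP x i 0" "ga x i 0 2 = - PP x i 1" "ga x i 0 1 = PP x i 2"
  by (simp_all add: ga_def sum_3 ga'_table del: One_nat_def)

end

definition base_point :: "nat \<Rightarrow> complex" where
  "base_point n = (if n \<in> {0, 3, 5, 33, 37} then 1 else 0)"

interpretation base: special_parameters base_point
proof
  show "XX base_point i k l = 0" if "i < 3" "k < 3" "l < 3" for i k l
    using less_3_cases[OF that(1)] less_3_cases[OF that(2)] less_3_cases[OF that(3)]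
    by (elim disjE) (simp_all add: XX_def base_point_def)
  show "BB base_point k l = (if k = l then 1 else 0)" if "k < 3" "l < 3" for k l
    using less_3_cases[OF that(1)] less_3_cases[OF that(2)]
    by (elim disjE) (simp_all add: BB_def base_point_def)
qed

lemma PP_base: "i < 3 \<Longrightarrow> j < 3 \<Longrightarrow> PP base_point i j = (if i = j then 1 else 0)"
  by (elim less_3_cases[THEN disjE] disjE) (simp_all add: PP_def base_point_def)

lemma det_PP_base: "det3 (PP base_point) = 1"
  by (simp add: det3_def sum_3 adj3_table PP_base del: One_nat_def)

lemma qm_base: "i < 4 \<Longrightarrow> j < 4 \<Longrightarrow> qm base_point i j = (if i = j then 1 else 0)"
proof -
  have "adj3 (PP base_point) i j = (if i = j then 1 else 0)" if "i < 3" "j < 3"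
    using less_3_cases[OF that(1)] less_3_cases[OF that(2)]
    by (elim disjE) (simp_all add: adj3_table PP_base del: One_nat_def)
  then show "i < 4 \<Longrightarrow> j < 4 \<Longrightarrow> qm base_point i j = (if i = j then 1 else 0)"
    by (auto simp: qm_def det_PP_base base.det_BB)
qed

definition bs :: "nat \<Rightarrow> nat \<Rightarrow> nat \<Rightarrow> complex" where
  "bs l a b = (if l = 0 then if a = 1 \<and> b = 2 \<or> a = 4 \<and> b = 5 then 1 else 0
     else if l = 1 then if a = 0 \<and> b = 2 \<or> a = 3 \<and> b = 5 then -1 else 0
     else if l = 2 then if a = 0 \<and> b = 1 \<or> a = 3 \<and> b = 4 then 1 else 0
     else if b = a + 3 then 1 else 0)"

lemma psi_base:
  assumes "l < 4" "a < b" "b < 6"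
  shows "\<psi>m base_point l a b = bs l a b"
proof (cases "l = 3")
  case True
  show ?thesis
    using sorted_pairs_6[OF assms(2,3)] unfolding True
    by (elim disjE conjE; hypsubst)
       (simp_all add: \<psi>m_def bm_blocks bs_def mk_def base.g40 base.BB1 base.det_BB)
next
  case False
  then have l: "l < 3"
    using assms(1) by simp
  have ga: "ga base_point l 0 1 = (if l = 2 then 1 else 0)" "ga base_point l 0 2 = (if l = 1 then -1 else 0)"
    "ga base_point l 1 2 = (if l = 0 then 1 else 0)"
    using base.ga_table[of l] PP_base[OF l] by simp_all
  show ?thesis
    using sorted_pairs_6[OF assms(2,3)] l ga
    by (elim disjE conjE; hypsubst) (auto simp: \<psi>m_def bm_blocks bs_def mk_def base.be0)
qed

context six_space
begin

definition \<psi> :: "(nat \<Rightarrow> complex) \<Rightarrow> nat \<Rightarrow> 'v bivector" where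
  "\<psi> x l = biv (\<psi>m x l)"

lemma co_psi: "i < 6 \<Longrightarrow> j < 6 \<Longrightarrow> co (\<psi> x l) i j = \<psi>m x l i j"
  by (simp add: \<psi>_def co_biv)

lemma psi_ext: "\<psi> x l \<in> ext2 s"
  by (simp add: \<psi>_def biv_ext2 skew_psi)

lemma rel_coordinatesI:
  assumes w: "\<And>l. l < 4 \<Longrightarrow> w l \<in> ext2 s"
    and zero: "\<And>a b c d. a < b \<Longrightarrow> b < c \<Longrightarrow> c < d \<Longrightarrow> d < 6 \<Longrightarrow>
      (\<Sum>i<4. \<Sum>j<4. r i j * w4 (co (w i)) (co (w j)) a b c d) = 0"
  shows "rel w r"
  unfolding rel_def
proof
  fix t
  have "(\<Sum>p\<in>{..<4} \<times> {..<4}. r (fst p) (snd p) * wedge (w (fst p)) (w (snd p)) t) = 0"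
  proof (rule wedge_sum_zero)
    fix a b c d :: nat assume *: "a < b" "b < c" "c < d" "d < 6"
    show "(\<Sum>p\<in>{..<4} \<times> {..<4}. r (fst p) (snd p) * wedge (w (fst p)) (w (snd p)) (e a, e b, e c, e d)) = 0"
      using zero[OF *] unfolding wedge_mt co_mt sum.cartesian_product case_prod_unfold .
  qed (use w in auto)
  then show "(\<Sum>i<4. \<Sum>j<4. r i j * wedge (w i) (w j) t) = 0"
    unfolding sum.cartesian_product case_prod_unfold .
qed

lemma rel_coordinatesD:
  "rel w r \<Longrightarrow> (\<Sum>i<4. \<Sum>j<4. r i j * w4 (co (w i)) (co (w j)) a b c d) = 0"
  unfolding co_mt wedge_mt[symmetric] rel_def by blast

lemma rel_psi:
  assumes "det3 (PP x) \<noteq> 0" "det3 (BB x) \<noteq> 0"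
  shows "rel (\<psi> x) (qm x)"
proof (rule rel_coordinatesI)
  fix a b c d :: nat assume *: "a < b" "b < c" "c < d" "d < 6"
  have "w4 (co (\<psi> x i)) (co (\<psi> x j)) a b c d = w4 (\<psi>m x i) (\<psi>m x j) a b c d" for i j
    by (rule w4_co_cong) (use * co_psi in auto)
  then show "(\<Sum>i<4. \<Sum>j<4. qm x i j * w4 (co (\<psi> x i)) (co (\<psi> x j)) a b c d) = 0"
    using psi_relation[OF assms *] by simp
qed (rule psi_ext)

lemma base_relation:
  assumes "symm 4 r" "rel (\<psi> base_point) r" "i < 4" "j < 4"
  shows "r i j = r 3 3 * qm base_point i j"
proof -
  have R: "(\<Sum>i<4. \<Sum>j<4. r i j * w4 (bs i) (bs j) a b c d) = 0"
    if *: "a < b" "b < c" "c < d" "d < 6" for a b c d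
  proof -
    have "w4 (co (\<psi> base_point i)) (co (\<psi> base_point j)) a b c d = w4 (bs i) (bs j) a b c d"
      if "i < 4" "j < 4" for i j
      using * that unfolding w4_def by (simp add: co_psi psi_base)
    then show ?thesis
      using rel_coordinatesD[OF assms(2), of a b c d] by simp
  qed
  have s: "r 1 0 = r 0 1" "r 2 0 = r 0 2" "r 3 0 = r 0 3" "r 2 1 = r 1 2" "r 3 1 = r 1 3" "r 3 2 = r 2 3"
    using assms(1) by (simp_all add: symm_def)
  have W: "(\<Sum>i<4. \<Sum>j<4. r i j * w4 (bs i) (bs j) a b c d)
      = (\<Sum>i<4. r i i * w4 (bs i) (bs i) a b c d)
        + 2 * (r 0 1 * w4 (bs 0) (bs 1) a b c d + r 0 2 * w4 (bs 0) (bs 2) a b c d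
          + r 0 3 * w4 (bs 0) (bs 3) a b c d + r 1 2 * w4 (bs 1) (bs 2) a b c d
          + r 1 3 * w4 (bs 1) (bs 3) a b c d + r 2 3 * w4 (bs 2) (bs 3) a b c d)" for a b c d
    unfolding sum_4 s w4_commute[of "bs 1" "bs 0"] w4_commute[of "bs 2" "bs 0"] w4_commute[of "bs 3" "bs 0"]
      w4_commute[of "bs 2" "bs 1"] w4_commute[of "bs 3" "bs 1"] w4_commute[of "bs 3" "bs 2"]
    by (simp add: algebra_simps del: One_nat_def)
  note R' = R[unfolded W, unfolded sum_4 w4_def bs_def]
  have z0: "r 0 3 = 0"
    using R'[of 0 1 2 3] by simp
  have z1: "r 1 3 = 0"
    using R'[of 0 1 2 4] by simp
  have z2: "r 2 3 = 0"
    using R'[of 0 1 2 5] by simp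
  have z3: "r 0 1 = 0"
    using R'[of 1 2 3 5] by simp
  have z4: "r 0 2 = 0"
    using R'[of 1 2 3 4] by simp
  have z5: "r 1 2 = 0"
    using R'[of 0 2 3 4] by simp
  have z6: "r 0 0 = r 3 3"
    using R'[of 1 2 4 5] by simp
  have z7: "r 1 1 = r 3 3"
    using R'[of 0 2 3 5] by simp
  have z8: "r 2 2 = r 3 3"
    using R'[of 0 1 3 4] by simp
  note z = z0 z1 z2 z3 z4 z5 z6 z7 z8
  show ?thesis
    using less_4_cases[OF assms(3)] less_4_cases[OF assms(4)] unfolding qm_base[OF assms(3,4)]
    by (elim disjE) (simp_all add: s z del: One_nat_def)
qed

lemma base_member: "\<exists>H\<in>variety_V s. frame_of 4 H (\<psi> base_point)"
proof -
  define w where "w = \<psi> base_point"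
  define H where "H = cfun.span (w ` {..<4})"
  have "\<forall>l\<in>{..<4}. c l = 0" if c: "\<And>t. (\<Sum>l<4. c l * w l t) = 0" for c
  proof -
    have "(\<Sum>l<4. c l * bs l a b) = 0" if "a < b" "b < 6" for a b
    proof -
      have "w l (e a, e b) = bs l a b" if "l < 4" for l
        using co_psi[of a b base_point l] psi_base[OF that] \<open>a < b\<close> \<open>b < 6\<close> by (simp add: co_def w_def)
      then show ?thesis
        using c[of "(e a, e b)"] by simp
    qed
    note zero = this
    have "c 0 = 0"
      using zero[of 1 2] by (simp add: sum_4 bs_def)
    moreover have "c 1 = 0"
      using zero[of 0 2] by (simp add: sum_4 bs_def)
    moreover have "c 2 = 0"
      using zero[of 0 1] by (simp add: sum_4 bs_def)
    moreover have "c 3 = 0"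
      using zero[of 0 3] by (simp add: sum_4 bs_def)
    ultimately have "c l = 0" if "l < 4" for l
      using less_4_cases[OF that] by (elim disjE) simp_all
    then show ?thesis
      by simp
  qed
  then have ind: "inj_on w {..<4}" "cfun.independent (w ` {..<4})"
    using independent_family[of "{..<4}" w] by blast+
  have frame: "frame_of 4 H w"
    using ind by (simp add: frame_of_def H_def)
  have "cfun.dim H = 4"
    using cfun.dim_eq_card_independent[OF ind(2)] card_image[OF ind(1)] by (simp add: H_def cfun.dim_span)
  moreover have "H \<subseteq> ext2 s"
    unfolding H_def by (rule cfun.span_minimal) (use psi_ext subspace_ext2 in \<open>auto simp: w_def\<close>)
  ultimately have "H \<in> Grass 4 (ext2 s)"
    by (simp add: Grass_def H_def)
  then interpret g: grass_frame H w "ext2 s"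
    by unfold_locales (use frame in auto)
  have det: "det3 (PP base_point) \<noteq> 0" "det3 (BB base_point) \<noteq> 0"
    by (simp_all add: det_PP_base base.det_BB)
  have "H \<in> variety_V s"
    unfolding g.variety_V_iff[OF refl]
  proof (intro exI[of _ "qm base_point"] conjI symm_qm nondeg_qm det allI impI iffI)
    fix r assume "symm 4 r" "rel w r"
    then show "\<exists>c. \<forall>i<4. \<forall>j<4. r i j = c * qm base_point i j"
      using base_relation[of r] unfolding w_def by blast
  next
    fix r assume "\<exists>c. \<forall>i<4. \<forall>j<4. r i j = c * qm base_point i j"
    then obtain c where c: "\<And>i j. i < 4 \<Longrightarrow> j < 4 \<Longrightarrow> r i j = c * qm base_point i j"
      by blast
    have "(\<Sum>i<4. \<Sum>j<4. r i j * wedge (w i) (w j) t) = c * (\<Sum>i<4. \<Sum>j<4. qm base_point i j * wedge (w i) (w j) t)" for t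
      by (simp add: c sum_distrib_left mult.assoc)
    then show "rel w r"
      using rel_psi[OF det] unfolding rel_def w_def by simp
  qed
  then show ?thesis
    using frame w_def by blast
qed

lemma biv_upper_cong:
  assumes "skew m" "skew n" "\<And>a b. a < b \<Longrightarrow> b < 6 \<Longrightarrow> m a b = n a b"
  shows "biv m = biv n"
proof (rule biv_cong)
  fix i j :: nat assume ij: "i < 6" "j < 6"
  consider "i < j" | "i = j" | "j < i" by linarith
  then show "m i j = n i j"
  proof cases
    case 1 then show ?thesis using assms(3) ij by blast
  next
    case 2 then show ?thesis using skewD[OF assms(1) ij] skewD[OF assms(2) ij] by simp
  next
    case 3 then show ?thesis using skewD[OF assms(1) ij] skewD[OF assms(2) ij] assms(3)[of j i] ij by simp
  qed
qed

lemma biv_combination: "biv (\<lambda>i j. k * m i j + k' * n i j) t = k * biv m t + k' * biv n t"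
  by (simp add: biv_def sum_distrib_left sum.distrib algebra_simps split: prod.split)

lemma psi_frame_normalised:
  assumes H: "H \<in> variety_V s" and fr: "frame_of 4 H f"
    and f12: "\<And>l. l < 4 \<Longrightarrow> co (f l) 1 2 = (if l = 0 then 1 else 0)"
    and f02: "\<And>l. l < 4 \<Longrightarrow> co (f l) 0 2 = (if l = 1 then -1 else 0)"
    and f01: "\<And>l. l < 4 \<Longrightarrow> co (f l) 0 1 = (if l = 2 then 1 else 0)"
    and f03: "co (f 3) 0 3 = 1"
    and r: "symm 4 r" "rel f r" and det: "det3 r \<noteq> 0"
    and vv: "\<And>i. i < 3 \<Longrightarrow> (\<Sum>j<3. r i j * vv j) = r i 3" and r33: "r 3 3 = 1 + (\<Sum>k<3. r k 3 * vv k)"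
    and detb: "det3 (\<lambda>k l. co (f 3) k (3 + l)) \<noteq> 0"
  shows "\<exists>x. frame_of 4 H (\<psi> x)"
proof -
  have ext: "f l \<in> ext2 s" if "l < 4" for l
    using frame_ext2[OF H fr that] .
  have sk: "skew (co (f l))" if "l < 4" for l
    using skew_co[OF ext[OF that]] .
  have rs: "r i j = r j i" if "i < 4" "j < 4" for i j
    using r(1) that by (simp add: symm_def)
  define P where "P i j = adj3 r i j / det3 r" for i j
  define h where "h i a b = co (f i) a b + vv i * co (f 3) a b" for i a b
  define h' where "h' i a b = (\<Sum>j<3. r i j * h j a b)" for i a b
  define g where "g = co (f 3)"
  interpret block_frame h h' g r
    by unfold_locales (use f12 f02 f01 rs in \<open>auto simp: h'_def h_def g_def\<close>)
  have h'_alt: "h' i a b = (\<Sum>j<3. r i j * co (f j) a b) + r i 3 * g a b" if "i < 3" for i a b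
    unfolding vv[OF that, symmetric]
    by (simp add: h'_def h_def g_def distrib_left sum.distrib sum_distrib_right mult.assoc)
  have Pr: "(\<Sum>k<3. P i k * r k j) = (if i = j then 1 else 0)" if "i < 3" "j < 3" for i j
    using adj3_left[OF that, of r] det by (simp add: P_def sum_divide_distrib[symmetric])
  have P_apply: "(\<Sum>k<3. P i k * (\<Sum>j<3. r k j * y j)) = y i" if "i < 3" for i y
    using sum_apply_inverse[of 3 P i r 1 y] Pr that by simp
  have P_symm: "P i j = P j i" if "i < 3" "j < 3" for i j
    using adj3_symm[of r i j] rs that by (simp add: P_def)
  have detP: "det3 P \<noteq> 0"
    using det3_scale[of "1 / det3 r" "adj3 r"] det3_adj3[of r] det by (simp add: P_def[abs_def])
  \<comment> \<open>the relation, after completing the square\<close>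
  have "E a b c d = 0" if "a < b" "b < c" "c < d" "d < 6" for a b c d
  proof -
    define W where "W i j = w4 (co (f i)) (co (f j)) a b c d" for i j
    have trm: "w4 (h i) (h' i) a b c d = (\<Sum>j<3. r i j * W i j) + r i 3 * W i 3
        + vv i * (\<Sum>j<3. r i j * W 3 j) + vv i * r i 3 * W 3 3" if "i < 3" for i
      unfolding w4_def h'_alt[OF that] h_def W_def g_def sum_3 by (simp add: algebra_simps)
    have vr: "vv 0 * r 0 j + vv 1 * r 1 j + vv 2 * r 2 j = r 3 j" if "j < 3" for j
      using vv[OF that] rs[of j 0] rs[of j 1] rs[of j 2] rs[of j 3] that by (simp add: sum_3 mult.commute del: One_nat_def)
    have "E a b c d = (\<Sum>i<3. \<Sum>j<3. r i j * W i j) + (\<Sum>i<3. r i 3 * W i 3)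
        + (\<Sum>j<3. (vv 0 * r 0 j + vv 1 * r 1 j + vv 2 * r 2 j) * W 3 j) + (1 + (\<Sum>k<3. r k 3 * vv k)) * W 3 3"
      unfolding E_def by (simp add: trm sum_3 g_def W_def algebra_simps del: One_nat_def)
    also have "\<dots> = (\<Sum>i<3. \<Sum>j<3. r i j * W i j) + (\<Sum>i<3. r i 3 * W i 3) + (\<Sum>j<3. r 3 j * W 3 j) + r 3 3 * W 3 3"
      using vr by (simp add: r33)
    also have "\<dots> = (\<Sum>i<4. \<Sum>j<4. r i j * W i j)"
      unfolding sum_3 sum_4 by (simp add: algebra_simps del: One_nat_def)
    also have "\<dots> = 0"
      unfolding W_def by (rule rel_coordinatesD[OF r(2)])
    finally show ?thesis .
  qed
  then have F: "\<And>d. 3 \<le> d \<Longrightarrow> d < 6 \<Longrightarrow> h' 0 0 d + h' 1 1 d + h' 2 2 d = 0"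
    and M: "\<And>c d. 3 \<le> c \<Longrightarrow> c < d \<Longrightarrow> d < 6 \<Longrightarrow> h' 0 c d = N 1 2 c d \<and> h' 1 c d = - N 0 2 c d \<and> h' 2 c d = N 0 1 c d"
    and L: "\<And>k. k < 3 \<Longrightarrow> L k = 0"
    using E_zero_iff by blast+
  define t where "t i = h' i 0 3" for i
  define X where "X i k l = h' i k (3 + l) - (if k = l then t i else 0)" for i k l
  define \<xi> where "\<xi> j k l = (\<Sum>i<3. P j i * X i k l) / det3 P" for j k l
  define b where "b k l = co (f 3) k (3 + l)" for k l
  have "\<xi> i 0 0 = 0" for i
    by (simp add: \<xi>_def X_def t_def)
  moreover have "b 0 0 = 1"
    using f03 by (simp add: b_def)
  ultimately obtain x where x: "\<And>i j. i < 3 \<Longrightarrow> j < 3 \<Longrightarrow> PP x i j = P i j"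
    "\<And>i k l. i < 3 \<Longrightarrow> k < 3 \<Longrightarrow> l < 3 \<Longrightarrow> XX x i k l = \<xi> i k l"
    "\<And>k l. k < 3 \<Longrightarrow> l < 3 \<Longrightarrow> BB x k l = b k l"
    using parameters_exist[of P \<xi> b] P_symm by metis
  have adjP: "adj3 (PP x) i j = adj3 P i j" for i j
    by (rule adj3_cong) (rule x)
  have detB: "det3 (BB x) \<noteq> 0"
    using detb det3_cong[of "BB x" b] x(3) by (simp add: b_def[abs_def])
  have YY: "YY x i k l = X i k l" if "i < 3" "k < 3" "l < 3" for i k l
  proof -
    have "YY x i k l = (\<Sum>j<3. adj3 P i j * (\<Sum>i<3. P j i * X i k l)) / det3 P"
      unfolding YY_def adjP sum_divide_distrib by (intro sum.cong refl) (simp add: x that \<xi>_def)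
    also have "(\<Sum>j<3. adj3 P i j * (\<Sum>i<3. P j i * X i k l)) = det3 P * X i k l"
      by (rule sum_apply_inverse) (use adj3_left[OF that(1)] that in auto)
    finally show ?thesis
      using detP by simp
  qed
  have be': "be' x i k l = h' i k (3 + l)" if "i < 3" "k < 3" "l < 3" for i k l
  proof -
    have "(\<Sum>j<3. YY x j j i) = (h' 0 0 (3 + i) + h' 1 1 (3 + i) + h' 2 2 (3 + i)) - t i"
      using less_3_cases[OF that(1)] by (elim disjE) (simp_all add: sum_3 YY X_def del: One_nat_def)
    also have "h' 0 0 (3 + i) + h' 1 1 (3 + i) + h' 2 2 (3 + i) = 0"
      using F[of "3 + i"] that by simp
    finally show ?thesis
      using that by (simp add: be'_def YY X_def)
  qed
  have be: "be x i k l = h i k (3 + l)" if "i < 3" "k < 3" "l < 3" for i k l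
  proof -
    have "be x i k l = (\<Sum>j<3. P i j * (\<Sum>m<3. r j m * h m k (3 + l)))"
      unfolding be_def by (intro sum.cong refl) (simp add: x be' that h'_def)
    then show ?thesis
      using P_apply[OF that(1)] by simp
  qed
  have gb: "g a c = co (f 3) a c" for a c
    by (simp add: g_def)
  have N_NN: "N p q (3 + c) (3 + d) = NN (be x) (be' x) (BB x) p q c d" if "p < 3" "q < 3" "c < 3" "d < 3" for p q c d
    using that gb by (simp add: N_def NN_def T_def be be' x(3) b_def)
  have ga': "ga' x i c d = h' i (3 + c) (3 + d)" if "i < 3" "c < d" "d < 3" for i c d
    using less_3_cases[OF that(1)] M[of "3 + c" "3 + d"] that N_NN[of _ _ c d]
    by (elim disjE) (simp_all add: ga'_def vc_def del: One_nat_def)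
  have ga: "ga x i c d = h i (3 + c) (3 + d)" if "i < 3" "c < d" "d < 3" for i c d
  proof -
    have "ga x i c d = (\<Sum>j<3. P i j * (\<Sum>m<3. r j m * h m (3 + c) (3 + d)))"
      unfolding ga_def by (intro sum.cong refl) (simp add: x ga' that h'_def)
    then show ?thesis
      using P_apply[OF that(1)] by simp
  qed
  define \<gamma> where "\<gamma> = vc (\<lambda>c d. g (3 + c) (3 + d))"
  have BB\<gamma>: "(\<Sum>l<3. BB x k l * \<gamma> l) = - SS x k" if k: "k < 3" for k
  proof -
    have "SS x k = (\<Sum>i<3. h i k 3 * h' i 4 5 - h i k 4 * h' i 3 5 + h i k 5 * h' i 3 4)"
      unfolding SS_def by (intro sum.cong refl) (simp add: sum_3 vc_def be ga' k del: One_nat_def)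
    also have "\<dots> = T k 3 4 5 - T k 4 3 5 + T k 5 3 4"
      by (simp add: T_def sum.distrib sum_subtractf)
    finally have "SS x k = T k 3 4 5 - T k 4 3 5 + T k 5 3 4" .
    moreover have "(\<Sum>l<3. BB x k l * \<gamma> l) = g k 3 * g 4 5 - g k 4 * g 3 5 + g k 5 * g 3 4"
      using k by (simp add: sum_3 \<gamma>_def vc_def x(3) b_def g_def del: One_nat_def)
    ultimately show ?thesis
      using L[OF k] unfolding L_def by (simp only: add_eq_0_iff)
  qed
  have g4: "g4 x l = det3 (BB x) * \<gamma> l" if "l < 3" for l
  proof -
    have "g4 x l = (\<Sum>k<3. adj3 (BB x) l k * (\<Sum>m<3. BB x k m * \<gamma> m))"
      unfolding g4_def sum_negf[symmetric] by (intro sum.cong refl) (simp add: BB\<gamma>)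
    also have "\<dots> = det3 (BB x) * \<gamma> l"
      by (rule sum_apply_inverse) (use adj3_left[OF that] that in auto)
    finally show ?thesis .
  qed
  have range: "a < b \<and> b < 3 \<or> a < 3 \<and> 3 \<le> b \<or> 3 \<le> a \<and> a < b" if "a < b" for a b :: nat
    using that by linarith
  have up: "\<psi>m x i a b = h i a b" if "i < 3" "a < b" "b < 6" for i a b
    using range[OF that(2)]
  proof (elim disjE conjE)
    assume ab: "a < b" "b < 3"
    then have "a = 0 \<and> b = 1 \<or> a = 0 \<and> b = 2 \<or> a = 1 \<and> b = 2"
      by linarith
    then show ?thesis
      using that(1) by (elim disjE conjE) (simp_all add: \<psi>m_def bm_blocks mk_def h01 h02 h12 h01[unfolded One_nat_def] h12[unfolded One_nat_def])
  next
    assume "a < 3" "3 \<le> b"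
    then show ?thesis
      using that be[of i a "b - 3"] by (simp add: \<psi>m_def bm_blocks)
  next
    assume "3 \<le> a" "a < b"
    then show ?thesis
      using that ga[of i "a - 3" "b - 3"] by (simp add: \<psi>m_def bm_blocks)
  qed
  have up3: "\<psi>m x 3 a b = det3 (BB x) * g a b" if "a < b" "b < 6" for a b
    using range[OF that(1)]
  proof (elim disjE conjE)
    assume ab: "a < b" "b < 3"
    then have "a = 0 \<and> b = 1 \<or> a = 0 \<and> b = 2 \<or> a = 1 \<and> b = 2"
      by linarith
    then show ?thesis
      using g0 by (elim disjE conjE) (simp_all add: \<psi>m_def bm_blocks mk_def)
  next
    assume "a < 3" "3 \<le> b"
    then show ?thesis
      using that x(3)[of a "b - 3"] by (simp add: \<psi>m_def bm_blocks b_def g_def)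
  next
    assume "3 \<le> a" "a < b"
    moreover from this that have "mk (g4 x) (a - 3) (b - 3) = det3 (BB x) * mk \<gamma> (a - 3) (b - 3)"
      by (simp add: mk_def g4)
    ultimately show ?thesis
      using that mk_vc[of "a - 3" "b - 3" "\<lambda>c d. g (3 + c) (3 + d)"] by (simp add: \<psi>m_def bm_blocks \<gamma>_def)
  qed
  have comb_skew: "skew (\<lambda>a b. k * m a b + k' * n a b)" if "skew m" "skew n" for k k' m n
  proof (rule skewI)
    fix i j :: nat assume "i < 6" "j < 6"
    then have "m i j = - m j i" "n i j = - n j i"
      by (rule skewD[OF that(1)], rule skewD[OF that(2)])
    then show "k * m i j + k' * n i j = - (k * m j i + k' * n j i)"
      by simp
  qed
  have psi: "\<psi> x i t = f i t + vv i * f 3 t" if i: "i < 3" for i t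
  proof -
    have "biv (\<psi>m x i) = biv (\<lambda>a b. 1 * co (f i) a b + vv i * co (f 3) a b)"
      by (rule biv_upper_cong[OF skew_psi comb_skew[OF sk sk]]) (use i up in \<open>auto simp: h_def\<close>)
    then show ?thesis
      using biv_combination[of 1 "co (f i)" "vv i" "co (f 3)" t] biv_co[OF ext, of i] biv_co[OF ext, of 3] i
      by (simp add: \<psi>_def)
  qed
  have psi3: "\<psi> x 3 t = det3 (BB x) * f 3 t" for t
  proof -
    have "biv (\<psi>m x 3) = biv (\<lambda>a b. det3 (BB x) * co (f 3) a b + 0 * co (f 3) a b)"
      by (rule biv_upper_cong[OF skew_psi comb_skew[OF sk sk]]) (use up3 in \<open>auto simp: g_def\<close>)
    then show ?thesis
      using biv_combination[of "det3 (BB x)" "co (f 3)" 0 "co (f 3)" t] biv_co[OF ext, of 3]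
      by (simp add: \<psi>_def)
  qed
  have "frame_of 4 H (\<psi> x)"
  proof (rule frame_change[OF variety_Grass[OF H] fr])
    show "\<psi> x k t = (\<Sum>l<4. (if k < 3 then if l = k then 1 else if l = 3 then vv k else 0
        else if l = 3 then det3 (BB x) else 0) * f l t)" if "k < 4" for k t
      using less_4_cases[OF that] psi[of k t] psi3[of t] by (elim disjE) (simp_all add: sum_4)
    show "f k t = (\<Sum>l<4. (if k < 3 then if l = k then 1 else if l = 3 then - vv k / det3 (BB x) else 0
        else if l = 3 then 1 / det3 (BB x) else 0) * \<psi> x l t)" if "k < 4" for k t
      using less_4_cases[OF that] psi[of k t] psi3[of t] detB by (elim disjE) (simp_all add: sum_4)
  qed
  then show ?thesis
    by blast
qed

lemma psi_frame:
  assumes H: "H \<in> variety_V s" and fr: "frame_of 4 H f"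
    and f12: "\<And>l. l < 4 \<Longrightarrow> co (f l) 1 2 = (if l = 0 then 1 else 0)"
    and f02: "\<And>l. l < 4 \<Longrightarrow> co (f l) 0 2 = (if l = 1 then -1 else 0)"
    and f01: "\<And>l. l < 4 \<Longrightarrow> co (f l) 0 1 = (if l = 2 then 1 else 0)"
    and f03: "co (f 3) 0 3 = 1"
    and r: "symm 4 r" "rel f r" and det: "det3 r \<noteq> 0"
    and detb: "det3 (\<lambda>k l. co (f 3) k (3 + l)) \<noteq> 0"
  shows "\<exists>x. frame_of 4 H (\<psi> x)"
proof -
  interpret gf: grass_frame H f "ext2 s"
    by unfold_locales (use variety_Grass[OF H] fr in auto)
  obtain q where q: "symm 4 q" "nondeg 4 q" "\<And>r. symm 4 r \<Longrightarrow> rel f r \<Longrightarrow> \<exists>c. \<forall>i<4. \<forall>j<4. r i j = c * q i j"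
    using assms(1) unfolding gf.variety_V_iff[OF refl] by blast
  obtain \<kappa> where \<kappa>: "\<And>i j. i < 4 \<Longrightarrow> j < 4 \<Longrightarrow> r i j = \<kappa> * q i j"
    using q(3)[OF r] by blast
  have "det3 r = \<kappa> ^ 3 * det3 q"
    unfolding det3_scale[symmetric] by (rule det3_cong) (simp add: \<kappa>)
  then have \<kappa>0: "\<kappa> \<noteq> 0"
    using det by auto
  define vv where "vv i = (\<Sum>k<3. adj3 r i k * r k 3) / det3 r" for i
  have rv: "(\<Sum>j<3. r i j * vv j) = r i 3" if i: "i < 3" for i
  proof -
    have "(\<Sum>j<3. r i j * vv j) = (\<Sum>j<3. r i j * (\<Sum>k<3. adj3 r j k * r k 3)) / det3 r"
      by (simp only: vv_def times_divide_eq_right sum_divide_distrib[symmetric])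
    also have "(\<Sum>j<3. r i j * (\<Sum>k<3. adj3 r j k * r k 3)) = det3 r * r i 3"
      by (rule sum_apply_inverse) (use adj3_right[OF i] i in auto)
    finally show ?thesis
      using det by simp
  qed
  define c where "c = r 3 3 - (\<Sum>k<3. r k 3 * vv k)"
  have four: "(\<Sum>j<4. f j) = (\<Sum>j<3. f j) + f 3" for f :: "nat \<Rightarrow> complex"
    by (simp add: sum_4 sum_3)
  have "c \<noteq> 0"
  proof
    assume c0: "c = 0"
    define z where "z j = (if j < 3 then - vv j else 1)" for j :: nat
    have rz: "(\<Sum>j<4. r i j * z j) = 0" if "i < 4" for i
    proof (cases "i < 3")
      case True
      then show ?thesis
        using rv[OF True] unfolding four by (simp add: z_def sum_negf)
    next
      case False
      then have i: "i = 3" using that by simp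
      have "(\<Sum>j<3. r 3 j * vv j) = (\<Sum>k<3. r k 3 * vv k)"
        using r(1) by (intro sum.cong refl) (simp add: symm_def)
      then show ?thesis
        using c0 unfolding four i c_def by (simp add: z_def sum_negf)
    qed
    have "(\<Sum>j<4. q i j * z j) = 0" if "i < 4" for i
    proof -
      have "\<kappa> * (\<Sum>j<4. q i j * z j) = (\<Sum>j<4. r i j * z j)"
        unfolding sum_distrib_left by (intro sum.cong refl) (simp add: \<kappa> that)
      then show ?thesis
        using rz[OF that] \<kappa>0 by simp
    qed
    then have "z 3 = 0"
      using q(2) unfolding nondeg_def by simp
    then show False
      by (simp add: z_def)
  qed
  define r' where "r' i j = 1 / c * r i j" for i j
  show ?thesis
  proof (rule psi_frame_normalised[OF H fr f12 f02 f01 f03, where r = r' and vv = vv])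
    show "symm 4 r'"
      using r(1) by (simp add: symm_def r'_def)
    have "(\<Sum>i<4. \<Sum>j<4. r' i j * wedge (f i) (f j) t) = 1 / c * (\<Sum>i<4. \<Sum>j<4. r i j * wedge (f i) (f j) t)" for t
      unfolding sum_distrib_left r'_def by (simp add: mult.assoc)
    then show "rel f r'"
      using r(2) unfolding rel_def by simp
    show "det3 r' \<noteq> 0"
      using det \<open>c \<noteq> 0\<close> det3_scale[of "1 / c" r] by (simp add: r'_def[abs_def])
    show "(\<Sum>j<3. r' i j * vv j) = r' i 3" if "i < 3" for i
      using rv[OF that] by (simp add: r'_def sum_divide_distrib[symmetric])
    have "(\<Sum>k<3. r' k 3 * vv k) = (\<Sum>k<3. r k 3 * vv k) / c"
      by (simp add: r'_def sum_divide_distrib)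
    then show "r' 3 3 = 1 + (\<Sum>k<3. r' k 3 * vv k)"
      using \<open>c \<noteq> 0\<close> by (simp add: r'_def c_def field_simps)
  qed (use detb in auto)
qed

end

section \<open>Density of the parametrised members\<close>

lemma det4:
  "det (mat 4 4 (\<lambda>(i, j). A i j)) =
     A 0 0 * (A 1 1 * (A 2 2 * A 3 3 - A 2 3 * A 3 2) - A 1 2 * (A 2 1 * A 3 3 - A 2 3 * A 3 1) + A 1 3 * (A 2 1 * A 3 2 - A 2 2 * A 3 1))
   - A 0 1 * (A 1 0 * (A 2 2 * A 3 3 - A 2 3 * A 3 2) - A 1 2 * (A 2 0 * A 3 3 - A 2 3 * A 3 0) + A 1 3 * (A 2 0 * A 3 2 - A 2 2 * A 3 0))
   + A 0 2 * (A 1 0 * (A 2 1 * A 3 3 - A 2 3 * A 3 1) - A 1 1 * (A 2 0 * A 3 3 - A 2 3 * A 3 0) + A 1 3 * (A 2 0 * A 3 1 - A 2 1 * A 3 0))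
   - A 0 3 * (A 1 0 * (A 2 1 * A 3 2 - A 2 2 * A 3 1) - A 1 1 * (A 2 0 * A 3 2 - A 2 2 * A 3 0) + A 1 2 * (A 2 0 * A 3 1 - A 2 1 * (A 3 0 :: complex)))"
proof -
  have S: "{0..<4} = {0, 1, 2, 3::nat}"
    by auto
  have "det (mat 4 4 (\<lambda>(i, j). A i j)) = (\<Sum>p | p permutes {0..<4}. signof p * (\<Prod>i\<in>{0..<4}. A i (p i)))"
    unfolding det_def by (auto intro!: sum.cong prod.cong simp: permutes_in_image)
  then show ?thesis
    unfolding S
    by (simp add: sum_over_permutations_insert permutes_sing sign_compose sign_swap_id
        permutation_swap_id permutation_compose sign_id swap_id_eq Transposition.transpose_def)
       (simp add: algebra_simps)
qed

definition pa :: "nat \<Rightarrow> nat" where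
  "pa k = (if k = 0 then 1 else if k = 1 then 2 else 0)"

definition pb :: "nat \<Rightarrow> nat" where
  "pb k = (if k = 0 then 2 else if k = 1 then 0 else if k = 2 then 1 else 3)"

lemma pab_lt: "pa k < 6" "pb k < 6"
  by (simp_all add: pa_def pb_def)

definition AA :: "(nat \<Rightarrow> complex) \<Rightarrow> nat \<Rightarrow> nat \<Rightarrow> complex" where
  "AA y k l = \<Phi>m y l (pa k) (pb k)"

definition D1 :: "(nat \<Rightarrow> complex) \<Rightarrow> complex" where
  "D1 y = det (mat 4 4 (\<lambda>(k, l). AA y k l))"

definition D2 :: "(nat \<Rightarrow> complex) \<Rightarrow> nat \<Rightarrow> nat \<Rightarrow> complex" where
  "D2 y k l = (\<Sum>i<4. \<Sum>j<4. hypq (2 * Pf (Sk y 0)) i j * (AA y k i * AA y l j))"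

definition D3 :: "(nat \<Rightarrow> complex) \<Rightarrow> nat \<Rightarrow> nat \<Rightarrow> complex" where
  "D3 y p c = det (mat 4 4 (\<lambda>(k, l). if k = 3 then \<Phi>m y l p (3 + c) else AA y k l))"

lemma ispoly_AA: "ispoly 108 (\<lambda>y. AA y k l)"
  unfolding AA_def by (intro ispoly_Phi pab_lt)

lemma ispoly_D1: "ispoly 108 D1"
  unfolding D1_def[abs_def] by (intro ispoly_det ispoly_AA)

lemma ispoly_D2: "ispoly 108 (\<lambda>y. det3 (D2 y))"
proof (rule ispoly_det3)
  have "ispoly 108 (\<lambda>y. hypq (2 * Pf (Sk y 0)) i j)" for i j
    unfolding hypq_def by (intro poly_intros ispoly_Pf ispoly_Sk) auto
  then show "ispoly 108 (\<lambda>y. D2 y i j)" for i j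
    unfolding D2_def by (intro ispoly_sum ispoly_mult ispoly_AA)
qed

lemma ispoly_D3: "ispoly 108 (\<lambda>y. det3 (D3 y))"
proof (rule ispoly_det3)
  show "ispoly 108 (\<lambda>y. D3 y p c)" if "p < 3" "c < 3" for p c
  proof -
    have "ispoly 108 (\<lambda>y. if k = 3 then \<Phi>m y l p (3 + c) else AA y k l)" for k l
      by (cases "k = 3") (use that in \<open>simp_all add: ispoly_AA ispoly_Phi\<close>)
    then show ?thesis
      unfolding D3_def by (rule ispoly_det)
  qed
qed

context six_space
begin

lemma dual_frame:
  assumes H: "H \<in> variety_V s" and fr: "frame_of 4 H (\<Phi> y)" and D: "D1 y \<noteq> 0"
  obtains f where "frame_of 4 H f" "\<And>k l. k < 4 \<Longrightarrow> l < 4 \<Longrightarrow> co (f l) (pa k) (pb k) = (if k = l then 1 else 0)"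
    "rel f (D2 y)" "\<And>p c. p < 3 \<Longrightarrow> c < 3 \<Longrightarrow> D3 y p c = D1 y * co (f 3) p (3 + c)"
proof -
  obtain B where B: "\<And>i j. i < 4 \<Longrightarrow> j < 4 \<Longrightarrow> (\<Sum>k<4. AA y i k * B k j) = (if i = j then 1 else 0)"
    "\<And>i j. i < 4 \<Longrightarrow> j < 4 \<Longrightarrow> (\<Sum>k<4. B i k * AA y k j) = (if i = j then 1 else 0)"
    by (rule inverse_exists[OF D[unfolded D1_def]]) (rule that)
  define f where "f l t = (\<Sum>m<4. B m l * \<Phi> y m t)" for l t
  have Phi_f: "\<Phi> y m t = (\<Sum>l<4. AA y l m * f l t)" if m: "m < 4" for m t
  proof -
    have "(\<Sum>l<4. AA y l m * f l t) = (\<Sum>l<4. \<Sum>k<4. B k l * AA y l m * \<Phi> y k t)"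
      by (simp add: f_def sum_distrib_left mult_ac)
    also have "\<dots> = (\<Sum>k<4. \<Sum>l<4. B k l * AA y l m * \<Phi> y k t)"
      by (rule sum.swap)
    also have "\<dots> = (\<Sum>k<4. (\<Sum>l<4. B k l * AA y l m) * \<Phi> y k t)"
      by (simp add: sum_distrib_right)
    also have "\<dots> = (\<Sum>k<4. if k = m then \<Phi> y k t else 0)"
      by (intro sum.cong refl) (simp add: B m)
    finally show ?thesis
      using m by simp
  qed
  have coPhi: "co (\<Phi> y m) a b = (\<Sum>l<4. AA y l m * co (f l) a b)" if "m < 4" for m a b
    unfolding co_def by (rule Phi_f[OF that])
  show ?thesis
  proof (rule that[of f])
    show "frame_of 4 H f"
    proof (rule frame_change[OF variety_Grass[OF H] fr])
      show "f k t = (\<Sum>l<4. B l k * \<Phi> y l t)" for k t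
        by (simp add: f_def)
    qed (rule Phi_f)
    have AA_co: "AA y k m = co (\<Phi> y m) (pa k) (pb k)" for k m
      by (simp add: AA_def co_Phi pab_lt)
    show "co (f l) (pa k) (pb k) = (if k = l then 1 else 0)" if "k < 4" "l < 4" for k l
    proof -
      have "co (f l) (pa k) (pb k) = (\<Sum>m<4. AA y k m * B m l)"
        unfolding AA_co by (simp add: f_def co_def mult.commute)
      then show ?thesis
        using B(1)[OF that] by simp
    qed
    show "rel f (D2 y)"
      unfolding rel_def
    proof
      fix t
      define q where "q = hypq (2 * Pf (Sk y 0))"
      have "wedge (\<Phi> y i) (\<Phi> y j) t = (\<Sum>k<4. \<Sum>l<4. AA y k i * AA y l j * wedge (f k) (f l) t)" if "i < 4" "j < 4" for i j
        by (rule wedge_sum_sum) (rule Phi_f[OF that(1)], rule Phi_f[OF that(2)])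
      then have "(\<Sum>i<4. \<Sum>j<4. q i j * wedge (\<Phi> y i) (\<Phi> y j) t)
          = (\<Sum>i<4. \<Sum>j<4. \<Sum>k<4. \<Sum>l<4. q i j * (AA y k i * AA y l j) * wedge (f k) (f l) t)"
        by (simp add: sum_distrib_left mult.assoc)
      also have "\<dots> = (\<Sum>k<4. \<Sum>l<4. \<Sum>i<4. \<Sum>j<4. q i j * (AA y k i * AA y l j) * wedge (f k) (f l) t)"
        by (simp add: sum_4 algebra_simps)
      also have "\<dots> = (\<Sum>k<4. \<Sum>l<4. D2 y k l * wedge (f k) (f l) t)"
        by (simp add: D2_def sum_distrib_right q_def)
      finally show "(\<Sum>k<4. \<Sum>l<4. D2 y k l * wedge (f k) (f l) t) = 0"
        using rel_Phi[of y, unfolded rel_def, THEN spec, of t] by (simp add: q_def)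
    qed
    show "D3 y p c = D1 y * co (f 3) p (3 + c)" if "p < 3" "c < 3" for p c
    proof -
      define R where "R k l = (if k = 3 then co (f l) p (3 + c) else if k = l then 1 else 0)" for k l :: nat
      have "mat 4 4 (\<lambda>(k, l). if k = 3 then \<Phi>m y l p (3 + c) else AA y k l)
          = mat 4 4 (\<lambda>(k, l). R k l) * mat 4 4 (\<lambda>(k, l). AA y k l)"
      proof (rule eq_matI)
        fix k m assume "k < dim_row (mat 4 4 (\<lambda>(k, l). R k l) * mat 4 4 (\<lambda>(k, l). AA y k l))"
          and "m < dim_col (mat 4 4 (\<lambda>(k, l). R k l) * mat 4 4 (\<lambda>(k, l). AA y k l))"
        then have km: "k < 4" "m < 4"
          by auto
        have "(\<Sum>l<4. R k l * AA y l m) = (if k = 3 then \<Phi>m y m p (3 + c) else AA y k m)"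
        proof (cases "k = 3")
          case True
          then show ?thesis
            using coPhi[OF km(2), of p "3 + c"] co_Phi[of p "3 + c" y m] \<open>p < 3\<close> \<open>c < 3\<close>
            by (simp add: R_def mult.commute)
        next
          case False
          then have "(\<Sum>l<4. R k l * AA y l m) = (\<Sum>l<4. if l = k then AA y l m else 0)"
            by (intro sum.cong refl) (simp add: R_def)
          then show ?thesis
            using False km(1) by simp
        qed
        then show "mat 4 4 (\<lambda>(k, l). if k = 3 then \<Phi>m y l p (3 + c) else AA y k l) $$ (k, m)
            = (mat 4 4 (\<lambda>(k, l). R k l) * mat 4 4 (\<lambda>(k, l). AA y k l)) $$ (k, m)"
          unfolding mat_mult_entry[OF km] using km by simp
      qed auto
      moreover have "det (mat 4 4 (\<lambda>(k, l). R k l)) = co (f 3) p (3 + c)"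
        unfolding det4 by (simp add: R_def)
      ultimately show ?thesis
        unfolding D3_def D1_def by (simp add: det_mult[of _ 4] mult.commute)
    qed
  qed
qed

lemma symm_D2: "symm 4 (D2 y)"
proof -
  have "D2 y k l = D2 y l k" for k l
    unfolding D2_def sum_4 hypq_def by (simp add: algebra_simps)
  then show ?thesis
    by (simp add: symm_def)
qed

lemma generic_member:
  assumes H: "H \<in> variety_V s" and fr: "frame_of 4 H (\<Phi> y)"
    and D: "D1 y \<noteq> 0" "det3 (D2 y) \<noteq> 0" "det3 (D3 y) \<noteq> 0"
  shows "\<exists>x. frame_of 4 H (\<psi> x)"
proof -
  obtain f where f: "frame_of 4 H f" "\<And>k l. k < 4 \<Longrightarrow> l < 4 \<Longrightarrow> co (f l) (pa k) (pb k) = (if k = l then 1 else 0)"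
    "rel f (D2 y)" "\<And>p c. p < 3 \<Longrightarrow> c < 3 \<Longrightarrow> D3 y p c = D1 y * co (f 3) p (3 + c)"
    by (rule dual_frame[OF H fr D(1)]) (rule that)
  have sk: "skew (co (f l))" if "l < 4" for l
    by (rule skew_co, rule frame_ext2[OF H f(1) that])
  show ?thesis
  proof (rule psi_frame[OF H f(1) _ _ _ _ symm_D2 f(3) D(2)])
    show "co (f l) 1 2 = (if l = 0 then 1 else 0)" if "l < 4" for l
      using f(2)[OF _ that, of 0] by (simp add: pa_def pb_def del: One_nat_def)
    show "co (f l) 0 2 = (if l = 1 then -1 else 0)" if "l < 4" for l
      using f(2)[OF _ that, of 1] skewD[OF sk[OF that], of 0 2] by (simp add: pa_def pb_def del: One_nat_def)
    show "co (f l) 0 1 = (if l = 2 then 1 else 0)" if "l < 4" for l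
      using f(2)[OF _ that, of 2] by (simp add: pa_def pb_def del: One_nat_def)
    show "co (f 3) 0 3 = 1"
      using f(2)[of 3 3] by (simp add: pa_def pb_def)
    have "det3 (D3 y) = D1 y ^ 3 * det3 (\<lambda>k l. co (f 3) k (3 + l))"
      unfolding det3_scale[symmetric] by (rule det3_cong) (simp add: f(4))
    then show "det3 (\<lambda>k l. co (f 3) k (3 + l)) \<noteq> 0"
      using D(3) by auto
  qed
qed

lemma psi_base_dual:
  assumes "k < 4" "l < 4"
  shows "co (\<psi> base_point l) (pa k) (pb k) = (if k = l then 1 else 0)"
proof -
  have "\<psi>m base_point l 2 0 = - \<psi>m base_point l 0 2"
    by (rule skewD[OF skew_psi]) auto
  then show ?thesis
    using less_4_cases[OF assms(1)] assms(2) psi_base[OF assms(2), of 1 2] psi_base[OF assms(2), of 0 2]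
      psi_base[OF assms(2), of 0 1] psi_base[OF assms(2), of 0 3] less_4_cases[OF assms(2)]
    by (elim disjE) (simp_all add: co_psi pab_lt pa_def pb_def bs_def del: One_nat_def)
qed

lemma generic_point: "\<exists>y\<in>E\<Phi>. D1 y \<noteq> 0 \<and> det3 (D2 y) \<noteq> 0 \<and> det3 (D3 y) \<noteq> 0"
proof -
  obtain H where H: "H \<in> variety_V s" and fr: "frame_of 4 H (\<psi> base_point)"
    using base_member by blast
  obtain y where y: "y \<in> E\<Phi>" "frame_of 4 H (\<Phi> y)"
    using Phi_surjective[OF H] by blast
  have D1: "D1 y \<noteq> 0"
    unfolding D1_def
  proof (rule det_nonzero_of_trivial_kernel)
    fix c assume c: "\<And>j. j < 4 \<Longrightarrow> (\<Sum>i<4. c i * AA y i j) = 0"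
    show "\<forall>i<4. c i = 0"
    proof (intro allI impI)
      fix l :: nat assume l: "l < 4"
      obtain K where K: "\<And>t. \<psi> base_point l t = (\<Sum>m<4. K m * \<Phi> y m t)"
        using frame_combination_fun[OF y(2) frame_of_mem[OF fr l]] by blast
      have "co (\<psi> base_point l) (pa k) (pb k) = (\<Sum>m<4. K m * AA y k m)" for k
        using K[of "(e (pa k), e (pb k))"] co_Phi[OF pab_lt] by (simp add: AA_def co_def)
      then have "(\<Sum>k<4. c k * (if k = l then 1 else 0)) = (\<Sum>k<4. c k * (\<Sum>m<4. K m * AA y k m))"
        using psi_base_dual[OF _ l] by (intro sum.cong refl) simp
      also have "\<dots> = (\<Sum>m<4. K m * (\<Sum>k<4. c k * AA y k m))"
        by (simp add: sum_4 algebra_simps)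
      also have "\<dots> = 0"
        by (simp add: c)
      finally show "c l = 0"
        using l by (simp add: if_distrib cong: if_cong)
    qed
  qed
  obtain f where f: "frame_of 4 H f" "\<And>k l. k < 4 \<Longrightarrow> l < 4 \<Longrightarrow> co (f l) (pa k) (pb k) = (if k = l then 1 else 0)"
    "rel f (D2 y)" "\<And>p c. p < 3 \<Longrightarrow> c < 3 \<Longrightarrow> D3 y p c = D1 y * co (f 3) p (3 + c)"
    by (rule dual_frame[OF H y(2) D1]) (rule that)
  have f_psi: "f l = \<psi> base_point l" if l: "l < 4" for l
  proof
    fix t
    obtain K where K: "\<And>t. f l t = (\<Sum>m<4. K m * \<psi> base_point m t)"
      using frame_combination_fun[OF fr frame_of_mem[OF f(1) l]] by blast
    have "K k = (if k = l then 1 else 0)" if k: "k < 4" for k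
    proof -
      have "co (f l) (pa k) (pb k) = (\<Sum>m<4. K m * (if k = m then 1 else 0))"
        using K[of "(e (pa k), e (pb k))"] psi_base_dual[OF k] by (simp add: co_def)
      also have "\<dots> = (\<Sum>m<4. if m = k then K m else 0)"
        by (intro sum.cong) auto
      also have "\<dots> = K k"
        using k by simp
      finally show ?thesis
        using f(2)[OF k l] by (simp only:)
    qed
    then have "f l t = (\<Sum>m<4. if m = l then \<psi> base_point m t else 0)"
      unfolding K[of t] by (intro sum.cong refl) simp
    then show "f l t = \<psi> base_point l t"
      using l by simp
  qed
  have "rel (\<psi> base_point) (D2 y)"
    using f(3) f_psi unfolding rel_def by simp
  then have r: "D2 y i j = D2 y 3 3 * qm base_point i j" if "i < 4" "j < 4" for i j
    using base_relation[OF symm_D2] that by blast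
  have nz: "D2 y 3 3 \<noteq> 0"
  proof
    assume z: "D2 y 3 3 = 0"
    obtain B where B: "\<And>i j. i < 4 \<Longrightarrow> j < 4 \<Longrightarrow> (\<Sum>k<4. B i k * AA y k j) = (if i = j then 1 else 0)"
      by (rule inverse_exists[OF D1[unfolded D1_def]]) (rule that)
    define q where "q = hypq (2 * Pf (Sk y 0))"
    define S where "S l i = (\<Sum>j<4. AA y l j * q i j)" for l i
    have "(\<Sum>i<4. AA y k i * S l i) = 0" if "k < 4" "l < 4" for k l
    proof -
      have "(\<Sum>i<4. AA y k i * S l i) = D2 y k l"
        unfolding D2_def S_def q_def[symmetric] sum_distrib_left by (intro sum.cong refl) simp
      then show ?thesis
        using r[OF that] z by simp
    qed
    then have S0: "S l m = 0" if "l < 4" "m < 4" for l m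
      using sum_apply_inverse[of 4 B m "AA y" 1 "S l"] B[OF that(2)] that by simp
    have "q m n = 0" if "m < 4" "n < 4" for m n
      using sum_apply_inverse[of 4 B n "AA y" 1 "q m"] B[OF that(2)] S0[OF _ that(1)] that
      by (simp add: S_def)
    from this[of 0 1] show False
      by (simp add: q_def hypq_def)
  qed
  have "det3 (D2 y) = D2 y 3 3 ^ 3 * det3 (\<lambda>i j. if i = j then 1 else 0)"
    unfolding det3_scale[symmetric]
  proof (rule det3_cong)
    fix i j :: nat assume "i < 3" "j < 3"
    then show "D2 y i j = D2 y 3 3 * (if i = j then 1 else 0)"
      using r[of i j] qm_base[of i j] by simp
  qed
  then have D2: "det3 (D2 y) \<noteq> 0"
    using nz by (simp add: det3_def sum_3 adj3_table)
  have "D3 y p c = D1 y * (if p = c then 1 else 0)" if "p < 3" "c < 3" for p c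
    using f(4)[OF that] f_psi[of 3] psi_base[of 3 p "3 + c"] co_psi[of p "3 + c" base_point 3] that
    by (simp add: bs_def)
  then have "det3 (D3 y) = D1 y ^ 3 * det3 (\<lambda>i j. if i = j then 1 else 0)"
    unfolding det3_scale[symmetric] by (intro det3_cong) simp
  then have D3: "det3 (D3 y) \<noteq> 0"
    using D1 by (simp add: det3_def sum_3 adj3_table)
  show ?thesis
    using y(1) D1 D2 D3 by blast
qed

lemma psi_dense:
  assumes F: "pluecker_form 4 (ext2 s) d F" and zero: "\<forall>x. F (\<psi> x) = 0"
  shows "V.van F (variety_V s)"
proof -
  have Phi_zero: "F (\<Phi> y) = 0" if y: "y \<in> E\<Phi>" for y
  proof (rule ccontr)
    assume nz: "F (\<Phi> y) \<noteq> 0"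
    obtain y0 where y0: "y0 \<in> E\<Phi>" "D1 y0 * (det3 (D2 y0) * det3 (D3 y0)) \<noteq> 0"
      using generic_point by auto
    have p1: "ispoly 108 (\<lambda>y. F (\<Phi> y))"
      using family_Phi(1) F unfolding V.family_def by blast
    have p2: "ispoly 108 (\<lambda>y. D1 y * (det3 (D2 y) * det3 (D3 y)))"
      by (intro poly_intros ispoly_D1 ispoly_D2 ispoly_D3)
    obtain z where z: "z \<in> E\<Phi>" "F (\<Phi> z) \<noteq> 0" "D1 z * (det3 (D2 z) * det3 (D3 z)) \<noteq> 0"
      by (rule zopen_common_nonzero[OF family_Phi(2) line_closed_UNIV p1 p2 y y0(1) nz y0(2)]) (rule that)
    obtain H where H: "H \<in> variety_V s" "frame_of 4 H (\<Phi> z)"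
      using z(1) by (auto simp: E\<Phi>_def)
    obtain x where "frame_of 4 H (\<psi> x)"
      using generic_member[OF H] z(3) by auto
    then have "F (\<Phi> z) = 0"
      using vanishing_frame_indep[OF F variety_Grass[OF H(1)] _ H(2)] zero by blast
    with z(2) show False ..
  qed
  show ?thesis
    unfolding vanishes_on_def
  proof (intro ballI allI impI)
    fix H w assume H: "H \<in> variety_V s" and w: "frame_of 4 H w"
    obtain y where "y \<in> E\<Phi>" "frame_of 4 H (\<Phi> y)"
      using Phi_surjective[OF H] by blast
    then show "F w = 0"
      using vanishing_frame_indep[OF F variety_Grass[OF H] _ w] Phi_zero by blast
  qed
qed

lemma psi_poly:
  obtains M where "\<And>d F. pluecker_form 4 (ext2 s) d F \<Longrightarrow> polyfun 38 (M * d) (\<lambda>x. F (\<psi> x))"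
proof (rule pluecker_form_frame_poly[of \<psi> 38])
  show "ispoly 38 (\<lambda>x. co (\<psi> x l) i j)" if "i < 6" "j < 6" for l i j
    using that by (simp add: co_psi ispoly_psi)
qed (use psi_ext that in auto)

lemma dim_le: "krull_dim V.X \<le> enat 38"
proof -
  obtain M where M: "\<And>d F. pluecker_form 4 (ext2 s) d F \<Longrightarrow> polyfun 38 (M * d) (\<lambda>x. F (\<psi> x))"
    by (rule psi_poly) (rule that)
  show ?thesis
    by (rule V.krull_dim_le[OF subspace_ext2 M psi_dense])
qed

end

section \<open>Coordinates on the parametrised members\<close>

lemma det_row_lt:
  assumes "i0 < 3"
  shows "det (mat 4 4 (\<lambda>(i, l). if i = i0 then y l else if i < 3 then if i = l then 1 else 0 else z l))
    = y i0 * z 3 - y 3 * (z i0 :: complex)"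
  using less_3_cases[OF assms] by (elim disjE) (simp_all add: det4 del: One_nat_def)

lemma det_row_3: "det (mat 4 4 (\<lambda>(i, l). if i = 3 then y l else if i = l then 1 else 0)) = (y 3 :: complex)"
  by (simp add: det4)

lemma be_XX:
  assumes "i < 3" "k < 3" "l < 3"
  shows "be x i k l - (if k = l then be x i 0 0 else 0) = det3 (PP x) * XX x i k l"
proof -
  have Y0: "YY x j 0 0 = 0" for j
    by (simp add: YY_def XX_def)
  have "be x i k l - (if k = l then be x i 0 0 else 0) = (\<Sum>j<3. PP x i j * YY x j k l)"
    by (cases "k = l") (simp_all add: be_def be'_def Y0 sum_subtractf[symmetric] algebra_simps)
  also have "\<dots> = (\<Sum>j<3. PP x i j * (\<Sum>m<3. adj3 (PP x) j m * XX x m k l))"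
    by (simp add: YY_def)
  also have "\<dots> = det3 (PP x) * XX x i k l"
    by (rule sum_apply_inverse) (use adj3_right[OF assms(1)] assms in auto)
  finally show ?thesis .
qed

definition rowi :: "nat \<Rightarrow> nat" where
  "rowi j = (if j < 3 then 0 else if j < 5 then 1 else if j < 6 then 2 else if j < 30 then (j - 6) div 8 else 3)"

definition coli :: "nat \<Rightarrow> nat" where
  "coli j = (if j = 0 then 0 else if j = 1 \<or> j = 3 then 1 else 2)"

definition posi :: "nat \<Rightarrow> nat" where
  "posi j = (if j < 30 then (j - 6) mod 8 + 1 else j - 29)"

definition tga :: "nat \<Rightarrow> nat" where
  "tga j = (if j < 6 then if coli j = 0 then 4 else if coli j = 1 then 5 else 3 else posi j div 3)"

definition tgb :: "nat \<Rightarrow> nat" where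
  "tgb j = (if j < 6 then if coli j = 0 then 5 else if coli j = 1 then 3 else 4 else 3 + posi j mod 3)"

definition cf :: "nat \<Rightarrow> complex" where
  "cf j = (if j < 6 then if rowi j = coli j then 1 else 0 else if j < 30 then 0
     else if posi j div 3 = posi j mod 3 then 1 else 0)"

definition uu :: "nat \<Rightarrow> (nat \<Rightarrow> complex) \<Rightarrow> complex" where
  "uu j x = (if j < 6 then 1 else if j < 30 then det3 (PP x) else det3 (BB x))"

definition VV :: "(nat \<Rightarrow> complex) \<Rightarrow> nat \<Rightarrow> nat \<Rightarrow> complex" where
  "VV x j l = \<psi>m x l (tga j) (tgb j) - cf j * \<psi>m x l (pa (rowi j)) (pb (rowi j))"

lemma rowi_lt: "j < 30 \<Longrightarrow> rowi j < 3"
  by (auto simp: rowi_def)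

lemma target_lt:
  assumes "j < 38"
  shows "tga j < 6" "tgb j < 6" "6 \<le> j \<Longrightarrow> posi j div 3 < 3"
proof -
  have "posi j < 9" if "6 \<le> j"
    using assms that by (auto simp: posi_def)
  then have p: "posi j div 3 < 3" if "6 \<le> j"
    using that by (simp add: div_less_iff_less_mult)
  then show "6 \<le> j \<Longrightarrow> posi j div 3 < 3" .
  show "tga j < 6"
    using p by (cases "j < 6") (auto simp: tga_def)
  show "tgb j < 6"
    by (auto simp: tgb_def)
qed

lemma psi_first_rows:
  assumes "i < 3" "l < 4"
  shows "\<psi>m x l (pa i) (pb i) = (if i = l then 1 else 0)"
proof -
  have "\<psi>m x l 2 0 = - \<psi>m x l 0 2"
    by (rule skewD[OF skew_psi]) auto
  then show ?thesis
    using less_3_cases[OF assms(1)] less_4_cases[OF assms(2)]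
    by (elim disjE) (simp_all add: pa_def pb_def \<psi>m_def bm_blocks mk_def)
qed

lemma psi_last_row: "\<psi>m x l (pa 3) (pb 3) = (if l < 3 then be x l 0 0 else det3 (BB x))"
  by (simp add: pa_def pb_def \<psi>m_def bm_blocks BB_def)

lemma flag_coordinate:
  assumes j: "j < 38" and x: "\<forall>i>j. x i = base_point i"
  shows "det (mat 4 4 (\<lambda>(i, l). if i = rowi j then VV x j l else \<psi>m x l (pa i) (pb i)))
    = (x j - base_point j) * uu j x" (is "?d = _")
proof (cases "j < 30")
  case True
  define z where "z l = (if l < 3 then be x l 0 0 else det3 (BB x))" for l :: nat
  have r: "rowi j < 3"
    by (rule rowi_lt[OF True])
  have "mat 4 4 (\<lambda>(i, l). if i = rowi j then VV x j l else \<psi>m x l (pa i) (pb i))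
      = mat 4 4 (\<lambda>(i, l). if i = rowi j then VV x j l else if i < 3 then if i = l then 1 else 0 else z l)"
  proof (rule eq_matI)
    fix i l assume "i < dim_row (mat 4 4 (\<lambda>(i, l). if i = rowi j then VV x j l else if i < 3 then if i = l then 1 else 0 else z l))"
      "l < dim_col (mat 4 4 (\<lambda>(i, l). if i = rowi j then VV x j l else if i < 3 then if i = l then 1 else 0 else z l))"
    then have il: "i < 4" "l < 4" by auto
    show "mat 4 4 (\<lambda>(i, l). if i = rowi j then VV x j l else \<psi>m x l (pa i) (pb i)) $$ (i, l)
      = mat 4 4 (\<lambda>(i, l). if i = rowi j then VV x j l else if i < 3 then if i = l then 1 else 0 else z l) $$ (i, l)"
    proof (cases "i < 3")
      case False
      then have "i = 3" using il by simp
      then show ?thesis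
        using il psi_last_row[of x l] r by (simp add: z_def)
    qed (use il psi_first_rows[OF _ il(2), of i x] in simp)
  qed auto
  then have d: "?d = VV x j (rowi j) * det3 (BB x) - VV x j 3 * be x (rowi j) 0 0"
    using det_row_lt[OF r, of "VV x j" z] r by (simp add: z_def)
  have BB1: "BB x k l = (if k = l then 1 else 0)" if "k < 3" "l < 3" for k l
  proof -
    have "BB x k l = BB base_point k l"
      using x True by (simp add: BB_def)
    then show ?thesis
      using base.BB1[OF that] by simp
  qed
  have det_BB: "det3 (BB x) = 1"
    by (simp add: det3_def sum_3 adj3_table BB1 del: One_nat_def)
  show ?thesis
  proof (cases "j < 6")
    case j6: True
    interpret sp: special_parameters x
    proof
      show "XX x i k l = 0" if "i < 3" "k < 3" "l < 3" for i k l
      proof -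
        have "XX x i k l = XX base_point i k l"
          using x j6 by (simp add: XX_def)
        then show ?thesis
          using base.XX0[OF that] by simp
      qed
    qed (rule BB1)
    have "VV x j (rowi j) = \<psi>m x (rowi j) (tga j) (tgb j) - cf j"
      unfolding VV_def using psi_first_rows[OF r, of "rowi j" x] r by simp
    moreover have "\<psi>m x (rowi j) (tga j) (tgb j) = PP x (rowi j) (coli j)"
    proof -
      have "\<psi>m x (rowi j) 5 3 = - \<psi>m x (rowi j) 3 5"
        by (rule skewD[OF skew_psi]) auto
      then show ?thesis
        using sp.ga_table[of "rowi j"] r j6
        by (auto simp: tga_def tgb_def coli_def \<psi>m_def bm_blocks)
    qed
    moreover have "PP x (rowi j) (coli j) = x j \<and> cf j = base_point j"
    proof -
      have "j = 0 \<or> j = 1 \<or> j = 2 \<or> j = 3 \<or> j = 4 \<or> j = 5"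
        using j6 by linarith
      then show ?thesis
        by (elim disjE) (simp_all add: PP_def rowi_def coli_def cf_def base_point_def, simp add: numeral_2_eq_2)
    qed
    ultimately show ?thesis
      unfolding d det_BB using j6 sp.be0[of 0 0 "rowi j"] by (simp add: uu_def)
  next
    case False
    define k where "k = posi j div 3"
    define l where "l = posi j mod 3"
    have kl: "k < 3" "l < 3"
      using target_lt(3)[OF j] False by (auto simp: k_def l_def)
    have t: "tga j = k" "tgb j = 3 + l" "cf j = 0"
      using False True by (simp_all add: tga_def tgb_def k_def l_def cf_def)
    have pos: "3 * k + l = posi j"
      by (simp add: k_def l_def)
    have "XX x (rowi j) k l = x j"
    proof -
      have "6 + 8 * rowi j + (posi j - 1) = j" "posi j \<noteq> 0"
        using False True by (auto simp: rowi_def posi_def)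
      then show ?thesis
        unfolding XX_def pos using pos by auto
    qed
    moreover have "VV x j (rowi j) = be x (rowi j) k l" "VV x j 3 = (if k = l then 1 else 0)"
      unfolding VV_def t using r kl det_BB BB1[OF kl] by (simp_all add: \<psi>m_def bm_blocks)
    moreover have "base_point j = 0"
      using False True by (simp add: base_point_def)
    ultimately show ?thesis
      unfolding d det_BB using be_XX[OF r kl, of x] False True by (simp add: uu_def split: if_splits)
  qed
next
  case False
  have r: "rowi j = 3"
    using False by (simp add: rowi_def)
  have "mat 4 4 (\<lambda>(i, l). if i = rowi j then VV x j l else \<psi>m x l (pa i) (pb i))
      = mat 4 4 (\<lambda>(i, l). if i = 3 then VV x j l else if i = l then 1 else 0)"
    unfolding r by (rule eq_matI) (auto simp: psi_first_rows)
  then have d: "?d = VV x j 3"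
    using det_row_3[of "VV x j"] by simp
  define k where "k = posi j div 3"
  define l where "l = posi j mod 3"
  have kl: "k < 3" "l < 3"
    using target_lt(3)[OF j] False by (auto simp: k_def l_def)
  have t: "tga j = k" "tgb j = 3 + l"
    using False by (simp_all add: tga_def tgb_def k_def l_def)
  have pos: "3 * k + l = posi j"
    by (simp add: k_def l_def)
  have p: "30 + (posi j - 1) = j" "posi j \<noteq> 0"
    using False by (auto simp: posi_def)
  have B: "BB y k l = y j" for y
    unfolding BB_def pos p(1) using pos p(2) by auto
  have "cf j = base_point j"
    using B[of base_point] base.BB1[OF kl] False by (simp add: cf_def k_def l_def)
  moreover have "VV x j 3 = det3 (BB x) * x j - cf j * det3 (BB x)"
    unfolding VV_def t r psi_last_row using kl B[of x] by (simp add: \<psi>m_def bm_blocks)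
  ultimately show ?thesis
    unfolding d using False by (simp add: uu_def algebra_simps)
qed

context six_space
begin

lemma entry_difference_dual: "(\<lambda>\<omega>. eval_at t \<omega> - c * eval_at t' \<omega>) \<in> dual_on cscale (ext2 s)"
  using eval_at_dual[of t] eval_at_dual[of t'] unfolding dual_on_def by (simp add: algebra_simps)

definition \<theta> :: "nat \<Rightarrow> nat \<Rightarrow> 'v bivector \<Rightarrow> complex" where
  "\<theta> j i \<omega> = (if i = rowi j
     then eval_at (e (tga j), e (tgb j)) \<omega> - cf j * eval_at (e (pa i), e (pb i)) \<omega>
     else eval_at (e (pa i), e (pb i)) \<omega> - 0 * eval_at (e (pa i), e (pb i)) \<omega>)"

lemma theta_dual: "\<theta> j i \<in> dual_on cscale (ext2 s)"
proof (cases "i = rowi j")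
  case True
  then have "\<theta> j i = (\<lambda>\<omega>. eval_at (e (tga j), e (tgb j)) \<omega> - cf j * eval_at (e (pa i), e (pb i)) \<omega>)"
    by (intro ext) (simp add: \<theta>_def)
  then show ?thesis
    by (simp only: entry_difference_dual)
next
  case False
  then have "\<theta> j i = (\<lambda>\<omega>. eval_at (e (pa i), e (pb i)) \<omega> - 0 * eval_at (e (pa i), e (pb i)) \<omega>)"
    by (intro ext) (simp add: \<theta>_def)
  then show ?thesis
    by (simp only: entry_difference_dual)
qed

lemma theta_psi: "j < 38 \<Longrightarrow> \<theta> j i (\<psi> x l) = (if i = rowi j then VV x j l else \<psi>m x l (pa i) (pb i))"
  using co_psi[of "tga j" "tgb j" x l] co_psi[of "pa i" "pb i" x l] target_lt[of j] pab_lt[of i]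
    co_psi[of "pa (rowi j)" "pb (rowi j)" x l] pab_lt[of "rowi j"]
  by (simp add: \<theta>_def VV_def eval_at_def psi_ext co_def)

lemma dim_ge: "enat 38 \<le> krull_dim V.X"
proof -
  define \<Delta> where "\<Delta> x = det3 (PP x) * det3 (BB x)" for x
  define E where "E = {x. \<Delta> x \<noteq> 0 \<and> (\<exists>H\<in>variety_V s. frame_of 4 H (\<psi> x))}"
  have poly: "ispoly 38 (\<lambda>x. co (\<psi> x l) i j)" if "i < 6" "j < 6" for l i j
    using that by (simp add: co_psi ispoly_psi)
  have dets: "ispoly 38 (\<lambda>x. det3 (PP x))" "ispoly 38 (\<lambda>x. det3 (BB x))"
    by (intro ispoly_det3 ispoly_PP ispoly_BB; assumption)+
  then have D: "ispoly 38 \<Delta>"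
    unfolding \<Delta>_def[abs_def] by (intro poly_intros)
  have q: "symm 4 (qm x) \<and> nondeg 4 (qm x) \<and> rel (\<psi> x) (qm x)" if "\<Delta> x \<noteq> 0" for x
    using that symm_qm nondeg_qm rel_psi by (simp add: \<Delta>_def)
  have fam: "V.family 38 E \<psi>" "zopen 38 UNIV E"
    unfolding E_def
    by (rule variety_family[of \<psi> 38 \<Delta> qm]; (rule psi_ext D | (rule poly q; assumption)))+
  show ?thesis
  proof (rule V.krull_dim_ge[OF fam])
    show "base_point \<in> E"
      using base_member by (simp add: E_def \<Delta>_def det_PP_base base.det_BB)
    show "\<exists>d. pluecker_form 4 (ext2 s) d (\<lambda>w. det (mat 4 4 (\<lambda>(i, l). \<theta> j i (w l))))" for j
      by (rule exI, rule pluecker_form.minor) (rule theta_dual)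
    show "ispoly 38 (uu j)" for j
      unfolding uu_def[abs_def] using dets by (auto intro!: poly_intros)
    show "uu j base_point \<noteq> 0" for j
      by (simp add: uu_def det_PP_base base.det_BB)
    show "det (mat 4 4 (\<lambda>(i, l). \<theta> j i (\<psi> x l))) = (x j - base_point j) * uu j x"
      if "j < 38" "\<forall>i>j. x i = base_point i" for j x
      unfolding theta_psi[OF that(1)] by (rule flag_coordinate[OF that])
  qed
qed

end

theorem theorem2p2:
  fixes s :: "complex \<Rightarrow> 'v::ab_group_add \<Rightarrow> 'v"
  assumes "vector_space s" and "vector_space.dim s UNIV = 6"
  shows "irreducible_space (variety_V_top s) \<and> krull_dim (variety_V_top s) = 38"
proof -
  obtain v e where "six_space s v e"
    using six_space_exists[OF assms] by blast
  then interpret six_space s v e .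
  have "irreducible_space (variety_V_top s)"
    using base_member irreducible_variety by blast
  moreover have "krull_dim (variety_V_top s) = enat 38"
    using dim_le dim_ge by (simp add: variety_V_top_def)
  ultimately show ?thesis
    by (simp add: numeral_eq_enat)
qed

end
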